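(* Let $g\in G/K$, and write $\nu^\ast=(\nu,\frac{\nu+1}2)$ for $\nu\in\mathbb C$. The Fourier coefficients of $E_\beta(g,\nu,1)$ are given as follows. For $m_1=m_2=0$: $$\begin{aligned} E_{\beta,\chi_{0,0}}(g)=\;&W_{s_\beta}(g,\nu^\ast,\chi_{0,0})+\frac{\zeta(\nu+1)}{\zeta(\nu+2)}W_{s_\beta s_\alpha}(g,\nu^\ast,\chi_{0,0})+\frac{\zeta(\nu)}{\zeta(\nu+1)}\frac{\zeta(\nu+1)}{\zeta(\nu+2)}W_{s_\beta s_\alpha s_\beta}(g,\nu^\ast,\chi_{0,0})\\ &+\frac{\zeta(\nu-1)}{\zeta(\nu)}\frac{\zeta(\nu)}{\zeta(\nu+1)}\frac{\zeta(\nu+1)}{\zeta(\nu+2)}W_{w_0}(g,\nu^\ast,\chi_{0,0}). \end{aligned}$$ For $m_1\ne0$, $m_2=0$: $$E_{\beta,\chi_{m_1,0}}(g)=\frac{\sigma_{-\nu-1}(m_1)}{\zeta(\nu+2)}W_{s_\beta s_\alpha}(g,\nu^\ast,\chi_{m_1,0})+\frac{\sigma_{-\nu+1}(m_1)}{\zeta(\nu)}\frac{\zeta(\nu)}{\zeta(\nu+1)}\frac{\zeta(\nu+1)}{\zeta(\nu+2)}W_{w_0}(g,\nu^\ast,\chi_{m_1,0}).$$ For $m_1=0$, $m_2\ne0$: $$E_{\beta,\chi_{0,m_2}}(g)=\frac{\sigma_{-\nu}(m_2)}{\zeta(\nu+1)}\frac{\zeta(\nu+1)}{\zeta(\nu+2)}W_{s_\beta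 s_\alpha s_\beta}(g,\nu^\ast,\chi_{0,m_2}).$$ For $m_1,m_2\ne0$: $E_{\beta,\chi_{m_1,m_2}}(g)=0$.
   Context: Let $J=\begin{pmatrix}0&I_2\\-I_2&0\end{pmatrix}$, $G=\mathrm{Sp}(4,\mathbb R)=\{g\in\mathrm{GL}(4,\mathbb R): g^\top Jg=J\}$, $\Gamma=\mathrm{Sp}(4,\mathbb Z)$, $K=\left\{\begin{pmatrix}A&B\\-B&A\end{pmatrix}: A+iB\in U(2)\right\}$. Let $U$ be the group of matrices $$\eta=\begin{pmatrix}1&n_1&n_2&n_3\\0&1&n_4&n_5\\0&0&1&0\\0&0&-n_1&1\end{pmatrix},\quad n_3=n_1n_5+n_4,$$ with $d\eta=dn_1\,dn_2\,dn_4\,dn_5$. Every element of $G/K$ has an Iwasawa representative $\eta\,\mathrm{diag}(y_1,y_2,y_1^{-1},y_2^{-1})$ with $\eta\in U(\mathbb R)$, $y_1,y_2>0$. Set $I_0(g,(\nu_1,\nu_2))=y_1^{\nu_1+2}y_2^{2\nu_2-\nu_1+1}$ and $I_\beta(g,\nu)=y_1^{\nu+2}$. Let $P_\beta=\left\{\begin{pmatrix}*&*&*&*\\0&*&*&*\\0&0&*&0\\0&*&*&*\end{pmatrix}\right\}\cap G$ be the Jacobi parabolic and $E_\beta(g,\nu,1)=\sum_{\gamma\in(P_\beta\cap\Gamma)\backslash\Gamma}I_\beta(\gamma g,\nu)$, continued meromorphically to $\nu\in\mathbb C$. For $m_1,m_2\in\mathbb Z$, $\chi_{m_1,m_2}(\eta)=e(m_1n_1+m_2n_5)$,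 $e(x)=e^{2\pi ix}$, and the Fourier coefficient for $\chi=\chi_{m_1,m_2}$ is $E_{\beta,\chi}(g)=\int_{U(\mathbb Z)\backslash U(\mathbb R)}E_\beta(\eta g,\nu,1)\overline\chi(\eta)\,d\eta$. The simple reflections are represented by $$s_\alpha=\begin{pmatrix}0&1&0&0\\1&0&0&0\\0&0&0&1\\0&0&1&0\end{pmatrix},\quad s_\beta=\begin{pmatrix}1&0&0&0\\0&0&0&1\\0&0&1&0\\0&-1&0&0\end{pmatrix},\quad w_0=s_\alpha s_\beta s_\alpha s_\beta.$$ For a Weyl element $w$ let $U_w=U\cap w^{-1}U^\top w$, $\overline U_w=U\cap w^{-1}Uw$ ($U_w$ is obtained from $U$ by setting some of $n_1,n_2,n_4,n_5$ to zero and carries Lebesgue measure in the remaining ones). Jacquet's Whittaker function is $W_w(g,(\nu_1,\nu_2),\chi)=\int_{U_w(\mathbb R)}I_0(w\eta g,(\nu_1,\nu_2))\overline\chi(\eta)\,d\eta$ if $\chi$ is trivial on $\overline U_w(\mathbb R)$, and $0$ otherwise. $\sigma_\mu(m)=\sum_{d\mid m}d^\mu$ is the divisor sum function; $\zeta$ is the Riemann zeta function.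
   Formalization: The first three formulas are proved with π·E_{β,χ}(g) on the left, since as printed they are off by the factor π (W_{s_β}(g,ν*,1)=π·I_β(g,ν)); they hold at every ν where E_β, the W's and the zeta quotients are defined. *)

theory Defs
  imports "HOL-Complex_Analysis.Complex_Analysis"
begin

text \<open>The notation \<open>$\<close> of formal power series leaks into this context and clashes with
  vector components.\<close>

no_notation fps_nth (infixl \<open>$\<close> 75)

section \<open>The groups\<close>

definition block :: "real^2^2 \<Rightarrow> real^2^2 \<Rightarrow> real^2^2 \<Rightarrow> real^2^2 \<Rightarrow> real^4^4" where
  "block A B C D = vector
     [vector [A$1$1, A$1$2, B$1$1, B$1$2],
      vector [A$2$1, A$2$2, B$2$1, B$2$2],
      vector [C$1$1, C$1$2, D$1$1, D$1$2],
      vector [C$2$1, C$2$2, D$2$1, D$2$2]]"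

definition J :: "real^4^4" where
  "J = block 0 (mat 1) (- mat 1) 0"

definition Sp4R :: "(real^4^4) set" where
  "Sp4R = {g. invertible g \<and> transpose g ** J ** g = J}"

definition Sp4Z :: "(real^4^4) set" where
  "Sp4Z = {g \<in> Sp4R. \<forall>i j. g $ i $ j \<in> \<int>}"

definition U2 :: "(complex^2^2) set" where
  "U2 = {M. M ** (\<chi> i j. cnj (M $ j $ i)) = mat 1}"

definition K :: "(real^4^4) set" where
  "K = {block A B (- B) A | A B. (\<chi> i j. Complex (A $ i $ j) (B $ i $ j)) \<in> U2}"

text \<open>The coordinates on the unipotent group \<open>U\<close> are indexed by \<open>{1, 2, 4, 5}\<close>;
  the entry \<open>n\<^sub>3\<close> is determined by them.\<close>

definition U_coords :: "nat set" where
  "U_coords = {1, 2, 4, 5}"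

definition eta :: "(nat \<Rightarrow> real) \<Rightarrow> real^4^4" where
  "eta n = vector
     [vector [1, n 1, n 2, n 1 * n 5 + n 4],
      vector [0, 1, n 4, n 5],
      vector [0, 0, 1, 0],
      vector [0, 0, - n 1, 1]]"

definition U :: "(real^4^4) set" where
  "U = range eta"

definition torus :: "real \<Rightarrow> real \<Rightarrow> real^4^4" where
  "torus y1 y2 = vector
     [vector [y1, 0, 0, 0],
      vector [0, y2, 0, 0],
      vector [0, 0, inverse y1, 0],
      vector [0, 0, 0, inverse y2]]"

definition P_beta :: "(real^4^4) set" where
  "P_beta = {g \<in> Sp4R. g$2$1 = 0 \<and> g$3$1 = 0 \<and> g$3$2 = 0 \<and> g$3$4 = 0 \<and> g$4$1 = 0}"

definition s_alpha :: "real^4^4" where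
  "s_alpha = vector
     [vector [0, 1, 0, 0],
      vector [1, 0, 0, 0],
      vector [0, 0, 0, 1],
      vector [0, 0, 1, 0]]"

definition s_beta :: "real^4^4" where
  "s_beta = vector
     [vector [1, 0, 0, 0],
      vector [0, 0, 0, 1],
      vector [0, 0, 1, 0],
      vector [0, -1, 0, 0]]"

definition w_0 :: "real^4^4" where
  "w_0 = s_alpha ** s_beta ** s_alpha ** s_beta"


section \<open>Iwasawa coordinates, characters\<close>

text \<open>Functions on \<open>G/K\<close> are right \<open>K\<close>-invariant functions on \<open>G\<close>.\<close>

definition iwasawa_y :: "real^4^4 \<Rightarrow> real \<times> real" where
  "iwasawa_y g = (THE y. 0 < fst y \<and> 0 < snd y \<and>
     (\<exists>u\<in>U. \<exists>k\<in>K. g = u ** torus (fst y) (snd y) ** k))"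

definition I_0 :: "real^4^4 \<Rightarrow> complex \<times> complex \<Rightarrow> complex" where
  "I_0 g = (\<lambda>(\<nu>1, \<nu>2).
     of_real (fst (iwasawa_y g)) powr (\<nu>1 + 2) *
     of_real (snd (iwasawa_y g)) powr (2 * \<nu>2 - \<nu>1 + 1))"

definition I_beta :: "real^4^4 \<Rightarrow> complex \<Rightarrow> complex" where
  "I_beta g \<nu> = of_real (fst (iwasawa_y g)) powr (\<nu> + 2)"

text \<open>On \<open>U\<close> the entries \<open>(1,2)\<close> and \<open>(2,4)\<close> are \<open>n\<^sub>1\<close> and \<open>n\<^sub>5\<close>.\<close>

definition chi :: "int \<Rightarrow> int \<Rightarrow> real^4^4 \<Rightarrow> complex" where
  "chi m1 m2 u = exp (2 * of_real pi * \<i> * of_real (of_int m1 * u$1$2 + of_int m2 * u$2$4))"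


section \<open>Meromorphic continuation, zeta and divisor functions\<close>

text \<open>The meromorphic function on \<open>\<complex>\<close> that agrees with \<open>f\<close> on \<open>S\<close>. It is unique as soon
  as \<open>S\<close> is open and nonempty, because a nicely meromorphic function has no removable
  singularities and takes the value \<open>0\<close> at its poles.\<close>

definition mero_cont :: "(complex \<Rightarrow> complex) \<Rightarrow> complex set \<Rightarrow> complex \<Rightarrow> complex" where
  "mero_cont f S = (THE F. F nicely_meromorphic_on UNIV \<and> (\<forall>s\<in>S. F s = f s))"

definition zeta :: "complex \<Rightarrow> complex" where
  "zeta = mero_cont (\<lambda>s. \<Sum>n. 1 / of_nat (Suc n) powr s) {s. Re s > 1}"

definition div_sigma :: "complex \<Rightarrow> int \<Rightarrow> complex" where
  "div_sigma \<mu> m = (\<Sum>d | 0 < d \<and> int d dvd m. of_nat d powr \<mu>)"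


section \<open>The Eisenstein series and its Fourier coefficients\<close>

definition P_beta_Z_rel :: "((real^4^4) \<times> (real^4^4)) set" where
  "P_beta_Z_rel = {(\<gamma>, \<gamma>'). \<gamma> \<in> Sp4Z \<and> \<gamma>' \<in> Sp4Z \<and> (\<exists>p \<in> P_beta \<inter> Sp4Z. \<gamma>' = p ** \<gamma>)}"

definition E_beta_series :: "real^4^4 \<Rightarrow> complex \<Rightarrow> complex" where
  "E_beta_series g \<nu> =
     (\<Sum>\<^sub>\<infinity>C \<in> Sp4Z // P_beta_Z_rel. I_beta ((SOME \<gamma>. \<gamma> \<in> C) ** g) \<nu>)"

text \<open>The series is, up to the factor \<open>2 \<zeta>(\<nu> + 2)\<close>, an Epstein zeta function of a
  quaternary form at \<open>(\<nu> + 2) / 2\<close>; it converges absolutely exactly for \<open>Re \<nu> > 2\<close>.\<close>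

definition E_beta :: "real^4^4 \<Rightarrow> complex \<Rightarrow> complex" where
  "E_beta g = mero_cont (E_beta_series g) {\<nu>. Re \<nu> > 2}"

text \<open>The cube \<open>[0,1]\<^sup>4\<close> in the coordinates \<open>n\<^sub>1, n\<^sub>2, n\<^sub>4, n\<^sub>5\<close> is, up to a null set, a
  fundamental domain for \<open>U(\<int>)\<close> acting on \<open>U(\<real>)\<close> from the left.\<close>

definition E_beta_coeff :: "int \<Rightarrow> int \<Rightarrow> real^4^4 \<Rightarrow> complex \<Rightarrow> complex" where
  "E_beta_coeff m1 m2 g \<nu> =
     (LINT n : (\<Pi>\<^sub>E i\<in>U_coords. {0..1}) | (\<Pi>\<^sub>M i\<in>U_coords. lborel).
        E_beta (eta n ** g) \<nu> * cnj (chi m1 m2 (eta n)))"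


section \<open>Jacquet's Whittaker functions\<close>

definition U_w :: "real^4^4 \<Rightarrow> (real^4^4) set" where
  "U_w w = U \<inter> {matrix_inv w ** transpose u ** w | u. u \<in> U}"

definition Ubar_w :: "real^4^4 \<Rightarrow> (real^4^4) set" where
  "Ubar_w w = U \<inter> {matrix_inv w ** u ** w | u. u \<in> U}"

text \<open>For a Weyl element \<open>w\<close>, \<open>U_w w\<close> consists of the \<open>eta n\<close> whose coordinates outside
  the following set vanish.\<close>

definition free_coords :: "real^4^4 \<Rightarrow> nat set" where
  "free_coords w = {i \<in> U_coords. \<exists>n. eta n \<in> U_w w \<and> n i \<noteq> 0}"

definition eta_w :: "real^4^4 \<Rightarrow> (nat \<Rightarrow> real) \<Rightarrow> real^4^4" where
  "eta_w w n = eta (\<lambda>i. if i \<in> free_coords w then n i else 0)"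

definition jacquet_integral ::
    "real^4^4 \<Rightarrow> real^4^4 \<Rightarrow> complex \<times> complex \<Rightarrow> int \<Rightarrow> int \<Rightarrow> complex" where
  "jacquet_integral w g \<nu>s m1 m2 =
     (if \<forall>u \<in> Ubar_w w. chi m1 m2 u = 1
      then (LINT n | (\<Pi>\<^sub>M i\<in>free_coords w. lborel).
              I_0 (w ** eta_w w n ** g) \<nu>s * cnj (chi m1 m2 (eta_w w n)))
      else 0)"

definition nu_star :: "complex \<Rightarrow> complex \<times> complex" where
  "nu_star \<nu> = (\<nu>, (\<nu> + 1) / 2)"

text \<open>\<open>\<nu> \<mapsto> W\<^sub>w(g, \<nu>\<^sup>*, \<chi>)\<close>, continued from the half plane \<open>Re \<nu> > 2\<close>, where the Jacquet
  integrals at \<open>\<nu>\<^sup>*\<close> converge absolutely for all four Weyl elements \<open>s\<^sub>\<beta>\<close>, \<open>s\<^sub>\<beta>s\<^sub>\<alpha>\<close>,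
  \<open>s\<^sub>\<beta>s\<^sub>\<alpha>s\<^sub>\<beta>\<close>, \<open>w\<^sub>0\<close>.

  Normalisation: at \<open>\<nu>\<^sup>*\<close> the exponent of \<open>y\<^sub>2\<close> in \<open>I_0\<close> is \<open>2\<close>, so integrating out the
  \<open>s\<^sub>\<beta>\<close>-direction gives \<open>\<integral> y / (x\<^sup>2 + y\<^sup>2) dx = \<pi>\<close> with \<open>y = y\<^sub>2\<^sup>2\<close>. In particular
  \<open>W\<close> for \<open>s\<^sub>\<beta>\<close> and the trivial character equals \<open>\<pi> I_beta g \<nu>\<close>, whereas the
  identity coset contributes \<open>I_beta g \<nu>\<close> to the constant term of the Eisenstein
  series. Hence with Lebesgue measure on \<open>U_w\<close> the Fourier coefficients of \<open>E_beta\<close>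
  are \<open>1/\<pi>\<close> times the corresponding combinations of Whittaker functions.\<close>

definition W_star :: "real^4^4 \<Rightarrow> real^4^4 \<Rightarrow> int \<Rightarrow> int \<Rightarrow> complex \<Rightarrow> complex" where
  "W_star w g m1 m2 = mero_cont (\<lambda>\<nu>. jacquet_integral w g (nu_star \<nu>) m1 m2) {\<nu>. Re \<nu> > 2}"

end

theory Submission
 imports Defs "HOL-Probability.Sinc_Integral" "HOL-Probability.Characteristic_Functions"
begin

lemma sum_integral_swap:
 fixes f :: "'v::countable => 'a => 'b::{banach,second_countable_topology}"
 assumes "sigma_finite_measure M"
  and int: "\<And>v. integrable M (f v)"
  and sum: "(\<lambda>v. \<integral>x. norm (f v x) \<partial>M) summable_on UNIV"
  and pt: "\<And>x. x \<in> space M ==> (\<lambda>v. norm (f v x)) summable_on UNIV"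
 shows "integrable M (\<lambda>x. \<Sum>\<^sub>\<infinity>v. f v x)" (is ?A)
  and "(\<integral>x. (\<Sum>\<^sub>\<infinity>v. f v x) \<partial>M) = (\<Sum>\<^sub>\<infinity>v. \<integral>x. f v x \<partial>M)" (is ?B)
  and "(\<lambda>v. norm (\<integral>x. f v x \<partial>M)) summable_on UNIV" (is ?C)
proof -
 interpret M: sigma_finite_measure M by fact
 interpret C: sigma_finite_measure "count_space (UNIV :: 'v set)" by (rule sigma_finite_measure_count_space)
 interpret P: pair_sigma_finite "count_space (UNIV :: 'v set)" M ..
 have meas: "(\<lambda>z. f (fst z) (snd z)) \<in> borel_measurable (count_space (UNIV :: 'v set) \<Otimes>\<^sub>M M)"
  by (rule measurable_pair_measure_countable1) (use int in auto)
 have abs: "Infinite_Set_Sum.abs_summable_on g (UNIV :: 'v set)"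
  if "(\<lambda>v. norm (g v)) summable_on UNIV" for g :: "'v => 'c::{banach,second_countable_topology}"
  using that by (simp add: abs_summable_equivalent)
 have inf: "(\<Sum>\<^sub>\<infinity>v. g v) = (\<integral>v. g v \<partial>count_space UNIV)"
  if "(\<lambda>v. norm (g v)) summable_on UNIV" for g :: "'v => 'c::{banach,second_countable_topology}"
  using infsetsum_infsum[OF abs[OF that]] by (simp add: infsetsum_def)
 have "integrable (count_space (UNIV :: 'v set)) (\<lambda>v. \<integral>x. norm (f v x) \<partial>M)"
  using abs[of "\<lambda>v. \<integral>x. norm (f v x) \<partial>M"] sum by (simp add: abs_summable_on_def set_integrable_def)
 hence I: "integrable (count_space (UNIV :: 'v set) \<Otimes>\<^sub>M M) (\<lambda>(v,x). f v x)"
  by (intro P.Fubini_integrable) (use meas int in \<open>auto simp: case_prod_beta'\<close>)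
 have "integrable M (\<lambda>x. \<integral>v. f v x \<partial>count_space UNIV)"
  using P.integrable_snd[OF I] by simp
 thus ?A by (rule Bochner_Integration.integrable_cong[THEN iffD1, rotated -1]) (auto simp: inf pt)
 have "norm (\<integral>x. f v x \<partial>M) \<le> (\<integral>x. norm (f v x) \<partial>M)" for v by (rule integral_norm_bound)
 thus C: ?C by (intro summable_on_comparison_test[OF sum]) auto
 have "(\<integral>x. (\<Sum>\<^sub>\<infinity>v. f v x) \<partial>M) = (\<integral>x. (\<integral>v. f v x \<partial>count_space UNIV) \<partial>M)"
  by (rule Bochner_Integration.integral_cong) (auto simp: inf pt)
 also have "\<dots> = (\<integral>v. (\<integral>x. f v x \<partial>M) \<partial>count_space UNIV)"
  using P.Fubini_integral[OF I] by simp
 also have "\<dots> = (\<Sum>\<^sub>\<infinity>v. \<integral>x. f v x \<partial>M)"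
  using inf[OF C] by simp
 finally show ?B .
qed

lemma sum_integral_swap_bounded:
 fixes f :: "'v::countable => 'a => 'b::{banach,second_countable_topology}"
 assumes "finite_measure M"
  and meas: "\<And>v. f v \<in> borel_measurable M"
  and B: "B summable_on UNIV"
  and le: "\<And>v x. x \<in> space M ==> norm (f v x) \<le> B v"
 shows "integrable M (\<lambda>x. \<Sum>\<^sub>\<infinity>v. f v x)" (is ?g1)
  and "(\<integral>x. (\<Sum>\<^sub>\<infinity>v. f v x) \<partial>M) = (\<Sum>\<^sub>\<infinity>v. \<integral>x. f v x \<partial>M)"
  and "(\<lambda>v. norm (\<integral>x. f v x \<partial>M)) summable_on UNIV"
proof -
 interpret finite_measure M by fact
 have int: "integrable M (f v)" for v by (rule integrable_const_bound[of _ "B v"]) (use meas le in auto)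
 have pt: "(\<lambda>v. norm (f v x)) summable_on UNIV" if "x \<in> space M" for x by (rule summable_on_comparison_test[OF B]) (use le that in auto)
 have le': "(\<integral>x. norm (f v x) \<partial>M) \<le> B v * measure M (space M)" for v
 proof -
  have "(\<integral>x. norm (f v x) \<partial>M) \<le> (\<integral>x. B v \<partial>M)" by (rule integral_mono) (use int le in auto)
  thus ?thesis by (simp add: mult.commute)
 qed
 have "(\<lambda>v. B v * measure M (space M)) summable_on UNIV" by (rule summable_on_cmult_left[OF B])
 hence sum: "(\<lambda>v. \<integral>x. norm (f v x) \<partial>M) summable_on UNIV" by (rule summable_on_comparison_test) (use le' in auto)
 note sum_integral_swap[OF sigma_finite_measure_axioms int sum pt]
 thus ?g1
  and "(\<integral>x. (\<Sum>\<^sub>\<infinity>v. f v x) \<partial>M) = (\<Sum>\<^sub>\<infinity>v. \<integral>x. f v x \<partial>M)"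
  and "(\<lambda>v. norm (\<integral>x. f v x \<partial>M)) summable_on UNIV" by auto
qed

lemma summable_on_int_geometric:
 fixes q :: real
 assumes "0 \<le> q" "q < 1"
 shows "(\<lambda>n::int. q ^ nat \<bar>n\<bar>) summable_on UNIV"
proof -
 have g: "(\<lambda>n::nat. q ^ n) summable_on UNIV"
  using assms by (simp add: summable_on_UNIV_nonneg_real_iff summable_geometric)
 have 1: "(\<lambda>n::int. q ^ nat \<bar>n\<bar>) summable_on range int" by (subst summable_on_reindex) (use g in \<open>auto simp: o_def\<close>)
 have 2: "(\<lambda>n::int. q ^ nat \<bar>n\<bar>) summable_on range (\<lambda>n. - int n)"
  by (subst summable_on_reindex) (use g in \<open>auto simp: o_def inj_on_def\<close>)
 have "(\<lambda>n::int. q ^ nat \<bar>n\<bar>) summable_on (range int \<union> range (\<lambda>n. - int n))" by (rule summable_on_union[OF 1 2])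
 also have "range int \<union> range (\<lambda>n. - int n) = UNIV" by (auto simp: image_def) (metis int_cases2)
 finally show ?thesis .
qed

text \<open>The Jacobi theta series of the shifted lattice \<open>r + \<int>\<close>.\<close>

definition jtheta :: "real => real => real" where
 "jtheta \<tau> r = (\<Sum>\<^sub>\<infinity>n::int. exp (- pi * \<tau> * (of_int n + r)\<^sup>2))"

lemma gauss_le_geometric:
 assumes "\<tau> > 0" "\<bar>r\<bar> \<le> R"
 shows "exp (- pi * \<tau> * (of_int n + r)\<^sup>2) \<le> exp (pi * \<tau> * R\<^sup>2) * exp (- pi * \<tau> / 2) ^ nat \<bar>n\<bar>"
proof -
 have "r\<^sup>2 \<le> R\<^sup>2" using assms(2) by (simp add: abs_le_square_iff[symmetric])
 have "(of_int n + 2 * r)\<^sup>2 \<ge> 0" by simp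
 hence "(of_int n + r)\<^sup>2 \<ge> (of_int n)\<^sup>2 / 2 - r\<^sup>2" by (simp add: power2_eq_square algebra_simps)
 moreover have "real_of_int \<bar>n\<bar> \<le> (of_int n)\<^sup>2"
 proof (cases "n = 0")
  case False
  hence "1 \<le> \<bar>real_of_int n\<bar>" by linarith
  hence "\<bar>real_of_int n\<bar> * 1 \<le> \<bar>real_of_int n\<bar> * \<bar>real_of_int n\<bar>" by (intro mult_left_mono) auto
  thus ?thesis by (simp add: power2_eq_square)
 qed auto
 ultimately have "(of_int n + r)\<^sup>2 \<ge> of_int \<bar>n\<bar> / 2 - R\<^sup>2" using \<open>r\<^sup>2 \<le> R\<^sup>2\<close> by linarith
 hence "pi * \<tau> * (of_int n + r)\<^sup>2 \<ge> pi * \<tau> * (of_int \<bar>n\<bar> / 2 - R\<^sup>2)"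
  using assms by (intro mult_left_mono) auto
 hence "exp (- pi * \<tau> * (of_int n + r)\<^sup>2) \<le> exp (pi * \<tau> * R\<^sup>2 + of_nat (nat \<bar>n\<bar>) * (- pi * \<tau> / 2))"
  by (simp add: algebra_simps)
 also have "\<dots> = exp (pi * \<tau> * R\<^sup>2) * exp (- pi * \<tau> / 2) ^ nat \<bar>n\<bar>"
  unfolding exp_add exp_of_nat_mult[symmetric] by simp
 finally show ?thesis .
qed

lemma gauss_bound_summable:
 assumes "\<tau> > 0"
 shows "(\<lambda>n::int. exp (pi * \<tau> * R\<^sup>2) * exp (- pi * \<tau> / 2) ^ nat \<bar>n\<bar>) summable_on UNIV"
 by (intro summable_on_cmult_right summable_on_int_geometric) (use assms in auto)

lemma jtheta_summable:
 assumes "\<tau> > 0"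
 shows "(\<lambda>n::int. exp (- pi * \<tau> * (of_int n + r)\<^sup>2)) summable_on UNIV"
 by (rule summable_on_comparison_test[OF gauss_bound_summable[OF assms, of "\<bar>r\<bar>"]])
   (use gauss_le_geometric[OF assms order.refl] in auto)

lemma gauss_fourier:
 fixes \<xi> :: real
 assumes "\<tau> > 0"
 shows "integrable lborel (\<lambda>x::real. of_real (exp (- pi * \<tau> * x\<^sup>2)) * cis (- 2 * pi * \<xi> * x))" (is ?A)
  and "(\<integral>x. of_real (exp (- pi * \<tau> * x\<^sup>2)) * cis (- 2 * pi * \<xi> * x) \<partial>lborel)
      = of_real (\<tau> powr (- 1/2) * exp (- pi * \<xi>\<^sup>2 / \<tau>))" (is ?B)
proof -
 define c where "c = sqrt (2 * pi * \<tau>)"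
 have c: "c > 0" "c\<^sup>2 = 2 * pi * \<tau>" using assms by (auto simp: c_def)
 define t where "t = - 2 * pi * \<xi> / c"
 have "char std_normal_distribution t = (\<integral>x. std_normal_density x *\<^sub>R iexp (t * x) \<partial>lborel)"
  unfolding char_def by (subst integral_density) auto
 hence 1: "(\<integral>x. std_normal_density x *\<^sub>R iexp (t * x) \<partial>lborel) = of_real (exp (- t\<^sup>2 / 2))"
  by (simp add: char_std_normal_distribution)
 have intd: "integrable lborel (\<lambda>x. std_normal_density x)" by simp
 have int: "integrable lborel (\<lambda>x. std_normal_density x *\<^sub>R iexp (t * x))" by (rule Bochner_Integration.integrable_bound[OF intd]) auto
 have eq: "std_normal_density (0 + c * x) *\<^sub>R iexp (t * (0 + c * x)) =
   (1 / sqrt (2 * pi)) *\<^sub>R (of_real (exp (- pi * \<tau> * x\<^sup>2)) * cis (- 2 * pi * \<xi> * x))" for x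
 proof -
  have "- (c * x)\<^sup>2 / 2 = - pi * \<tau> * x\<^sup>2" using c by (simp add: power_mult_distrib)
  moreover have "t * (c * x) = - 2 * pi * \<xi> * x" using c(1) by (simp add: t_def)
  ultimately show ?thesis by (simp add: std_normal_density_def cis_conv_exp scaleR_conv_of_real mult_ac)
 qed
 have "integrable lborel (\<lambda>x. std_normal_density (0 + c * x) *\<^sub>R iexp (t * (0 + c * x)))"
  by (rule lborel_integrable_real_affine[OF int]) (use c in auto)
 hence "integrable lborel (\<lambda>x. sqrt (2 * pi) *\<^sub>R ((1 / sqrt (2 * pi)) *\<^sub>R
   (of_real (exp (- pi * \<tau> * x\<^sup>2)) * cis (- 2 * pi * \<xi> * x) :: complex)))"
  unfolding eq by (rule integrable_scaleR_right)
 thus ?A by simp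
 have "(\<integral>x. std_normal_density x *\<^sub>R iexp (t * x) \<partial>lborel) =
   c *\<^sub>R (\<integral>x. (1 / sqrt (2 * pi)) *\<^sub>R (of_real (exp (- pi * \<tau> * x\<^sup>2)) * cis (- 2 * pi * \<xi> * x)) \<partial>lborel)"
  by (subst lborel_integral_real_affine[of c _ 0]) (use c eq in auto)
 also have "\<dots> = sqrt \<tau> *\<^sub>R (\<integral>x. of_real (exp (- pi * \<tau> * x\<^sup>2)) * cis (- 2 * pi * \<xi> * x) \<partial>lborel)"
  by (simp add: c_def real_sqrt_mult)
 finally have "of_real (sqrt \<tau>) * (\<integral>x. of_real (exp (- pi * \<tau> * x\<^sup>2)) * cis (- 2 * pi * \<xi> * x) \<partial>lborel)
   = complex_of_real (exp (- t\<^sup>2 / 2))" using 1 by (simp add: scaleR_conv_of_real)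
 moreover have "- t\<^sup>2 / 2 = - pi * \<xi>\<^sup>2 / \<tau>"
  unfolding t_def power_divide c(2) using assms by (simp add: field_simps power2_eq_square)
 moreover have "\<tau> powr (-1/2) = 1 / sqrt \<tau>"
  using assms by (simp add: powr_minus_divide powr_half_sqrt[symmetric])
 ultimately have "complex_of_real (sqrt \<tau>) *
   (\<integral>x. of_real (exp (- pi * \<tau> * x\<^sup>2)) * cis (- 2 * pi * \<xi> * x) \<partial>lborel) =
   of_real (sqrt \<tau>) * of_real (\<tau> powr (- 1/2) * exp (- pi * \<xi>\<^sup>2 / \<tau>))"
  using assms by simp
 thus ?B using assms by simp
qed

abbreviation I01 :: "real measure" where "I01 \<equiv> restrict_space lborel {0..1}"

lemma space_I01 [simp]: "space I01 = {0..1}" by (simp add: space_restrict_space)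

lemma prob_space_I01: "prob_space I01" by (rule prob_spaceI) (simp add: emeasure_restrict_space)

lemma finite_measure_I01: "finite_measure I01"
 using prob_space_I01 by (rule prob_space.finite_measure)

lemma I01_measurable [measurable]:
 "f \<in> borel_measurable borel ==> f \<in> borel_measurable I01" by (rule measurable_restrict_space1) simp

lemma integral_I01: "(\<integral>x. f x \<partial>I01) = (LINT x:{0..1}|lborel. f x)"
 for f :: "real => 'b::{banach,second_countable_topology}" by (simp add: integral_restrict_space set_lebesgue_integral_def)

lemma continuous_integrable_I01:
 fixes f :: "real => complex"
 assumes "continuous_on {0..1} f"
 shows "integrable I01 f" and "(\<integral>x. f x \<partial>I01) = integral {0..1} f" (is ?g1)
proof -
 have *: "set_integrable lborel {0..1} f"
  using borel_integrable_compact[of "{0..1}" f] assms by (simp add: set_integrable_def)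
 thus "integrable I01 f" by (simp add: integrable_restrict_space set_integrable_def)
 show ?g1
  using set_borel_integral_eq_integral(2)[OF *] by (simp add: integral_I01)
qed

lemma integral_half_open:
 fixes G :: "real => complex"
 assumes "integrable lborel G"
 shows "(\<integral>x. indicator {0..<1} x *\<^sub>R G x \<partial>lborel) = (\<integral>x. indicator {0..1} x *\<^sub>R G x \<partial>lborel)"
proof (rule Bochner_Integration.integral_cong_AE)
 have m: "(\<lambda>x. indicator A x *\<^sub>R G x) \<in> borel_measurable lborel"
  if "A \<in> sets lborel" for A :: "real set" by (rule borel_measurable_integrable[OF integrable_mult_indicator[OF that assms]])
 show "(\<lambda>x. indicator {0..<1} x *\<^sub>R G x) \<in> borel_measurable lborel" by (rule m) simp
 show "(\<lambda>x. indicator {0..1} x *\<^sub>R G x) \<in> borel_measurable lborel" by (rule m) simp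
 have "AE x in lborel. x \<noteq> (1::real)" by (rule AE_lborel_singleton)
 thus "AE x in lborel. indicator {0..<1} x *\<^sub>R G x = indicator {0..1} x *\<^sub>R G x" by (rule AE_mp) (auto simp: indicator_def)
qed

text \<open>Unfolding: summing the integrals over all integer translates of the unit interval.\<close>

lemma unfold_integral:
 fixes F :: "real => complex"
 assumes "integrable lborel F"
 shows "(\<Sum>\<^sub>\<infinity>n::int. \<integral>x. F (of_int n + x) \<partial>I01) = (\<integral>x. F x \<partial>lborel)"
proof -
 define f where "f = (\<lambda>(n::int) x. indicator {of_int n..<of_int n + 1} x *\<^sub>R F x)"
 have fl: "f n x = (if n = \<lfloor>x\<rfloor> then F x else 0)" for n x
  unfolding f_def indicator_def by (auto simp: floor_eq_iff) (metis floor_unique)+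
 have int: "integrable lborel (f n)" for n
  unfolding f_def using assms by (intro integrable_mult_indicator) auto
 have pt: "(\<lambda>n. norm (f n x)) summable_on UNIV" for x
  by (rule finite_nonzero_values_imp_summable_on, rule finite_subset[of _ "{\<lfloor>x\<rfloor>}"]) (auto simp: fl)
 have "(\<Sum>n\<in>S. \<integral>x. norm (f n x) \<partial>lborel) \<le> (\<integral>x. norm (F x) \<partial>lborel)" if "finite S" for S
 proof -
  have "(\<Sum>n\<in>S. \<integral>x. norm (f n x) \<partial>lborel) = (\<integral>x. (\<Sum>n\<in>S. norm (f n x)) \<partial>lborel)"
   using int by (subst Bochner_Integration.integral_sum) auto
  also have "\<dots> \<le> (\<integral>x. norm (F x) \<partial>lborel)"
  proof (rule integral_mono)
   show "(\<Sum>n\<in>S. norm (f n x)) \<le> norm (F x)" for x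
   proof -
    have "(\<Sum>n\<in>S. norm (f n x)) = (\<Sum>n\<in>S. if n = \<lfloor>x\<rfloor> then norm (F x) else 0)" by (intro sum.cong) (auto simp: fl)
    also have "\<dots> \<le> norm (F x)" using that by (simp add: sum.delta)
    finally show ?thesis .
   qed
  qed (use int assms in auto)
  finally show ?thesis .
 qed
 hence sum: "(\<lambda>n. \<integral>x. norm (f n x) \<partial>lborel) summable_on UNIV" by (intro nonneg_bdd_above_summable_on bdd_aboveI2) auto
 have "(\<integral>x. (\<Sum>\<^sub>\<infinity>n. f n x) \<partial>lborel) = (\<Sum>\<^sub>\<infinity>n. \<integral>x. f n x \<partial>lborel)"
  by (rule sum_integral_swap(2)[OF lborel.sigma_finite_measure_axioms int sum pt])
 moreover have "(\<Sum>\<^sub>\<infinity>n. f n x) = F x" for x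
 proof -
  have "(\<Sum>\<^sub>\<infinity>n. f n x) = (\<Sum>\<^sub>\<infinity>n\<in>{\<lfloor>x\<rfloor>}. f n x)"
   by (rule infsum_cong_neutral) (auto simp: fl)
  thus ?thesis by (simp add: fl)
 qed
 moreover have "(\<integral>x. f n x \<partial>lborel) = (\<integral>x. F (of_int n + x) \<partial>I01)" for n
 proof -
  have m: "integrable lborel (\<lambda>x. F (of_int n + 1 * x))" by (rule lborel_integrable_real_affine[OF assms]) simp
  have "f n (of_int n + 1 * x) = indicator {0..<1} x *\<^sub>R F (of_int n + 1 * x)" for x by (simp add: f_def indicator_def)
  hence "(\<integral>x. f n x \<partial>lborel) = (\<integral>x. indicator {0..<1} x *\<^sub>R F (of_int n + 1 * x) \<partial>lborel)"
   using lborel_integral_real_affine[of 1 "f n" "of_int n"] by simp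
  also note integral_half_open[OF m]
  finally show ?thesis by (simp add: integral_I01 set_lebesgue_integral_def)
 qed
 ultimately show ?thesis by simp
qed

lemma periodic_of_int:
 fixes H :: "real => 'a"
 assumes "\<And>x. H (x + 1) = H x"
 shows "H (x + of_int n) = H x"
proof (induction n rule: int_induct[where k = 0])
 case (step1 i)
 thus ?case using assms[of "x + of_int i"] by (simp add: add_ac)
next
 case (step2 i)
 thus ?case using assms[of "x + of_int i - 1"] by (simp add: algebra_simps)
qed auto

lemma continuous_on_circle:
 fixes H :: "real => real"
 assumes cont: "continuous_on UNIV H" and per: "\<And>x. H (x + 1) = H x"
 obtains h where "continuous_on (sphere (0::complex) 1) h" "\<And>x. h (cis (2 * pi * x)) = H x"
proof -
 define h where "h = (\<lambda>z. H (Arg2pi z / (2 * pi)))"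
 have h: "h (cis (2 * pi * x)) = H x" for x
 proof -
  have eq: "cis (2 * pi * x) = cis (Arg2pi (cis (2 * pi * x)))"
   using Arg2pi_eq[of "cis (2*pi*x)"] by (simp add: cis_conv_exp)
  hence "exp (\<i> * of_real (Arg2pi (cis (2 * pi * x)))) = exp (\<i> * of_real (2 * pi * x))" by (simp add: cis_conv_exp)
  then obtain n :: int where "\<i> * complex_of_real (Arg2pi (cis (2 * pi * x))) =
    \<i> * of_real (2 * pi * x) + of_real (of_int (2 * n) * pi) * \<i>"
   unfolding exp_eq by blast
  hence "Im (\<i> * complex_of_real (Arg2pi (cis (2 * pi * x)))) =
    Im (\<i> * of_real (2 * pi * x) + of_real (of_int (2 * n) * pi) * \<i>)" by (rule arg_cong)
  hence "Arg2pi (cis (2 * pi * x)) = 2 * pi * x + 2 * pi * of_int n" by simp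
  hence "Arg2pi (cis (2 * pi * x)) / (2 * pi) = x + of_int n" by (simp add: field_simps)
  thus ?thesis by (simp add: h_def periodic_of_int[of H, OF per])
 qed
 let ?q = "\<lambda>x. cis (2 * pi * x)"
 have sph: "sphere (0::complex) 1 \<subseteq> ?q ` {0..1}"
 proof
  fix z :: complex assume "z \<in> sphere 0 1"
  hence "z = cis (2 * pi * (Arg2pi z / (2 * pi)))" using Arg2pi_eq[of z] by (simp add: cis_conv_exp)
  moreover have "Arg2pi z / (2 * pi) \<in> {0..1}" using Arg2pi_ge_0[of z] Arg2pi_lt_2pi[of z] by auto
  ultimately show "z \<in> ?q ` {0..1}" by blast
 qed
 have "closed (h -` B \<inter> sphere 0 1)" if "closed B" for B
 proof -
  have "h -` B \<inter> sphere 0 1 = ?q ` ({0..1} \<inter> H -` B)"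
  proof (intro subset_antisym subsetI)
   fix z assume z: "z \<in> h -` B \<inter> sphere 0 1"
   then obtain x where "x \<in> {0..1}" "z = ?q x" using sph by auto
   thus "z \<in> ?q ` ({0..1} \<inter> H -` B)" using z h[of x] by auto
  next
   fix z assume "z \<in> ?q ` ({0..1} \<inter> H -` B)"
   then obtain x where "H x \<in> B" "z = ?q x" by auto
   thus "z \<in> h -` B \<inter> sphere 0 1" using h[of x] by auto
  qed
  moreover have "closed (H -` B)"
   using continuous_closed_vimage[OF that, of H] cont by (simp add: continuous_on_eq_continuous_at)
  hence "compact ({0..1} \<inter> H -` B)" by (intro compact_Int_closed) auto
  hence "compact (?q ` ({0..1} \<inter> H -` B))" by (intro compact_continuous_image continuous_intros)
  ultimately show ?thesis by (simp add: compact_imp_closed)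
 qed
 hence "continuous_on (sphere 0 1) h" by (subst continuous_on_closed_vimage) auto
 thus ?thesis using h that by blast
qed

lemma cis_int [simp]: "cis (2 * pi * of_int n) = 1" by (rule cis_multiple_2pi) simp

text \<open>Those \<open>F\<close> for which multiplication preserves the vanishing of all Fourier coefficients
 form an algebra, so it contains all trigonometric polynomials.\<close>

lemma fourier_zero_polynomial:
 fixes H :: "real => complex" and p :: "complex => real"
 assumes cont: "continuous_on UNIV H"
  and zero: "\<And>k::int. integral {0..1} (\<lambda>x. H x * cis (- 2 * pi * of_int k * x)) = 0"
  and p: "real_polynomial_function p"
 shows "integral {0..1} (\<lambda>x. H x * of_real (p (cis (2 * pi * x)))) = 0"
proof -
 define good where "good = (\<lambda>G::real => complex. continuous_on UNIV G \<and>
  (\<forall>k::int. integral {0..1} (\<lambda>x. G x * cis (- 2 * pi * of_int k * x)) = 0))"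
 have int: "(\<lambda>x. G x * cis (- 2 * pi * of_int k * x)) integrable_on {0..1}"
  if "good G" for G k
  using that unfolding good_def by (intro integrable_continuous_interval continuous_intros) (auto intro: continuous_on_subset)
 have add: "good (\<lambda>x. G1 x + G2 x)" if "good G1" "good G2" for G1 G2
  using that int[OF that(1)] int[OF that(2)] by (auto simp: good_def ring_distribs integral_add intro!: continuous_intros)
 have cmul: "good (\<lambda>x. c * G x)" if "good G" for G c
  using that by (auto simp: good_def mult.assoc intro!: continuous_intros)
 have shift: "good (\<lambda>x. cis (2 * pi * of_int m * x) * G x)" if "good G" for G m
 proof -
  have "cis (2 * pi * of_int m * x) * G x * cis (- 2 * pi * of_int k * x)
    = G x * cis (- 2 * pi * of_int (k - m) * x)" for k x
  proof -
   have "cis (2 * pi * of_int m * x) * cis (- 2 * pi * of_int k * x) = cis (- 2 * pi * of_int (k - m) * x)" by (simp add: cis_mult algebra_simps)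
   thus ?thesis by (metis mult.commute mult.left_commute)
  qed
  hence "(\<lambda>x. cis (2 * pi * of_int m * x) * G x * cis (- 2 * pi * of_int k * x))
    = (\<lambda>x. G x * cis (- 2 * pi * of_int (k - m) * x))" for k by blast
  thus ?thesis using that unfolding good_def by (auto simp only: intro!: continuous_intros)
 qed
 have "good G ==> good (\<lambda>x. of_real (p (cis (2 * pi * x))) * G x)" for G
  using p
 proof (induction p arbitrary: G rule: real_polynomial_function.induct)
  case (linear f)
  have lin: "f (cis t) = cos t * f 1 + sin t * f \<i>" for t
  proof -
   have "cis t = cos t *\<^sub>R 1 + sin t *\<^sub>R \<i>" by (simp add: complex_eq_iff)
   thus ?thesis using linear by (simp add: linear_add linear_scale bounded_linear.linear)
  qed
  have "of_real (f (cis (2 * pi * x))) = (of_real (f 1) / 2 + of_real (f \<i>) / (2 * \<i>)) * cis (2 * pi * of_int 1 * x)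
    + (of_real (f 1) / 2 - of_real (f \<i>) / (2 * \<i>)) * cis (2 * pi * of_int (-1) * x)" for x by (simp add: lin complex_eq_iff field_simps)
  hence eq: "(\<lambda>x. of_real (f (cis (2 * pi * x))) * G x) =
    (\<lambda>x. (of_real (f 1) / 2 + of_real (f \<i>) / (2 * \<i>)) * (cis (2 * pi * of_int 1 * x) * G x)
    + (of_real (f 1) / 2 - of_real (f \<i>) / (2 * \<i>)) * (cis (2 * pi * of_int (-1) * x) * G x))" by (simp only: distrib_right mult.assoc)
  show ?case unfolding eq by (intro add cmul shift linear(2))
 next
  case (const c)
  thus ?case by (rule cmul)
 next
  case (add f g)
  have "good (\<lambda>x. of_real (f (cis (2 * pi * x))) * G x + of_real (g (cis (2 * pi * x))) * G x)"
   using add.IH add.prems by (intro \<open>\<And>G1 G2. good G1 ==> good G2 ==> good (\<lambda>x. G1 x + G2 x)\<close>) auto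
  thus ?case by (simp add: distrib_right)
 next
  case (mult f g)
  have "good (\<lambda>x. of_real (f (cis (2 * pi * x))) * (of_real (g (cis (2 * pi * x))) * G x))"
   using mult.IH(1)[OF mult.IH(2)[OF mult.prems]] .
  thus ?case by (simp add: mult.assoc)
 qed
 moreover have "good H" using cont zero by (simp add: good_def)
 ultimately have "good (\<lambda>x. of_real (p (cis (2 * pi * x))) * H x)" by blast
 hence "integral {0..1} (\<lambda>x. of_real (p (cis (2 * pi * x))) * H x * cis (- 2 * pi * of_int 0 * x)) = 0"
  unfolding good_def by blast
 thus ?thesis by (simp add: mult.commute)
qed

lemma fourier_unique_Re:
 fixes H :: "real => complex"
 assumes cont: "continuous_on UNIV H" and per: "\<And>x. H (x + 1) = H x"
  and zero: "\<And>k::int. integral {0..1} (\<lambda>x. H x * cis (- 2 * pi * of_int k * x)) = 0"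
 shows "Re (H x) = 0"
proof -
 define R where "R = (\<lambda>x. Re (H x))"
 have cR: "continuous_on UNIV R" unfolding R_def using cont by (intro continuous_intros)
 note cR' = continuous_on_subset[OF cR subset_UNIV]
 have perR: "R (x + 1) = R x" for x by (simp add: R_def per)
 obtain h where h: "continuous_on (sphere (0::complex) 1) h" "\<And>x. h (cis (2 * pi * x)) = R x"
  using continuous_on_circle[OF cR perR] by blast
 have le: "integral {0..1} (\<lambda>x. (R x)\<^sup>2) \<le> e * integral {0..1} (\<lambda>x. \<bar>R x\<bar>)" if e: "e > 0" for e
 proof -
  obtain p where p: "real_polynomial_function p" "\<And>z. z \<in> sphere 0 1 ==> \<bar>h z - p z\<bar> < e"
   using Stone_Weierstrass_real_polynomial_function[OF compact_sphere h(1) e] by metis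
  let ?p = "\<lambda>x. p (cis (2 * pi * x))"
  have cp: "continuous_on {0..1} ?p" by (rule continuous_on_compose2[OF continuous_on_subset[OF continuous_on_polymonial_function subset_UNIV]])
    (auto intro!: continuous_intros p(1) simp: real_polynomial_function_eq[symmetric])
  have "integral {0..1} (\<lambda>x. Re (H x * of_real (?p x))) = Re (integral {0..1} (\<lambda>x. H x * of_real (?p x)))"
   by (subst integral_linear[OF _ bounded_linear_Re, symmetric])
     (auto simp: o_def intro!: integrable_continuous_interval continuous_intros cp continuous_on_subset[OF cont])
  hence zp: "integral {0..1} (\<lambda>x. R x * ?p x) = 0"
   using fourier_zero_polynomial[OF cont zero p(1)] by (simp add: R_def)
  have "integral {0..1} (\<lambda>x. (R x)\<^sup>2) = integral {0..1} (\<lambda>x. R x * (R x - ?p x) + R x * ?p x)"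
   by (simp add: power2_eq_square algebra_simps)
  also have "\<dots> = integral {0..1} (\<lambda>x. R x * (R x - ?p x))"
   by (subst integral_add) (auto intro!: integrable_continuous_interval continuous_intros cp cR' simp: zp)
  also have "\<dots> \<le> integral {0..1} (\<lambda>x. e * \<bar>R x\<bar>)"
  proof (rule integral_le)
   fix x :: real
   have "\<bar>R x - ?p x\<bar> \<le> e" using p(2)[of "cis (2 * pi * x)"] h(2)[of x] by simp
   hence "\<bar>R x\<bar> * \<bar>R x - ?p x\<bar> \<le> \<bar>R x\<bar> * e" by (intro mult_left_mono) auto
   thus "R x * (R x - ?p x) \<le> e * \<bar>R x\<bar>"
    using abs_ge_self[of "R x * (R x - ?p x)"] by (simp add: abs_mult mult.commute)
  qed (auto intro!: integrable_continuous_interval continuous_intros cp cR')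
  finally show ?thesis by simp
 qed
 have nn: "integral {0..1} (\<lambda>x. \<bar>R x\<bar>) \<ge> 0"
  by (intro integral_nonneg integrable_continuous_interval continuous_intros cR') auto
 have "integral {0..1} (\<lambda>x. (R x)\<^sup>2) \<le> 0"
 proof (rule field_le_epsilon)
  fix e :: real assume e: "e > 0"
  let ?I = "integral {0..1} (\<lambda>x. \<bar>R x\<bar>)"
  have "integral {0..1} (\<lambda>x. (R x)\<^sup>2) \<le> e / (?I + 1) * ?I" using nn e by (intro le) auto
  also have "\<dots> \<le> e" using nn e by (simp add: field_simps)
  finally show "integral {0..1} (\<lambda>x. (R x)\<^sup>2) \<le> 0 + e" by simp
 qed
 moreover have "integral {0..1} (\<lambda>x. (R x)\<^sup>2) \<ge> 0"
  by (intro integral_nonneg integrable_continuous_interval continuous_intros cR') auto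
 ultimately have "integral {0..1} (\<lambda>x. (R x)\<^sup>2) = 0" by linarith
 hence R0: "R x = 0" if "x \<in> {0..1}" for x
  using that by (subst (asm) integral_eq_0_iff) (auto intro!: continuous_intros cR')
 have "R x = R (frac x + of_int \<lfloor>x\<rfloor>)" by (simp add: frac_def)
 also have "\<dots> = R (frac x)" by (rule periodic_of_int[of R, OF perR])
 also have "\<dots> = 0" by (rule R0) (simp add: frac_lt_1 less_imp_le)
 finally show ?thesis by (simp add: R_def)
qed

lemma fourier_unique:
 fixes H :: "real => complex"
 assumes cont: "continuous_on UNIV H" and per: "\<And>x. H (x + 1) = H x"
  and zero: "\<And>k::int. integral {0..1} (\<lambda>x. H x * cis (- 2 * pi * of_int k * x)) = 0"
 shows "H x = 0"
proof -
 have "Re (- \<i> * H x) = 0" by (rule fourier_unique_Re) (use assms in \<open>auto intro!: continuous_intros simp: mult.assoc\<close>)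
 moreover have "Re (H x) = 0" by (rule fourier_unique_Re) (use assms in auto)
 ultimately show ?thesis by (simp add: complex_eq_iff)
qed

lemma continuous_on_infsum_int:
 fixes f :: "int => real => 'b::banach"
 assumes cont: "\<And>n. continuous_on A (f n)"
  and le: "\<And>n x. x \<in> A ==> norm (f n x) \<le> B n" and B: "B summable_on UNIV"
 shows "continuous_on A (\<lambda>x. \<Sum>\<^sub>\<infinity>n. f n x)"
proof (rule uniform_limit_theorem)
 show "uniform_limit A (\<lambda>S x. \<Sum>n\<in>S. f n x) (\<lambda>x. \<Sum>\<^sub>\<infinity>n. f n x) (finite_subsets_at_top UNIV)"
  by (rule Weierstrass_m_test_general[OF _ B]) (use le in auto)
 show "\<forall>\<^sub>F S in finite_subsets_at_top UNIV. continuous_on A (\<lambda>x. \<Sum>n\<in>S. f n x)"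
  using cont by (auto intro!: always_eventually continuous_intros)
qed auto

lemma jtheta_periodic: "jtheta \<tau> (r + 1) = jtheta \<tau> r"
proof -
 have "jtheta \<tau> (r + 1) = (\<Sum>\<^sub>\<infinity>n\<in>range (\<lambda>n::int. n + 1). exp (- pi * \<tau> * (of_int n + r)\<^sup>2))"
  by (subst infsum_reindex) (auto simp: jtheta_def o_def add_ac)
 also have "range (\<lambda>n::int. n + 1) = UNIV" by (metis surj_def diff_add_cancel)
 finally show ?thesis by (simp add: jtheta_def)
qed

lemma jtheta_continuous:
 assumes "\<tau> > 0"
 shows "continuous_on UNIV (jtheta \<tau>)"
proof -
 have "continuous_on {-R<..<R} (jtheta \<tau>)" for R
  unfolding jtheta_def by (rule continuous_on_infsum_int[OF _ _ gauss_bound_summable[OF assms, of R]])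
    (use gauss_le_geometric[OF assms] in \<open>auto intro!: continuous_intros\<close>)
 note * = this
 have "isCont (jtheta \<tau>) x" for x
  using *[of "\<bar>x\<bar> + 1"] continuous_on_eq_continuous_at[OF open_greaterThanLessThan, of "-(\<bar>x\<bar> + 1)" "\<bar>x\<bar> + 1" "jtheta \<tau>"]
  by (auto simp: abs_real_def)
 thus ?thesis by (simp add: continuous_on_eq_continuous_at)
qed

lemma infsum_of_real:
 fixes f :: "'v => real"
 assumes "f summable_on A"
 shows "(\<Sum>\<^sub>\<infinity>x\<in>A. complex_of_real (f x)) = of_real (\<Sum>\<^sub>\<infinity>x\<in>A. f x)"
 by (rule infsumI[OF has_sum_of_real[OF has_sum_infsum[OF assms]]])

lemma jtheta_fourier_coeff:
 assumes "\<tau> > 0"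
 shows "(\<integral>x. of_real (jtheta \<tau> x) * cis (- 2 * pi * of_int k * x) \<partial>I01)
   = of_real (\<tau> powr (- 1/2) * exp (- pi * (of_int k)\<^sup>2 / \<tau>))"
proof -
 define F where "F = (\<lambda>x::real. of_real (exp (- pi * \<tau> * x\<^sup>2)) * cis (- 2 * pi * of_int k * x))"
 have F: "integrable lborel F"
  unfolding F_def by (rule gauss_fourier(1)[OF assms])
 have cisF: "F (of_int n + x) = of_real (exp (- pi * \<tau> * (of_int n + x)\<^sup>2)) * cis (- 2 * pi * of_int k * x)" for n x
 proof -
  have "cis (- 2 * pi * of_int k * (of_int n + x)) = cis (2 * pi * of_int (- k * n)) * cis (- 2 * pi * of_int k * x)"
   by (simp add: cis_mult algebra_simps del: cis_int)
  thus ?thesis unfolding F_def by (simp only: cis_int mult_1)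
 qed
 have "(\<integral>x. of_real (jtheta \<tau> x) * cis (- 2 * pi * of_int k * x) \<partial>I01) = (\<integral>x. (\<Sum>\<^sub>\<infinity>n::int. F (of_int n + x)) \<partial>I01)"
 proof (rule arg_cong[where f = "integral\<^sup>L I01"], rule ext)
  fix x
  have "(\<lambda>n::int. complex_of_real (exp (- pi * \<tau> * (of_int n + x)\<^sup>2))) summable_on UNIV"
   using jtheta_summable[OF assms] by (rule summable_on_of_real)
  moreover have "of_real (jtheta \<tau> x) = (\<Sum>\<^sub>\<infinity>n::int. complex_of_real (exp (- pi * \<tau> * (of_int n + x)\<^sup>2)))"
   unfolding jtheta_def by (rule infsum_of_real[OF jtheta_summable[OF assms], symmetric])
  ultimately show "of_real (jtheta \<tau> x) * cis (- 2 * pi * of_int k * x) = (\<Sum>\<^sub>\<infinity>n::int. F (of_int n + x))"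
   unfolding cisF by (simp only: infsum_cmult_left)
 qed
 also have "\<dots> = (\<Sum>\<^sub>\<infinity>n::int. \<integral>x. F (of_int n + x) \<partial>I01)"
 proof (rule sum_integral_swap_bounded(2)[OF finite_measure_I01 _ gauss_bound_summable[OF assms, of 1]])
  show "(\<lambda>x. F (of_int n + x)) \<in> borel_measurable I01" for n
   unfolding F_def by (intro I01_measurable borel_measurable_continuous_onI continuous_intros)
  show "norm (F (of_int n + x)) \<le> exp (pi * \<tau> * 1\<^sup>2) * exp (- pi * \<tau> / 2) ^ nat \<bar>n\<bar>"
   if "x \<in> space I01" for n x
   using gauss_le_geometric[OF assms, of x 1 n] that unfolding cisF by (simp add: norm_mult)
 qed
 also have "\<dots> = (\<integral>x. F x \<partial>lborel)" by (rule unfold_integral[OF F])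
 also have "\<dots> = of_real (\<tau> powr (- 1/2) * exp (- pi * (of_int k)\<^sup>2 / \<tau>))"
  unfolding F_def by (rule gauss_fourier(2)[OF assms])
 finally show ?thesis .
qed

lemma integral_cis_I01:
 "(\<integral>x. cis (2 * pi * of_int j * x) \<partial>I01) = (if j = 0 then 1 else 0)"
proof (cases "j = 0")
 case True
 interpret prob_space I01 by (rule prob_space_I01)
 show ?thesis using True prob_space by simp
next
 case False
 define c where "c = 2 * of_real pi * \<i> * of_int j"
 have c: "c \<noteq> 0" using False by (simp add: c_def)
 have ec: "cis (2 * pi * of_int j * x) = exp (c * of_real x)" for x by (simp add: cis_conv_exp c_def mult_ac)
 have "((\<lambda>x. exp (c * of_real x)) has_integral exp (c * of_real 1) / c - exp (c * of_real 0) / c) {0..1}"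
 proof (rule fundamental_theorem_of_calculus)
  fix x :: real
  have "((\<lambda>z. exp (c * z) / c) has_field_derivative exp (c * of_real x)) (at (of_real x))"
   using c by (auto intro!: derivative_eq_intros)
  thus "((\<lambda>x. exp (c * of_real x) / c) has_vector_derivative exp (c * of_real x)) (at x within {0..1})"
   by (rule has_vector_derivative_real_field)
 qed auto
 moreover have "exp (c * of_real 1) = 1" unfolding ec[symmetric] by simp
 ultimately have "integral {0..1} (\<lambda>x. exp (c * of_real x)) = 0" by (simp add: integral_unique)
 thus ?thesis using False unfolding ec by (subst continuous_integrable_I01(2)) (auto intro!: continuous_intros)
qed

theorem jtheta_poisson:
 assumes "\<tau> > 0"
 shows "complex_of_real (jtheta \<tau> r) =
  of_real (\<tau> powr (- 1/2)) * (\<Sum>\<^sub>\<infinity>k::int. of_real (exp (- pi * (of_int k)\<^sup>2 / \<tau>)) * cis (2 * pi * of_int k * r))"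
proof -
 define e where "e = (\<lambda>k::int. exp (- pi * (of_int k)\<^sup>2 / \<tau>))"
 define S where "S = (\<lambda>r. \<Sum>\<^sub>\<infinity>k::int. complex_of_real (e k) * cis (2 * pi * of_int k * r))"
 have e: "e summable_on UNIV" using jtheta_summable[of "1/\<tau>" 0] assms by (simp add: e_def)
 have contS: "continuous_on UNIV S"
  unfolding S_def by (rule continuous_on_infsum_int[OF _ _ e]) (auto intro!: continuous_intros simp: norm_mult e_def)
 define H where "H = (\<lambda>r. complex_of_real (jtheta \<tau> r) - of_real (\<tau> powr (- 1/2)) * S r)"
 have contH: "continuous_on UNIV H"
  unfolding H_def by (intro continuous_intros contS jtheta_continuous assms)
 have "H r = 0"
 proof (rule fourier_unique[OF contH])
  have "cis (2 * pi * of_int k * (r + 1)) = cis (2 * pi * of_int k * r)" for k r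
  proof -
   have "cis (2 * pi * of_int k * (r + 1)) = cis (2 * pi * of_int k * r) * cis (2 * pi * of_int k)"
    unfolding cis_mult by (simp add: algebra_simps)
   thus ?thesis by simp
  qed
  thus "H (x + 1) = H x" for x by (simp add: H_def S_def jtheta_periodic)
 next
  fix m :: int
  have "(\<integral>x. S x * cis (- 2 * pi * of_int m * x) \<partial>I01)
    = (\<integral>x. (\<Sum>\<^sub>\<infinity>k. of_real (e k) * cis (2 * pi * of_int (k - m) * x)) \<partial>I01)"
  proof (rule arg_cong[where f = "integral\<^sup>L I01"], rule ext)
   fix x
   have "(\<lambda>k. complex_of_real (e k) * cis (2 * pi * of_int k * x)) summable_on UNIV"
    by (rule abs_summable_summable, rule summable_on_comparison_test[OF e]) (auto simp: norm_mult e_def)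
   hence "S x * cis (- 2 * pi * of_int m * x) =
     (\<Sum>\<^sub>\<infinity>k. of_real (e k) * cis (2 * pi * of_int k * x) * cis (- 2 * pi * of_int m * x))"
    unfolding S_def by (simp add: infsum_cmult_left)
   also have "\<dots> = (\<Sum>\<^sub>\<infinity>k. of_real (e k) * cis (2 * pi * of_int (k - m) * x))"
   proof (rule infsum_cong)
    fix k
    have "2 * pi * of_int k * x + - 2 * pi * of_int m * x = 2 * pi * of_int (k - m) * x" by (simp add: left_diff_distrib right_diff_distrib)
    thus "of_real (e k) * cis (2 * pi * of_int k * x) * cis (- 2 * pi * of_int m * x)
      = of_real (e k) * cis (2 * pi * of_int (k - m) * x)" by (simp only: mult.assoc cis_mult)
   qed
   finally show "S x * cis (- 2 * pi * of_int m * x) = \<dots>" .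
  qed
  also have "\<dots> = (\<Sum>\<^sub>\<infinity>k. (\<integral>x. of_real (e k) * cis (2 * pi * of_int (k - m) * x) \<partial>I01))"
  proof (rule sum_integral_swap_bounded(2)[OF finite_measure_I01 _ e])
   show "(\<lambda>x. of_real (e k) * cis (2 * pi * of_int (k - m) * x)) \<in> borel_measurable I01" for k
    by (intro I01_measurable borel_measurable_continuous_onI continuous_intros)
  qed (auto simp: norm_mult e_def)
  also have "\<dots> = (\<Sum>\<^sub>\<infinity>k. of_real (e k) * (if k - m = 0 then 1 else 0))"
   by (simp only: integral_mult_right_zero integral_cis_I01)
  also have "\<dots> = (\<Sum>\<^sub>\<infinity>k\<in>{m}. of_real (e k))" by (rule infsum_cong_neutral) auto
  finally have S: "(\<integral>x. S x * cis (- 2 * pi * of_int m * x) \<partial>I01) = of_real (e m)" by simp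
  have intS: "integrable I01 (\<lambda>x. S x * cis (- 2 * pi * of_int m * x))"
   by (intro continuous_integrable_I01 continuous_intros continuous_on_subset[OF contS]) auto
  have intJ: "integrable I01 (\<lambda>x. of_real (jtheta \<tau> x) * cis (- 2 * pi * of_int m * x))"
   by (intro continuous_integrable_I01 continuous_intros continuous_on_subset[OF jtheta_continuous[OF assms]]) auto
  have "(\<integral>x. H x * cis (- 2 * pi * of_int m * x) \<partial>I01) =
    (\<integral>x. of_real (jtheta \<tau> x) * cis (- 2 * pi * of_int m * x)
      - of_real (\<tau> powr (- 1/2)) * (S x * cis (- 2 * pi * of_int m * x)) \<partial>I01)" by (simp add: H_def algebra_simps)
  also have "\<dots> = 0"
   using jtheta_fourier_coeff[OF assms, of m] by (subst Bochner_Integration.integral_diff) (use intS intJ S in \<open>auto simp: e_def\<close>)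
  finally show "integral {0..1} (\<lambda>x. H x * cis (- 2 * pi * of_int m * x)) = 0"
   by (subst (asm) continuous_integrable_I01(2)) (auto intro!: continuous_intros continuous_on_subset[OF contH])
 qed
 thus ?thesis by (simp add: H_def S_def e_def)
qed

definition jdelta :: "real => real" where
 "jdelta \<tau> = jtheta \<tau> 0 - 1"

lemma has_sum_single:
 fixes f :: "'v => 'a::{comm_monoid_add,t2_space}"
 shows "((\<lambda>k. if k = a then f k else 0) has_sum f a) UNIV"
proof -
 have "((\<lambda>k. if k = a then f k else 0) has_sum f a) {a}"
  using has_sum_finite[of "{a}" "\<lambda>k. if k = a then f k else 0"] by simp
 thus ?thesis by (rule has_sum_cong_neutral[THEN iffD1, rotated -1]) auto
qed

lemma has_sum_diff:
 fixes f g :: "'v => 'a::real_normed_vector"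
 assumes "(f has_sum a) A" "(g has_sum b) A"
 shows "((\<lambda>x. f x - g x) has_sum (a - b)) A"
 using has_sum_add[OF assms(1), of "\<lambda>x. - g x" "- b"] assms(2) by (simp add: has_sum_uminus)

lemma jtheta_zero_sum:
 assumes "\<tau> > 0"
 shows "((\<lambda>k::int. exp (- pi * \<tau> * (of_int k)\<^sup>2) - (if k = 0 then 1 else 0)) has_sum jdelta \<tau>) UNIV"
 unfolding jdelta_def jtheta_def
 using has_sum_diff[OF has_sum_infsum[OF jtheta_summable[OF assms, of 0]] has_sum_single[of 0 "\<lambda>_. 1::real"]] by simp

lemma jdelta_nonneg: "\<tau> > 0 ==> jdelta \<tau> \<ge> 0" by (rule has_sum_nonneg[OF jtheta_zero_sum]) auto

lemma jtheta_near:
 assumes "\<tau> > 0"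
 shows "\<bar>jtheta \<tau> r - \<tau> powr (- 1/2)\<bar> \<le> \<tau> powr (- 1/2) * jdelta (1 / \<tau>)"
proof -
 define e where "e = (\<lambda>k::int. exp (- pi * (1 / \<tau>) * (of_int k)\<^sup>2))"
 define f where "f = (\<lambda>k::int. of_real (e k) * cis (2 * pi * of_int k * r) - (if k = 0 then 1 else 0))"
 have e: "e summable_on UNIV" using jtheta_summable[of "1/\<tau>" 0] assms by (simp add: e_def)
 have "(\<lambda>k. complex_of_real (e k) * cis (2 * pi * of_int k * r)) summable_on UNIV"
  by (rule abs_summable_summable, rule summable_on_comparison_test[OF e]) (auto simp: norm_mult e_def)
 from has_sum_diff[OF has_sum_infsum[OF this] has_sum_single[of 0 "\<lambda>_. 1::complex"]]
 have f: "(f has_sum ((\<Sum>\<^sub>\<infinity>k. complex_of_real (e k) * cis (2 * pi * of_int k * r)) - 1)) UNIV" by (simp add: f_def)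
 have nf: "norm (f k) = e k - (if k = 0 then 1 else 0)" for k by (simp add: f_def e_def norm_mult)
 have d: "((\<lambda>k. norm (f k)) has_sum jdelta (1/\<tau>)) UNIV"
  using jtheta_zero_sum[of "1/\<tau>"] assms unfolding nf e_def by simp
 have "complex_of_real (jtheta \<tau> r - \<tau> powr (- 1/2)) = of_real (\<tau> powr (- 1/2)) * (\<Sum>\<^sub>\<infinity>k. f k)"
  unfolding infsumI[OF f] using jtheta_poisson[OF assms, of r] by (simp add: e_def algebra_simps)
 hence "norm (complex_of_real (jtheta \<tau> r - \<tau> powr (- 1/2))) = \<tau> powr (- 1/2) * norm (\<Sum>\<^sub>\<infinity>k. f k)"
  by (simp only: norm_mult norm_of_real) simp
 also have "norm (\<Sum>\<^sub>\<infinity>k. f k) \<le> (\<Sum>\<^sub>\<infinity>k. norm (f k))"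
  by (rule norm_infsum_bound) (use d in \<open>auto simp: summable_on_def\<close>)
 also have "\<dots> = jdelta (1/\<tau>)" by (rule infsumI[OF d])
 finally show ?thesis by (simp add: mult_left_mono del: of_real_diff)
qed

lemma jtheta_le:
 assumes "\<tau> > 0"
 shows "jtheta \<tau> r \<le> \<tau> powr (- 1/2) * (1 + jdelta (1 / \<tau>))"
 using jtheta_near[OF assms, of r] by (simp add: abs_le_iff algebra_simps)

lemma power_le_fact_exp:
 assumes "(x::real) \<ge> 0"
 shows "x ^ n \<le> fact n * exp x"
proof -
 have "(\<Sum>k\<in>{n}. x ^ k /\<^sub>R fact k) \<le> (\<Sum>k. x ^ k /\<^sub>R fact k)"
  by (rule sum_le_suminf) (use assms summable_exp_generic[of x] in auto)
 thus ?thesis by (simp add: exp_def field_simps)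
qed

lemma summable_on_int_inverse_square:
 "(\<lambda>k::int. 1 / (of_int k)\<^sup>2 :: real) summable_on UNIV"
proof -
 have g: "(\<lambda>n::nat. 1 / (of_nat n)\<^sup>2 :: real) summable_on UNIV"
  using inverse_power_summable[of 2, where 'a = real] by (simp add: summable_on_UNIV_nonneg_real_iff field_simps)
 have 1: "(\<lambda>k::int. 1 / (of_int k)\<^sup>2 :: real) summable_on range int"
  by (subst summable_on_reindex) (use g in \<open>auto simp: o_def\<close>)
 have 2: "(\<lambda>k::int. 1 / (of_int k)\<^sup>2 :: real) summable_on range (\<lambda>n. - int n)"
  by (subst summable_on_reindex) (use g in \<open>auto simp: o_def inj_on_def\<close>)
 have "range int \<union> range (\<lambda>n. - int n) = UNIV" by (auto simp: image_def) (metis int_cases2)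
 thus ?thesis using summable_on_union[OF 1 2] by simp
qed

lemma jdelta_decay: "\<exists>C\<ge>0. \<forall>\<tau>>0. jdelta \<tau> \<le> C / \<tau> ^ Suc N"
proof -
 define M where "M = Suc N"
 define C where "C = fact M * (\<Sum>\<^sub>\<infinity>k::int. 1 / (of_int k)\<^sup>2 :: real)"
 have "jdelta \<tau> \<le> C / \<tau> ^ M" if t: "\<tau> > 0" for \<tau>
 proof -
  have s: "((\<lambda>k::int. fact M / \<tau> ^ M * (1 / (of_int k)\<^sup>2)) has_sum (fact M / \<tau> ^ M * (\<Sum>\<^sub>\<infinity>k::int. 1 / (of_int k)\<^sup>2 :: real))) UNIV"
   by (intro has_sum_cmult_right has_sum_infsum summable_on_int_inverse_square)
  have "jdelta \<tau> \<le> fact M / \<tau> ^ M * (\<Sum>\<^sub>\<infinity>k::int. 1 / (of_int k)\<^sup>2 :: real)"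
  proof (rule has_sum_mono[OF jtheta_zero_sum[OF t] s])
   fix k :: int
   show "exp (- pi * \<tau> * (of_int k)\<^sup>2) - (if k = 0 then 1 else 0) \<le> fact M / \<tau> ^ M * (1 / (of_int k)\<^sup>2)"
   proof (cases "k = 0")
    case False
    define y where "y = (of_int k :: real)\<^sup>2"
    have "1 \<le> \<bar>k\<bar>" using False by linarith
    hence "1 \<le> \<bar>real_of_int k\<bar>" by linarith
    hence y: "1 \<le> y" unfolding y_def by (simp add: abs_le_square_iff[of 1, simplified])
    have py: "pi * \<tau> * y > 0" using t y by auto
    have "(\<tau> * y) ^ M \<le> (pi * \<tau> * y) ^ M"
     using t y pi_ge_two by (intro power_mono) (auto intro!: mult_right_mono)
    also have "\<dots> \<le> fact M * exp (pi * \<tau> * y)" using py by (intro power_le_fact_exp) auto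
    finally have "(\<tau> * y) ^ M \<le> fact M * exp (pi * \<tau> * y)" .
    moreover have "\<tau> ^ M * y \<le> (\<tau> * y) ^ M"
     using t y by (auto simp: power_mult_distrib M_def intro!: mult_left_mono self_le_power)
    ultimately have "\<tau> ^ M * y \<le> fact M * exp (pi * \<tau> * y)" by linarith
    hence "exp (- pi * \<tau> * y) \<le> fact M / (\<tau> ^ M * y)"
     using t y by (simp add: exp_minus field_simps)
    thus ?thesis using False by (simp add: y_def)
   qed auto
  qed
  thus ?thesis by (simp add: C_def)
 qed
 moreover have "C \<ge> 0" unfolding C_def by (intro mult_nonneg_nonneg infsum_nonneg) auto
 ultimately show ?thesis unfolding M_def by blast
qed

text \<open>One step of the triangular summation: if all inner sums agree with \<open>c\<close> up to the relative error
 \<open>E\<close>, then summing against a shifted Gaussian multiplies \<open>c\<close> by \<open>\<tau>\<^sup>-\<^sup>1\<^sup>/\<^sup>2\<close> and the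
 error factor \<open>1 + E\<close> by \<open>1 + jdelta (1/\<tau>)\<close>.\<close>

lemma triangular_step:
 fixes g :: "int => 'v => real" and \<rho> :: real
 assumes "\<tau> > 0" and nn: "\<And>a w. g a w \<ge> 0" and g: "\<And>a. g a summable_on UNIV"
  and near: "\<And>a. \<bar>(\<Sum>\<^sub>\<infinity>w. g a w) - c\<bar> \<le> c * E" and cE: "c \<ge> 0" "E \<ge> 0"
 defines "f \<equiv> (\<lambda>(a::int,w). exp (- pi * \<tau> * (of_int a + \<rho>)\<^sup>2) * g a w)"
 shows "f summable_on UNIV"
  and "(\<Sum>\<^sub>\<infinity>p. f p) = (\<Sum>\<^sub>\<infinity>a. exp (- pi * \<tau> * (of_int a + \<rho>)\<^sup>2) * (\<Sum>\<^sub>\<infinity>w. g a w))" (is ?g1)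
  and "(\<lambda>a. exp (- pi * \<tau> * (of_int a + \<rho>)\<^sup>2) * (\<Sum>\<^sub>\<infinity>w. g a w)) summable_on UNIV" (is ?g2)
  and "\<bar>(\<Sum>\<^sub>\<infinity>p. f p) - \<tau> powr (- 1/2) * c\<bar> \<le> \<tau> powr (- 1/2) * c * ((1 + E) * (1 + jdelta (1 / \<tau>)) - 1)" (is ?g3)
proof -
 define e where "e = (\<lambda>a::int. exp (- pi * \<tau> * (of_int a + \<rho>)\<^sup>2))"
 define s where "s = (\<lambda>a. \<Sum>\<^sub>\<infinity>w. g a w)"
 have e: "e summable_on UNIV" unfolding e_def by (rule jtheta_summable[OF assms(1)])
 have s: "0 \<le> s a" "s a \<le> c * (1 + E)" for a
  using near[of a] infsum_nonneg[of UNIV "g a"] nn by (auto simp: s_def algebra_simps abs_le_iff)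
 have es: "(\<lambda>a. e a * s a) summable_on UNIV"
 proof (rule summable_on_comparison_test)
  show "(\<lambda>a. e a * (c * (1 + E))) summable_on UNIV" by (rule summable_on_cmult_left[OF e])
 qed (use s in \<open>auto intro!: mult_left_mono simp: e_def\<close>)
 have inner: "((\<lambda>w. f (a, w)) has_sum e a * s a) UNIV" for a
  unfolding f_def e_def s_def using has_sum_cmult_right[OF has_sum_infsum[OF g[of a]]] by simp
 have f: "f summable_on (UNIV \<times> UNIV)" by (rule summable_on_SigmaI[OF inner es]) (auto simp: f_def nn)
 thus f': "f summable_on UNIV" by simp
 have "((\<lambda>a. e a * s a) has_sum (\<Sum>\<^sub>\<infinity>p. f p)) UNIV"
  by (rule has_sum_SigmaD[of f UNIV "\<lambda>_. UNIV"]) (use inner has_sum_infsum[OF f'] in auto)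
 hence eq: "(\<Sum>\<^sub>\<infinity>p. f p) = (\<Sum>\<^sub>\<infinity>a. e a * s a)" by (simp add: infsumI)
 thus ?g1 by (simp add: e_def s_def)
 show ?g2
  using es by (simp add: e_def s_def)
 define T where "T = \<tau> powr (- 1/2)"
 define D where "D = jdelta (1 / \<tau>)"
 have jt: "jtheta \<tau> \<rho> = (\<Sum>\<^sub>\<infinity>a. e a)" by (simp add: jtheta_def e_def)
 have "\<bar>(\<Sum>\<^sub>\<infinity>a. e a * s a) - c * jtheta \<tau> \<rho>\<bar> = \<bar>\<Sum>\<^sub>\<infinity>a. e a * (s a - c)\<bar>"
 proof -
  have "((\<lambda>a. e a * s a - e a * c) has_sum ((\<Sum>\<^sub>\<infinity>a. e a * s a) - jtheta \<tau> \<rho> * c)) UNIV"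
   unfolding jt by (intro has_sum_diff has_sum_infsum es has_sum_cmult_left e)
  hence "(\<Sum>\<^sub>\<infinity>a. e a * (s a - c)) = (\<Sum>\<^sub>\<infinity>a. e a * s a) - jtheta \<tau> \<rho> * c"
   by (simp add: infsumI algebra_simps)
  thus ?thesis by (simp add: mult.commute)
 qed
 also have "\<dots> \<le> (\<Sum>\<^sub>\<infinity>a. e a * (c * E))"
 proof -
  have le: "\<bar>e a * (s a - c)\<bar> \<le> e a * (c * E)" for a
   using near[of a] unfolding abs_mult by (intro mult_mono) (auto simp: s_def e_def)
  have sm: "(\<lambda>a. e a * (c * E)) summable_on UNIV" by (rule summable_on_cmult_left[OF e])
  have sn: "(\<lambda>a. norm (e a * (s a - c))) summable_on UNIV" by (rule summable_on_comparison_test[OF sm]) (use le in auto)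
  have "norm (\<Sum>\<^sub>\<infinity>a. e a * (s a - c)) \<le> (\<Sum>\<^sub>\<infinity>a. norm (e a * (s a - c)))"
   by (rule norm_infsum_bound[OF sn])
  also have "\<dots> \<le> (\<Sum>\<^sub>\<infinity>a. e a * (c * E))" by (rule infsum_mono[OF sn sm]) (use le in auto)
  finally show ?thesis by simp
 qed
 also have "\<dots> = jtheta \<tau> \<rho> * (c * E)" unfolding jt using e by (simp add: infsum_cmult_left)
 also have "\<dots> \<le> T * (1 + D) * (c * E)"
  using jtheta_le[OF assms(1), of \<rho>] cE by (intro mult_right_mono) (auto simp: T_def D_def)
 finally have 1: "\<bar>(\<Sum>\<^sub>\<infinity>a. e a * s a) - c * jtheta \<tau> \<rho>\<bar> \<le> T * (1 + D) * (c * E)" .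
 have "\<bar>c * jtheta \<tau> \<rho> - T * c\<bar> = c * \<bar>jtheta \<tau> \<rho> - T\<bar>"
 proof -
  have "c * jtheta \<tau> \<rho> - T * c = c * (jtheta \<tau> \<rho> - T)" by (simp add: algebra_simps)
  thus ?thesis using cE by (simp add: abs_mult)
 qed
 also have "\<dots> \<le> c * (T * D)"
  using jtheta_near[OF assms(1), of \<rho>] cE by (intro mult_left_mono) (auto simp: T_def D_def)
 finally have 2: "\<bar>c * jtheta \<tau> \<rho> - T * c\<bar> \<le> c * (T * D)" .
 have "T * (1 + D) * (c * E) + c * (T * D) = T * c * ((1 + E) * (1 + D) - 1)" by (simp add: algebra_simps)
 thus ?g3
  using 1 2 unfolding eq T_def[symmetric] D_def[symmetric] by linarith
qed

lemma cauchy_density: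
 shows "integrable lborel (\<lambda>x::real. 1 / (1 + x\<^sup>2))" and "(\<integral>x. 1 / (1 + x\<^sup>2) \<partial>lborel) = pi"
 using integrable_inverse_1_plus_square LBINT_inverse_1_plus_square
 by (simp_all add: set_integrable_def interval_lebesgue_integral_def set_lebesgue_integral_def inverse_eq_divide)

abbreviation Rpos :: "real measure" where "Rpos \<equiv> restrict_space lborel {0<..}"

lemma space_Rpos [simp]: "space Rpos = {0<..}" by (simp add: space_restrict_space)

lemma sigma_finite_Rpos: "sigma_finite_measure Rpos" by (rule sigma_finite_measure_restrict_space[OF lborel.sigma_finite_measure_axioms]) simp

lemma Rpos_measurable_continuous:
 fixes f :: "real => 'b::topological_space"
 assumes "continuous_on {0<..} f"
 shows "f \<in> borel_measurable Rpos"
 using borel_measurable_continuous_on_restrict[OF assms]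
 by (rule measurable_cong_sets[THEN equalityD1, THEN subsetD, rotated 2]) (auto simp: sets_restrict_space)

lemma integral_Rpos: "(\<integral>x. f x \<partial>Rpos) = (\<integral>x. indicator {0<..} x *\<^sub>R f x \<partial>lborel)"
 for f :: "real => 'b::{banach,second_countable_topology}" by (simp add: integral_restrict_space)

lemma integrable_Rpos: "integrable Rpos f \<longleftrightarrow> integrable lborel (\<lambda>x. indicator {0<..} x *\<^sub>R f x)"
 for f :: "real => 'b::{banach,second_countable_topology}" by (simp add: integrable_restrict_space)

lemma powr_measurable_Rpos: "(\<lambda>t. complex_of_real t powr w) \<in> borel_measurable Rpos"
 by (rule Rpos_measurable_continuous) (auto intro!: continuous_intros)

lemma norm_real_powr: "t > 0 ==> norm (complex_of_real t powr w) = t powr Re w" by (simp add: norm_powr_real_powr)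

definition mellin :: "(real => complex) => complex => complex" where
 "mellin \<phi> z = (\<integral>t. \<phi> t * of_real t powr (z - 1) \<partial>Rpos)"

definition rapid_bound :: "(nat => real) => (real => complex) => bool" where
 "rapid_bound D \<phi> \<longleftrightarrow> \<phi> \<in> borel_measurable Rpos \<and>
   (\<forall>N t. t > 0 \<longrightarrow> norm (\<phi> t) \<le> D N * t ^ N \<and> norm (\<phi> t) * t ^ N \<le> D N)"

lemma rapid_boundD:
 assumes "rapid_bound D \<phi>"
 shows "\<phi> \<in> borel_measurable Rpos"
  and "t > 0 ==> norm (\<phi> t) \<le> D N * t ^ N" and "t > 0 ==> norm (\<phi> t) * t ^ N \<le> D N"
 using assms unfolding rapid_bound_def by blast+

lemma rapid_dominated:
 fixes a t x R :: real and D :: "nat => real"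
 assumes "\<And>N. a \<le> D N * t ^ N" "\<And>N. a * t ^ N \<le> D N" and "t > 0" "\<bar>x\<bar> \<le> R" "a \<ge> 0"
 shows "a * t powr (x - 1) \<le> 2 * D (nat \<lceil>R\<rceil> + 1) * (1 / (1 + t\<^sup>2))"
proof -
 define N where "N = nat \<lceil>R\<rceil> + 1"
 have N: "real N \<ge> \<bar>x\<bar> + 1"
 proof -
  have "R \<le> real (nat \<lceil>R\<rceil>)" by linarith
  thus ?thesis using assms(4) unfolding N_def by linarith
 qed
 have D0: "D N \<ge> 0"
  using assms(2)[of N] assms(3,5) by (meson mult_nonneg_nonneg order_trans zero_le_power less_imp_le)
 show ?thesis
 proof (cases "t \<le> 1")
  case True
  have "a * t powr (x - 1) \<le> D N * t ^ N * t powr (x - 1)" by (rule mult_right_mono[OF assms(1)]) simp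
  also have "\<dots> = D N * t powr (N + x - 1)"
   using assms(3) by (simp add: powr_realpow[symmetric] powr_add[symmetric] algebra_simps)
  also have "\<dots> \<le> D N * t powr 0"
   using True N D0 assms(3) by (intro mult_left_mono powr_mono') auto
  also have "\<dots> = D N" using assms(3) by simp
  also have "\<dots> \<le> 2 * D N * (1 / (1 + t\<^sup>2))"
  proof -
   have "t\<^sup>2 \<le> 1" using True assms(3) by (simp add: power_le_one)
   hence "D N * (1 + t\<^sup>2) \<le> D N * 2" using D0 by (intro mult_left_mono) auto
   thus ?thesis by (simp add: field_simps add_pos_nonneg)
  qed
  finally show ?thesis by (simp add: N_def)
 next
  case False
  have tN: "t ^ N > 0" using assms(3) by simp
  have "a \<le> D N / t ^ N" using assms(2)[of N] tN by (simp add: field_simps)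
  hence "a * t powr (x - 1) \<le> D N / t ^ N * t powr (x - 1)" by (rule mult_right_mono) simp
  also have "\<dots> = D N * t powr (- real N + x - 1)"
  proof -
   have "t powr (- real N + x - 1) = t powr (x - 1) / t ^ N"
    using assms(3) by (simp add: powr_realpow[symmetric] powr_diff[symmetric] algebra_simps)
   thus ?thesis by simp
  qed
  also have "\<dots> \<le> D N * t powr (-2)"
   using False N D0 by (intro mult_left_mono powr_mono) auto
  also have "\<dots> = D N / t\<^sup>2" using assms(3) by (simp add: powr_minus powr_numeral divide_inverse)
  also have "\<dots> \<le> 2 * D N * (1 / (1 + t\<^sup>2))"
  proof -
   have "1 \<le> t\<^sup>2" using False assms(3) by (simp add: one_le_power)
   hence "D N * (1 + t\<^sup>2) \<le> D N * (2 * t\<^sup>2)" using D0 by (intro mult_left_mono) auto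
   thus ?thesis using assms(3) by (simp add: field_simps add_pos_nonneg)
  qed
  finally show ?thesis by (simp add: N_def)
 qed
qed

lemma integrable_Rpos_cauchy: "integrable Rpos (\<lambda>t. c * (1 / (1 + t\<^sup>2)))"
 unfolding integrable_Rpos
 using integrable_mult_indicator[OF _ integrable_mult_right[OF cauchy_density(1)], of "{0<..}" c] by simp

lemma mellin_integrable:
 assumes "rapid_bound D \<phi>"
 shows "integrable Rpos (\<lambda>t. \<phi> t * of_real t powr (z - 1))"
proof (rule Bochner_Integration.integrable_bound[OF integrable_Rpos_cauchy])
 show "(\<lambda>t. \<phi> t * of_real t powr (z - 1)) \<in> borel_measurable Rpos"
  by (rule borel_measurable_times[OF rapid_boundD(1)[OF assms] powr_measurable_Rpos])
 show "AE t in Rpos. norm (\<phi> t * of_real t powr (z - 1))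
   \<le> norm (2 * D (nat \<lceil>\<bar>Re z\<bar>\<rceil> + 1) * (1 / (1 + t\<^sup>2)))"
 proof (rule AE_I2)
  fix t assume "t \<in> space Rpos"
  hence t: "t > 0" by simp
  have "norm (\<phi> t) * t powr (Re z - 1) \<le> 2 * D (nat \<lceil>\<bar>Re z\<bar>\<rceil> + 1) * (1 / (1 + t\<^sup>2))"
   by (rule rapid_dominated[OF rapid_boundD(2,3)[OF assms t] t order.refl norm_ge_zero])
  thus "norm (\<phi> t * of_real t powr (z - 1)) \<le> norm (2 * D (nat \<lceil>\<bar>Re z\<bar>\<rceil> + 1) * (1 / (1 + t\<^sup>2)))"
   unfolding norm_mult[of "\<phi> t"] norm_real_powr[OF t] real_norm_def minus_complex.sel one_complex.sel by (rule order_trans[OF _ abs_ge_self])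
 qed
qed

lemma exp_has_sum: "((\<lambda>k. x ^ k / fact k) has_sum exp x) UNIV" for x :: complex
proof -
 have eq: "x ^ k /\<^sub>R fact k = x ^ k / fact k" for k by (simp add: scaleR_conv_of_real divide_inverse)
 show ?thesis
  using norm_summable_imp_has_sum[OF summable_norm_exp[of x] exp_converges[of x]] unfolding eq .
qed

theorem mellin_entire:
 assumes "rapid_bound D \<phi>"
 shows "mellin \<phi> holomorphic_on UNIV"
proof -
 define G where "G = (\<lambda>z0 t. norm (\<phi> t * of_real t powr ((z0 + 1) - 1)) + norm (\<phi> t * of_real t powr ((z0 - 1) - 1)))"
 have "mellin \<phi> holomorphic_on ball z0 1" for z0
 proof -
  define a where "a = (\<lambda>k. (\<integral>t. \<phi> t * of_real t powr (z0 - 1) * of_real (ln t ^ k / fact k) \<partial>Rpos))"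
  have "(\<lambda>k. a k * (w - z0) ^ k) sums mellin \<phi> w" if w: "w \<in> ball z0 1" for w
  proof -
   define u where "u = w - z0"
   have u: "norm u < 1" using w by (simp add: u_def dist_norm norm_minus_commute)
   define f where "f = (\<lambda>k t. \<phi> t * of_real t powr (z0 - 1) * of_real (ln t ^ k / fact k) * u ^ k)"
   have fmeas: "f k \<in> borel_measurable Rpos" for k
   proof -
    have "continuous_on {0<..} (\<lambda>t. complex_of_real (ln t ^ k / fact k))"
     by (intro continuous_on_of_real continuous_on_divide continuous_on_power continuous_on_ln
       continuous_on_id continuous_on_const) auto
    note * = Rpos_measurable_continuous[OF this]
    have \<phi>: "\<phi> \<in> borel_measurable Rpos" using assms by (simp only: rapid_bound_def)
    show ?thesis unfolding f_def
     by (rule borel_measurable_times[OF borel_measurable_times[OF borel_measurable_times[OF \<phi> powr_measurable_Rpos] *] borel_measurable_const])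
   qed
   note expsum = exp_has_sum
   have fsum: "((\<lambda>k. f k t) has_sum \<phi> t * of_real t powr (w - 1)) UNIV" if "t > 0" for t
   proof -
    have "((\<lambda>k. \<phi> t * of_real t powr (z0 - 1) * ((u * of_real (ln t)) ^ k / fact k)) has_sum
      \<phi> t * of_real t powr (z0 - 1) * exp (u * of_real (ln t))) UNIV" by (rule has_sum_cmult_right[OF expsum])
    moreover have "of_real t powr (z0 - 1) * exp (u * of_real (ln t)) = of_real t powr (w - 1)"
    proof -
     have "(w - 1) * of_real (ln t) = (z0 - 1) * of_real (ln t) + u * of_real (ln t)" by (simp add: u_def algebra_simps)
     thus ?thesis using that by (simp add: powr_def Ln_of_real exp_add)
    qed
    ultimately have "((\<lambda>k. \<phi> t * of_real t powr (z0 - 1) * ((u * of_real (ln t)) ^ k / fact k)) has_sum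
      \<phi> t * of_real t powr (w - 1)) UNIV" by (simp add: mult.assoc)
    moreover have "\<phi> t * of_real t powr (z0 - 1) * ((u * of_real (ln t)) ^ k / fact k) = f k t" for k by (simp add: f_def power_mult_distrib)
    ultimately show ?thesis by simp
   qed
   have le: "(\<Sum>k\<in>S. norm (f k t)) \<le> G z0 t" if "t > 0" "finite S" for t S
   proof -
    have nf: "norm (f k t) = norm (\<phi> t * of_real t powr (z0 - 1)) * ((norm u * \<bar>ln t\<bar>) ^ k / fact k)" for k
     by (simp add: f_def norm_mult norm_power norm_divide power_abs power_mult_distrib)
    have "(\<Sum>k\<in>S. norm (f k t)) = norm (\<phi> t * of_real t powr (z0 - 1)) * (\<Sum>k\<in>S. (norm u * \<bar>ln t\<bar>) ^ k / fact k)"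
     by (simp add: nf sum_distrib_left)
    also have "(\<Sum>k\<in>S. (norm u * \<bar>ln t\<bar>) ^ k / fact k) \<le> exp (norm u * \<bar>ln t\<bar>)"
    proof -
     have "(\<Sum>k\<in>S. (norm u * \<bar>ln t\<bar>) ^ k /\<^sub>R fact k) \<le> (\<Sum>k. (norm u * \<bar>ln t\<bar>) ^ k /\<^sub>R fact k)"
      by (rule sum_le_suminf[OF summable_exp_generic]) (use that in auto)
     thus ?thesis by (simp add: exp_def divide_inverse mult.commute)
    qed
    also have "exp (norm u * \<bar>ln t\<bar>) \<le> exp \<bar>ln t\<bar>"
     using u mult_right_mono[of "norm u" 1 "\<bar>ln t\<bar>"] by simp
    also have "exp \<bar>ln t\<bar> \<le> t + inverse t"
     using that by (cases "ln t \<ge> 0") (auto simp: exp_minus)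
    also have "norm (\<phi> t * of_real t powr (z0 - 1)) * (t + inverse t) = G z0 t"
    proof -
     have 1: "t powr (Re (z0 + 1 - 1)) = t powr (Re z0 - 1) * t"
      using that powr_add[of t "Re z0 - 1" 1] by simp
     have 2: "t powr (Re (z0 - 1 - 1)) = t powr (Re z0 - 1) * inverse t"
      using that powr_diff[of t "Re z0 - 1" 1] by (simp add: divide_inverse)
     show ?thesis
      unfolding G_def norm_mult norm_real_powr[OF that(1)] 1 2 by (simp only: distrib_left mult.assoc minus_complex.sel one_complex.sel)
    qed
    finally show ?thesis by (simp add: mult_left_mono)
   qed
   have Gint: "integrable Rpos (G z0)"
    unfolding G_def using mellin_integrable[OF assms] by (intro Bochner_Integration.integrable_add integrable_norm)
   have G0: "G z0 t \<ge> 0" for t by (simp add: G_def)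
   have fint: "integrable Rpos (f k)" for k by (rule Bochner_Integration.integrable_bound[OF Gint fmeas])
      (use le[of _ "{k}"] G0 in auto)
   have fint': "integrable Rpos (\<lambda>t. norm (f k t))" for k by (rule integrable_norm[OF fint])
   have sum: "(\<lambda>k. \<integral>t. norm (f k t) \<partial>Rpos) summable_on UNIV"
   proof (intro nonneg_bdd_above_summable_on bdd_aboveI2)
    fix S :: "nat set" assume "S \<in> {F. F \<subseteq> UNIV \<and> finite F}"
    hence S: "finite S" by simp
    have "(\<Sum>k\<in>S. \<integral>t. norm (f k t) \<partial>Rpos) = (\<integral>t. (\<Sum>k\<in>S. norm (f k t)) \<partial>Rpos)"
     using fint' by (subst Bochner_Integration.integral_sum) auto
    also have "\<dots> \<le> (\<integral>t. G z0 t \<partial>Rpos)" by (rule integral_mono) (use fint' Gint le S in auto)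
    finally show "(\<Sum>k\<in>S. \<integral>t. norm (f k t) \<partial>Rpos) \<le> (\<integral>t. G z0 t \<partial>Rpos)" .
   qed auto
   have pt: "(\<lambda>k. norm (f k t)) summable_on UNIV" if "t \<in> space Rpos" for t
    by (intro nonneg_bdd_above_summable_on bdd_aboveI2) (use le that in auto)
   note sw = sum_integral_swap[OF sigma_finite_Rpos fint sum pt]
   have "mellin \<phi> w = (\<integral>t. (\<Sum>\<^sub>\<infinity>k. f k t) \<partial>Rpos)"
    unfolding mellin_def by (rule Bochner_Integration.integral_cong) (simp_all add: infsumI[OF fsum])
   also have "\<dots> = (\<Sum>\<^sub>\<infinity>k. \<integral>t. f k t \<partial>Rpos)" by (rule sw(2))
   finally have "((\<lambda>k. \<integral>t. f k t \<partial>Rpos) has_sum mellin \<phi> w) UNIV"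
    using abs_summable_summable[OF sw(3)] by (simp add: has_sum_infsum)
   hence "(\<lambda>k. \<integral>t. f k t \<partial>Rpos) sums mellin \<phi> w" by (rule has_sum_imp_sums)
   thus ?thesis by (simp add: f_def a_def u_def)
  qed
  thus ?thesis by (rule power_series_holomorphic)
 qed
 note ball = this
 have "mellin \<phi> field_differentiable at z" for z by (rule holomorphic_on_imp_differentiable_at[OF ball[of z] open_ball]) simp
 thus ?thesis unfolding holomorphic_on_def by (blast intro: field_differentiable_at_within)
qed

lemma mellin_scale:
 assumes "c > 0"
 shows "mellin (\<lambda>t. \<phi> (c * t)) z = of_real c powr (- z) * mellin \<phi> z"
proof -
 define F where "F = (\<lambda>t. indicator {0<..} t *\<^sub>R (\<phi> t * of_real t powr (z - 1)))"
 have "F (0 + c * t) = of_real c powr (z - 1) * (indicator {0<..} t *\<^sub>R (\<phi> (c * t) * of_real t powr (z - 1)))" for t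
 proof (cases "t > 0")
  case True
  hence "complex_of_real (c * t) powr (z - 1) = of_real c powr (z - 1) * of_real t powr (z - 1)"
   using assms by (simp add: powr_times_real)
  thus ?thesis using True assms by (simp add: F_def)
 qed (use assms in \<open>simp add: F_def zero_less_mult_iff\<close>)
 hence eq: "(\<lambda>t. F (0 + c * t)) =
   (\<lambda>t. of_real c powr (z - 1) * (indicator {0<..} t *\<^sub>R (\<phi> (c * t) * of_real t powr (z - 1))))" by blast
 have "mellin \<phi> z = (\<integral>t. F t \<partial>lborel)" by (simp only: mellin_def integral_Rpos F_def)
 also have "\<dots> = \<bar>c\<bar> *\<^sub>R (\<integral>t. F (0 + c * t) \<partial>lborel)"
  by (rule lborel_integral_real_affine) (use assms in simp)
 also have "\<dots> = of_real c * (of_real c powr (z - 1) * mellin (\<lambda>t. \<phi> (c * t)) z)"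
  unfolding eq integral_mult_right_zero using assms by (simp only: mellin_def integral_Rpos scaleR_conv_of_real abs_of_pos)
 also have "of_real c * (of_real c powr (z - 1) * mellin (\<lambda>t. \<phi> (c * t)) z) = of_real c powr z * mellin (\<lambda>t. \<phi> (c * t)) z"
  using assms by (simp add: powr_diff)
 finally show ?thesis using assms by (simp add: powr_minus)
qed

lemma mellin_exp:
 assumes "a > 0" "Re z > 0"
 shows "integrable Rpos (\<lambda>t. of_real (exp (- a * t)) * complex_of_real t powr (z - 1))" (is ?A)
  and "mellin (\<lambda>t. of_real (exp (- a * t))) z = Gamma z * of_real a powr (- z)" (is ?g1)
proof -
 have meas: "(\<lambda>t. of_real (exp (- a * t)) * complex_of_real t powr (z - 1)) \<in> borel_measurable Rpos" for a
  by (intro borel_measurable_times powr_measurable_Rpos Rpos_measurable_continuous continuous_intros)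
 have int: "integrable lborel (\<lambda>t. indicator {0<..} t *\<^sub>R (of_real (exp (- a * t)) * complex_of_real t powr (z - 1)))"
  if "a > 0" for a
 proof -
  have "set_integrable lebesgue {0<..} (\<lambda>t. complex_of_real t powr (z - 1) / of_real (exp (a * t)))"
   by (rule absolutely_integrable_Gamma_integral[OF assms(2) that])
  moreover have "(\<lambda>t. complex_of_real t powr (z - 1) / of_real (exp (a * t)))
    = (\<lambda>t. of_real (exp (- a * t)) * complex_of_real t powr (z - 1))" by (rule ext) (simp add: exp_minus divide_inverse mult.commute)
  ultimately have "integrable lebesgue (\<lambda>t. indicator {0<..} t *\<^sub>R (of_real (exp (- a * t)) * complex_of_real t powr (z - 1)))"
   by (simp add: set_integrable_def)
  moreover have "(\<lambda>t. indicator {0<..} t *\<^sub>R (of_real (exp (- a * t)) * complex_of_real t powr (z - 1))) \<in> borel_measurable lborel"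
   using meas[of a] by (subst (asm) borel_measurable_restrict_space_iff) auto
  ultimately show ?thesis using integrable_completion by blast
 qed
 show ?A using int[OF assms(1)] by (simp add: integrable_Rpos)
 have "((\<lambda>t. indicator {0<..} t *\<^sub>R (of_real (exp (- 1 * t)) * complex_of_real t powr (z - 1))) has_integral
   mellin (\<lambda>t. of_real (exp (- t))) z) UNIV"
  using has_integral_integral_lborel[OF int[of 1]] by (simp add: mellin_def integral_Rpos)
 moreover have "((\<lambda>t. indicator {0<..} t *\<^sub>R (of_real (exp (- 1 * t)) * complex_of_real t powr (z - 1))) has_integral
   Gamma z) UNIV"
 proof -
  have "((\<lambda>t. if t \<in> {0<..} then complex_of_real t powr (z - 1) / of_real (exp t) else 0) has_integral Gamma z) UNIV"
   using Gamma_integral_complex'[OF assms(2)] by (simp only: has_integral_restrict_UNIV)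
  also have "(\<lambda>t. if t \<in> {0<..} then complex_of_real t powr (z - 1) / of_real (exp t) else 0) =
    (\<lambda>t. indicator {0<..} t *\<^sub>R (of_real (exp (- 1 * t)) * complex_of_real t powr (z - 1)))"
   by (rule ext) (simp add: exp_minus divide_inverse mult.commute)
  finally show ?thesis .
 qed
 ultimately have "mellin (\<lambda>t. of_real (exp (- t))) z = Gamma z" by (rule has_integral_unique)
 thus ?g1
  using mellin_scale[OF assms(1), of "\<lambda>t. of_real (exp (- t))" z] by simp
qed

lemma infsum_measurable:
 fixes f :: "'v::countable => 'a => 'b::{banach,second_countable_topology}"
 assumes meas: "\<And>v. f v \<in> borel_measurable M"
  and pt: "\<And>x. x \<in> space M ==> (\<lambda>v. norm (f v x)) summable_on UNIV"
 shows "(\<lambda>x. \<Sum>\<^sub>\<infinity>v. f v x) \<in> borel_measurable M"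
proof -
 interpret C: sigma_finite_measure "count_space (UNIV :: 'v set)" by (rule sigma_finite_measure_count_space)
 have "(\<lambda>z. f (fst z) (snd z)) \<in> borel_measurable (count_space (UNIV :: 'v set) \<Otimes>\<^sub>M M)"
  by (rule measurable_pair_measure_countable1) (use meas in auto)
 hence "(\<lambda>(x, v). f v x) \<in> borel_measurable (M \<Otimes>\<^sub>M count_space (UNIV :: 'v set))"
  by (subst measurable_pair_swap_iff) (simp add: case_prod_beta')
 hence "(\<lambda>x. \<integral>v. f v x \<partial>count_space UNIV) \<in> borel_measurable M" by (rule C.borel_measurable_lebesgue_integral)
 moreover have "(\<Sum>\<^sub>\<infinity>v. f v x) = (\<integral>v. f v x \<partial>count_space UNIV)" if "x \<in> space M" for x
  using infsetsum_infsum[of "\<lambda>v. f v x" UNIV] pt[OF that] by (simp add: abs_summable_equivalent infsetsum_def)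
 ultimately show ?thesis by (subst measurable_cong) auto
qed

lemma integral_powr_01:
 assumes "Re w > 0"
 shows "integrable Rpos (\<lambda>t. (if t \<le> 1 then 1 else 0) * complex_of_real t powr (w - 1))" (is ?g1)
  and "(\<integral>t. (if t \<le> 1 then 1 else 0) * complex_of_real t powr (w - 1) \<partial>Rpos) = 1 / w" (is ?g2)
proof -
 define f where "f = (\<lambda>t. complex_of_real t powr (w - 1))"
 have w: "w \<noteq> 0" using assms by auto
 have hi: "(f has_integral 1 / w) {0..1}"
 proof -
  have "(f has_integral complex_of_real 1 powr w / w - complex_of_real 0 powr w / w) {0..1}"
  proof (rule fundamental_theorem_of_calculus_interior)
   show "continuous_on {0..1} (\<lambda>t. complex_of_real t powr w / w)"
    using assms w by (intro continuous_intros) auto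
   fix x :: real assume "x \<in> {0<..<1}"
   hence "((\<lambda>z. z powr w / w) has_field_derivative f x) (at (of_real x))"
    unfolding f_def using w by (auto intro!: derivative_eq_intros simp: complex_nonpos_Reals_iff)
   thus "((\<lambda>t. complex_of_real t powr w / w) has_vector_derivative f x) (at x)" by (rule has_vector_derivative_real_field)
  qed auto
  thus ?thesis by simp
 qed
 have nf: "norm (f t) \<le> t powr (Re w - 1)" if "t \<in> {0..1}" for t
  using that by (cases "t = 0") (auto simp: f_def norm_real_powr)
 have "f absolutely_integrable_on {0..1}" by (rule absolutely_integrable_integrable_bound[OF nf])
    (use hi integrable_on_powr_from_0[of "Re w - 1" 1] assms in \<open>auto simp: has_integral_integrable\<close>)
 hence leb: "integrable lebesgue (\<lambda>t. indicator {0..1} t *\<^sub>R f t)" by (simp add: set_integrable_def)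
 have eq: "(\<lambda>t. indicator {0<..} t *\<^sub>R ((if t \<le> 1 then 1 else 0) * complex_of_real t powr (w - 1))) =
   (\<lambda>t. indicator {0..1} t *\<^sub>R f t)" by (rule ext) (auto simp: f_def indicator_def)
 have "(\<lambda>t::real. (if t \<le> 1 then 1 else 0) :: complex) \<in> borel_measurable Rpos"
 proof -
  have "(indicator {..1} :: real => complex) \<in> borel_measurable lborel" by (rule borel_measurable_indicator) simp
  also have "(indicator {..1} :: real => complex) = (\<lambda>t. if t \<le> 1 then 1 else 0)" by (rule ext) (simp add: indicator_def)
  finally show ?thesis by (rule measurable_restrict_space1)
 qed
 from borel_measurable_times[OF this powr_measurable_Rpos[of "w - 1"]]
 have meas: "(\<lambda>t. indicator {0..1} t *\<^sub>R f t) \<in> borel_measurable lborel"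
  unfolding eq[symmetric] by (subst (asm) borel_measurable_restrict_space_iff) auto
 have lb: "integrable lborel (\<lambda>t. indicator {0..1} t *\<^sub>R f t)"
  using leb integrable_completion[OF meas] by blast
 thus ?g1
  unfolding integrable_Rpos eq .
 have "((\<lambda>t. indicator {0..1} t *\<^sub>R f t) has_integral 1 / w) UNIV"
 proof -
  have "(\<lambda>t. indicator {0..1} t *\<^sub>R f t) = (\<lambda>t. if t \<in> {0..1} then f t else 0)" by (rule ext) (auto simp: indicator_def)
  thus ?thesis using hi by (simp only: has_integral_restrict_UNIV)
 qed
 thus ?g2
  unfolding integral_Rpos eq using has_integral_integral_lborel[OF lb] has_integral_unique by blast
qed

lemma hecke_mellin:
 fixes \<theta> :: "real => real" and k V :: real
 assumes D: "rapid_bound D (\<lambda>t. of_real (\<theta> t - (if t \<le> 1 then V * t powr (- k) else 1)))"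
  and k: "k > 0" "Re z > k"
 shows "integrable Rpos (\<lambda>t. of_real (\<theta> t - 1) * complex_of_real t powr (z - 1))" (is ?g1)
  and "mellin (\<lambda>t. of_real (\<theta> t - 1)) z =
   mellin (\<lambda>t. of_real (\<theta> t - (if t \<le> 1 then V * t powr (- k) else 1))) z + of_real V / (z - of_real k) - 1 / z" (is ?g2)
proof -
 define \<phi> where "\<phi> = (\<lambda>t. complex_of_real (\<theta> t - (if t \<le> 1 then V * t powr (- k) else 1)))"
 define c where "c = (\<lambda>w t. (if t \<le> 1 then 1 else 0) * complex_of_real t powr (w - 1))"
 have i1: "integrable Rpos (\<lambda>t. \<phi> t * complex_of_real t powr (z - 1))"
  unfolding \<phi>_def by (rule mellin_integrable[OF D])
 have i2: "integrable Rpos (c (z - of_real k))" "integral\<^sup>L Rpos (c (z - of_real k)) = 1 / (z - of_real k)"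
  unfolding c_def by (rule integral_powr_01; use k in simp)+
 have i3: "integrable Rpos (c z)" "integral\<^sup>L Rpos (c z) = 1 / z"
  unfolding c_def by (rule integral_powr_01; use k in simp)+
 have i2': "integrable Rpos (\<lambda>t. of_real V * c (z - of_real k) t)" by (rule integrable_mult_right[OF i2(1)])
 have eq: "of_real (\<theta> t - 1) * complex_of_real t powr (z - 1) =
   \<phi> t * complex_of_real t powr (z - 1) + of_real V * c (z - of_real k) t - c z t" if "t > 0" for t
 proof (cases "t \<le> 1")
  case True
  have "complex_of_real (t powr (- k)) * complex_of_real t powr (z - 1) = complex_of_real t powr (z - of_real k - 1)"
   using that by (simp add: powr_of_real[symmetric] powr_add[symmetric] algebra_simps)
  thus ?thesis using True by (simp add: \<phi>_def c_def algebra_simps)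
 qed (simp add: \<phi>_def c_def)
 have "integrable Rpos (\<lambda>t. \<phi> t * complex_of_real t powr (z - 1) + of_real V * c (z - of_real k) t - c z t)"
  by (rule Bochner_Integration.integrable_diff[OF Bochner_Integration.integrable_add[OF i1 i2'] i3(1)])
 thus ?g1 by (rule Bochner_Integration.integrable_cong[THEN iffD1, rotated -1]) (auto simp only: space_Rpos greaterThan_iff eq)
 have "mellin (\<lambda>t. of_real (\<theta> t - 1)) z =
  (\<integral>t. \<phi> t * complex_of_real t powr (z - 1) + of_real V * c (z - of_real k) t - c z t \<partial>Rpos)"
  unfolding mellin_def by (rule Bochner_Integration.integral_cong) (auto simp only: space_Rpos greaterThan_iff eq)
 also have "\<dots> = mellin \<phi> z + of_real V / (z - of_real k) - 1 / z"
  unfolding mellin_def by (subst Bochner_Integration.integral_diff[OF Bochner_Integration.integrable_add[OF i1 i2'] i3(1)],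
    subst Bochner_Integration.integral_add[OF i1 i2']) (simp add: i2(2) i3(2))
 finally show ?g2 by (simp only: \<phi>_def)
qed

lemma gauss_sum_mellin:
 fixes w N :: "'v::countable => real" and z :: complex
 defines "\<theta> \<equiv> \<lambda>t. \<Sum>\<^sub>\<infinity>v. w v * exp (- pi * N v * t)"
 assumes w: "\<And>v. w v \<ge> 0" and N: "\<And>v. w v \<noteq> 0 ==> N v > 0" and z: "Re z > 0"
  and pt: "\<And>t. t > 0 ==> (\<lambda>v. w v * exp (- pi * N v * t)) summable_on UNIV"
  and int: "integrable Rpos (\<lambda>t. of_real (\<theta> t) * complex_of_real t powr (z - 1))"
 shows "(\<lambda>v. w v * N v powr (- Re z)) summable_on UNIV" (is ?g1)
  and "mellin (\<lambda>t. of_real (\<theta> t)) z =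
    of_real pi powr (- z) * Gamma z * (\<Sum>\<^sub>\<infinity>v. of_real (w v) * of_real (N v) powr (- z))" (is ?g2)
proof -
 define f where "f = (\<lambda>v t. of_real (w v * exp (- pi * N v * t)) * complex_of_real t powr (z - 1))"
 have th0: "\<theta> t \<ge> 0" for t unfolding \<theta>_def by (intro infsum_nonneg) (simp add: w)
 have f: "integrable Rpos (f v)" "integral\<^sup>L Rpos (f v) = of_real (w v) * (of_real pi powr (- z) * Gamma z * of_real (N v) powr (- z))" for v
 proof -
  have f_eq: "f v = (\<lambda>t. of_real (w v) * (of_real (exp (- (pi * N v) * t)) * complex_of_real t powr (z - 1)))"
   by (rule ext) (simp add: f_def)
  have "integrable Rpos (f v) \<and> integral\<^sup>L Rpos (f v) = of_real (w v) * (of_real pi powr (- z) * Gamma z * of_real (N v) powr (- z))"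
  proof (cases "w v = 0")
   case True
   thus ?thesis by (simp add: f_eq)
  next
   case False
   hence p: "pi * N v > 0" using N by simp
   have "complex_of_real (pi * N v) powr (- z) = of_real pi powr (- z) * of_real (N v) powr (- z)"
    using N[OF False] by (simp add: powr_times_real)
   moreover have "integrable Rpos (f v)"
    unfolding f_eq by (rule integrable_mult_right[OF mellin_exp(1)[OF p z]])
   moreover have "integral\<^sup>L Rpos (f v) = of_real (w v) * mellin (\<lambda>t. of_real (exp (- (pi * N v) * t))) z"
    unfolding f_eq mellin_def by (rule integral_mult_right_zero)
   ultimately show ?thesis unfolding mellin_exp(2)[OF p z] by (simp add: mult_ac)
  qed
  thus "integrable Rpos (f v)" "integral\<^sup>L Rpos (f v) = of_real (w v) * (of_real pi powr (- z) * Gamma z * of_real (N v) powr (- z))" by auto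
 qed
 have nf: "norm (f v t) = w v * exp (- pi * N v * t) * t powr (Re z - 1)" if "t > 0" for v t
  using w[of v] that unfolding f_def norm_mult norm_of_real norm_real_powr[OF that] by (simp add: abs_mult)
 have f': "integrable Rpos (\<lambda>t. norm (f v t))" for v by (rule integrable_norm[OF f(1)])
 have le: "(\<Sum>v\<in>S. norm (f v t)) \<le> norm (of_real (\<theta> t) * complex_of_real t powr (z - 1))" if "t > 0" "finite S" for S t
 proof -
  have "(\<Sum>v\<in>S. w v * exp (- pi * N v * t)) \<le> \<theta> t"
   unfolding \<theta>_def by (rule finite_sum_le_infsum[OF pt[OF that(1)] that(2)]) (auto simp: w)
  thus ?thesis using th0[of t] unfolding norm_mult norm_real_powr[OF that(1)] nf[OF that(1)]
   by (simp add: sum_distrib_right[symmetric] mult_right_mono)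
 qed
 have sum: "(\<lambda>v. \<integral>t. norm (f v t) \<partial>Rpos) summable_on UNIV"
 proof (intro nonneg_bdd_above_summable_on bdd_aboveI2)
  fix S :: "'v set" assume "S \<in> {F. F \<subseteq> UNIV \<and> finite F}"
  hence S: "finite S" by simp
  have "(\<Sum>v\<in>S. \<integral>t. norm (f v t) \<partial>Rpos) = (\<integral>t. (\<Sum>v\<in>S. norm (f v t)) \<partial>Rpos)"
   using f' by (subst Bochner_Integration.integral_sum) auto
  also have "\<dots> \<le> (\<integral>t. norm (of_real (\<theta> t) * complex_of_real t powr (z - 1)) \<partial>Rpos)"
   by (rule integral_mono) (use f' integrable_norm[OF int] le S in auto)
  finally show "(\<Sum>v\<in>S. \<integral>t. norm (f v t) \<partial>Rpos) \<le> (\<integral>t. norm (of_real (\<theta> t) * complex_of_real t powr (z - 1)) \<partial>Rpos)" .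
 qed auto
 have ptf: "(\<lambda>v. norm (f v t)) summable_on UNIV" if "t \<in> space Rpos" for t
  using summable_on_cmult_left[OF pt[of t], of "t powr (Re z - 1)"] that by (simp add: nf)
 note sw = sum_integral_swap[OF sigma_finite_Rpos f(1) sum ptf]
 have fsum: "of_real (\<theta> t) * complex_of_real t powr (z - 1) = (\<Sum>\<^sub>\<infinity>v. f v t)" if "t > 0" for t
  unfolding \<theta>_def f_def infsum_of_real[OF pt[OF that], symmetric] by (rule infsum_cmult_left'[symmetric])
 have "mellin (\<lambda>t. of_real (\<theta> t)) z = (\<integral>t. (\<Sum>\<^sub>\<infinity>v. f v t) \<partial>Rpos)"
  unfolding mellin_def by (rule Bochner_Integration.integral_cong) (auto simp only: space_Rpos greaterThan_iff fsum)
 also have "\<dots> = (\<Sum>\<^sub>\<infinity>v. integral\<^sup>L Rpos (f v))" by (rule sw(2))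
 also have "\<dots> = (\<Sum>\<^sub>\<infinity>v. of_real pi powr (- z) * Gamma z * (of_real (w v) * of_real (N v) powr (- z)))"
  by (simp add: f(2) mult_ac)
 also have "\<dots> = of_real pi powr (- z) * Gamma z * (\<Sum>\<^sub>\<infinity>v. of_real (w v) * of_real (N v) powr (- z))"
  by (rule infsum_cmult_right')
 finally show ?g2 .
 define K where "K = norm (complex_of_real pi powr (- z) * Gamma z)"
 have "z \<notin> \<int>\<^sub>\<le>\<^sub>0" using z by (auto elim!: nonpos_Ints_cases)
 hence K: "K \<noteq> 0" by (simp add: K_def Gamma_eq_zero_iff)
 have "norm (integral\<^sup>L Rpos (f v)) = w v * N v powr (- Re z) * K" for v
 proof (cases "w v = 0")
  case False
  thus ?thesis using w[of v] N[OF False] by (simp add: f(2) norm_mult K_def norm_real_powr)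
 qed (simp add: f(2))
 hence "(\<lambda>v. w v * N v powr (- Re z) * K) summable_on UNIV" using sw(3) by simp
 hence "(\<lambda>v. w v * N v powr (- Re z) * K * inverse K) summable_on UNIV" by (rule summable_on_cmult_left)
 thus ?g1 using K by (simp add: mult.assoc)
qed

definition env_rapid :: "(real => real) => bool" where
 "env_rapid B \<longleftrightarrow> (\<forall>N. \<exists>C. (\<forall>t. 0 < t \<and> t \<le> 1 \<longrightarrow> B t \<le> C * t ^ N) \<and> (\<forall>t>1. B t \<le> C / t ^ N))"

lemma env_rapid_imp_rapid_bound:
 assumes "env_rapid B"
 obtains D where "\<And>\<phi>. \<phi> \<in> borel_measurable Rpos ==> (\<And>t. t > 0 ==> norm (\<phi> t) \<le> B t) ==> rapid_bound D \<phi>"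
proof -
 obtain C where C: "\<And>N t. 0 < t ==> t \<le> 1 ==> B t \<le> C N * t ^ N" "\<And>N t. t > 1 ==> B t \<le> C N / t ^ N"
  using assms unfolding env_rapid_def by metis
 have "rapid_bound (\<lambda>N. \<bar>C N\<bar>) \<phi>" if "\<phi> \<in> borel_measurable Rpos" and le: "\<And>t. t > 0 ==> norm (\<phi> t) \<le> B t" for \<phi>
  unfolding rapid_bound_def
 proof (intro conjI allI impI that(1))
  fix N and t :: real assume t: "t > 0"
  have a: "norm (\<phi> t) \<le> \<bar>C N\<bar> * min (t ^ N) (1 / t ^ N)"
  proof (cases "t \<le> 1")
   case True
   have "norm (\<phi> t) \<le> C N * t ^ N" using le[OF t] C(1)[OF t True, of N] by linarith
   also have "\<dots> \<le> \<bar>C N\<bar> * t ^ N" using t by (intro mult_right_mono) auto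
   also have "t ^ N = min (t ^ N) (1 / t ^ N)"
   proof -
    have "t ^ N \<le> 1" using t True by (simp add: power_le_one)
    moreover have "1 \<le> 1 / t ^ N" using t \<open>t ^ N \<le> 1\<close> by simp
    ultimately show ?thesis by linarith
   qed
   finally show ?thesis .
  next
   case False
   have "norm (\<phi> t) \<le> C N / t ^ N" using le[OF t] C(2)[of t N] False by linarith
   also have "\<dots> \<le> \<bar>C N\<bar> * (1 / t ^ N)" using t by (simp add: divide_right_mono)
   also have "1 / t ^ N = min (t ^ N) (1 / t ^ N)"
   proof -
    have "1 \<le> t ^ N" using False by (simp add: one_le_power)
    moreover have "1 / t ^ N \<le> 1" using t \<open>1 \<le> t ^ N\<close> by simp
    ultimately show ?thesis by linarith
   qed
   finally show ?thesis .
  qed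
  have "\<bar>C N\<bar> * min (t ^ N) (1 / t ^ N) \<le> \<bar>C N\<bar> * t ^ N" by (intro mult_left_mono) auto
  thus "norm (\<phi> t) \<le> \<bar>C N\<bar> * t ^ N" using a by linarith
  have "\<bar>C N\<bar> * min (t ^ N) (1 / t ^ N) \<le> \<bar>C N\<bar> * (1 / t ^ N)" by (intro mult_left_mono) auto
  hence "norm (\<phi> t) \<le> \<bar>C N\<bar> / t ^ N" using a by simp
  thus "norm (\<phi> t) * t ^ N \<le> \<bar>C N\<bar>" using t by (simp add: field_simps)
 qed
 thus ?thesis using that by blast
qed

lemma two_factor_bound:
 fixes x y K L u :: real
 assumes "0 \<le> x" "x \<le> K * u" "0 \<le> y" "y \<le> L * u" "0 \<le> u" "u \<le> 1" "0 \<le> K" "0 \<le> L"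
 shows "(1 + x) * (1 + y) - 1 \<le> ((1 + K) * (1 + L) - 1) * u" (is ?g1) and "0 \<le> (1 + x) * (1 + y) - 1"
proof -
 have "x * y \<le> (K * u) * (L * u)" using assms by (intro mult_mono) auto
 also have "\<dots> = (K * L * u) * u" by simp
 also have "\<dots> \<le> (K * L * u) * 1" using assms by (intro mult_left_mono) auto
 finally have "x * y \<le> K * L * u" by simp
 thus ?g1
  using assms by (simp add: algebra_simps)
 show "0 \<le> (1 + x) * (1 + y) - 1" using assms by (simp add: algebra_simps)
qed

lemma jdelta_inverse_decay:
 assumes "A > 0"
 shows "\<exists>C\<ge>0. \<forall>t>0. jdelta (1 / (t * A)) \<le> C * t ^ Suc N"
proof -
 obtain C where C: "C \<ge> 0" "\<And>\<tau>. \<tau> > 0 ==> jdelta \<tau> \<le> C / \<tau> ^ Suc N"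
  using jdelta_decay by blast
 have "jdelta (1 / (t * A)) \<le> (C * A ^ Suc N) * t ^ Suc N" if "t > 0" for t
  using C(2)[of "1 / (t * A)"] that assms by (simp add: power_divide power_mult_distrib mult_ac)
 moreover have "C * A ^ Suc N \<ge> 0" using C(1) assms by simp
 ultimately show ?thesis by blast
qed

lemma exp_decay:
 fixes \<kappa> :: real
 assumes "\<kappa> > 0"
 shows "\<exists>C\<ge>0. \<forall>t>0. exp (- \<kappa> * t) \<le> C / t ^ N"
proof -
 have "exp (- \<kappa> * t) \<le> (fact N / \<kappa> ^ N) / t ^ N" if "t > 0" for t
 proof -
  have "(\<kappa> * t) ^ N \<le> fact N * exp (\<kappa> * t)" using assms that by (intro power_le_fact_exp mult_nonneg_nonneg) auto
  thus ?thesis using assms that by (simp add: exp_minus field_simps power_mult_distrib)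
 qed
 thus ?thesis using assms by (intro exI[of _ "fact N / \<kappa> ^ N"]) simp
qed

definition theta_error :: "real => real => real => real => real => real" where
 "theta_error A1 A2 A3 A4 t =
   (1 + ((1 + ((1 + jdelta (1 / (t * A4))) * (1 + jdelta (1 / (t * A3))) - 1)) * (1 + jdelta (1 / (t * A2))) - 1))
    * (1 + jdelta (1 / (t * A1))) - 1"

definition theta_envelope :: "real => real => real => real => real => real" where
 "theta_envelope A1 A2 A3 A4 t =
   (if t \<le> 1 then (A1 * A2 * A3 * A4) powr (- 1/2) * t powr (- 2) * theta_error A1 A2 A3 A4 t
   else exp (- pi * Min {A1, A2, A3, A4} * (t - 1)) *
    ((A1 * A2 * A3 * A4) powr (- 1/2) * (1 + theta_error A1 A2 A3 A4 1)))"

lemma theta_error_decay: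
 assumes "A1 > 0" "A2 > 0" "A3 > 0" "A4 > 0"
 shows "\<exists>C\<ge>0. \<forall>t. 0 < t \<longrightarrow> t \<le> 1 \<longrightarrow> theta_error A1 A2 A3 A4 t \<le> C * t ^ Suc N"
proof -
 obtain C1 where C1: "C1 \<ge> 0" "\<And>t. t > 0 ==> jdelta (1 / (t * A1)) \<le> C1 * t ^ Suc N"
  using jdelta_inverse_decay[OF assms(1), of N] by blast
 obtain C2 where C2: "C2 \<ge> 0" "\<And>t. t > 0 ==> jdelta (1 / (t * A2)) \<le> C2 * t ^ Suc N"
  using jdelta_inverse_decay[OF assms(2), of N] by blast
 obtain C3 where C3: "C3 \<ge> 0" "\<And>t. t > 0 ==> jdelta (1 / (t * A3)) \<le> C3 * t ^ Suc N"
  using jdelta_inverse_decay[OF assms(3), of N] by blast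
 obtain C4 where C4: "C4 \<ge> 0" "\<And>t. t > 0 ==> jdelta (1 / (t * A4)) \<le> C4 * t ^ Suc N"
  using jdelta_inverse_decay[OF assms(4), of N] by blast
 define D3 where "D3 = (1 + C4) * (1 + C3) - 1"
 define D2 where "D2 = (1 + D3) * (1 + C2) - 1"
 define D1 where "D1 = (1 + D2) * (1 + C1) - 1"
 have D: "D3 \<ge> 0" "D2 \<ge> 0" "D1 \<ge> 0"
 proof -
  show 3: "D3 \<ge> 0" using C3(1) C4(1) by (simp add: D3_def algebra_simps)
  show 2: "D2 \<ge> 0" using C2(1) 3 by (simp add: D2_def algebra_simps)
  show "D1 \<ge> 0" using C1(1) 2 by (simp add: D1_def algebra_simps)
 qed
 have "theta_error A1 A2 A3 A4 t \<le> D1 * t ^ Suc N" if t: "0 < t" "t \<le> 1" for t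
 proof -
  define u where "u = t ^ Suc N"
  have u: "0 \<le> u" "u \<le> 1" using t power_le_one[of t "Suc N"] by (auto simp: u_def)
  have j: "jdelta (1 / (t * A)) \<ge> 0" if "A > 0" for A using that t by (intro jdelta_nonneg) simp
  note s3 = two_factor_bound[OF j[OF assms(4)] C4(2)[OF t(1)] j[OF assms(3)] C3(2)[OF t(1)] u[unfolded u_def] C4(1) C3(1), folded D3_def]
  note s2 = two_factor_bound[OF s3(2) s3(1) j[OF assms(2)] C2(2)[OF t(1)] u[unfolded u_def] D(1) C2(1), folded D2_def]
  note s1 = two_factor_bound[OF s2(2) s2(1) j[OF assms(1)] C1(2)[OF t(1)] u[unfolded u_def] D(2) C1(1), folded D1_def]
  show ?thesis using s1(1) by (simp only: theta_error_def)
 qed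
 thus ?thesis using D(3) by blast
qed

lemma theta_error_nonneg:
 assumes "A1 > 0" "A2 > 0" "A3 > 0" "A4 > 0" "t > 0"
 shows "theta_error A1 A2 A3 A4 t \<ge> 0"
proof -
 have j: "jdelta (1 / (t * A)) \<ge> 0" if "A > 0" for A using that assms by (intro jdelta_nonneg) simp
 have p: "0 \<le> x ==> 0 \<le> y ==> 0 \<le> (1 + x) * (1 + y) - 1" for x y :: real by (simp add: algebra_simps)
 show ?thesis unfolding theta_error_def by (intro p j assms)
qed

lemma theta_envelope_rapid:
 assumes A: "A1 > 0" "A2 > 0" "A3 > 0" "A4 > 0"
 shows "env_rapid (theta_envelope A1 A2 A3 A4)"
 unfolding env_rapid_def
proof
 fix N
 define V where "V = (A1 * A2 * A3 * A4) powr (- 1/2)"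
 have V: "V \<ge> 0" by (simp add: V_def)
 obtain C where C: "C \<ge> 0" "\<And>t. 0 < t ==> t \<le> 1 ==> theta_error A1 A2 A3 A4 t \<le> C * t ^ Suc (Suc N)"
  using theta_error_decay[OF A, of "Suc N"] by blast
 define \<kappa> where "\<kappa> = pi * Min {A1, A2, A3, A4}"
 have \<kappa>: "\<kappa> > 0" using A by (simp add: \<kappa>_def)
 obtain C' where C': "C' \<ge> 0" "\<And>t. t > 0 ==> exp (- \<kappa> * t) \<le> C' / t ^ N"
  using exp_decay[OF \<kappa>, of N] by blast
 define W where "W = V * (1 + theta_error A1 A2 A3 A4 1)"
 have W: "W \<ge> 0" using V theta_error_nonneg[OF A, of 1] by (simp add: W_def)
 define M where "M = V * C + exp \<kappa> * C' * W"
 have M: "V * C \<le> M" "exp \<kappa> * C' * W \<le> M" using V C(1) C'(1) W by (auto simp: M_def)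
 have "theta_envelope A1 A2 A3 A4 t \<le> M * t ^ N" if t: "0 < t \<and> t \<le> 1" for t
 proof -
  have "theta_envelope A1 A2 A3 A4 t \<le> V * t powr (- 2) * (C * t ^ Suc (Suc N))"
  proof -
   have "V * t powr (- 2) * theta_error A1 A2 A3 A4 t \<le> V * t powr (- 2) * (C * t ^ Suc (Suc N))"
    using t V by (intro mult_left_mono C(2)) auto
   thus ?thesis using t by (simp only: theta_envelope_def V_def if_True)
  qed
  also have "\<dots> = V * C * t ^ N"
  proof -
   have "t powr (- 2) * t ^ Suc (Suc N) = t ^ N"
    using t by (simp add: powr_minus powr_numeral power2_eq_square field_simps)
   thus ?thesis by (metis mult.assoc mult.left_commute)
  qed
  also have "\<dots> \<le> M * t ^ N" using M t by (intro mult_right_mono) auto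
  finally show ?thesis .
 qed
 moreover have "theta_envelope A1 A2 A3 A4 t \<le> M / t ^ N" if t: "t > 1" for t
 proof -
  have "theta_envelope A1 A2 A3 A4 t = exp \<kappa> * exp (- \<kappa> * t) * W"
   using t by (simp add: theta_envelope_def V_def W_def \<kappa>_def exp_add[symmetric] algebra_simps del: Min_insert)
  also have "\<dots> \<le> exp \<kappa> * (C' / t ^ N) * W"
   using t W C'(2)[of t] by (intro mult_right_mono mult_left_mono) auto
  also have "\<dots> = (exp \<kappa> * C' * W) / t ^ N" by simp
  also have "\<dots> \<le> M / t ^ N" using M t by (intro divide_right_mono) auto
  finally show ?thesis .
 qed
 ultimately show "\<exists>C. (\<forall>t. 0 < t \<and> t \<le> 1 \<longrightarrow> theta_envelope A1 A2 A3 A4 t \<le> C * t ^ N) \<and>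
   (\<forall>t>1. theta_envelope A1 A2 A3 A4 t \<le> C / t ^ N)" by blast
qed

locale triangular_form =
 fixes A1 A2 A3 A4 :: real and r2 :: "int => real" and r3 :: "int => int => real"
  and r4 :: "int => int => int => real"
 assumes pos: "A1 > 0" "A2 > 0" "A3 > 0" "A4 > 0"
  and zero: "r2 0 = 0" "r3 0 0 = 0" "r4 0 0 0 = 0"
begin

definition Q :: "int \<times> int \<times> int \<times> int => real" where
 "Q = (\<lambda>(a, b, d, c). A1 * (of_int a)\<^sup>2 + A2 * (of_int b + r2 a)\<^sup>2
   + A3 * (of_int d + r3 a b)\<^sup>2 + A4 * (of_int c + r4 a b d)\<^sup>2)"

definition theta :: "real => real" where
 "theta t = (\<Sum>\<^sub>\<infinity>v. exp (- pi * Q v * t))"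

definition theta3 :: "real => int => int => real" where
 "theta3 t a b = (\<Sum>\<^sub>\<infinity>d. exp (- pi * (t * A3) * (of_int d + r3 a b)\<^sup>2) * jtheta (t * A4) (r4 a b d))"

definition theta2 :: "real => int => real" where
 "theta2 t a = (\<Sum>\<^sub>\<infinity>b. exp (- pi * (t * A2) * (of_int b + r2 a)\<^sup>2) * theta3 t a b)"

lemma
 assumes t: "t > 0"
 shows theta_summable: "(\<lambda>v. exp (- pi * Q v * t)) summable_on UNIV" (is ?g1)
  and theta_nested: "theta t = (\<Sum>\<^sub>\<infinity>a. exp (- pi * (t * A1) * (of_int a)\<^sup>2) * theta2 t a)" (is ?g2)
  and theta_near: "\<bar>theta t - (A1 * A2 * A3 * A4) powr (- 1/2) * t powr (- 2)\<bar>
    \<le> (A1 * A2 * A3 * A4) powr (- 1/2) * t powr (- 2) * theta_error A1 A2 A3 A4 t" (is ?g3)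
  and theta2_summable: "(\<lambda>b. exp (- pi * (t * A2) * (of_int b + r2 a)\<^sup>2) * theta3 t a b) summable_on UNIV" (is ?g4)
  and theta3_summable: "(\<lambda>d. exp (- pi * (t * A3) * (of_int d + r3 a b)\<^sup>2) * jtheta (t * A4) (r4 a b d)) summable_on UNIV" (is ?g5)
  and theta1_summable: "(\<lambda>a. exp (- pi * (t * A1) * (of_int a)\<^sup>2) * theta2 t a) summable_on UNIV" (is ?g6)
  and theta3_bounds: "0 \<le> theta3 t a b" "theta3 t a b \<le> (t * A3) powr (- 1/2) * (t * A4) powr (- 1/2) *
    ((1 + jdelta (1 / (t * A4))) * (1 + jdelta (1 / (t * A3))))" (is ?g7)
  and theta2_bounds: "0 \<le> theta2 t a" "theta2 t a \<le> (t * A2) powr (- 1/2) * ((t * A3) powr (- 1/2) * (t * A4) powr (- 1/2)) *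
    ((1 + jdelta (1 / (t * A4))) * (1 + jdelta (1 / (t * A3))) * (1 + jdelta (1 / (t * A2))))" (is ?g8)
proof -
 have tA: "t * A1 > 0" "t * A2 > 0" "t * A3 > 0" "t * A4 > 0" using t pos by auto
 have j: "jdelta (1 / (t * A)) \<ge> 0" if "A > 0" for A using that t by (intro jdelta_nonneg) simp
 have p: "0 \<le> x ==> 0 \<le> y ==> 0 \<le> (1 + x) * (1 + y) - 1" for x y :: real by (simp add: algebra_simps)
 define g4 where "g4 = (\<lambda>a b d (c::int). exp (- pi * (t * A4) * (of_int c + r4 a b d)\<^sup>2))"
 define g3 where "g3 = (\<lambda>a b. (\<lambda>(d::int, c). exp (- pi * (t * A3) * (of_int d + r3 a b)\<^sup>2) * g4 a b d c))"
 define g2 where "g2 = (\<lambda>a. (\<lambda>(b::int, w). exp (- pi * (t * A2) * (of_int b + r2 a)\<^sup>2) * g3 a b w))"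
 define g1 where "g1 = (\<lambda>(a::int, w). exp (- pi * (t * A1) * (of_int a + 0)\<^sup>2) * g2 a w)"
 define c4 where "c4 = (t * A4) powr (- 1/2)"
 define c3 where "c3 = (t * A3) powr (- 1/2) * c4"
 define c2 where "c2 = (t * A2) powr (- 1/2) * c3"
 define c1 where "c1 = (t * A1) powr (- 1/2) * c2"
 have c: "c4 \<ge> 0" "c3 \<ge> 0" "c2 \<ge> 0" by (auto simp: c4_def c3_def c2_def)
 define E4 where "E4 = jdelta (1 / (t * A4))"
 define E3 where "E3 = (1 + E4) * (1 + jdelta (1 / (t * A3))) - 1"
 define E2 where "E2 = (1 + E3) * (1 + jdelta (1 / (t * A2))) - 1"
 have E4: "E4 \<ge> 0" unfolding E4_def by (intro j pos)
 have E3: "E3 \<ge> 0" unfolding E3_def by (intro p E4 j pos)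
 have E2: "E2 \<ge> 0" unfolding E2_def by (intro p E3 j pos)
 have nn4: "g4 a b d c \<ge> 0" for a b d c by (simp add: g4_def)
 have nn3: "g3 a b w \<ge> 0" for a b w by (cases w) (simp add: g3_def nn4)
 have nn2: "g2 a w \<ge> 0" for a w by (cases w) (simp add: g2_def nn3)
 have s4: "g4 a b d summable_on UNIV" for a b d unfolding g4_def by (rule jtheta_summable[OF tA(4)])
 have i4: "(\<Sum>\<^sub>\<infinity>c. g4 a b d c) = jtheta (t * A4) (r4 a b d)" for a b d by (simp add: g4_def jtheta_def)
 have n4: "\<bar>(\<Sum>\<^sub>\<infinity>c. g4 a b d c) - c4\<bar> \<le> c4 * E4" for a b d
  unfolding i4 c4_def E4_def by (rule jtheta_near[OF tA(4)])
 note T3 = triangular_step[OF tA(3), of "g4 a b" for a b, OF nn4 s4 n4 c(1) E4]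
 have s3: "g3 a b summable_on UNIV" for a b using T3(1)[of "r3 a b" a b] by (simp add: g3_def)
 have i3: "(\<Sum>\<^sub>\<infinity>w. g3 a b w) = theta3 t a b" for a b
  using T3(2)[of "r3 a b" a b] by (simp only: g3_def theta3_def i4)
 have n3: "\<bar>(\<Sum>\<^sub>\<infinity>w. g3 a b w) - c3\<bar> \<le> c3 * E3" for a b
  using T3(4)[of "r3 a b" a b] by (simp only: g3_def c3_def E3_def)
 note T2 = triangular_step[OF tA(2), of "g3 a" for a, OF nn3 s3 n3 c(2) E3]
 have s2: "g2 a summable_on UNIV" for a using T2(1)[of "r2 a" a] by (simp add: g2_def)
 have i2: "(\<Sum>\<^sub>\<infinity>w. g2 a w) = theta2 t a" for a
  using T2(2)[of "r2 a" a] by (simp only: g2_def theta2_def i3)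
 have n2: "\<bar>(\<Sum>\<^sub>\<infinity>w. g2 a w) - c2\<bar> \<le> c2 * E2" for a
  using T2(4)[of "r2 a" a] by (simp only: g2_def c2_def E2_def)
 note T1 = triangular_step[OF tA(1), of g2, OF nn2 s2 n2 c(3) E2, where \<rho> = 0]
 have g1: "g1 v = exp (- pi * Q v * t)" for v by (cases v) (simp add: g1_def g2_def g3_def g4_def Q_def exp_add[symmetric] algebra_simps)
 have g1': "(\<lambda>v. exp (- pi * Q v * t)) = g1" by (rule ext) (simp only: g1)
 show ?g1 unfolding g1' using T1(1) by (simp add: g1_def)
 show ?g2
  using T1(2) unfolding theta_def g1' g1_def i2 by simp
 have c1: "c1 = (A1 * A2 * A3 * A4) powr (- 1/2) * t powr (- 2)"
 proof -
  have "t powr (- 2) = t powr (- 1/2) * t powr (- 1/2) * t powr (- 1/2) * t powr (- 1/2)"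
   unfolding powr_add[symmetric] by simp
  thus ?thesis using t pos by (simp add: c1_def c2_def c3_def c4_def powr_mult)
 qed
 have "\<bar>theta t - c1\<bar> \<le> c1 * ((1 + E2) * (1 + jdelta (1 / (t * A1))) - 1)"
  using T1(4) unfolding theta_def g1' g1_def c1_def by simp
 thus ?g3
  unfolding c1 theta_error_def E2_def E3_def E4_def .
 show ?g4
  using T2(3)[of "r2 a" a] unfolding i3 .
 show ?g5
  using T3(3)[of "r3 a b" a b] unfolding i4 .
 show ?g6
  using T1(3) unfolding i2 by simp
 show "0 \<le> theta3 t a b" unfolding i3[symmetric] by (intro infsum_nonneg nn3)
 show "0 \<le> theta2 t a" unfolding i2[symmetric] by (intro infsum_nonneg nn2)
 have "theta3 t a b \<le> c3 * (1 + E3)" using n3[of a b] unfolding i3 by (simp add: abs_le_iff algebra_simps)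
 thus ?g7 by (simp add: c3_def c4_def E3_def E4_def)
 have "theta2 t a \<le> c2 * (1 + E2)" using n2[of a] unfolding i2 by (simp add: abs_le_iff algebra_simps)
 thus ?g8 by (simp add: c2_def c3_def c4_def E2_def E3_def E4_def)
qed

lemma Q_zero [simp]: "Q (0, 0, 0, 0) = 0" by (simp add: Q_def zero)

lemma Q_ge:
 assumes "v \<noteq> (0, 0, 0, 0)"
 shows "Min {A1, A2, A3, A4} \<le> Q v"
proof -
 obtain a b d c where v: "v = (a, b, d, c)" by (cases v)
 have sq: "1 \<le> (real_of_int n)\<^sup>2" if "n \<noteq> 0" for n
 proof -
  have "1 \<le> \<bar>n\<bar>" using that by linarith
  hence "1 \<le> \<bar>real_of_int n\<bar>" by linarith
  thus ?thesis by (simp add: abs_le_square_iff[of 1, simplified])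
 qed
 define x1 x2 x3 x4 where "x1 = A1 * (of_int a)\<^sup>2" "x2 = A2 * (of_int b + r2 a)\<^sup>2"
   "x3 = A3 * (of_int d + r3 a b)\<^sup>2" "x4 = A4 * (of_int c + r4 a b d)\<^sup>2"
 note x = this
 have nn: "x1 \<ge> 0" "x2 \<ge> 0" "x3 \<ge> 0" "x4 \<ge> 0" using pos by (auto simp: x)
 have Q: "Q v = x1 + x2 + x3 + x4" by (simp add: v Q_def x)
 have m: "Min {A1, A2, A3, A4} \<le> A1" "Min {A1, A2, A3, A4} \<le> A2" "Min {A1, A2, A3, A4} \<le> A3" "Min {A1, A2, A3, A4} \<le> A4"
  by (auto intro: Min_le)
 consider "a \<noteq> 0" | "a = 0" "b \<noteq> 0" | "a = 0" "b = 0" "d \<noteq> 0" | "a = 0" "b = 0" "d = 0" "c \<noteq> 0"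
  using assms v by auto
 thus ?thesis
 proof cases
  case 1
  have "A1 * 1 \<le> x1" unfolding x using sq[OF 1] pos by (intro mult_left_mono) auto
  thus ?thesis using Q nn m by linarith
 next
  case 2
  have "A2 * 1 \<le> x2" unfolding x using sq[OF 2(2)] pos 2 zero by (intro mult_left_mono) auto
  thus ?thesis using Q nn m by linarith
 next
  case 3
  have "A3 * 1 \<le> x3" unfolding x using sq[OF 3(3)] pos 3 zero by (intro mult_left_mono) auto
  thus ?thesis using Q nn m by linarith
 next
  case 4
  have "A4 * 1 \<le> x4" unfolding x using sq[OF 4(4)] pos 4 zero by (intro mult_left_mono) auto
  thus ?thesis using Q nn m by linarith
 qed
qed

lemma Q_pos: "v \<noteq> (0, 0, 0, 0) ==> Q v > 0"
 using Q_ge[of v] pos by (auto simp: min_def split: if_splits)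

definition wt :: "int \<times> int \<times> int \<times> int => real" where
 "wt v = (if v = (0, 0, 0, 0) then 0 else 1)"

lemma theta_minus_one:
 assumes "t > 0"
 shows "((\<lambda>v. wt v * exp (- pi * Q v * t)) has_sum (theta t - 1)) UNIV"
proof -
 have "((\<lambda>v. exp (- pi * Q v * t) - (if v = (0,0,0,0) then 1 else 0)) has_sum (theta t - 1)) UNIV"
  unfolding theta_def by (intro has_sum_diff has_sum_infsum theta_summable assms has_sum_single)
 moreover have "exp (- pi * Q v * t) - (if v = (0,0,0,0) then 1 else 0) = wt v * exp (- pi * Q v * t)" for v by (auto simp: wt_def)
 ultimately show ?thesis by simp
qed

lemma theta_envelope:
 assumes t: "t > 0"
 shows "\<bar>theta t - (if t \<le> 1 then (A1 * A2 * A3 * A4) powr (- 1/2) * t powr (- 2) else 1)\<bar>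
   \<le> theta_envelope A1 A2 A3 A4 t"
proof (cases "t \<le> 1")
 case True
 thus ?thesis using theta_near[OF t] by (simp add: theta_envelope_def)
next
 case False
 let ?e = "exp (- pi * Min {A1, A2, A3, A4} * (t - 1))"
 have "theta t - 1 \<ge> 0" by (rule has_sum_nonneg[OF theta_minus_one[OF t]]) (simp add: wt_def)
 moreover have "theta t - 1 \<le> ?e * (theta 1 - 1)"
 proof (rule has_sum_mono[OF theta_minus_one[OF t] has_sum_cmult_right[OF theta_minus_one]])
  fix v
  show "wt v * exp (- pi * Q v * t) \<le> ?e * (wt v * exp (- pi * Q v * 1))"
  proof (cases "v = (0,0,0,0)")
   case v: False
   have "exp (- pi * Q v * t) = exp (- pi * Q v * (t - 1)) * exp (- pi * Q v * 1)"
    unfolding exp_add[symmetric] by (simp add: algebra_simps)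
   also have "\<dots> \<le> ?e * exp (- pi * Q v * 1)"
    using Q_ge[OF v] False by (intro mult_right_mono) (auto intro!: mult_right_mono mult_left_mono simp del: Min_insert)
   finally show ?thesis using v by (simp add: wt_def del: Min_insert)
  qed (simp add: wt_def)
 qed simp
 ultimately have le: "\<bar>theta t - 1\<bar> \<le> ?e * (theta 1 - 1)" by simp
 have "theta 1 - 1 \<le> (A1 * A2 * A3 * A4) powr (- 1/2) * (1 + theta_error A1 A2 A3 A4 1)"
  using theta_near[of 1] by (simp add: abs_le_iff algebra_simps)
 hence "?e * (theta 1 - 1) \<le> ?e * ((A1 * A2 * A3 * A4) powr (- 1/2) * (1 + theta_error A1 A2 A3 A4 1))" by (intro mult_left_mono) auto
 hence "\<bar>theta t - 1\<bar> \<le> ?e * ((A1 * A2 * A3 * A4) powr (- 1/2) * (1 + theta_error A1 A2 A3 A4 1))"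
  using le by (rule order_trans[rotated])
 thus ?thesis using False by (simp only: theta_envelope_def if_False)
qed

end

lemma meromorphic_eq_cosparse:
 assumes "F meromorphic_on UNIV" "G meromorphic_on UNIV" "open S" "S \<noteq> {}"
  and eq: "\<And>s. s \<in> S ==> F s = G s"
 shows "eventually (\<lambda>z. F z = G z) (cosparse UNIV)"
proof -
 have "(\<lambda>z. F z - G z) meromorphic_on UNIV" by (intro meromorphic_intros assms)
 from meromorphic_imp_constant_or_avoid[OF this open_UNIV connected_UNIV, of 0]
 show ?thesis
 proof
  assume "eventually (\<lambda>z. F z - G z = 0) (cosparse UNIV)"
  thus ?thesis by simp
 next
  assume ne: "eventually (\<lambda>z. F z - G z \<noteq> 0) (cosparse UNIV)"
  obtain z where z: "z \<in> S" using assms(4) by blast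
  have "eventually (\<lambda>w. F w - G w \<noteq> 0) (at z)"
   using ne by (auto simp: eventually_cosparse_open_eq)
  moreover have "eventually (\<lambda>w. w \<in> S) (at z)"
   using assms(3) z by (rule eventually_at_in_open')
  ultimately have "eventually (\<lambda>w. False) (at z)" by eventually_elim (use eq in auto)
  thus ?thesis by simp
 qed
qed

lemma nicely_meromorphic_eqI:
 assumes F: "F nicely_meromorphic_on UNIV" and G: "G nicely_meromorphic_on UNIV"
  and ev: "eventually (\<lambda>z. F z = G z) (cosparse UNIV)"
 shows "F = G"
proof
 fix z
 have ev: "eventually (\<lambda>w. F w = G w) (at z)" using ev by (auto simp: eventually_cosparse_open_eq)
 hence pole: "is_pole F z \<longleftrightarrow> is_pole G z" by (intro is_pole_cong) auto
 show "F z = G z"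
 proof (cases "is_pole F z")
  case True
  hence "\<not> F \<midarrow>z\<rightarrow> F z" "\<not> G \<midarrow>z\<rightarrow> G z"
   using pole is_pole_def not_tendsto_and_filterlim_at_infinity[of "at z"] by (metis at_neq_bot)+
  thus ?thesis using F G unfolding nicely_meromorphic_on_def by (metis UNIV_I)
 next
  case False
  hence "F \<midarrow>z\<rightarrow> F z" "G \<midarrow>z\<rightarrow> G z" using F G pole by (auto simp: nicely_meromorphic_on_def)
  moreover from this(2) have "F \<midarrow>z\<rightarrow> G z" using ev by (subst tendsto_cong[OF ev])
  ultimately show ?thesis by (intro LIM_unique)
 qed
qed

lemma mero_cont_eq:
 assumes "F meromorphic_on UNIV" "F analytic_on S" "open S" "S \<noteq> {}" "\<And>s. s \<in> S ==> F s = f s"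
 shows "mero_cont f S = remove_sings F"
 unfolding mero_cont_def
proof (rule the_equality)
 have nice: "remove_sings F nicely_meromorphic_on UNIV" by (rule remove_sings_nicely_meromorphic[OF assms(1)])
 have agree: "remove_sings F s = f s" if "s \<in> S" for s
  using assms(2,5) that by (metis analytic_on_analytic_at remove_sings_at_analytic)
 show "remove_sings F nicely_meromorphic_on UNIV \<and> (\<forall>s\<in>S. remove_sings F s = f s)"
  using nice agree by blast
 fix G assume G: "G nicely_meromorphic_on UNIV \<and> (\<forall>s\<in>S. G s = f s)"
 show "G = remove_sings F"
 proof (rule nicely_meromorphic_eqI)
  show "eventually (\<lambda>z. G z = remove_sings F z) (cosparse UNIV)"
   using G nice agree assms(3,4) by (intro meromorphic_eq_cosparse[of _ _ S]) (auto simp: nicely_meromorphic_on_def)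
 qed (use G nice in auto)
qed

lemma open_Re_gt: "open {s. Re s > c}" by (rule open_halfspace_Re_gt)

lemma Re_gt_nonempty: "{s. Re s > c} \<noteq> {}"
proof -
 have "Complex (c + 1) 0 \<in> {s. Re s > c}" by simp
 thus ?thesis by blast
qed

lemma of_real_measurable:
 assumes "f \<in> borel_measurable M"
 shows "(\<lambda>x. complex_of_real (f x)) \<in> borel_measurable M"
 by (rule measurable_compose[OF assms borel_measurable_continuous_onI]) (intro continuous_intros)

lemma not_pi_le_0 [simp]: "\<not> pi \<le> 0"
 using pi_gt_zero by linarith

section \<open>The Riemann zeta function\<close>

definition zeta_phi :: "real => complex" where
 "zeta_phi = (\<lambda>t. of_real (jtheta t 0 - (if t \<le> 1 then 1 * t powr (- (1/2)) else 1)))"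

lemma jtheta_measurable: "(\<lambda>t. jtheta (t * A) r) \<in> borel_measurable Rpos" if "A > 0"
 unfolding jtheta_def
proof (rule infsum_measurable)
 show "(\<lambda>t. exp (- pi * (t * A) * (of_int n + r)\<^sup>2)) \<in> borel_measurable Rpos" for n
  by (intro Rpos_measurable_continuous continuous_intros)
 show "(\<lambda>n::int. norm (exp (- pi * (t * A) * (of_int n + r)\<^sup>2))) summable_on UNIV" if "t \<in> space Rpos" for t
  using jtheta_summable[of "t * A" r] that \<open>A > 0\<close> by simp
qed

lemma cut_measurable: "(\<lambda>t. if t \<le> 1 then V * t powr k else (1::real)) \<in> borel_measurable Rpos"
proof (rule measurable_If)
 show "(\<lambda>t. V * t powr k) \<in> borel_measurable Rpos" by (intro Rpos_measurable_continuous continuous_intros) auto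
 show "{x \<in> space Rpos. x \<le> 1} \<in> sets Rpos" by (simp add: sets_restrict_space image_iff) (intro bexI[of _ "{..1}"], auto)
qed auto

lemma zeta_phi_rapid: "\<exists>D. rapid_bound D zeta_phi"
proof -
 define B where "B = (\<lambda>t::real. if t \<le> 1 then t powr (- (1/2)) * jdelta (1 / (t * 1)) else jdelta t)"
 have "env_rapid B"
  unfolding env_rapid_def
 proof
  fix N
  obtain C where C: "C \<ge> 0" "\<And>t. t > 0 ==> jdelta (1 / (t * 1)) \<le> C * t ^ Suc N"
   using jdelta_inverse_decay[of 1 N] by auto
  obtain C' where C': "C' \<ge> 0" "\<And>t. t > 0 ==> jdelta t \<le> C' / t ^ Suc N"
   using jdelta_decay[of N] by auto
  have "B t \<le> (C + C') * t ^ N" if "0 < t \<and> t \<le> 1" for t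
  proof -
   have "B t \<le> t powr (- (1/2)) * (C * t ^ Suc N)"
    using that C(2)[of t] by (simp add: B_def mult_left_mono del: power_Suc)
   also have "\<dots> = C * t ^ N * t powr (1/2)"
    using that powr_add[of t "- (1/2)" 1] by (simp add: mult_ac)
   also have "\<dots> \<le> C * t ^ N * 1" using that C(1) by (intro mult_left_mono) (auto simp: powr_le1)
   also have "\<dots> \<le> (C + C') * t ^ N" using that C'(1) by (simp add: mult_right_mono)
   finally show ?thesis .
  qed
  moreover have "B t \<le> (C + C') / t ^ N" if "t > 1" for t
  proof -
   have "B t \<le> C' / t ^ Suc N" using that C'(2)[of t] by (simp add: B_def)
   also have "\<dots> \<le> C' / t ^ N" using that C'(1) by (intro divide_left_mono) (auto simp: field_simps)
   also have "\<dots> \<le> (C + C') / t ^ N" using that C(1) by (intro divide_right_mono) auto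
   finally show ?thesis .
  qed
  ultimately show "\<exists>C. (\<forall>t. 0 < t \<and> t \<le> 1 \<longrightarrow> B t \<le> C * t ^ N) \<and> (\<forall>t>1. B t \<le> C / t ^ N)" by blast
 qed
 then obtain D where D: "\<And>\<phi>. \<phi> \<in> borel_measurable Rpos ==> (\<And>t. t > 0 ==> norm (\<phi> t) \<le> B t) ==> rapid_bound D \<phi>"
  using env_rapid_imp_rapid_bound by blast
 have "rapid_bound D zeta_phi"
 proof (rule D)
  show "zeta_phi \<in> borel_measurable Rpos"
  proof -
   have j: "(\<lambda>t. jtheta t 0) \<in> borel_measurable Rpos"
    using jtheta_measurable[OF zero_less_one, of 0] unfolding mult_1_right .
   show ?thesis
    unfolding zeta_phi_def by (rule of_real_measurable[OF borel_measurable_diff[OF j cut_measurable]])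
  qed
  fix t :: real assume t: "t > 0"
  show "norm (zeta_phi t) \<le> B t"
   using jtheta_near[OF t, of 0] jdelta_nonneg[OF t] unfolding zeta_phi_def norm_of_real by (auto simp: B_def jdelta_def)
 qed
 thus ?thesis by blast
qed

definition zeta_formula :: "complex => complex" where
 "zeta_formula s = of_real pi powr (s / 2) *
   ((mellin zeta_phi (s / 2) + 1 / (s / 2 - 1 / 2)) * rGamma (s / 2) - rGamma (s / 2 + 1)) / 2"

lemma mellin_analytic:
 assumes "rapid_bound D \<phi>" "f analytic_on A"
 shows "(\<lambda>s. mellin \<phi> (f s)) analytic_on A"
proof -
 have "mellin \<phi> analytic_on UNIV" using mellin_entire[OF assms(1)] by (simp add: analytic_on_open)
 from analytic_on_compose[OF assms(2) analytic_on_subset[OF this subset_UNIV]]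
 show ?thesis by (simp add: o_def)
qed

lemma zeta_formula_analytic: "zeta_formula analytic_on - {1}"
proof -
 obtain D where D: "rapid_bound D zeta_phi" using zeta_phi_rapid by blast
 show ?thesis unfolding zeta_formula_def by (intro analytic_intros mellin_analytic[OF D]) auto
qed

lemma zeta_formula_meromorphic: "zeta_formula meromorphic_on UNIV"
proof -
 obtain D where D: "rapid_bound D zeta_phi" using zeta_phi_rapid by blast
 have a: "(\<lambda>s. mellin zeta_phi (s / 2)) analytic_on UNIV" "(\<lambda>s. rGamma (s / 2)) analytic_on UNIV"
  "(\<lambda>s. rGamma (s / 2 + 1)) analytic_on UNIV" "(\<lambda>s. complex_of_real pi powr (s / 2)) analytic_on UNIV"
  by (intro analytic_intros mellin_analytic[OF D]; simp)+
 show ?thesis unfolding zeta_formula_def by (intro meromorphic_intros a[THEN analytic_on_imp_meromorphic_on])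
qed

lemma rGamma_divide:
 fixes z :: complex
 assumes "z \<noteq> 0"
 shows "rGamma z * (1 / z) = rGamma (z + 1)"
proof -
 have "rGamma z * (1 / z) = (z * rGamma (z + 1)) * (1 / z)" by (simp only: rGamma_plus1)
 also have "\<dots> = rGamma (z + 1)" using assms by simp
 finally show ?thesis .
qed

lemma Gamma_factor_inverse:
 assumes "Re z > 0"
 shows "of_real pi powr z * rGamma z * (of_real pi powr (- z) * Gamma z * X) = X"
proof -
 have "z \<notin> \<int>\<^sub>\<le>\<^sub>0" using assms by (auto elim!: nonpos_Ints_cases)
 hence "rGamma z * Gamma z = 1" by (simp add: rGamma_inverse_Gamma Gamma_eq_zero_iff)
 moreover have "complex_of_real pi powr z * of_real pi powr (- z) = 1" by (simp add: powr_minus)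
 moreover have "of_real pi powr z * rGamma z * (of_real pi powr (- z) * Gamma z * X) =
   (of_real pi powr z * of_real pi powr (- z)) * (rGamma z * Gamma z) * X" by (simp only: mult_ac)
 ultimately show ?thesis by simp
qed

lemma zeta_lattice_sum:
 assumes s: "Re s > 1"
 shows "(\<lambda>k::int. (if k = 0 then 0 else 1) * \<bar>real_of_int k\<bar> powr (- Re s)) summable_on UNIV" (is ?g1)
  and "(\<Sum>\<^sub>\<infinity>k::int. (if k = 0 then 0 else 1) * of_real \<bar>real_of_int k\<bar> powr (- s)) = 2 * zeta_formula s" (is ?g2)
proof -
 obtain D where D: "rapid_bound D zeta_phi" using zeta_phi_rapid by blast
 define w where "w = (\<lambda>k::int. if k = 0 then 0 else 1 :: real)"
 define N where "N = (\<lambda>k::int. (real_of_int k)\<^sup>2)"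
 have sum: "((\<lambda>k. w k * exp (- pi * N k * t)) has_sum (jtheta t 0 - 1)) UNIV" if "t > 0" for t
 proof -
  have "exp (- pi * t * (of_int k)\<^sup>2) - (if k = 0 then 1 else 0) = w k * exp (- pi * N k * t)" for k :: int by (simp add: w_def N_def mult_ac)
  thus ?thesis using jtheta_zero_sum[OF that] by (simp only: jdelta_def)
 qed
 have z: "Re (s / 2) > 1/2" using s by simp
 note H = hecke_mellin[of D "\<lambda>t. jtheta t 0" 1 "1/2" "s / 2", folded zeta_phi_def, OF D]
 have int: "integrable Rpos (\<lambda>t. of_real (\<Sum>\<^sub>\<infinity>v. w v * exp (- pi * N v * t)) * complex_of_real t powr (s / 2 - 1))"
  using H(1) z by (subst Bochner_Integration.integrable_cong[OF refl]) (auto simp only: space_Rpos greaterThan_iff infsumI[OF sum])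
 have "mellin (\<lambda>t. of_real (\<Sum>\<^sub>\<infinity>v. w v * exp (- pi * N v * t))) (s / 2) = mellin (\<lambda>t. of_real (jtheta t 0 - 1)) (s / 2)"
  unfolding mellin_def by (rule Bochner_Integration.integral_cong) (auto simp only: space_Rpos greaterThan_iff infsumI[OF sum])
 also have "\<dots> = mellin zeta_phi (s / 2) + 1 / (s / 2 - 1 / 2) - 1 / (s / 2)"
  using H(2)[OF _ z] by simp
 finally have M: "mellin (\<lambda>t. of_real (\<Sum>\<^sub>\<infinity>v. w v * exp (- pi * N v * t))) (s / 2) =
   mellin zeta_phi (s / 2) + 1 / (s / 2 - 1 / 2) - 1 / (s / 2)" .
 have w: "w v \<ge> 0" for v by (simp add: w_def)
 have N: "N v > 0" if "w v \<noteq> 0" for v using that by (auto simp: w_def N_def split: if_splits)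
 have z0: "Re (s / 2) > 0" using s by simp
 have pt: "(\<lambda>v. w v * exp (- pi * N v * t)) summable_on UNIV" if "t > 0" for t
  using sum[OF that] by (auto simp: summable_on_def)
 note G = gauss_sum_mellin[of w N "s / 2", OF w N z0 pt int]
 have "w v * N v powr (- Re (s / 2)) = (if v = 0 then 0 else 1) * \<bar>real_of_int v\<bar> powr (- Re s)" for v
 proof (cases "v = 0")
  case False
  have N2: "N v = \<bar>real_of_int v\<bar> powr 2" using False by (simp add: N_def powr_numeral)
  have "N v powr (- Re (s / 2)) = \<bar>real_of_int v\<bar> powr (2 * (- Re (s / 2)))"
   unfolding N2 by (rule powr_powr)
  also have "2 * (- Re (s / 2)) = - Re s" by simp
  finally show ?thesis using False by (simp add: w_def)
 qed (simp add: w_def)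
 thus ?g1
  using G(1) by simp
 have "of_real (w v) * complex_of_real (N v) powr (- (s / 2)) = (if v = 0 then 0 else 1) * complex_of_real \<bar>real_of_int v\<bar> powr (- s)" for v
 proof (cases "v = 0")
  case False
  have "complex_of_real (N v) = of_real \<bar>real_of_int v\<bar> * of_real \<bar>real_of_int v\<bar>"
   by (simp add: N_def power2_eq_square flip: of_real_mult)
  hence "complex_of_real (N v) powr (- (s / 2)) = of_real \<bar>real_of_int v\<bar> powr (- (s / 2)) * of_real \<bar>real_of_int v\<bar> powr (- (s / 2))"
   using powr_times_real[of "of_real \<bar>real_of_int v\<bar>" "of_real \<bar>real_of_int v\<bar>" "- (s/2)"] by simp
  also have "\<dots> = of_real \<bar>real_of_int v\<bar> powr (- s)" by (simp add: powr_add[symmetric])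
  finally show ?thesis using False by (simp add: w_def)
 qed (simp add: w_def)
 hence "(\<Sum>\<^sub>\<infinity>k::int. (if k = 0 then 0 else 1) * of_real \<bar>real_of_int k\<bar> powr (- s)) =
   (\<Sum>\<^sub>\<infinity>v. of_real (w v) * complex_of_real (N v) powr (- (s / 2)))" by simp
 also have "\<dots> = of_real pi powr (s / 2) * rGamma (s / 2) * (mellin zeta_phi (s / 2) + 1 / (s / 2 - 1 / 2) - 1 / (s / 2))"
 proof -
  have "of_real pi powr (- (s / 2)) * Gamma (s / 2) * (\<Sum>\<^sub>\<infinity>v. of_real (w v) * complex_of_real (N v) powr (- (s / 2))) = mellin zeta_phi (s / 2) + 1 / (s / 2 - 1 / 2) - 1 / (s / 2)"
   by (rule trans[OF G(2)[symmetric] M])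
  thus ?thesis using Gamma_factor_inverse[OF z0, of "(\<Sum>\<^sub>\<infinity>v. of_real (w v) * complex_of_real (N v) powr (- (s / 2)))"] by (simp only:)
 qed
 also have "\<dots> = 2 * zeta_formula s"
 proof -
  have e: "rGamma (s / 2) * (1 / (s / 2)) = rGamma (s / 2 + 1)" by (rule rGamma_divide) (use s in auto)
  have "2 * zeta_formula s = of_real pi powr (s / 2) * ((mellin zeta_phi (s / 2) + 1 / (s / 2 - 1 / 2)) * rGamma (s / 2) - rGamma (s / 2) * (1 / (s / 2)))"
   unfolding e zeta_formula_def by simp
  thus ?thesis by (simp only: right_diff_distrib left_diff_distrib mult.assoc mult.commute mult.left_commute)
 qed
 finally show ?g2 .
qed

lemma zeta_formula_series:
 assumes s: "Re s > 1"
 shows "(\<lambda>n. 1 / of_nat (Suc n) powr s) sums zeta_formula s"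
proof -
 define g where "g = (\<lambda>k::int. (if k = 0 then 0 else 1) * complex_of_real \<bar>real_of_int k\<bar> powr (- s))"
 have ng: "norm (g k) = (if k = 0 then 0 else 1) * \<bar>real_of_int k\<bar> powr (- Re s)" for k by (auto simp: g_def norm_real_powr)
 have gabs: "(\<lambda>k. norm (g k)) summable_on UNIV"
  unfolding ng by (rule zeta_lattice_sum(1)[OF s])
 have gs: "g summable_on A" for A by (rule summable_on_subset_banach[OF abs_summable_summable[OF gabs]]) simp
 define P where "P = (\<lambda>n. int (Suc n))"
 define M where "M = (\<lambda>n. - int (Suc n))"
 have inj: "inj P" "inj M" by (auto simp: P_def M_def inj_on_def)
 have gPM: "g (P n) = 1 / of_nat (Suc n) powr s" "g (M n) = 1 / of_nat (Suc n) powr s" for n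
  by (simp_all add: g_def P_def M_def powr_minus divide_inverse add_ac)
 have 2: "2 * zeta_formula s = (\<Sum>\<^sub>\<infinity>k. g k)"
  using zeta_lattice_sum(2)[OF s] by (simp only: g_def)
 also have "\<dots> = (\<Sum>\<^sub>\<infinity>k\<in>range P \<union> range M. g k)"
 proof (rule infsum_cong_neutral)
  fix k assume "k \<in> UNIV - (range P \<union> range M)"
  hence k: "k \<notin> range P" "k \<notin> range M" by auto
  have "k = 0"
  proof (rule ccontr)
   assume "k \<noteq> 0"
   hence "k > 0 \<or> k < 0" by linarith
   moreover have "k = P (nat (k - 1))" if "k > 0" using that by (simp add: P_def)
   moreover have "k = M (nat (- k - 1))" if "k < 0" using that by (simp add: M_def)
   ultimately show False using k by blast
  qed
  thus "g k = 0" by (simp add: g_def)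
 qed auto
 also have "\<dots> = (\<Sum>\<^sub>\<infinity>k\<in>range P. g k) + (\<Sum>\<^sub>\<infinity>k\<in>range M. g k)"
  by (rule infsum_Un_disjoint[OF gs gs]) (auto simp: P_def M_def)
 also have "\<dots> = 2 * (\<Sum>\<^sub>\<infinity>n. 1 / of_nat (Suc n) powr s)"
  unfolding infsum_reindex[OF inj(1)] infsum_reindex[OF inj(2)] o_def gPM by simp
 finally have eq: "zeta_formula s = (\<Sum>\<^sub>\<infinity>n. 1 / of_nat (Suc n) powr s)" by simp
 have "(g \<circ> P) summable_on UNIV" using gs[of "range P"] summable_on_reindex[OF inj(1), of g] by simp
 hence "(\<lambda>n. 1 / of_nat (Suc n) powr s) summable_on UNIV" by (simp only: o_def gPM)
 hence "((\<lambda>n. 1 / of_nat (Suc n) powr s) has_sum zeta_formula s) UNIV" unfolding eq by (rule has_sum_infsum)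
 thus ?thesis by (rule has_sum_imp_sums)
qed

lemma zeta_eq: "zeta = remove_sings zeta_formula"
 unfolding zeta_def
proof (rule mero_cont_eq[OF zeta_formula_meromorphic _ open_Re_gt Re_gt_nonempty])
 show "zeta_formula analytic_on {s. Re s > 1}" by (rule analytic_on_subset[OF zeta_formula_analytic]) auto
 show "zeta_formula s = (\<Sum>n. 1 / of_nat (Suc n) powr s)" if "s \<in> {s. Re s > 1}" for s
  using sums_unique[OF zeta_formula_series[of s]] that by simp
qed

lemma zeta_eq_formula: "s \<noteq> 1 ==> zeta s = zeta_formula s"
 using zeta_formula_analytic unfolding zeta_eq by (metis ComplI analytic_on_analytic_at remove_sings_at_analytic singletonD)

lemma zeta_nicely_meromorphic: "zeta nicely_meromorphic_on UNIV"
 unfolding zeta_eq by (rule remove_sings_nicely_meromorphic[OF zeta_formula_meromorphic])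

lemma zeta_analytic: "zeta analytic_on - {1}"
 unfolding zeta_eq by (rule remove_sings_analytic_on[OF zeta_formula_analytic])

lemma zeta_nonzero:
 assumes "Re s \<ge> 4"
 shows "zeta s \<noteq> 0"
proof
 assume 0: "zeta s = 0"
 define f where "f = (\<lambda>n. 1 / of_nat (Suc n) powr s :: complex)"
 have f: "f sums 0"
  using zeta_formula_series[of s] zeta_eq_formula[of s] assms 0 by (fastforce simp: f_def)
 hence fs: "summable f" by (simp add: sums_iff)
 have "(\<Sum>n. f (Suc n)) = (\<Sum>n. f n) - f 0" by (rule suminf_split_head[OF fs])
 hence 1: "(\<Sum>n. f (Suc n)) = -1" using f by (simp add: sums_iff f_def)
 define h where "h = (\<lambda>n::nat. 1 / real (n + 1) ^ 2)"
 have h: "h sums (pi\<^sup>2 / 6)" using inverse_squares_sums by (simp add: h_def add.commute)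
 have hs: "summable (\<lambda>n. h (Suc n) / 4)"
  using h by (simp add: summable_Suc_iff sums_iff)
 have le: "norm (f (Suc n)) \<le> h (Suc n) / 4" for n
 proof -
  have "norm (f (Suc n)) = 1 / real (n + 2) powr Re s"
   using norm_real_powr[of "real (n + 2)" s] by (simp add: f_def norm_divide add_ac)
  also have "\<dots> \<le> 1 / real (n + 2) powr 4"
   using assms by (intro divide_left_mono powr_mono) auto
  also have "\<dots> = 1 / (real (n + 2) ^ 2 * real (n + 2) ^ 2)" by (simp add: powr_numeral power_add[symmetric])
  also have "\<dots> \<le> 1 / (4 * real (n + 2) ^ 2)"
  proof -
   have "4 \<le> real (n + 2) ^ 2" using power_mono[of 2 "real (n + 2)" 2] by simp
   thus ?thesis by (intro divide_left_mono mult_right_mono) auto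
  qed
  finally show ?thesis by (simp add: h_def add_ac)
 qed
 have "1 = norm (\<Sum>n. f (Suc n))" using 1 by simp
 also have "\<dots> \<le> (\<Sum>n. h (Suc n) / 4)" by (rule norm_suminf_le[OF le hs])
 also have "\<dots> = ((\<Sum>n. h n) - h 0) / 4"
  using h suminf_split_head[of h] suminf_divide[of "\<lambda>n. h (Suc n)" 4] by (simp add: sums_iff summable_Suc_iff)
 also have "\<dots> = (pi\<^sup>2 / 6 - 1) / 4" using h by (simp add: sums_iff h_def)
 also have "\<dots> < 1"
 proof -
  have "pi * pi < 4 * 4" using pi_less_4 pi_gt_zero by (intro mult_strict_mono) auto
  thus ?thesis by (simp add: power2_eq_square)
 qed
 finally show False by simp
qed

section \<open>The Epstein zeta function of a triangular form\<close>

context triangular_form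
begin

definition V :: real where "V = (A1 * A2 * A3 * A4) powr (- 1/2)"

definition phi :: "real => complex" where
 "phi = (\<lambda>t. of_real (theta t - (if t \<le> 1 then V * t powr (- 2) else 1)))"

definition epstein :: "complex => complex" where
 "epstein z = (mellin phi z + of_real V / (z - 2)) * rGamma z - rGamma (z + 1)"

lemma theta_measurable: "theta \<in> borel_measurable Rpos"
proof -
 have eq: "theta = (\<lambda>t. \<Sum>\<^sub>\<infinity>v. exp (- pi * Q v * t))" by (rule ext) (rule theta_def)
 show ?thesis unfolding eq
 proof (rule infsum_measurable)
  show "(\<lambda>t. exp (- pi * Q v * t)) \<in> borel_measurable Rpos" for v by (intro Rpos_measurable_continuous continuous_intros)
  show "(\<lambda>v. norm (exp (- pi * Q v * t))) summable_on UNIV" if "t \<in> space Rpos" for t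
   using theta_summable[of t] that by simp
 qed
qed

lemma phi_measurable: "phi \<in> borel_measurable Rpos"
 unfolding phi_def by (rule of_real_measurable[OF borel_measurable_diff[OF theta_measurable cut_measurable]])

lemma phi_bound: "t > 0 ==> norm (phi t) \<le> theta_envelope A1 A2 A3 A4 t"
 using theta_envelope[of t] by (simp only: phi_def norm_of_real V_def real_norm_def)

lemma phi_rapid: "\<exists>D. rapid_bound D phi"
proof -
 obtain D where "\<And>\<phi>. \<phi> \<in> borel_measurable Rpos ==> (\<And>t. t > 0 ==> norm (\<phi> t) \<le> theta_envelope A1 A2 A3 A4 t) ==> rapid_bound D \<phi>"
  using env_rapid_imp_rapid_bound[OF theta_envelope_rapid[OF pos]] by blast
 thus ?thesis using phi_measurable phi_bound by blast
qed

lemma epstein_analytic: "epstein analytic_on - {2}"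
proof -
 obtain D where D: "rapid_bound D phi" using phi_rapid by blast
 show ?thesis unfolding epstein_def by (intro analytic_intros mellin_analytic[OF D]) auto
qed

lemma epstein_meromorphic: "epstein meromorphic_on UNIV"
proof -
 obtain D where D: "rapid_bound D phi" using phi_rapid by blast
 have a: "mellin phi analytic_on UNIV" "(\<lambda>s. rGamma s :: complex) analytic_on UNIV" "(\<lambda>s. rGamma (s + 1) :: complex) analytic_on UNIV"
  using mellin_analytic[OF D, of "\<lambda>z. z" UNIV] by (auto intro!: analytic_intros)
 show ?thesis unfolding epstein_def by (intro meromorphic_intros a[THEN analytic_on_imp_meromorphic_on])
qed

lemma epstein_series:
 assumes z: "Re z > 2"
 shows "(\<lambda>v. wt v * Q v powr (- Re z)) summable_on UNIV" (is ?g1)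
  and "(\<Sum>\<^sub>\<infinity>v. of_real (wt v) * of_real (Q v) powr (- z)) = of_real pi powr z * epstein z" (is ?g2)
proof -
 obtain D where D: "rapid_bound D phi" using phi_rapid by blast
 note sum = theta_minus_one
 note H = hecke_mellin[of D theta V 2 z, folded phi_def, OF D]
 have int: "integrable Rpos (\<lambda>t. of_real (\<Sum>\<^sub>\<infinity>v. wt v * exp (- pi * Q v * t)) * complex_of_real t powr (z - 1))"
  using H(1) z by (subst Bochner_Integration.integrable_cong[OF refl]) (auto simp only: space_Rpos greaterThan_iff infsumI[OF sum])
 have "mellin (\<lambda>t. of_real (\<Sum>\<^sub>\<infinity>v. wt v * exp (- pi * Q v * t))) z = mellin (\<lambda>t. of_real (theta t - 1)) z"
  unfolding mellin_def by (rule Bochner_Integration.integral_cong) (auto simp only: space_Rpos greaterThan_iff infsumI[OF sum])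
 also have "\<dots> = mellin phi z + of_real V / (z - 2) - 1 / z"
  using H(2)[OF _ z] by simp
 finally have M: "mellin (\<lambda>t. of_real (\<Sum>\<^sub>\<infinity>v. wt v * exp (- pi * Q v * t))) z = mellin phi z + of_real V / (z - 2) - 1 / z" .
 have w: "wt v \<ge> 0" for v by (simp add: wt_def)
 have N: "Q v > 0" if "wt v \<noteq> 0" for v using that Q_pos[of v] by (auto simp: wt_def split: if_splits)
 have z0: "Re z > 0" using z by simp
 have pt: "(\<lambda>v. wt v * exp (- pi * Q v * t)) summable_on UNIV" if "t > 0" for t
  using sum[OF that] by (auto simp: summable_on_def)
 note G = gauss_sum_mellin[of wt Q z, OF w N z0 pt int]
 show ?g1 by (rule G(1))
 have "(\<Sum>\<^sub>\<infinity>v. of_real (wt v) * of_real (Q v) powr (- z)) = of_real pi powr z * rGamma z * (mellin phi z + of_real V / (z - 2) - 1 / z)"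
 proof -
  have "of_real pi powr (- z) * Gamma z * (\<Sum>\<^sub>\<infinity>v. of_real (wt v) * complex_of_real (Q v) powr (- z)) = mellin phi z + of_real V / (z - 2) - 1 / z"
   by (rule trans[OF G(2)[symmetric] M])
  thus ?thesis using Gamma_factor_inverse[OF z0, of "(\<Sum>\<^sub>\<infinity>v. of_real (wt v) * complex_of_real (Q v) powr (- z))"] by (simp only:)
 qed
 also have "\<dots> = of_real pi powr z * epstein z"
 proof -
  have e: "rGamma z * (1 / z) = rGamma (z + 1)" by (rule rGamma_divide) (use z in auto)
  have "epstein z = (mellin phi z + of_real V / (z - 2)) * rGamma z - rGamma z * (1 / z)"
   unfolding e epstein_def by simp
  thus ?thesis by (simp only: right_diff_distrib left_diff_distrib mult.assoc mult.commute mult.left_commute)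
 qed
 finally show ?g2 .
qed

end

lemma jtheta_affine_fourier:
 fixes a m :: int
 assumes "\<tau> > 0" "a \<noteq> 0"
 shows "(\<integral>x. of_real (jtheta \<tau> (r + of_int a * x)) * cis (- 2 * pi * of_int m * x) \<partial>I01) =
   (if a dvd m then of_real (\<tau> powr (- 1/2) * exp (- pi * (of_int (m div a))\<^sup>2 / \<tau>)) * cis (2 * pi * of_int (m div a) * r) else 0)"
proof -
 define e where "e = (\<lambda>k::int. exp (- pi * (of_int k)\<^sup>2 / \<tau>))"
 define T where "T = complex_of_real (\<tau> powr (- 1/2))"
 have e: "e summable_on UNIV" using jtheta_summable[of "1/\<tau>" 0] assms by (simp add: e_def)
 have eq: "of_real (jtheta \<tau> (r + of_int a * x)) * cis (- 2 * pi * of_int m * x) =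
   (\<Sum>\<^sub>\<infinity>k. T * (of_real (e k) * cis (2 * pi * of_int k * r) * cis (2 * pi * of_int (k * a - m) * x)))" for x
 proof -
  have "of_real (jtheta \<tau> (r + of_int a * x)) * cis (- 2 * pi * of_int m * x) =
    (\<Sum>\<^sub>\<infinity>k. T * (of_real (e k) * cis (2 * pi * of_int k * (r + of_int a * x)))) * cis (- 2 * pi * of_int m * x)"
   unfolding jtheta_poisson[OF assms(1)] T_def e_def infsum_cmult_right' ..
  also have "\<dots> = (\<Sum>\<^sub>\<infinity>k. T * (of_real (e k) * cis (2 * pi * of_int k * (r + of_int a * x))) * cis (- 2 * pi * of_int m * x))"
   by (rule infsum_cmult_left'[symmetric])
  also have "\<dots> = (\<Sum>\<^sub>\<infinity>k. T * (of_real (e k) * cis (2 * pi * of_int k * r) * cis (2 * pi * of_int (k * a - m) * x)))"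
  proof (rule infsum_cong)
   fix k
   have "2 * pi * of_int k * (r + of_int a * x) + - 2 * pi * of_int m * x = 2 * pi * of_int k * r + 2 * pi * of_int (k * a - m) * x"
    by (simp add: algebra_simps)
   hence "cis (2 * pi * of_int k * (r + of_int a * x)) * cis (- 2 * pi * of_int m * x) =
     cis (2 * pi * of_int k * r) * cis (2 * pi * of_int (k * a - m) * x)" by (simp only: cis_mult)
   thus "T * (of_real (e k) * cis (2 * pi * of_int k * (r + of_int a * x))) * cis (- 2 * pi * of_int m * x)
     = T * (of_real (e k) * cis (2 * pi * of_int k * r) * cis (2 * pi * of_int (k * a - m) * x))" by (simp only: mult.assoc)
  qed
  finally show ?thesis .
 qed
 have "(\<integral>x. of_real (jtheta \<tau> (r + of_int a * x)) * cis (- 2 * pi * of_int m * x) \<partial>I01) =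
   (\<Sum>\<^sub>\<infinity>k. \<integral>x. T * (of_real (e k) * cis (2 * pi * of_int k * r) * cis (2 * pi * of_int (k * a - m) * x)) \<partial>I01)"
  unfolding eq
 proof (rule sum_integral_swap_bounded(2)[OF finite_measure_I01])
  show "(\<lambda>k. norm T * e k) summable_on UNIV" by (rule summable_on_cmult_right[OF e])
  show "(\<lambda>x. T * (of_real (e k) * cis (2 * pi * of_int k * r) * cis (2 * pi * of_int (k * a - m) * x))) \<in> borel_measurable I01" for k
   by (intro I01_measurable borel_measurable_continuous_onI continuous_intros)
 qed (auto simp: norm_mult e_def)
 also have "\<dots> = (\<Sum>\<^sub>\<infinity>k. T * (of_real (e k) * cis (2 * pi * of_int k * r)) * (if k * a - m = 0 then 1 else 0))"
  by (simp only: integral_mult_right_zero integral_cis_I01) (simp only: mult.assoc)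
 also have "\<dots> = (if a dvd m then T * (of_real (e (m div a)) * cis (2 * pi * of_int (m div a) * r)) else 0)"
 proof (cases "a dvd m")
  case True
  hence "k * a - m = 0 \<longleftrightarrow> k = m div a" for k using assms(2) by auto
  hence "(\<Sum>\<^sub>\<infinity>k. T * (of_real (e k) * cis (2 * pi * of_int k * r)) * (if k * a - m = 0 then 1 else 0)) =
    (\<Sum>\<^sub>\<infinity>k\<in>{m div a}. T * (of_real (e k) * cis (2 * pi * of_int k * r)))" by (intro infsum_cong_neutral) auto
  thus ?thesis using True by simp
 next
  case False
  hence "k * a - m \<noteq> 0" for k by (metis dvd_triv_right eq_iff_diff_eq_0)
  thus ?thesis using False by simp
 qed
 finally show ?thesis by (simp add: T_def e_def)
qed

lemma jtheta_affine_integral: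
 assumes "\<tau> > 0" "a \<noteq> 0"
 shows "(\<integral>x. jtheta \<tau> (r + of_int a * x) \<partial>I01) = \<tau> powr (- 1/2)"
proof -
 have "complex_of_real (\<integral>x. jtheta \<tau> (r + of_int a * x) \<partial>I01) = (\<integral>x. of_real (jtheta \<tau> (r + of_int a * x)) \<partial>I01)"
  by (rule integral_complex_of_real[symmetric])
 also have "\<dots> = of_real (\<tau> powr (- 1/2))"
  using jtheta_affine_fourier[OF assms, of r 0] by simp
 finally show ?thesis by (simp only: of_real_eq_iff)
qed

lemma jtheta_nonneg: "jtheta \<tau> r \<ge> 0"
 unfolding jtheta_def by (intro infsum_nonneg) simp

lemma jtheta_affine_measurable:
 assumes "\<tau> > 0" "continuous_on UNIV f"
 shows "(\<lambda>x. jtheta \<tau> (f x)) \<in> borel_measurable I01"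
 by (intro I01_measurable borel_measurable_continuous_onI continuous_on_compose2[OF jtheta_continuous[OF assms(1)] assms(2)]) auto

section \<open>Iterated integrals over the cube\<close>

lemma cube_step:
 fixes f :: "(nat => real) => complex"
 assumes I: "finite I" "i \<notin> I" and f: "f \<in> borel_measurable (PiM (insert i I) (\<lambda>_. lborel))"
  and B: "\<forall>n\<in>PiE (insert i I) (\<lambda>_. {0..1}). norm (f n) \<le> B"
 shows "(LINT n:PiE (insert i I) (\<lambda>_. {0..1})|PiM (insert i I) (\<lambda>_. lborel). f n) =
    (LINT y:PiE I (\<lambda>_. {0..1})|PiM I (\<lambda>_. lborel). (\<integral>x. f (y(i := x)) \<partial>I01))" (is ?g1)
  and "(\<lambda>y. \<integral>x. f (y(i := x)) \<partial>I01) \<in> borel_measurable (PiM I (\<lambda>_. lborel))" (is ?g2)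
  and "\<forall>y\<in>PiE I (\<lambda>_. {0..1}). norm (\<integral>x. f (y(i := x)) \<partial>I01) \<le> B" (is ?g3)
proof -
 interpret P: product_sigma_finite "\<lambda>_::nat. lborel :: real measure" ..
 let ?C = "\<lambda>I::nat set. PiE I (\<lambda>_. {0..1::real})"
 have box: "?C J \<in> sets (PiM J (\<lambda>_. lborel))" if "finite J" for J
  using that by (intro sets_PiM_I_finite) auto
 have "f \<circ> (\<lambda>(y, x). y(i := x)) \<in> borel_measurable (PiM I (\<lambda>_. lborel) \<Otimes>\<^sub>M lborel)"
  by (rule measurable_comp[OF measurable_add_dim f])
 hence j: "(\<lambda>(y, x). f (y(i := x))) \<in> borel_measurable (PiM I (\<lambda>_. lborel) \<Otimes>\<^sub>M lborel)"
  by (simp only: o_def case_prod_beta')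
 have ind: "(\<lambda>(y :: nat => real, x :: real). indicator {0..1} x :: real) \<in> borel_measurable (PiM I (\<lambda>_. lborel) \<Otimes>\<^sub>M lborel)"
 proof -
  have "(indicator {0..1::real} :: real => real) \<in> borel_measurable lborel" by (rule borel_measurable_indicator) simp
  from measurable_compose[OF measurable_snd this] show ?thesis by (simp only: case_prod_beta')
 qed
 have "(\<lambda>(y, x). indicator {0..1} x *\<^sub>R f (y(i := x))) \<in> borel_measurable (PiM I (\<lambda>_. lborel) \<Otimes>\<^sub>M lborel)"
  using borel_measurable_scaleR[OF ind j] by (simp only: case_prod_beta')
 hence "(\<lambda>y. \<integral>x. indicator {0..1} x *\<^sub>R f (y(i := x)) \<partial>lborel) \<in> borel_measurable (PiM I (\<lambda>_. lborel))"
  by (rule lborel.borel_measurable_lebesgue_integral)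
 thus ?g2 by (simp only: integral_I01 set_lebesgue_integral_def)
 define g where "g = (\<lambda>n. indicator (?C (insert i I)) n *\<^sub>R f n)"
 have gm: "g \<in> borel_measurable (PiM (insert i I) (\<lambda>_. lborel))"
  unfolding g_def by (rule borel_measurable_scaleR[OF borel_measurable_indicator[OF box] f]) (use I in simp)
 have fin: "emeasure (PiM (insert i I) (\<lambda>_. lborel)) (?C (insert i I)) < \<infinity>"
  using I by (subst P.emeasure_PiM) auto
 have "integrable (PiM (insert i I) (\<lambda>_. lborel)) (\<lambda>n. indicator (?C (insert i I)) n *\<^sub>R B)"
  using fin I by (intro integrable_scaleR_left integrable_real_indicator box) auto
 hence gi: "integrable (PiM (insert i I) (\<lambda>_. lborel)) g"
  by (rule Bochner_Integration.integrable_bound[OF _ gm]) (use B in \<open>auto simp: g_def indicator_def intro!: AE_I2 order_trans[OF _ abs_ge_self]\<close>)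
 have gy: "g (y(i := x)) = indicator (?C I) y *\<^sub>R (indicator {0..1} x *\<^sub>R f (y(i := x)))"
  if "y \<in> space (PiM I (\<lambda>_. lborel))" for y x
 proof -
  have "y \<in> extensional I" using that by (simp add: space_PiM PiE_def)
  hence "y(i := x) \<in> ?C (insert i I) \<longleftrightarrow> y \<in> ?C I \<and> x \<in> {0..1}"
   using I(2) by (auto simp: PiE_def Pi_def extensional_def)
  thus ?thesis by (simp add: g_def indicator_def)
 qed
 have "(LINT n:?C (insert i I)|PiM (insert i I) (\<lambda>_. lborel). f n) = (\<integral>y. (\<integral>x. g (y(i := x)) \<partial>lborel) \<partial>PiM I (\<lambda>_. lborel))"
  unfolding set_lebesgue_integral_def using P.product_integral_insert[OF I gi] by (simp only: g_def)
 also have "\<dots> = (\<integral>y. indicator (?C I) y *\<^sub>R (\<integral>x. f (y(i := x)) \<partial>I01) \<partial>PiM I (\<lambda>_. lborel))"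
  by (rule Bochner_Integration.integral_cong[OF refl]) (simp only: gy integral_scaleR_right integral_I01 set_lebesgue_integral_def)
 finally show ?g1 by (simp only: set_lebesgue_integral_def)
 show ?g3
 proof
 fix y assume y: "y \<in> ?C I"
 have yx: "norm (f (y(i := x))) \<le> B" if "x \<in> {0..1}" for x by (rule B[rule_format, OF PiE_fun_upd[OF that y]])
 interpret prob_space I01 by (rule prob_space_I01)
 show "norm (\<integral>x. f (y(i := x)) \<partial>I01) \<le> B"
 proof (cases "integrable I01 (\<lambda>x. f (y(i := x)))")
  case True
  have "norm (\<integral>x. f (y(i := x)) \<partial>I01) \<le> (\<integral>x. norm (f (y(i := x))) \<partial>I01)" by (rule integral_norm_bound)
  also have "\<dots> \<le> B" using True yx by (intro integral_le_const) auto
  finally show ?thesis .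
 next
  case False
  have "0 \<le> B" using order_trans[OF norm_ge_zero yx[of 0]] by simp
  thus ?thesis using False by (simp add: not_integrable_integral_eq)
 qed
 qed
qed

definition ucoords :: "real => real => real => real => nat => real" where
 "ucoords x1 x5 x4 x2 = ((((\<lambda>_. undefined)(1 := x1))(5 := x5))(4 := x4))(2 := x2)"

lemma cube_iterated:
 fixes f :: "(nat => real) => complex"
 assumes f: "f \<in> borel_measurable (PiM U_coords (\<lambda>_. lborel))"
  and B: "\<forall>n\<in>PiE U_coords (\<lambda>_. {0..1}). norm (f n) \<le> B"
 shows "(LINT n:PiE U_coords (\<lambda>_. {0..1})|PiM U_coords (\<lambda>_. lborel). f n) =
   (\<integral>x1. (\<integral>x5. (\<integral>x4. (\<integral>x2. f (ucoords x1 x5 x4 x2) \<partial>I01) \<partial>I01) \<partial>I01) \<partial>I01)"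
proof -
 have U: "U_coords = insert 2 (insert 4 (insert 5 (insert 1 {})))" by (auto simp: U_coords_def)
 have n: "(2::nat) \<notin> insert 4 (insert 5 (insert 1 {}))" "(4::nat) \<notin> insert 5 (insert 1 {})" "(5::nat) \<notin> insert 1 {}" "(1::nat) \<notin> {}"
  by auto
 have fin: "finite (insert (4::nat) (insert 5 (insert 1 {})))" "finite (insert (5::nat) (insert 1 {}))"
  "finite (insert (1::nat) {})" "finite ({} :: nat set)" by auto
 note s1 = cube_step[OF fin(1) n(1) f[unfolded U] B[unfolded U]]
 note s2 = cube_step[OF fin(2) n(2) s1(2) s1(3)]
 note s3 = cube_step[OF fin(3) n(3) s2(2) s2(3)]
 note s4 = cube_step[OF fin(4) n(4) s3(2) s3(3)]
 have e: "(LINT y:PiE {} (\<lambda>_. {0..1})|PiM {} (\<lambda>_. lborel). h y) = h (\<lambda>_. undefined)" for h :: "(nat => real) => complex"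
 proof -
  interpret P: product_sigma_finite "\<lambda>_::nat. lborel :: real measure" ..
  show ?thesis unfolding set_lebesgue_integral_def by (simp add: PiM_empty lebesgue_integral_count_space_finite)
 qed
 show ?thesis
  unfolding U ucoords_def by (rule trans[OF s1(1)], rule trans[OF s2(1)], rule trans[OF s3(1)], rule trans[OF s4(1)], rule e)
qed

lemma weighted_swap:
 fixes g :: "'v::countable => real" and h :: "'v => real => 'b::{banach,second_countable_topology}"
 assumes g: "g summable_on UNIV" "\<And>v. g v \<ge> 0" and meas: "\<And>v. h v \<in> borel_measurable I01"
  and Kb: "\<And>v x. norm (h v x) \<le> Kb"
 shows "(\<integral>x. (\<Sum>\<^sub>\<infinity>v. g v *\<^sub>R h v x) \<partial>I01) = (\<Sum>\<^sub>\<infinity>v. g v *\<^sub>R (\<integral>x. h v x \<partial>I01))" (is ?g1)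
  and "integrable I01 (\<lambda>x. \<Sum>\<^sub>\<infinity>v. g v *\<^sub>R h v x)" (is ?g2)
proof -
 have B: "(\<lambda>v. g v * Kb) summable_on UNIV" by (rule summable_on_cmult_left[OF g(1)])
 have m: "(\<lambda>x. g v *\<^sub>R h v x) \<in> borel_measurable I01" for v by (rule borel_measurable_scaleR[OF borel_measurable_const meas])
 have le: "norm (g v *\<^sub>R h v x) \<le> g v * Kb" for v x
  using mult_left_mono[OF Kb g(2)] g(2)[of v] by simp
 note sw = sum_integral_swap_bounded[OF finite_measure_I01 m B le]
 show ?g1
  using sw(2) by simp
 show ?g2 by (rule sw(1))
qed

lemma jtheta_shift_fourier:
 fixes a m :: int
 assumes "\<tau> > 0" "a \<noteq> 0"
 shows "(\<integral>x. of_real (jtheta \<tau> ((x + p) * of_int a)) * cis (- 2 * pi * of_int m * x) \<partial>I01) =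
   (if a dvd m then of_real (\<tau> powr (- 1/2) * exp (- pi * (of_int (m div a))\<^sup>2 / \<tau>)) * cis (2 * pi * of_int m * p) else 0)"
proof -
 have e1: "(x + p) * of_int a = p * of_int a + of_int a * x" for x :: real by (simp add: algebra_simps)
 have e2: "2 * pi * of_int (m div a) * (p * of_int a) = 2 * pi * of_int m * p" if "a dvd m"
 proof -
  have "of_int (m div a) * real_of_int a = of_int m" using that by (simp flip: of_int_mult)
  moreover have "2 * pi * of_int (m div a) * (p * of_int a) = 2 * pi * (of_int (m div a) * of_int a) * p" by (simp only: mult_ac)
  ultimately show ?thesis by (simp only:)
 qed
 show ?thesis
 proof (cases "a dvd m")
  case True
  show ?thesis unfolding e1 jtheta_affine_fourier[OF assms] e2[OF True] ..
 next
  case False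
  thus ?thesis unfolding e1 jtheta_affine_fourier[OF assms] by simp
 qed
qed

text \<open>The divisor sum of Gaussians whose Mellin transform carries the divisor function.\<close>

definition divsum :: "real => real => int => real" where
 "divsum \<tau> \<tau>' m = (\<Sum>\<^sub>\<infinity>d::int. if d \<noteq> 0 \<and> d dvd m
   then exp (- pi * \<tau> * (of_int d)\<^sup>2) * exp (- pi * (of_int (m div d))\<^sup>2 / \<tau>') else 0)"

text \<open>A sum over \<open>\<int>\<close> of \<open>f\<close> plus a correction at \<open>0\<close> only.\<close>

lemma infsum_split_zero:
 fixes f :: "int => 'b::banach"
 assumes "(\<lambda>k. if k = 0 then 0 else f k) summable_on UNIV"
 shows "(\<Sum>\<^sub>\<infinity>k. f k) = f 0 + (\<Sum>\<^sub>\<infinity>k. if k = 0 then 0 else f k)"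
proof -
 have "((\<lambda>k. (if k = 0 then f k else 0) + (if k = 0 then 0 else f k)) has_sum (f 0 + (\<Sum>\<^sub>\<infinity>k. if k = 0 then 0 else f k))) UNIV"
  by (intro has_sum_add has_sum_single has_sum_infsum assms)
 also have "(\<lambda>k. (if k = 0 then f k else 0) + (if k = 0 then 0 else f k)) = f" by auto
 finally show ?thesis by (rule infsumI)
qed

lemma gauss_weighted_summable:
 fixes h :: "int => 'b::banach"
 assumes "\<tau> > 0" "\<And>k. norm (h k) \<le> Kb"
 shows "(\<lambda>k::int. exp (- pi * \<tau> * (of_int k)\<^sup>2) *\<^sub>R h k) summable_on UNIV"
proof (rule abs_summable_summable, rule summable_on_comparison_test)
 show "(\<lambda>k::int. exp (- pi * \<tau> * (of_int k)\<^sup>2) * Kb) summable_on UNIV"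
  using summable_on_cmult_left[OF jtheta_summable[OF assms(1), of 0], of Kb] by simp
qed (use assms(2) in \<open>auto intro: mult_left_mono\<close>)

lemma jtheta_norm_le: "\<tau> > 0 ==> norm (jtheta \<tau> r) \<le> \<tau> powr (- 1/2) * (1 + jdelta (1 / \<tau>))"
 using jtheta_le[of \<tau> r] jtheta_nonneg[of \<tau> r] by simp

lemma norm_integral_I01_le:
 fixes f :: "real => 'b::{banach,second_countable_topology}"
 assumes "\<And>x. norm (f x) \<le> Kb"
 shows "norm (\<integral>x. f x \<partial>I01) \<le> Kb"
proof (cases "integrable I01 f")
 case True
 interpret prob_space I01 by (rule prob_space_I01)
 have "norm (\<integral>x. f x \<partial>I01) \<le> (\<integral>x. norm (f x) \<partial>I01)" by (rule integral_norm_bound)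
 also have "\<dots> \<le> Kb" using True assms by (intro integral_le_const) auto
 finally show ?thesis .
next
 case False
 have "0 \<le> Kb" by (rule order_trans[OF norm_ge_zero assms[of 0]])
 thus ?thesis using False by (simp add: not_integrable_integral_eq)
qed

lemma gauss_split_zero:
 fixes h :: "int => 'b::banach"
 assumes "\<tau> > 0" "\<And>k. norm (if k = 0 then 0 else h k) \<le> Kb"
 shows "(\<Sum>\<^sub>\<infinity>k::int. exp (- pi * \<tau> * (of_int k)\<^sup>2) *\<^sub>R (if k = 0 then c else h k)) =
   c + (\<Sum>\<^sub>\<infinity>k::int. exp (- pi * \<tau> * (of_int k)\<^sup>2) *\<^sub>R (if k = 0 then 0 else h k))"
proof -
 let ?e = "\<lambda>k::int. exp (- pi * \<tau> * (of_int k)\<^sup>2)"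
 have eq: "(\<lambda>k. if k = 0 then 0 else ?e k *\<^sub>R (if k = 0 then c else h k)) = (\<lambda>k. ?e k *\<^sub>R (if k = 0 then 0 else h k))"
  by (rule ext) simp
 have "(\<lambda>k. if k = 0 then 0 else ?e k *\<^sub>R (if k = 0 then c else h k)) summable_on UNIV"
  unfolding eq by (rule gauss_weighted_summable[OF assms])
 from infsum_split_zero[OF this] show ?thesis unfolding eq by simp
qed

locale horocycle =
 fixes y1 y2 p1 p2 p4 p5 :: real
 assumes y: "y1 > 0" "y2 > 0"
begin

definition R2 :: "real => int => real" where
 "R2 x1 a = (x1 + p1) * of_int a"

definition R3 :: "real => real => real => int => int => real" where
 "R3 x1 x5 x4 a b = (x5 + p5) * of_int b + (p1 * p5 + p4 + x1 * p5 + x1 * x5 + x4) * of_int a"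

definition R4 :: "real => real => real => real => int => int => int => real" where
 "R4 x1 x5 x4 x2 a b d = - (x1 + p1) * of_int d + (x4 + p4 - x5 * p1) * of_int b
   + (p2 + x1 * p4 + x2 - (x1 * x5 + x4) * p1) * of_int a"

lemma tf: "triangular_form (y1\<^sup>2) (y2\<^sup>2) (1 / y2\<^sup>2) (1 / y1\<^sup>2) (R2 x1) (R3 x1 x5 x4) (R4 x1 x5 x4 x2)"
 by standard (use y in \<open>auto simp: R2_def R3_def R4_def\<close>)

definition Th :: "real => real => real => real => real => real" where
 "Th t x1 x5 x4 x2 = triangular_form.theta (y1\<^sup>2) (y2\<^sup>2) (1 / y2\<^sup>2) (1 / y1\<^sup>2) (R2 x1) (R3 x1 x5 x4) (R4 x1 x5 x4 x2) t"

context
 fixes t :: real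
 assumes t: "t > 0"
begin

definition \<tau>1 where "\<tau>1 = t * y1\<^sup>2"
definition \<tau>2 where "\<tau>2 = t * y2\<^sup>2"
definition \<tau>3 where "\<tau>3 = t * (1 / y2\<^sup>2)"
definition \<tau>4 where "\<tau>4 = t * (1 / y1\<^sup>2)"

lemma \<tau>_pos: "\<tau>1 > 0" "\<tau>2 > 0" "\<tau>3 > 0" "\<tau>4 > 0"
 using t y by (auto simp: \<tau>1_def \<tau>2_def \<tau>3_def \<tau>4_def)

definition T3 where
 "T3 x1 x5 x4 x2 a b = (\<Sum>\<^sub>\<infinity>d. exp (- pi * \<tau>3 * (of_int d + R3 x1 x5 x4 a b)\<^sup>2) *\<^sub>R jtheta \<tau>4 (R4 x1 x5 x4 x2 a b d))"

definition T2 where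
 "T2 x1 x5 x4 x2 a = (\<Sum>\<^sub>\<infinity>b. exp (- pi * \<tau>2 * (of_int b + R2 x1 a)\<^sup>2) *\<^sub>R T3 x1 x5 x4 x2 a b)"

lemma Th_eq: "Th t x1 x5 x4 x2 = (\<Sum>\<^sub>\<infinity>a. exp (- pi * \<tau>1 * (of_int a)\<^sup>2) *\<^sub>R T2 x1 x5 x4 x2 a)"
proof -
 interpret T: triangular_form "y1\<^sup>2" "y2\<^sup>2" "1 / y2\<^sup>2" "1 / y1\<^sup>2" "R2 x1" "R3 x1 x5 x4" "R4 x1 x5 x4 x2" by (rule tf)
 have 3: "T3 x1 x5 x4 x2 a b = T.theta3 t a b" for a b by (simp only: T3_def T.theta3_def \<tau>3_def \<tau>4_def real_scaleR_def)
 have 2: "T2 x1 x5 x4 x2 a = T.theta2 t a" for a by (simp only: T2_def T.theta2_def \<tau>2_def 3 real_scaleR_def)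
 show ?thesis unfolding Th_def T.theta_nested[OF t] 2 \<tau>1_def real_scaleR_def ..
qed

definition K3 where
 "K3 = (\<tau>3 powr (- 1/2) * \<tau>4 powr (- 1/2) * ((1 + jdelta (1 / \<tau>4)) * (1 + jdelta (1 / \<tau>3))))"

definition K2 where
 "K2 = \<tau>2 powr (- 1/2) * (\<tau>3 powr (- 1/2) * \<tau>4 powr (- 1/2)) *
    ((1 + jdelta (1 / \<tau>4)) * (1 + jdelta (1 / \<tau>3)) * (1 + jdelta (1 / \<tau>2)))"

lemma T_bounds: "norm (T3 x1 x5 x4 x2 a b) \<le> K3" "norm (T2 x1 x5 x4 x2 a) \<le> K2"
proof -
 interpret T: triangular_form "y1\<^sup>2" "y2\<^sup>2" "1 / y2\<^sup>2" "1 / y1\<^sup>2" "R2 x1" "R3 x1 x5 x4" "R4 x1 x5 x4 x2" by (rule tf)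
 have 3: "T3 x1 x5 x4 x2 a b = T.theta3 t a b" for a b by (simp only: T3_def T.theta3_def \<tau>3_def \<tau>4_def real_scaleR_def)
 have 2: "T2 x1 x5 x4 x2 a = T.theta2 t a" for a by (simp only: T2_def T.theta2_def \<tau>2_def 3 real_scaleR_def)
 show "norm (T3 x1 x5 x4 x2 a b) \<le> K3"
  unfolding 3 K3_def \<tau>3_def \<tau>4_def real_norm_def abs_of_nonneg[OF T.theta3_bounds(1)[OF t]] by (rule T.theta3_bounds(2)[OF t])
 show "norm (T2 x1 x5 x4 x2 a) \<le> K2"
  unfolding 2 K2_def \<tau>2_def \<tau>3_def \<tau>4_def real_norm_def abs_of_nonneg[OF T.theta2_bounds(1)[OF t]] by (rule T.theta2_bounds(2)[OF t])
qed

lemma jtheta_sum: "(\<Sum>\<^sub>\<infinity>n::int. exp (- pi * \<tau> * (of_int n + r)\<^sup>2) *\<^sub>R c) = c * jtheta \<tau> r"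
 unfolding jtheta_def real_scaleR_def by (subst infsum_cmult_left') simp

lemma R4_cont: "continuous_on UNIV (\<lambda>x. R4 x1 x5 x4 x a b d)" "continuous_on UNIV (\<lambda>x. R4 x1 x5 x x2 a b d)"
 "continuous_on UNIV (\<lambda>x. R3 x1 x5 x a b)"
 unfolding R4_def R3_def by (intro continuous_intros)+

lemma T3_int_x2:
 assumes "a \<noteq> 0"
 shows "(\<integral>x2. T3 x1 x5 x4 x2 a b \<partial>I01) = \<tau>4 powr (- 1/2) * jtheta \<tau>3 (R3 x1 x5 x4 a b)" (is ?g1)
  and "(\<lambda>x2. T3 x1 x5 x4 x2 a b) \<in> borel_measurable I01" (is ?g2)
proof -
 have aff: "(\<integral>x2. jtheta \<tau>4 (R4 x1 x5 x4 x2 a b d) \<partial>I01) = \<tau>4 powr (- 1/2)" for d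
 proof -
  define c where "c = R4 x1 x5 x4 0 a b d"
  have "R4 x1 x5 x4 x2 a b d = c + of_int a * x2" for x2 by (simp add: c_def R4_def algebra_simps)
  thus ?thesis by (simp only: jtheta_affine_integral[OF \<tau>_pos(4) assms])
 qed
 note w = weighted_swap[where g = "\<lambda>j::int. exp (- pi * \<tau>3 * (of_int j + R3 x1 x5 x4 a b)\<^sup>2)" and h = "\<lambda>d x2. jtheta \<tau>4 (R4 x1 x5 x4 x2 a b d)",
   OF jtheta_summable[OF \<tau>_pos(3)] exp_ge_zero jtheta_affine_measurable[OF \<tau>_pos(4) R4_cont(1)] jtheta_norm_le[OF \<tau>_pos(4)]]
 show ?g1
  unfolding T3_def by (rule trans[OF w(1)]) (simp only: aff jtheta_sum)
 have "integrable I01 (\<lambda>x2. T3 x1 x5 x4 x2 a b)" unfolding T3_def by (rule w(2))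
 thus ?g2 by (rule borel_measurable_integrable)
qed

definition S3 where
 "S3 x1 x5 x4 a = (\<Sum>\<^sub>\<infinity>b. exp (- pi * \<tau>2 * (of_int b + R2 x1 a)\<^sup>2) *\<^sub>R jtheta \<tau>3 (R3 x1 x5 x4 a b))"

lemma T2_int_x2:
 assumes "a \<noteq> 0"
 shows "(\<integral>x2. T2 x1 x5 x4 x2 a \<partial>I01) = \<tau>4 powr (- 1/2) * S3 x1 x5 x4 a" (is ?g1)
  and "(\<lambda>x2. T2 x1 x5 x4 x2 a) \<in> borel_measurable I01" (is ?g2)
proof -
 note w = weighted_swap[where g = "\<lambda>j::int. exp (- pi * \<tau>2 * (of_int j + R2 x1 a)\<^sup>2)" and h = "\<lambda>b x2. T3 x1 x5 x4 x2 a b",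
   OF jtheta_summable[OF \<tau>_pos(2)] exp_ge_zero T3_int_x2(2)[OF assms] T_bounds(1)]
 have "(\<integral>x2. T2 x1 x5 x4 x2 a \<partial>I01) = (\<Sum>\<^sub>\<infinity>b. exp (- pi * \<tau>2 * (of_int b + R2 x1 a)\<^sup>2) *\<^sub>R (\<tau>4 powr (- 1/2) * jtheta \<tau>3 (R3 x1 x5 x4 a b)))"
  unfolding T2_def by (rule trans[OF w(1)]) (simp only: T3_int_x2(1)[OF assms])
 also have "\<dots> = (\<Sum>\<^sub>\<infinity>b. \<tau>4 powr (- 1/2) * (exp (- pi * \<tau>2 * (of_int b + R2 x1 a)\<^sup>2) *\<^sub>R jtheta \<tau>3 (R3 x1 x5 x4 a b)))"
  by (simp only: real_scaleR_def mult.left_commute)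
 also have "\<dots> = \<tau>4 powr (- 1/2) * S3 x1 x5 x4 a"
  unfolding S3_def by (rule infsum_cmult_right')
 finally show ?g1 .
 have "integrable I01 (\<lambda>x2. T2 x1 x5 x4 x2 a)" unfolding T2_def by (rule w(2))
 thus ?g2 by (rule borel_measurable_integrable)
qed

lemma S3_int_x4:
 assumes "a \<noteq> 0"
 shows "(\<integral>x4. S3 x1 x5 x4 a \<partial>I01) = \<tau>3 powr (- 1/2) * jtheta \<tau>2 (R2 x1 a)" (is ?g1)
  and "(\<lambda>x4. S3 x1 x5 x4 a) \<in> borel_measurable I01" (is ?g2)
proof -
 have aff: "(\<integral>x4. jtheta \<tau>3 (R3 x1 x5 x4 a b) \<partial>I01) = \<tau>3 powr (- 1/2)" for b
 proof -
  define c where "c = R3 x1 x5 0 a b"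
  have "R3 x1 x5 x4 a b = c + of_int a * x4" for x4 by (simp add: c_def R3_def algebra_simps)
  thus ?thesis by (simp only: jtheta_affine_integral[OF \<tau>_pos(3) assms])
 qed
 note w = weighted_swap[where g = "\<lambda>j::int. exp (- pi * \<tau>2 * (of_int j + R2 x1 a)\<^sup>2)" and h = "\<lambda>b x4. jtheta \<tau>3 (R3 x1 x5 x4 a b)",
   OF jtheta_summable[OF \<tau>_pos(2)] exp_ge_zero jtheta_affine_measurable[OF \<tau>_pos(3) R4_cont(3)] jtheta_norm_le[OF \<tau>_pos(3)]]
 show ?g1
  unfolding S3_def by (rule trans[OF w(1)]) (simp only: aff jtheta_sum)
 have "integrable I01 (\<lambda>x4. S3 x1 x5 x4 a)" unfolding S3_def by (rule w(2))
 thus ?g2 by (rule borel_measurable_integrable)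
qed

lemma T3_int_x4:
 assumes "b \<noteq> 0"
 shows "(\<integral>x4. T3 x1 x5 x4 x2 0 b \<partial>I01) = \<tau>4 powr (- 1/2) * jtheta \<tau>3 ((x5 + p5) * of_int b)" (is ?g1)
  and "(\<lambda>x4. T3 x1 x5 x4 x2 0 b) \<in> borel_measurable I01" (is ?g2)
proof -
 have aff: "(\<integral>x4. jtheta \<tau>4 (R4 x1 x5 x4 x2 0 b d) \<partial>I01) = \<tau>4 powr (- 1/2)" for d
 proof -
  define c where "c = R4 x1 x5 0 x2 0 b d"
  have "R4 x1 x5 x4 x2 0 b d = c + of_int b * x4" for x4 by (simp add: c_def R4_def algebra_simps)
  thus ?thesis by (simp only: jtheta_affine_integral[OF \<tau>_pos(4) assms])
 qed
 have R3: "R3 x1 x5 x4 0 b = (x5 + p5) * of_int b" for x4 by (simp add: R3_def)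
 note w = weighted_swap[where g = "\<lambda>j::int. exp (- pi * \<tau>3 * (of_int j + (x5 + p5) * of_int b)\<^sup>2)" and h = "\<lambda>d x4. jtheta \<tau>4 (R4 x1 x5 x4 x2 0 b d)",
   OF jtheta_summable[OF \<tau>_pos(3)] exp_ge_zero jtheta_affine_measurable[OF \<tau>_pos(4) R4_cont(2)] jtheta_norm_le[OF \<tau>_pos(4)]]
 show ?g1
  unfolding T3_def R3 by (rule trans[OF w(1)]) (simp only: aff jtheta_sum)
 have "integrable I01 (\<lambda>x4. T3 x1 x5 x4 x2 0 b)" unfolding T3_def R3 by (rule w(2))
 thus ?g2 by (rule borel_measurable_integrable)
qed

definition L where
 "L x1 = (\<Sum>\<^sub>\<infinity>d::int. exp (- pi * \<tau>3 * (of_int d)\<^sup>2) *\<^sub>R jtheta \<tau>4 ((x1 + p1) * of_int (- d)))"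

lemma T3_00: "T3 x1 x5 x4 x2 0 0 = L x1" by (simp add: T3_def L_def R3_def R4_def algebra_simps)

definition Y where
 "Y x5 = (\<Sum>\<^sub>\<infinity>b::int. exp (- pi * \<tau>2 * (of_int b)\<^sup>2) *\<^sub>R
   (if b = 0 then 0 else \<tau>4 powr (- 1/2) * jtheta \<tau>3 ((x5 + p5) * of_int b)))"

definition X where
 "X x1 = L x1 + (\<Sum>\<^sub>\<infinity>a::int. exp (- pi * \<tau>1 * (of_int a)\<^sup>2) *\<^sub>R
   (if a = 0 then 0 else \<tau>4 powr (- 1/2) * (\<tau>3 powr (- 1/2) * jtheta \<tau>2 ((x1 + p1) * of_int a))))"

lemma T2_zero_int:
 "(\<integral>x4. (\<integral>x2. T2 x1 x5 x4 x2 0 \<partial>I01) \<partial>I01) = L x1 + Y x5"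
proof -
 interpret prob_space I01 by (rule prob_space_I01)
 have i2: "(\<integral>x2. T2 x1 x5 x4 x2 0 \<partial>I01) = T2 x1 x5 x4 0 0" for x4
 proof -
  define c where "c = T2 x1 x5 x4 0 0"
  have "T2 x1 x5 x4 x2 0 = c" for x2 by (simp add: c_def T2_def T3_def R4_def)
  thus ?thesis unfolding c_def[symmetric] using prob_space by simp
 qed
 have meas: "(\<lambda>x4. T3 x1 x5 x4 0 0 b) \<in> borel_measurable I01" for b
 proof (cases "b = 0")
  case True
  show ?thesis unfolding True T3_00 by (rule borel_measurable_const)
 qed (rule T3_int_x4(2))
 have i4: "(\<integral>x4. T3 x1 x5 x4 0 0 b \<partial>I01) = (if b = 0 then L x1 else \<tau>4 powr (- 1/2) * jtheta \<tau>3 ((x5 + p5) * of_int b))" for b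
  using T3_int_x4(1)[of b x1 x5 0] prob_space by (cases "b = 0") (simp_all add: T3_00)
 have "(\<integral>x4. T2 x1 x5 x4 0 0 \<partial>I01) = (\<Sum>\<^sub>\<infinity>b. exp (- pi * \<tau>2 * (of_int b)\<^sup>2) *\<^sub>R
   (if b = 0 then L x1 else \<tau>4 powr (- 1/2) * jtheta \<tau>3 ((x5 + p5) * of_int b)))"
  using weighted_swap(1)[OF jtheta_summable[OF \<tau>_pos(2), of 0] _ meas T_bounds(1)] by (simp add: T2_def R2_def i4)
 also have "\<dots> = L x1 + Y x5"
 proof -
  have "norm (if b = 0 then 0 else \<tau>4 powr (- 1/2) * jtheta \<tau>3 ((x5 + p5) * of_int b)) \<le>
    \<tau>4 powr (- 1/2) * (\<tau>3 powr (- 1/2) * (1 + jdelta (1 / \<tau>3)))" for b :: int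
   using jtheta_norm_le[OF \<tau>_pos(3)] jdelta_nonneg[of "1/\<tau>3"] \<tau>_pos by (auto simp: abs_mult intro!: mult_left_mono)
  from gauss_split_zero[where h = "\<lambda>b. \<tau>4 powr (- 1/2) * jtheta \<tau>3 ((x5 + p5) * of_int b)" and c = "L x1", OF \<tau>_pos(2) this] show ?thesis by (simp only: Y_def)
 qed
 finally show ?thesis unfolding i2 .
qed

lemma T2_int:
 "(\<integral>x4. (\<integral>x2. T2 x1 x5 x4 x2 a \<partial>I01) \<partial>I01) =
   (if a = 0 then L x1 + Y x5 else \<tau>4 powr (- 1/2) * (\<tau>3 powr (- 1/2) * jtheta \<tau>2 ((x1 + p1) * of_int a)))"
proof (cases "a = 0")
 case True
 thus ?thesis by (simp add: T2_zero_int)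
next
 case False
 thus ?thesis by (simp add: T2_int_x2(1) S3_int_x4(1) R2_def del: of_int_mult)
qed

lemma Th_int_x4_x2: "(\<integral>x4. (\<integral>x2. Th t x1 x5 x4 x2 \<partial>I01) \<partial>I01) = X x1 + Y x5"
proof -
 let ?e = "\<lambda>a::int. exp (- pi * \<tau>1 * (of_int a)\<^sup>2)"
 have e: "?e summable_on UNIV" using jtheta_summable[OF \<tau>_pos(1), of 0] by simp
 have m2: "(\<lambda>x2. T2 x1 x5 x4 x2 a) \<in> borel_measurable I01" for x4 a
 proof (cases "a = 0")
  case True
  have "T2 x1 x5 x4 x2 0 = T2 x1 x5 x4 0 0" for x2 by (simp add: T2_def T3_def R4_def)
  hence "(\<lambda>x2. T2 x1 x5 x4 x2 0) = (\<lambda>_. T2 x1 x5 x4 0 0)" by blast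
  thus ?thesis using True by (simp only: borel_measurable_const)
 qed (rule T2_int_x2(2))
 have 1: "(\<integral>x2. Th t x1 x5 x4 x2 \<partial>I01) = (\<Sum>\<^sub>\<infinity>a. ?e a *\<^sub>R (\<integral>x2. T2 x1 x5 x4 x2 a \<partial>I01))" for x4
  unfolding Th_eq by (rule weighted_swap(1)[OF e _ m2 T_bounds(2)]) simp
 have m4: "(\<lambda>x4. \<integral>x2. T2 x1 x5 x4 x2 a \<partial>I01) \<in> borel_measurable I01" for a
 proof (cases "a = 0")
  case True
  have "(\<lambda>x4. \<integral>x2. T2 x1 x5 x4 x2 0 \<partial>I01) = (\<lambda>x4. T2 x1 x5 x4 0 0)"
  proof
   fix x4
   interpret prob_space I01 by (rule prob_space_I01)
   define c where "c = T2 x1 x5 x4 0 0"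
   have "T2 x1 x5 x4 x2 0 = c" for x2 by (simp add: c_def T2_def T3_def R4_def)
   thus "(\<integral>x2. T2 x1 x5 x4 x2 0 \<partial>I01) = T2 x1 x5 x4 0 0" unfolding c_def[symmetric] using prob_space by simp
  qed
  moreover have "(\<lambda>x4. T2 x1 x5 x4 0 0) \<in> borel_measurable I01"
  proof -
   have meas: "(\<lambda>x4. T3 x1 x5 x4 0 0 b) \<in> borel_measurable I01" for b
   proof (cases "b = 0")
    case True
    show ?thesis unfolding True T3_00 by (rule borel_measurable_const)
   qed (rule T3_int_x4(2))
   have "integrable I01 (\<lambda>x4. T2 x1 x5 x4 0 0)"
    unfolding T2_def by (rule weighted_swap(2)[OF jtheta_summable[OF \<tau>_pos(2)] _ meas T_bounds(1)]) simp
   thus ?thesis by (rule borel_measurable_integrable)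
  qed
  ultimately show ?thesis using True by (simp only:)
 next
  case False
  show ?thesis unfolding T2_int_x2(1)[OF False] by (rule borel_measurable_times[OF borel_measurable_const S3_int_x4(2)[OF False]])
 qed
 have "(\<integral>x4. (\<integral>x2. Th t x1 x5 x4 x2 \<partial>I01) \<partial>I01) = (\<Sum>\<^sub>\<infinity>a. ?e a *\<^sub>R (\<integral>x4. (\<integral>x2. T2 x1 x5 x4 x2 a \<partial>I01) \<partial>I01))"
  unfolding 1 by (rule weighted_swap(1)[OF e _ m4 norm_integral_I01_le[OF T_bounds(2)]]) simp
 also have "\<dots> = X x1 + Y x5"
 proof -
  have "norm (if a = 0 then 0 else \<tau>4 powr (- 1/2) * (\<tau>3 powr (- 1/2) * jtheta \<tau>2 ((x1 + p1) * of_int a))) \<le>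
    \<tau>4 powr (- 1/2) * (\<tau>3 powr (- 1/2) * (\<tau>2 powr (- 1/2) * (1 + jdelta (1 / \<tau>2))))" for a :: int
   using jtheta_norm_le[OF \<tau>_pos(2)] jdelta_nonneg[of "1/\<tau>2"] \<tau>_pos by (auto simp: abs_mult intro!: mult_left_mono)
  from gauss_split_zero[where h = "\<lambda>a. \<tau>4 powr (- 1/2) * (\<tau>3 powr (- 1/2) * jtheta \<tau>2 ((x1 + p1) * of_int a))" and c = "L x1 + Y x5", OF \<tau>_pos(1) this] show ?thesis unfolding T2_int by (simp add: X_def)
 qed
 finally show ?thesis .
qed

end

end

definition gauss_jtheta :: "real => real => real => real => real" where
 "gauss_jtheta \<tau> \<tau>' p x = (\<Sum>\<^sub>\<infinity>d::int. exp (- pi * \<tau> * (of_int d)\<^sup>2) *\<^sub>R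
   (if d = 0 then 0 else jtheta \<tau>' ((x + p) * of_int d)))"

lemma gauss_jtheta_facts:
 assumes \<tau>: "\<tau> > 0" "\<tau>' > 0"
 shows "integrable I01 (\<lambda>x. of_real (gauss_jtheta \<tau> \<tau>' p x) * cis (- 2 * pi * of_int m * x))" (is ?g1)
  and "(\<integral>x. of_real (gauss_jtheta \<tau> \<tau>' p x) * cis (- 2 * pi * of_int m * x) \<partial>I01) =
    of_real (\<tau>' powr (- 1/2) * divsum \<tau> \<tau>' m) * cis (2 * pi * of_int m * p)" (is ?g2)
proof -
 define Kb where "Kb = \<tau>' powr (- 1/2) * (1 + jdelta (1 / \<tau>'))"
 have Kb0: "Kb \<ge> 0" using jdelta_nonneg[of "1/\<tau>'"] \<tau> by (simp add: Kb_def)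
 let ?e = "\<lambda>d::int. exp (- pi * \<tau> * (of_int d)\<^sup>2)"
 let ?j = "\<lambda>d x. (if d = 0 then 0 else jtheta \<tau>' ((x + p) * of_int d))"
 define h where "h = (\<lambda>(d::int) x. of_real (?j d x) * cis (- 2 * pi * of_int m * x))"
 have nj: "norm (?j d x) \<le> Kb" for d x
  using jtheta_norm_le[OF \<tau>(2)] Kb0 by (simp add: Kb_def)
 have e: "?e summable_on UNIV" using jtheta_summable[OF \<tau>(1), of 0] by simp
 have eq: "of_real (gauss_jtheta \<tau> \<tau>' p x) * cis (- 2 * pi * of_int m * x) = (\<Sum>\<^sub>\<infinity>d. ?e d *\<^sub>R h d x)" for x
 proof -
  have "complex_of_real (gauss_jtheta \<tau> \<tau>' p x) = (\<Sum>\<^sub>\<infinity>d. of_real (?e d *\<^sub>R ?j d x))"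
   unfolding gauss_jtheta_def by (rule infsum_of_real[OF gauss_weighted_summable[OF \<tau>(1) nj], symmetric])
  hence "of_real (gauss_jtheta \<tau> \<tau>' p x) * cis (- 2 * pi * of_int m * x)
    = (\<Sum>\<^sub>\<infinity>d. of_real (?e d *\<^sub>R ?j d x) * cis (- 2 * pi * of_int m * x))" by (simp only: infsum_cmult_left')
  also have "\<dots> = (\<Sum>\<^sub>\<infinity>d. ?e d *\<^sub>R h d x)"
   by (rule infsum_cong) (simp only: h_def real_scaleR_def scaleR_conv_of_real of_real_mult mult.assoc)
  finally show ?thesis .
 qed
 have meas: "h d \<in> borel_measurable I01" for d
 proof (cases "d = 0")
  case True
  have "h d = (\<lambda>x. 0)" by (rule ext) (simp add: h_def True)
  thus ?thesis by (simp only: borel_measurable_const)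
 next
  case False
  have "h d = (\<lambda>x. of_real (jtheta \<tau>' ((x + p) * of_int d)) * cis (- 2 * pi * of_int m * x))" by (rule ext) (simp add: h_def False)
  moreover have "continuous_on UNIV (\<lambda>x. (x + p) * of_int d)" by (intro continuous_intros)
  ultimately show ?thesis by (simp only:) (intro I01_measurable borel_measurable_continuous_onI continuous_intros
     continuous_on_compose2[OF jtheta_continuous[OF \<tau>(2)]], auto)
 qed
 have nh: "norm (h d x) \<le> Kb" for d x
  using nj[of d x] unfolding h_def norm_mult by (simp only: norm_of_real norm_cis mult_1_right real_norm_def)
 note w = weighted_swap[OF e exp_ge_zero meas nh]
 show ?g1
  unfolding eq by (rule w(2))
 define C where "C = of_real (\<tau>' powr (- 1/2)) * cis (2 * pi * of_int m * p)"
 let ?D = "\<lambda>d::int. (if d \<noteq> 0 \<and> d dvd m then exp (- pi * \<tau> * (of_int d)\<^sup>2) * exp (- pi * (of_int (m div d))\<^sup>2 / \<tau>') else 0)"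
 have Ds: "?D summable_on UNIV"
 proof (rule summable_on_comparison_test[OF e])
  show "?D d \<le> ?e d" for d using \<tau> by (auto intro!: mult_left_le)
 qed auto
 have ih: "(\<integral>x. h d x \<partial>I01) = (if d \<noteq> 0 \<and> d dvd m then of_real (exp (- pi * (of_int (m div d))\<^sup>2 / \<tau>')) * C else 0)" for d
 proof (cases "d = 0")
  case False
  thus ?thesis using jtheta_shift_fourier[OF \<tau>(2) False, of p m] by (simp add: h_def C_def mult_ac)
 qed (simp add: h_def)
 have "(\<integral>x. of_real (gauss_jtheta \<tau> \<tau>' p x) * cis (- 2 * pi * of_int m * x) \<partial>I01) = (\<Sum>\<^sub>\<infinity>d. ?e d *\<^sub>R (\<integral>x. h d x \<partial>I01))"
  unfolding eq by (rule w(1))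
 also have "\<dots> = (\<Sum>\<^sub>\<infinity>d. of_real (?D d) * C)" by (rule infsum_cong) (simp add: ih scaleR_conv_of_real)
 also have "\<dots> = of_real (divsum \<tau> \<tau>' m) * C"
  unfolding divsum_def infsum_of_real[OF Ds, symmetric] by (rule infsum_cmult_left')
 finally show ?g2 by (simp add: C_def mult_ac)
qed

lemma integral_cis_I01_neg: "(\<integral>x. cis (- 2 * pi * of_int m * x) \<partial>I01) = (if m = 0 then 1 else 0)"
 using integral_cis_I01[of "- m"] by simp

lemma integrable_cis_I01: "integrable I01 (\<lambda>x. cis (- 2 * pi * of_int m * x))" by (intro continuous_integrable_I01 continuous_intros)

context horocycle
begin

context
 fixes t :: real
 assumes t: "t > 0"
begin

abbreviation "\<tau>a \<equiv> \<tau>1 t"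
abbreviation "\<tau>b \<equiv> \<tau>2 t"
abbreviation "\<tau>c \<equiv> \<tau>3 t"
abbreviation "\<tau>d \<equiv> \<tau>4 t"

lemma L_eq: "L t x = jtheta \<tau>d 0 + gauss_jtheta \<tau>c \<tau>d p1 x"
proof -
 note p = \<tau>_pos[OF t]
 let ?f = "\<lambda>d::int. exp (- pi * \<tau>c * (of_int d)\<^sup>2) *\<^sub>R jtheta \<tau>d ((x + p1) * of_int d)"
 have 1: "L t x = (\<Sum>\<^sub>\<infinity>d. ?f d)"
 proof -
  have "(\<Sum>\<^sub>\<infinity>d. ?f (- d)) = (\<Sum>\<^sub>\<infinity>d. ?f d)"
   by (rule infsum_reindex_bij_betw) (auto simp: bij_def inj_def surj_def intro: exI[of _ "- _"])
  thus ?thesis unfolding L_def[OF t] by (simp only: of_int_minus power2_minus)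
 qed
 have "norm (if d = 0 then 0 else jtheta \<tau>d ((x + p1) * of_int d)) \<le> \<tau>d powr (- 1/2) * (1 + jdelta (1 / \<tau>d))" for d :: int
  using jtheta_norm_le[OF p(4)] jdelta_nonneg[of "1/\<tau>d"] p by simp
 note sp = gauss_split_zero[where h = "\<lambda>d. jtheta \<tau>d ((x + p1) * of_int d)" and c = "jtheta \<tau>d 0", OF p(3) this]
 have "?f d = exp (- pi * \<tau>c * (of_int d)\<^sup>2) *\<^sub>R (if d = 0 then jtheta \<tau>d 0 else jtheta \<tau>d ((x + p1) * of_int d))" for d
  by simp
 thus ?thesis unfolding 1 gauss_jtheta_def using sp by (simp only:)
qed

lemma scaled_gauss_jtheta:
 "(\<Sum>\<^sub>\<infinity>b::int. exp (- pi * \<tau> * (of_int b)\<^sup>2) *\<^sub>R (if b = 0 then 0 else c * jtheta \<tau>' ((x + p) * of_int b)))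
   = c * gauss_jtheta \<tau> \<tau>' p x"
 unfolding gauss_jtheta_def infsum_cmult_right'[symmetric] by (rule infsum_cong) simp

lemma Y_eq: "Y t x = \<tau>d powr (- 1/2) * gauss_jtheta \<tau>b \<tau>c p5 x"
 unfolding Y_def[OF t] by (rule scaled_gauss_jtheta)

lemma X_eq: "X t x = jtheta \<tau>d 0 + gauss_jtheta \<tau>c \<tau>d p1 x + \<tau>d powr (- 1/2) * \<tau>c powr (- 1/2) * gauss_jtheta \<tau>a \<tau>b p1 x"
 unfolding X_def[OF t] L_eq mult.assoc[symmetric] scaled_gauss_jtheta ..

definition hat :: "int => int => complex" where
 "hat m1 m2 =
  (if m2 = 0 then (if m1 = 0 then of_real (jtheta \<tau>d 0) else 0)
    + of_real (\<tau>d powr (- 1/2) * divsum \<tau>c \<tau>d m1) * cis (2 * pi * of_int m1 * p1)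
    + of_real (\<tau>d powr (- 1/2) * \<tau>c powr (- 1/2) * \<tau>b powr (- 1/2) * divsum \<tau>a \<tau>b m1) * cis (2 * pi * of_int m1 * p1) else 0)
  + (if m1 = 0 then of_real (\<tau>d powr (- 1/2) * \<tau>c powr (- 1/2) * divsum \<tau>b \<tau>c m2) * cis (2 * pi * of_int m2 * p5) else 0)"

lemma X_fourier:
 "integrable I01 (\<lambda>x. of_real (X t x) * cis (- 2 * pi * of_int m * x))"
 "(\<integral>x. of_real (X t x) * cis (- 2 * pi * of_int m * x) \<partial>I01) = (if m = 0 then of_real (jtheta \<tau>d 0) else 0)
    + of_real (\<tau>d powr (- 1/2) * divsum \<tau>c \<tau>d m) * cis (2 * pi * of_int m * p1)
    + of_real (\<tau>d powr (- 1/2) * \<tau>c powr (- 1/2) * \<tau>b powr (- 1/2) * divsum \<tau>a \<tau>b m) * cis (2 * pi * of_int m * p1)"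
proof -
 note p = \<tau>_pos[OF t]
 let ?c = "\<lambda>x. cis (- 2 * pi * of_int m * x)"
 have eq: "of_real (X t x) * ?c x = of_real (jtheta \<tau>d 0) * ?c x + of_real (gauss_jtheta \<tau>c \<tau>d p1 x) * ?c x
   + of_real (\<tau>d powr (- 1/2) * \<tau>c powr (- 1/2)) * (of_real (gauss_jtheta \<tau>a \<tau>b p1 x) * ?c x)" for x
  unfolding X_eq by (simp only: of_real_add of_real_mult distrib_right mult.assoc)
 have i1: "integrable I01 (\<lambda>x. of_real (jtheta \<tau>d 0) * ?c x)" by (rule integrable_mult_right[OF integrable_cis_I01])
 have i2: "integrable I01 (\<lambda>x. of_real (gauss_jtheta \<tau>c \<tau>d p1 x) * ?c x)" by (rule gauss_jtheta_facts(1)[OF p(3,4)])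
 have i3: "integrable I01 (\<lambda>x. of_real (\<tau>d powr (- 1/2) * \<tau>c powr (- 1/2)) * (of_real (gauss_jtheta \<tau>a \<tau>b p1 x) * ?c x))"
  by (rule integrable_mult_right[OF gauss_jtheta_facts(1)[OF p(1,2)]])
 show "integrable I01 (\<lambda>x. of_real (X t x) * ?c x)"
  unfolding eq by (rule Bochner_Integration.integrable_add[OF Bochner_Integration.integrable_add[OF i1 i2] i3])
 show "(\<integral>x. of_real (X t x) * ?c x \<partial>I01) = (if m = 0 then of_real (jtheta \<tau>d 0) else 0)
    + of_real (\<tau>d powr (- 1/2) * divsum \<tau>c \<tau>d m) * cis (2 * pi * of_int m * p1)
    + of_real (\<tau>d powr (- 1/2) * \<tau>c powr (- 1/2) * \<tau>b powr (- 1/2) * divsum \<tau>a \<tau>b m) * cis (2 * pi * of_int m * p1)"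
  unfolding eq Bochner_Integration.integral_add[OF Bochner_Integration.integrable_add[OF i1 i2] i3]
   Bochner_Integration.integral_add[OF i1 i2] integral_mult_right_zero
   gauss_jtheta_facts(2)[OF p(3,4)] gauss_jtheta_facts(2)[OF p(1,2)] integral_cis_I01_neg by (simp add: mult_ac)
qed

lemma Y_fourier:
 "integrable I01 (\<lambda>x. of_real (Y t x) * cis (- 2 * pi * of_int m * x))"
 "(\<integral>x. of_real (Y t x) * cis (- 2 * pi * of_int m * x) \<partial>I01) =
   of_real (\<tau>d powr (- 1/2) * \<tau>c powr (- 1/2) * divsum \<tau>b \<tau>c m) * cis (2 * pi * of_int m * p5)"
proof -
 note p = \<tau>_pos[OF t]
 let ?c = "\<lambda>x. cis (- 2 * pi * of_int m * x)"
 have eq: "of_real (Y t x) * ?c x = of_real (\<tau>d powr (- 1/2)) * (of_real (gauss_jtheta \<tau>b \<tau>c p5 x) * ?c x)" for x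
  unfolding Y_eq by (simp only: of_real_mult mult.assoc)
 show "integrable I01 (\<lambda>x. of_real (Y t x) * ?c x)"
  unfolding eq by (rule integrable_mult_right[OF gauss_jtheta_facts(1)[OF p(2,3)]])
 show "(\<integral>x. of_real (Y t x) * ?c x \<partial>I01) =
   of_real (\<tau>d powr (- 1/2) * \<tau>c powr (- 1/2) * divsum \<tau>b \<tau>c m) * cis (2 * pi * of_int m * p5)"
  unfolding eq integral_mult_right_zero gauss_jtheta_facts(2)[OF p(2,3)] by (simp add: mult_ac)
qed

theorem theta_hat:
 "(\<integral>x1. (\<integral>x5. (\<integral>x4. (\<integral>x2. of_real (Th t x1 x5 x4 x2) * cis (- 2 * pi * (of_int m1 * x1 + of_int m2 * x5)) \<partial>I01) \<partial>I01) \<partial>I01) \<partial>I01)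
  = hat m1 m2"
proof -
 let ?c1 = "\<lambda>x. cis (- 2 * pi * of_int m1 * x)"
 let ?c2 = "\<lambda>x. cis (- 2 * pi * of_int m2 * x)"
 have c: "cis (- 2 * pi * (of_int m1 * x1 + of_int m2 * x5)) = ?c1 x1 * ?c2 x5" for x1 x5 by (simp add: cis_mult algebra_simps)
 have 1: "(\<integral>x4. (\<integral>x2. of_real (Th t x1 x5 x4 x2) * (?c1 x1 * ?c2 x5) \<partial>I01) \<partial>I01) =
   ?c1 x1 * (of_real (X t x1) * ?c2 x5) + ?c1 x1 * (of_real (Y t x5) * ?c2 x5)" for x1 x5
 proof -
  have "(\<integral>x4. (\<integral>x2. of_real (Th t x1 x5 x4 x2) * (?c1 x1 * ?c2 x5) \<partial>I01) \<partial>I01) =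
   of_real (\<integral>x4. (\<integral>x2. Th t x1 x5 x4 x2 \<partial>I01) \<partial>I01) * (?c1 x1 * ?c2 x5)"
   by (simp only: integral_mult_left_zero integral_complex_of_real)
  also have "\<dots> = of_real (X t x1 + Y t x5) * (?c1 x1 * ?c2 x5)" by (simp only: Th_int_x4_x2[OF t])
  finally show ?thesis by (simp add: algebra_simps)
 qed
 have 2: "(\<integral>x5. ?c1 x1 * (of_real (X t x1) * ?c2 x5) + ?c1 x1 * (of_real (Y t x5) * ?c2 x5) \<partial>I01) =
   (of_real (X t x1) * ?c1 x1) * (if m2 = 0 then 1 else 0) +
   ?c1 x1 * (\<integral>x5. of_real (Y t x5) * ?c2 x5 \<partial>I01)" for x1
 proof -
  have i1: "integrable I01 (\<lambda>x5. ?c1 x1 * (of_real (X t x1) * ?c2 x5))" by (intro integrable_mult_right integrable_cis_I01)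
  have i2: "integrable I01 (\<lambda>x5. ?c1 x1 * (of_real (Y t x5) * ?c2 x5))" by (intro integrable_mult_right Y_fourier(1))
  show ?thesis unfolding Bochner_Integration.integral_add[OF i1 i2] integral_mult_right_zero integral_cis_I01_neg by (simp add: mult_ac)
 qed
 define W where "W = (\<integral>x5. of_real (Y t x5) * ?c2 x5 \<partial>I01)"
 have i1: "integrable I01 (\<lambda>x1. (of_real (X t x1) * ?c1 x1) * (if m2 = 0 then 1 else 0))" by (intro integrable_mult_left X_fourier(1))
 have i2: "integrable I01 (\<lambda>x1. ?c1 x1 * W)" by (intro integrable_mult_left integrable_cis_I01)
 show ?thesis
  unfolding c
  unfolding 1
  unfolding 2
  unfolding W_def[symmetric] Bochner_Integration.integral_add[OF i1 i2] integral_mult_left_zero integral_cis_I01_neg X_fourier(2)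
  unfolding W_def Y_fourier(2) hat_def by simp
qed

end

end

lemma cube_integrable:
 fixes f :: "(nat => real) => complex"
 assumes f: "f \<in> borel_measurable (PiM U_coords (\<lambda>_. lborel))"
  and B: "\<forall>n\<in>PiE U_coords (\<lambda>_. {0..1}). norm (f n) \<le> B"
 shows "set_integrable (PiM U_coords (\<lambda>_. lborel)) (PiE U_coords (\<lambda>_. {0..1})) f"
proof -
 interpret P: product_sigma_finite "\<lambda>_::nat. lborel :: real measure" ..
 let ?C = "PiE U_coords (\<lambda>_. {0..1::real})"
 have U: "finite U_coords" by (simp add: U_coords_def)
 have box: "?C \<in> sets (PiM U_coords (\<lambda>_. lborel))"
  using U by (intro sets_PiM_I_finite) auto
 have fin: "emeasure (PiM U_coords (\<lambda>_. lborel)) ?C < \<infinity>"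
  using U by (subst P.emeasure_PiM) auto
 have m: "(\<lambda>n. indicator ?C n *\<^sub>R f n) \<in> borel_measurable (PiM U_coords (\<lambda>_. lborel))"
  by (rule borel_measurable_scaleR[OF borel_measurable_indicator[OF box] f])
 have "integrable (PiM U_coords (\<lambda>_. lborel)) (\<lambda>n. indicator ?C n *\<^sub>R B)"
  using fin by (intro integrable_scaleR_left integrable_real_indicator box) auto
 hence "integrable (PiM U_coords (\<lambda>_. lborel)) (\<lambda>n. indicator ?C n *\<^sub>R f n)"
  by (rule Bochner_Integration.integrable_bound[OF _ m]) (use B in \<open>auto simp: indicator_def intro!: AE_I2 order_trans[OF _ abs_ge_self]\<close>)
 thus ?thesis by (simp add: set_integrable_def)
qed

definition uchar :: "int => int => (nat => real) => complex" where
 "uchar m1 m2 n = cis (- 2 * pi * (of_int m1 * n 1 + of_int m2 * n 5))"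

lemma coord_measurable:
 assumes "i \<in> U_coords"
 shows "(\<lambda>n. n i) \<in> borel_measurable (PiM U_coords (\<lambda>_. lborel :: real measure))"
 using measurable_component_singleton[OF assms, of "\<lambda>_. lborel :: real measure"] unfolding measurable_lborel1 .

lemma uchar_measurable: "uchar m1 m2 \<in> borel_measurable (PiM U_coords (\<lambda>_. lborel))"
proof -
 have "(\<lambda>n. of_int m1 * n 1 + of_int m2 * n 5) \<in> borel_measurable (PiM U_coords (\<lambda>_. lborel :: real measure))"
  by (intro borel_measurable_add borel_measurable_times borel_measurable_const coord_measurable) (auto simp: U_coords_def)
 moreover have "(\<lambda>x. cis (- 2 * pi * x)) \<in> borel_measurable borel" by (intro borel_measurable_continuous_onI continuous_intros)
 ultimately have "(\<lambda>n. cis (- 2 * pi * (of_int m1 * n 1 + of_int m2 * n 5))) \<in> borel_measurable (PiM U_coords (\<lambda>_. lborel :: real measure))"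
  by (rule measurable_compose)
 thus ?thesis by (simp only: uchar_def[abs_def])
qed

lemma uchar_integral:
 "(LINT n:PiE U_coords (\<lambda>_. {0..1})|PiM U_coords (\<lambda>_. lborel). uchar m1 m2 n) = (if m1 = 0 \<and> m2 = 0 then 1 else 0)"
proof -
 interpret prob_space I01 by (rule prob_space_I01)
 have 1: "\<forall>n\<in>PiE U_coords (\<lambda>_. {0..1}). norm (uchar m1 m2 n) \<le> 1" by (simp add: uchar_def)
 have c: "uchar m1 m2 (ucoords x1 x5 x4 x2) = cis (- 2 * pi * of_int m1 * x1) * cis (- 2 * pi * of_int m2 * x5)" for x1 x5 x4 x2
  by (simp add: uchar_def ucoords_def cis_mult algebra_simps)
 show ?thesis unfolding cube_iterated[OF uchar_measurable 1] unfolding c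
  using prob_space integral_cis_I01_neg[of m1] integral_cis_I01_neg[of m2] by simp
qed

context horocycle
begin

abbreviation cube_measure where "cube_measure \<equiv> PiM U_coords (\<lambda>_::nat. lborel :: real measure)"
abbreviation cube where "cube \<equiv> PiE U_coords (\<lambda>_::nat. {0..1::real})"

definition cut :: "real => real" where "cut t = (if t \<le> 1 then 1 * t powr (- 2) else 1)"

definition phiN :: "(nat => real) => real => complex" where
 "phiN n = triangular_form.phi (y1\<^sup>2) (y2\<^sup>2) (1 / y2\<^sup>2) (1 / y1\<^sup>2) (R2 (n 1)) (R3 (n 1) (n 5) (n 4)) (R4 (n 1) (n 5) (n 4) (n 2))"

definition epsteinN :: "(nat => real) => complex => complex" where
 "epsteinN n = triangular_form.epstein (y1\<^sup>2) (y2\<^sup>2) (1 / y2\<^sup>2) (1 / y1\<^sup>2) (R2 (n 1)) (R3 (n 1) (n 5) (n 4)) (R4 (n 1) (n 5) (n 4) (n 2))"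

lemma V_eq_1: "(y1\<^sup>2 * y2\<^sup>2 * (1 / y2\<^sup>2) * (1 / y1\<^sup>2)) powr (- 1/2) = 1"
 using y by simp

lemma phiN_eq: "phiN n t = of_real (Th t (n 1) (n 5) (n 4) (n 2) - cut t)"
proof -
 interpret T: triangular_form "y1\<^sup>2" "y2\<^sup>2" "1 / y2\<^sup>2" "1 / y1\<^sup>2" "R2 (n 1)" "R3 (n 1) (n 5) (n 4)" "R4 (n 1) (n 5) (n 4) (n 2)" by (rule tf)
 show ?thesis unfolding phiN_def T.phi_def T.V_def V_eq_1 Th_def cut_def ..
qed

lemma epsteinN_eq: "epsteinN n z = (mellin (phiN n) z + 1 / (z - 2)) * rGamma z - rGamma (z + 1)"
proof -
 interpret T: triangular_form "y1\<^sup>2" "y2\<^sup>2" "1 / y2\<^sup>2" "1 / y1\<^sup>2" "R2 (n 1)" "R3 (n 1) (n 5) (n 4)" "R4 (n 1) (n 5) (n 4) (n 2)" by (rule tf)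
 show ?thesis unfolding epsteinN_def T.epstein_def T.V_def V_eq_1 phiN_def by simp
qed

lemma phiN_rapid: "\<exists>D. \<forall>n. rapid_bound D (phiN n)"
proof -
 have "y1\<^sup>2 > 0" "y2\<^sup>2 > 0" "1 / y2\<^sup>2 > 0" "1 / y1\<^sup>2 > 0" using y by auto
 then obtain D where D: "\<And>\<phi>. \<phi> \<in> borel_measurable Rpos ==>
   (\<And>t. t > 0 ==> norm (\<phi> t) \<le> theta_envelope (y1\<^sup>2) (y2\<^sup>2) (1 / y2\<^sup>2) (1 / y1\<^sup>2) t) ==> rapid_bound D \<phi>"
  using env_rapid_imp_rapid_bound[OF theta_envelope_rapid] by metis
 have "rapid_bound D (phiN n)" for n
 proof -
  interpret T: triangular_form "y1\<^sup>2" "y2\<^sup>2" "1 / y2\<^sup>2" "1 / y1\<^sup>2" "R2 (n 1)" "R3 (n 1) (n 5) (n 4)" "R4 (n 1) (n 5) (n 4) (n 2)" by (rule tf)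
  show ?thesis unfolding phiN_def by (rule D[OF T.phi_measurable T.phi_bound])
 qed
 thus ?thesis by blast
qed

lemma Th_bounded: "t > 0 ==> \<exists>B. \<forall>x1 x5 x4 x2. \<bar>Th t x1 x5 x4 x2\<bar> \<le> B"
proof -
 assume t: "t > 0"
 have "\<bar>Th t x1 x5 x4 x2\<bar> \<le> theta_envelope (y1\<^sup>2) (y2\<^sup>2) (1 / y2\<^sup>2) (1 / y1\<^sup>2) t + \<bar>cut t\<bar>" for x1 x5 x4 x2
 proof -
  interpret T: triangular_form "y1\<^sup>2" "y2\<^sup>2" "1 / y2\<^sup>2" "1 / y1\<^sup>2" "R2 x1" "R3 x1 x5 x4" "R4 x1 x5 x4 x2" by (rule tf)
  have "\<bar>Th t x1 x5 x4 x2 - cut t\<bar> \<le> theta_envelope (y1\<^sup>2) (y2\<^sup>2) (1 / y2\<^sup>2) (1 / y1\<^sup>2) t"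
   using T.theta_envelope[OF t] unfolding V_eq_1 Th_def cut_def .
  thus ?thesis by linarith
 qed
 thus ?thesis by blast
qed

lemma Th_joint_measurable:
 "(\<lambda>p. Th (snd p) (fst p 1) (fst p 5) (fst p 4) (fst p 2)) \<in> borel_measurable (cube_measure \<Otimes>\<^sub>M Rpos)"
proof -
 let ?P = "cube_measure \<Otimes>\<^sub>M Rpos"
 have c: "(\<lambda>p. fst p i) \<in> borel_measurable ?P" if "i \<in> U_coords" for i
  by (rule measurable_compose[OF measurable_fst coord_measurable[OF that]])
 have s: "(\<lambda>p. snd p) \<in> borel_measurable ?P"
 proof -
  have "(\<lambda>x. x) \<in> borel_measurable Rpos" by (rule Rpos_measurable_continuous) (intro continuous_intros)
  from measurable_compose[OF measurable_snd this] show ?thesis .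
 qed
 have u: "1 \<in> U_coords" "5 \<in> U_coords" "4 \<in> U_coords" "2 \<in> U_coords" by (auto simp: U_coords_def)
 define q where "q = (\<lambda>v (p :: (nat => real) \<times> real). triangular_form.Q (y1\<^sup>2) (y2\<^sup>2) (1 / y2\<^sup>2) (1 / y1\<^sup>2) (R2 (fst p 1)) (R3 (fst p 1) (fst p 5) (fst p 4)) (R4 (fst p 1) (fst p 5) (fst p 4) (fst p 2)) v)"
 have q: "q v \<in> borel_measurable ?P" for v
 proof -
  obtain a b d e where v: "v = (a, b, d, e)" by (cases v)
  have "q v = (\<lambda>p. y1\<^sup>2 * (of_int a)\<^sup>2 + y2\<^sup>2 * (of_int b + R2 (fst p 1) a)\<^sup>2
    + (1 / y2\<^sup>2) * (of_int d + R3 (fst p 1) (fst p 5) (fst p 4) a b)\<^sup>2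
    + (1 / y1\<^sup>2) * (of_int e + R4 (fst p 1) (fst p 5) (fst p 4) (fst p 2) a b d)\<^sup>2)"
   by (rule ext) (simp add: q_def v triangular_form.Q_def[OF tf])
  also have "\<dots> \<in> borel_measurable ?P"
   unfolding R2_def R3_def R4_def
   by (intro borel_measurable_add borel_measurable_diff borel_measurable_times borel_measurable_power borel_measurable_uminus borel_measurable_const c u)
  finally show ?thesis .
 qed
 have eq: "(\<lambda>p. Th (snd p) (fst p 1) (fst p 5) (fst p 4) (fst p 2)) = (\<lambda>p. \<Sum>\<^sub>\<infinity>v. exp (- pi * q v p * snd p))"
  by (rule ext) (simp add: Th_def q_def triangular_form.theta_def[OF tf])
 show ?thesis unfolding eq
 proof (rule infsum_measurable)
  fix v
  have "(\<lambda>p. - pi * q v p * snd p) \<in> borel_measurable ?P" by (intro borel_measurable_times borel_measurable_const q s)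
  moreover have "(exp :: real => real) \<in> borel_measurable borel" by (intro borel_measurable_continuous_onI continuous_intros)
  ultimately show "(\<lambda>p. exp (- pi * q v p * snd p)) \<in> borel_measurable ?P" by (rule measurable_compose)
 next
  fix p assume "p \<in> space ?P"
  hence "snd p > 0" by (auto simp: space_pair_measure)
  from triangular_form.theta_summable[OF tf this]
  show "(\<lambda>v. norm (exp (- pi * q v p * snd p))) summable_on UNIV" by (simp add: q_def)
 qed
qed

definition delta :: "int => int => complex" where
 "delta m1 m2 = (if m1 = 0 \<and> m2 = 0 then 1 else 0)"

lemma cube_phiN:
 assumes t: "t > 0"
 shows "(LINT n:cube|cube_measure. phiN n t * uchar m1 m2 n) = hat t m1 m2 - delta m1 m2 * of_real (cut t)"
proof -
 obtain B where B: "\<And>x1 x5 x4 x2. \<bar>Th t x1 x5 x4 x2\<bar> \<le> B" using Th_bounded[OF t] by blast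
 have mT: "(\<lambda>n. Th t (n 1) (n 5) (n 4) (n 2)) \<in> borel_measurable cube_measure"
 proof -
  have "(\<lambda>n. (n, t)) \<in> measurable cube_measure (cube_measure \<Otimes>\<^sub>M Rpos)" by (rule measurable_Pair2') (simp add: t)
  from measurable_compose[OF this Th_joint_measurable] show ?thesis unfolding fst_conv snd_conv .
 qed
 have m1: "(\<lambda>n. of_real (Th t (n 1) (n 5) (n 4) (n 2)) * uchar m1 m2 n) \<in> borel_measurable cube_measure"
  by (rule borel_measurable_times[OF of_real_measurable[OF mT] uchar_measurable])
 have m2: "(\<lambda>n. of_real (cut t) * uchar m1 m2 n) \<in> borel_measurable cube_measure"
  by (rule borel_measurable_times[OF borel_measurable_const uchar_measurable])
 have b1: "\<forall>n\<in>cube. norm (of_real (Th t (n 1) (n 5) (n 4) (n 2)) * uchar m1 m2 n) \<le> B"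
  using B by (simp add: norm_mult uchar_def)
 have b2: "\<forall>n\<in>cube. norm (of_real (cut t) * uchar m1 m2 n) \<le> \<bar>cut t\<bar>" by (simp add: norm_mult uchar_def)
 have "(LINT n:cube|cube_measure. phiN n t * uchar m1 m2 n) =
   (LINT n:cube|cube_measure. of_real (Th t (n 1) (n 5) (n 4) (n 2)) * uchar m1 m2 n - of_real (cut t) * uchar m1 m2 n)"
  by (simp add: phiN_eq left_diff_distrib)
 also have "\<dots> = (LINT n:cube|cube_measure. of_real (Th t (n 1) (n 5) (n 4) (n 2)) * uchar m1 m2 n)
   - (LINT n:cube|cube_measure. of_real (cut t) * uchar m1 m2 n)"
  by (rule set_integral_diff(2)[OF cube_integrable[OF m1 b1] cube_integrable[OF m2 b2]])
 also have "(LINT n:cube|cube_measure. of_real (Th t (n 1) (n 5) (n 4) (n 2)) * uchar m1 m2 n) = hat t m1 m2"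
  unfolding cube_iterated[OF m1 b1] theta_hat[OF t, symmetric] by (simp add: ucoords_def uchar_def)
 also have "(LINT n:cube|cube_measure. of_real (cut t) * uchar m1 m2 n) = delta m1 m2 * of_real (cut t)"
  using uchar_integral[of m1 m2] by (simp add: delta_def)
 finally show ?thesis .
qed

definition hat_phi :: "int => int => real => complex" where
 "hat_phi m1 m2 t = (LINT n:cube|cube_measure. phiN n t * uchar m1 m2 n)"

lemma
 shows hat_phi_rapid: "\<exists>D. rapid_bound D (hat_phi m1 m2)" (is ?g1)
  and mellin_fubini_integrable: "set_integrable cube_measure cube (\<lambda>n. mellin (phiN n) z * uchar m1 m2 n)" (is ?g2)
  and mellin_fubini: "(LINT n:cube|cube_measure. mellin (phiN n) z * uchar m1 m2 n) = mellin (hat_phi m1 m2) z" (is ?g3)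
proof -
 interpret PF: product_sigma_finite "\<lambda>_::nat. lborel :: real measure" ..
 have Ufin: "finite U_coords" by (simp add: U_coords_def)
 interpret CM: sigma_finite_measure cube_measure by (rule PF.sigma_finite[OF Ufin])
 interpret RP: sigma_finite_measure Rpos by (rule sigma_finite_Rpos)
 interpret P: pair_sigma_finite cube_measure Rpos ..
 obtain D where D: "\<And>n. rapid_bound D (phiN n)" using phiN_rapid by blast
 have box: "cube \<in> sets cube_measure" using Ufin by (intro sets_PiM_I_finite) auto
 have fin: "emeasure cube_measure cube = 1" using Ufin by (subst PF.emeasure_PiM) auto
 let ?P = "cube_measure \<Otimes>\<^sub>M Rpos"
 have mphi: "(\<lambda>p. phiN (fst p) (snd p)) \<in> borel_measurable ?P"
 proof -
  have "cut \<in> borel_measurable Rpos" using cut_measurable[of 1 "-2"] by (simp only: cut_def[abs_def])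
  from measurable_compose[OF measurable_snd this]
  have "(\<lambda>p. cut (snd p)) \<in> borel_measurable ?P" .
  from of_real_measurable[OF borel_measurable_diff[OF Th_joint_measurable this]]
  show ?thesis by (simp only: phiN_eq)
 qed
 have mu: "(\<lambda>p. uchar m1 m2 (fst p)) \<in> borel_measurable ?P" by (rule measurable_compose[OF measurable_fst uchar_measurable])
 have mi: "(\<lambda>p. indicator cube (fst p) :: real) \<in> borel_measurable ?P"
  by (rule measurable_compose[OF measurable_fst borel_measurable_indicator[OF box]])
 have mz: "(\<lambda>p. complex_of_real (snd p) powr (z - 1)) \<in> borel_measurable ?P"
  by (rule measurable_compose[OF measurable_snd powr_measurable_Rpos])
 define G where "G = (\<lambda>n t. indicator cube n *\<^sub>R (phiN n t * uchar m1 m2 n))"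
 have mG: "(\<lambda>(n,t). G n t) \<in> borel_measurable ?P"
  using borel_measurable_scaleR[OF mi borel_measurable_times[OF mphi mu]] by (simp only: G_def case_prod_beta')
 define F where "F = (\<lambda>n t. G n t * of_real t powr (z - 1))"
 have mF: "(\<lambda>(n,t). F n t) \<in> borel_measurable ?P"
  using borel_measurable_times[OF mG mz] by (simp only: F_def case_prod_beta')
 have hp: "hat_phi m1 m2 t = (\<integral>n. G n t \<partial>cube_measure)" for t by (simp only: hat_phi_def G_def set_lebesgue_integral_def)
 have nG: "norm (G n t) \<le> indicator cube n * norm (phiN n t)" for n t by (simp add: G_def norm_mult uchar_def)
 have ind_int: "integrable cube_measure (\<lambda>n. indicator cube n * c)" for c :: real
  using fin by (intro integrable_mult_left integrable_real_indicator box) auto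
 have ind_val: "(\<integral>n. indicator cube n * c \<partial>cube_measure) = c" for c :: real
  using fin box by (simp add: measure_def)
 have mean: "norm (\<integral>n. g n \<partial>cube_measure) \<le> c" if "\<And>n. norm (g n) \<le> indicator cube n * c" "c \<ge> 0" for g :: "(nat => real) => complex" and c
 proof (cases "integrable cube_measure g")
  case True
  have "norm (\<integral>n. g n \<partial>cube_measure) \<le> (\<integral>n. norm (g n) \<partial>cube_measure)" by (rule integral_norm_bound)
  also have "\<dots> \<le> (\<integral>n. indicator cube n * c \<partial>cube_measure)" by (rule integral_mono) (use True that ind_int in auto)
  finally show ?thesis by (simp only: ind_val)
 qed (use that in \<open>simp add: not_integrable_integral_eq\<close>)
 show ?g1
 proof -
  have "(\<lambda>(t,n). G n t) \<in> borel_measurable (Rpos \<Otimes>\<^sub>M cube_measure)"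
   using measurable_pair_swap[OF mG] by (simp only: prod.case)
  from CM.borel_measurable_lebesgue_integral[OF this]
  have m: "hat_phi m1 m2 \<in> borel_measurable Rpos" by (simp only: hp[abs_def])
  have "rapid_bound D (hat_phi m1 m2)"
   unfolding rapid_bound_def
  proof (intro conjI allI impI m)
   fix N and t :: real assume t: "t > 0"
   define c where "c = min (D N * t ^ N) (D N / t ^ N)"
   have c: "norm (phiN n t) \<le> c" for n
    using rapid_boundD(2,3)[OF D t] t unfolding c_def by (simp add: field_simps)
   have c0: "c \<ge> 0" using order_trans[OF norm_ge_zero c] .
   have "norm (hat_phi m1 m2 t) \<le> c"
    unfolding hp
   proof (rule mean[OF _ c0])
    fix n
    show "norm (G n t) \<le> indicator cube n * c" by (rule order_trans[OF nG mult_left_mono[OF c]]) simp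
   qed
   thus "norm (hat_phi m1 m2 t) \<le> D N * t ^ N" "norm (hat_phi m1 m2 t) * t ^ N \<le> D N"
    using t unfolding c_def by (auto simp: field_simps)
  qed
  thus ?thesis by blast
 qed
 define C where "C = 2 * D (nat \<lceil>\<bar>Re z\<bar>\<rceil> + 1)"
 have dom: "norm (phiN n t * of_real t powr (z - 1)) \<le> C * (1 / (1 + t\<^sup>2))" if "t > 0" for n t
 proof -
  have "norm (phiN n t) * t powr (Re z - 1) \<le> C * (1 / (1 + t\<^sup>2))"
   unfolding C_def by (rule rapid_dominated[OF rapid_boundD(2,3)[OF D that] that order.refl norm_ge_zero])
  thus ?thesis using that by (simp add: norm_mult norm_real_powr)
 qed
 have nF: "norm (F n t) \<le> indicator cube n * norm (phiN n t * of_real t powr (z - 1))" for n t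
  unfolding F_def norm_mult mult.assoc[symmetric] using nG[of n t] by (intro mult_right_mono) auto
 have Fi: "integrable Rpos (F n)" for n
 proof -
  have "F n = (\<lambda>t. (indicator cube n *\<^sub>R uchar m1 m2 n) * (phiN n t * of_real t powr (z - 1)))"
   by (rule ext) (simp add: F_def G_def scaleR_conv_of_real)
  thus ?thesis using integrable_mult_right[OF mellin_integrable[OF D]] by simp
 qed
 define W where "W = (\<integral>t. C * (1 / (1 + t\<^sup>2)) \<partial>Rpos)"
 have inner: "(\<integral>t. norm (F n t) \<partial>Rpos) \<le> indicator cube n * W" for n
 proof -
  have "(\<integral>t. norm (F n t) \<partial>Rpos) \<le> (\<integral>t. indicator cube n * (C * (1 / (1 + t\<^sup>2))) \<partial>Rpos)"
   by (rule integral_mono[OF integrable_norm[OF Fi] integrable_mult_right[OF integrable_Rpos_cauchy]])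
     (use order_trans[OF nF mult_left_mono[OF dom]] in auto)
  thus ?thesis by (simp only: W_def integral_mult_right_zero)
 qed
 have "integrable cube_measure (\<lambda>n. \<integral>t. norm (F n t) \<partial>Rpos)"
 proof (rule Bochner_Integration.integrable_bound[OF ind_int[of W]])
  have "(\<lambda>(n,t). norm (F n t)) \<in> borel_measurable ?P"
   using measurable_compose[OF mF borel_measurable_norm] by (simp only: case_prod_beta')
  thus "(\<lambda>n. \<integral>t. norm (F n t) \<partial>Rpos) \<in> borel_measurable cube_measure" by (rule RP.borel_measurable_lebesgue_integral)
  show "AE n in cube_measure. norm (\<integral>t. norm (F n t) \<partial>Rpos) \<le> norm (indicator cube n * W)"
  proof (rule AE_I2)
   fix n
   have "0 \<le> (\<integral>t. norm (F n t) \<partial>Rpos)" by (rule Bochner_Integration.integral_nonneg) simp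
   thus "norm (\<integral>t. norm (F n t) \<partial>Rpos) \<le> norm (indicator cube n * W)" using inner[of n] by simp
  qed
 qed
 hence FI: "integrable ?P (\<lambda>(n,t). F n t)" by (intro P.Fubini_integrable mF) (simp_all add: Fi)
 have Fn: "(\<integral>t. F n t \<partial>Rpos) = indicator cube n *\<^sub>R (mellin (phiN n) z * uchar m1 m2 n)" for n
 proof -
  have "F n = (\<lambda>t. (indicator cube n *\<^sub>R uchar m1 m2 n) * (phiN n t * of_real t powr (z - 1)))"
   by (rule ext) (simp add: F_def G_def scaleR_conv_of_real)
  hence "(\<integral>t. F n t \<partial>Rpos) = (indicator cube n *\<^sub>R uchar m1 m2 n) * mellin (phiN n) z"
   by (simp only: mellin_def integral_mult_right_zero)
  thus ?thesis by (simp add: scaleR_conv_of_real mult_ac)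
 qed
 have "integrable cube_measure (\<lambda>n. \<integral>t. F n t \<partial>Rpos)" using P.integrable_fst[OF FI] by simp
 thus ?g2
  unfolding Fn set_integrable_def .
 have "(LINT n:cube|cube_measure. mellin (phiN n) z * uchar m1 m2 n) = (\<integral>n. (\<integral>t. F n t \<partial>Rpos) \<partial>cube_measure)"
  unfolding Fn set_lebesgue_integral_def ..
 also have "\<dots> = (\<integral>t. (\<integral>n. F n t \<partial>cube_measure) \<partial>Rpos)" by (rule P.Fubini_integral[OF FI, symmetric])
 also have "\<dots> = mellin (hat_phi m1 m2) z"
  unfolding mellin_def F_def hp by (simp only: integral_mult_left_zero)
 finally show ?g3 .
qed

theorem cube_epstein:
 "(LINT n:cube|cube_measure. epsteinN n z * uchar m1 m2 n) =
   (mellin (hat_phi m1 m2) z + delta m1 m2 / (z - 2)) * rGamma z - delta m1 m2 * rGamma (z + 1)"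
proof -
 have b: "\<forall>n\<in>cube. norm (uchar m1 m2 n) \<le> 1" by (simp add: uchar_def)
 note iu = cube_integrable[OF uchar_measurable b]
 have eq: "epsteinN n z * uchar m1 m2 n = rGamma z * (mellin (phiN n) z * uchar m1 m2 n)
   + (rGamma z / (z - 2) - rGamma (z + 1)) * uchar m1 m2 n" for n by (simp add: epsteinN_eq field_simps)
 have "(LINT n:cube|cube_measure. epsteinN n z * uchar m1 m2 n) =
   rGamma z * (LINT n:cube|cube_measure. mellin (phiN n) z * uchar m1 m2 n)
   + (rGamma z / (z - 2) - rGamma (z + 1)) * (LINT n:cube|cube_measure. uchar m1 m2 n)"
  unfolding eq by (subst set_integral_add(2)) (auto intro!: set_integrable_mult_right mellin_fubini_integrable iu)
 thus ?thesis unfolding mellin_fubini uchar_integral by (simp add: delta_def algebra_simps)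
qed

end

lemma mellin_cong: "(\<And>t. t > 0 ==> \<phi> t = \<psi> t) ==> mellin \<phi> z = mellin \<psi> z"
 unfolding mellin_def by (rule Bochner_Integration.integral_cong) auto

lemma integrable_Rpos_cong: "(\<And>t. t > 0 ==> \<phi> t = \<psi> t) ==> integrable Rpos \<phi> \<longleftrightarrow> integrable Rpos \<psi>"
 by (rule Bochner_Integration.integrable_cong) auto

lemma rapid_bound_cong:
 assumes "rapid_bound D \<phi>" "\<And>t. t > 0 ==> \<phi> t = \<psi> t"
 shows "rapid_bound D \<psi>"
proof -
 have "\<phi> \<in> borel_measurable Rpos \<longleftrightarrow> \<psi> \<in> borel_measurable Rpos" by (rule measurable_cong) (use assms(2) in simp)
 thus ?thesis using assms unfolding rapid_bound_def by metis
qed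

definition mellin_ok :: "(real => complex) => complex => bool" where
 "mellin_ok \<phi> z \<longleftrightarrow> integrable Rpos (\<lambda>t. \<phi> t * of_real t powr (z - 1))"

lemma mellin_ok_cong: "(\<And>t. t > 0 ==> \<phi> t = \<psi> t) ==> mellin_ok \<phi> z \<longleftrightarrow> mellin_ok \<psi> z"
 unfolding mellin_ok_def by (rule integrable_Rpos_cong) simp

lemma mellin_ok_congI: "mellin_ok \<psi> z ==> (\<And>t. t > 0 ==> \<phi> t = \<psi> t) ==> mellin_ok \<phi> z"
 using mellin_ok_cong[of \<phi> \<psi> z] by simp

lemma mellin_add:
 assumes "mellin_ok \<phi> z" "mellin_ok \<psi> z"
 shows "mellin_ok (\<lambda>t. \<phi> t + \<psi> t) z" "mellin (\<lambda>t. \<phi> t + \<psi> t) z = mellin \<phi> z + mellin \<psi> z"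
 using assms unfolding mellin_ok_def mellin_def distrib_right by (auto intro: Bochner_Integration.integrable_add Bochner_Integration.integral_add)

lemma mellin_cmult:
 "mellin_ok \<phi> z ==> mellin_ok (\<lambda>t. c * \<phi> t) z" "mellin (\<lambda>t. c * \<phi> t) z = c * mellin \<phi> z"
 unfolding mellin_ok_def mellin_def mult.assoc by (auto intro: integrable_mult_right)

lemma mellin_sum:
 assumes "finite S" "\<And>d. d \<in> S ==> mellin_ok (\<phi> d) z"
 shows "mellin_ok (\<lambda>t. \<Sum>d\<in>S. \<phi> d t) z" "mellin (\<lambda>t. \<Sum>d\<in>S. \<phi> d t) z = (\<Sum>d\<in>S. mellin (\<phi> d) z)"
 using assms unfolding mellin_ok_def mellin_def sum_distrib_right
 by (auto intro: Bochner_Integration.integrable_sum Bochner_Integration.integral_sum)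

lemma mellin_shift:
 shows "mellin_ok (\<lambda>t. of_real (t powr (- a)) * \<phi> t) z \<longleftrightarrow> mellin_ok \<phi> (z - of_real a)" (is ?g1)
  and "mellin (\<lambda>t. of_real (t powr (- a)) * \<phi> t) z = mellin \<phi> (z - of_real a)" (is ?g2)
proof -
 have e: "of_real (t powr (- a)) * \<phi> t * of_real t powr (z - 1) = \<phi> t * of_real t powr (z - of_real a - 1)" if "t > 0" for t
 proof -
  have "complex_of_real (t powr (- a)) = of_real t powr (of_real (- a))" using powr_of_real[of t "- a"] that by (simp only: less_imp_le)
  hence "complex_of_real (t powr (- a)) * of_real t powr (z - 1) = of_real t powr (z - of_real a - 1)"
   using that by (simp add: powr_add[symmetric] algebra_simps)
  thus ?thesis by (simp add: mult_ac)
 qed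
 show ?g1
  unfolding mellin_ok_def by (rule integrable_Rpos_cong) (rule e)
 show ?g2
  unfolding mellin_def by (rule Bochner_Integration.integral_cong) (use e in auto)
qed

lemma mellin_ok_scale:
 assumes "c > 0" "mellin_ok \<phi> z"
 shows "mellin_ok (\<lambda>t. \<phi> (c * t)) z"
proof -
 have "integrable lborel (\<lambda>t. indicator {0<..} t *\<^sub>R (\<phi> t * of_real t powr (z - 1)))"
  using assms(2) by (simp only: mellin_ok_def integrable_Rpos)
 from lborel_integrable_real_affine[OF this, of c 0] assms(1)
 have "integrable lborel (\<lambda>t. indicator {0<..} (c * t) *\<^sub>R (\<phi> (c * t) * of_real (c * t) powr (z - 1)))" by simp
 hence "integrable lborel (\<lambda>t. of_real c powr (1 - z) * (indicator {0<..} (c * t) *\<^sub>R (\<phi> (c * t) * of_real (c * t) powr (z - 1))))"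
  by (rule integrable_mult_right)
 also have "(\<lambda>t. of_real c powr (1 - z) * (indicator {0<..} (c * t) *\<^sub>R (\<phi> (c * t) * of_real (c * t) powr (z - 1))))
   = (\<lambda>t. indicator {0<..} t *\<^sub>R (\<phi> (c * t) * of_real t powr (z - 1)))"
 proof
  fix t
  show "of_real c powr (1 - z) * (indicator {0<..} (c * t) *\<^sub>R (\<phi> (c * t) * of_real (c * t) powr (z - 1)))
   = indicator {0<..} t *\<^sub>R (\<phi> (c * t) * of_real t powr (z - 1))"
  proof (cases "t > 0")
   case True
   have a: "complex_of_real (c * t) powr (z - 1) = of_real c powr (z - 1) * of_real t powr (z - 1)"
    using True assms(1) by (simp add: powr_times_real)
   have b: "complex_of_real c powr (1 - z) * of_real c powr (z - 1) = 1"
    using assms(1) by (simp add: powr_add[symmetric])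
   have "complex_of_real c powr (1 - z) * (\<phi> (c * t) * (of_real c powr (z - 1) * of_real t powr (z - 1)))
    = (complex_of_real c powr (1 - z) * of_real c powr (z - 1)) * (\<phi> (c * t) * of_real t powr (z - 1))" by (simp only: mult_ac)
   thus ?thesis using True assms(1) unfolding a b by (simp add: a)
  qed (use assms(1) in \<open>simp add: zero_less_mult_iff\<close>)
 qed
 finally show ?thesis by (simp only: mellin_ok_def integrable_Rpos)
qed

definition besf :: "real => real => real => complex" where
 "besf \<alpha> \<beta> t = of_real (exp (- pi * \<alpha> * t) * exp (- pi * \<beta> / t))"

definition bes :: "complex => real => real => complex" where
 "bes w \<alpha> \<beta> = mellin (besf \<alpha> \<beta>) w"

lemma besf_rapid:
 assumes "\<alpha> > 0" "\<beta> > 0"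
 shows "\<exists>D. rapid_bound D (besf \<alpha> \<beta>)"
proof -
 define D where "D = (\<lambda>N. fact N / (pi * \<alpha>) ^ N + fact N / (pi * \<beta>) ^ N)"
 have e: "exp (- x) * x ^ N \<le> fact N" if "x \<ge> 0" for x :: real and N
  using power_le_fact_exp[OF that, of N] by (simp add: exp_minus field_simps)
 have p: "pi * \<alpha> > 0" "pi * \<beta> > 0" using assms by auto
 have m: "besf \<alpha> \<beta> \<in> borel_measurable Rpos"
  unfolding besf_def[abs_def] by (intro Rpos_measurable_continuous continuous_intros) auto
 have n: "norm (besf \<alpha> \<beta> t) = exp (- (pi * \<alpha> * t)) * exp (- (pi * \<beta> / t))" for t
  unfolding besf_def norm_of_real by simp
 have "norm (besf \<alpha> \<beta> t) \<le> D N * t ^ N" "norm (besf \<alpha> \<beta> t) * t ^ N \<le> D N" if t: "t > 0" for N t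
 proof -
  have nn: "pi * \<alpha> * t \<ge> 0" "pi * \<beta> / t \<ge> 0" using p t by auto
  have D0: "fact N / (pi * \<alpha>) ^ N \<le> D N" "fact N / (pi * \<beta>) ^ N \<le> D N" using p by (auto simp: D_def)
  have "norm (besf \<alpha> \<beta> t) \<le> exp (- (pi * \<beta> / t))" unfolding n using nn by (simp add: mult_le_cancel_right1)
  also have "\<dots> \<le> fact N / (pi * \<beta> / t) ^ N"
  proof -
   have "(pi * \<beta> / t) ^ N > 0" using p t by simp
   thus ?thesis using e[OF nn(2), of N] by (simp only: pos_le_divide_eq)
  qed
  also have "\<dots> = (fact N / (pi * \<beta>) ^ N) * t ^ N" using t by (simp add: power_divide)
  also have "\<dots> \<le> D N * t ^ N" using D0(2) t by (intro mult_right_mono) auto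
  finally show "norm (besf \<alpha> \<beta> t) \<le> D N * t ^ N" .
  have "norm (besf \<alpha> \<beta> t) * t ^ N \<le> exp (- (pi * \<alpha> * t)) * t ^ N"
   unfolding n using nn t by (intro mult_right_mono) (auto simp: mult_le_cancel_left1)
  also have "\<dots> = (exp (- (pi * \<alpha> * t)) * (pi * \<alpha> * t) ^ N) / (pi * \<alpha>) ^ N"
  proof -
   have "(pi * \<alpha> * t) ^ N = (pi * \<alpha>) ^ N * t ^ N" by (rule power_mult_distrib)
   thus ?thesis using p assms by simp
  qed
  also have "\<dots> \<le> fact N / (pi * \<alpha>) ^ N" by (rule divide_right_mono[OF e[OF nn(1)]]) (use p in simp)
  also have "\<dots> \<le> D N" by (rule D0)
  finally show "norm (besf \<alpha> \<beta> t) * t ^ N \<le> D N" .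
 qed
 thus ?thesis using m unfolding rapid_bound_def by blast
qed

lemma bes_ok: "\<alpha> > 0 ==> \<beta> > 0 ==> mellin_ok (besf \<alpha> \<beta>) w"
 unfolding mellin_ok_def using besf_rapid mellin_integrable by blast

lemma bes_entire: "\<alpha> > 0 ==> \<beta> > 0 ==> f analytic_on A ==> (\<lambda>z. bes (f z) \<alpha> \<beta>) analytic_on A"
 unfolding bes_def using besf_rapid mellin_analytic by blast

lemma bes_zero:
 assumes "\<alpha> > 0" "Re w > 0"
 shows "mellin_ok (besf \<alpha> 0) w" "bes w \<alpha> 0 = Gamma w * of_real (pi * \<alpha>) powr (- w)"
proof -
 have b: "besf \<alpha> 0 = (\<lambda>t. of_real (exp (- (pi * \<alpha>) * t)))" by (rule ext) (simp add: besf_def)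
 have p: "pi * \<alpha> > 0" using assms by simp
 show "mellin_ok (besf \<alpha> 0) w" "bes w \<alpha> 0 = Gamma w * of_real (pi * \<alpha>) powr (- w)"
  unfolding mellin_ok_def bes_def b using mellin_exp[OF p assms(2)] by (simp_all only:)
qed

lemma bes_scale:
 assumes "c > 0" "\<alpha> > 0" "\<beta> > 0"
 shows "mellin_ok (besf (c * \<alpha>) (\<beta> / c)) w" (is ?g1) "bes w (c * \<alpha>) (\<beta> / c) = of_real c powr (- w) * bes w \<alpha> \<beta>" (is ?g2)
proof -
 have e: "besf (c * \<alpha>) (\<beta> / c) = (\<lambda>t. besf \<alpha> \<beta> (c * t))" by (rule ext) (simp add: besf_def mult_ac)
 show ?g1 unfolding e by (rule mellin_ok_scale[OF assms(1) bes_ok[OF assms(2,3)]])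
 show ?g2
  unfolding bes_def e by (rule mellin_scale[OF assms(1)])
qed

definition arith_factor :: "complex => int => complex" where
 "arith_factor s m = (if m = 0 then zeta s else div_sigma (- s) m)"

lemma div_sigma_int:
 assumes m: "m \<noteq> 0"
 shows "finite {d::int. d \<noteq> 0 \<and> d dvd m}" (is ?g1)
  and "(\<Sum>d | d \<noteq> 0 \<and> d dvd m. of_real (real_of_int \<bar>d\<bar>) powr \<mu>) = 2 * div_sigma \<mu> m" (is ?g2)
proof -
 define P where "P = {d::nat. 0 < d \<and> int d dvd m}"
 have f: "finite {d::int. d dvd m}" using m by (rule finite_divisors_int)
 thus ?g1 by (rule finite_subset[rotated]) auto
 have "int ` P \<subseteq> {d::int. d dvd m}" by (auto simp: P_def)
 hence "finite (int ` P)" using f finite_subset by blast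
 hence fP: "finite P" by (rule finite_imageD) simp
 have split: "{d::int. d \<noteq> 0 \<and> d dvd m} = int ` P \<union> (\<lambda>d. - int d) ` P"
 proof (rule set_eqI, rule iffI)
  fix d assume d: "d \<in> {d::int. d \<noteq> 0 \<and> d dvd m}"
  show "d \<in> int ` P \<union> (\<lambda>d. - int d) ` P"
  proof (cases "d > 0")
   case True
   hence "d = int (nat d)" "nat d \<in> P" using d by (auto simp: P_def)
   thus ?thesis by blast
  next
   case False
   hence "d = - int (nat (- d))" "nat (- d) \<in> P" using d by (auto simp: P_def)
   thus ?thesis by blast
  qed
 qed (auto simp: P_def)
 have "(\<Sum>d | d \<noteq> 0 \<and> d dvd m. of_real (real_of_int \<bar>d\<bar>) powr \<mu>) =
   (\<Sum>d\<in>int ` P. of_real (real_of_int \<bar>d\<bar>) powr \<mu>) + (\<Sum>d\<in>(\<lambda>d. - int d) ` P. complex_of_real (real_of_int \<bar>d\<bar>) powr \<mu>)"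
  unfolding split by (rule sum.union_disjoint) (use fP in \<open>auto simp: P_def\<close>)
 also have "(\<Sum>d\<in>int ` P. complex_of_real (real_of_int \<bar>d\<bar>) powr \<mu>) = (\<Sum>d\<in>P. of_nat d powr \<mu>)"
  by (subst sum.reindex) (auto simp: inj_on_def)
 also have "(\<Sum>d\<in>(\<lambda>d. - int d) ` P. complex_of_real (real_of_int \<bar>d\<bar>) powr \<mu>) = (\<Sum>d\<in>P. of_nat d powr \<mu>)"
  by (subst sum.reindex) (auto simp: inj_on_def)
 finally show ?g2 by (simp add: div_sigma_def P_def)
qed

lemma mellin_jdelta:
 assumes w: "Re w > 1/2"
 shows "mellin_ok (\<lambda>t. of_real (jdelta t)) w" (is ?g1)
  and "mellin (\<lambda>t. of_real (jdelta t)) w = Gamma w * of_real pi powr (- w) * (2 * zeta (2 * w))" (is ?g2)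
proof -
 obtain D where D: "rapid_bound D zeta_phi" using zeta_phi_rapid by blast
 note H = hecke_mellin[of D "\<lambda>t. jtheta t 0" 1 "1/2" w, folded zeta_phi_def, OF D]
 show ?g1 unfolding mellin_ok_def jdelta_def using H(1) w by simp
 have M: "mellin (\<lambda>t. of_real (jdelta t)) w = mellin zeta_phi w + 1 / (w - 1/2) - 1 / w"
  unfolding jdelta_def using H(2) w by simp
 have w0: "w \<noteq> 0" "Re w > 0" using w by auto
 have z1: "2 * w \<noteq> 1" using w by (metis Re_complex_of_real one_complex.sel(1) mult_2 plus_complex.sel(1) less_irrefl field_sum_of_halves add_strict_mono)
 have z: "2 * zeta (2 * w) = of_real pi powr w * ((mellin zeta_phi w + 1 / (w - 1/2)) * rGamma w - rGamma w * (1 / w))"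
  unfolding zeta_eq_formula[OF z1] zeta_formula_def rGamma_divide[OF w0(1)] by simp
 have e: "(mellin zeta_phi w + 1 / (w - 1/2)) * rGamma w - rGamma w * (1 / w) = rGamma w * mellin (\<lambda>t. of_real (jdelta t)) w"
  unfolding M by (simp only: left_diff_distrib right_diff_distrib mult.commute)
 have g: "Gamma w * rGamma w = 1"
 proof -
  have "w \<notin> \<int>\<^sub>\<le>\<^sub>0" using w0 by (auto elim!: nonpos_Ints_cases)
  thus ?thesis by (simp add: rGamma_inverse_Gamma Gamma_eq_zero_iff)
 qed
 have pp: "complex_of_real pi powr (- w) * of_real pi powr w = 1" by (simp add: powr_minus)
 have "Gamma w * of_real pi powr (- w) * (2 * zeta (2 * w)) =
  (Gamma w * rGamma w) * (complex_of_real pi powr (- w) * of_real pi powr w) * mellin (\<lambda>t. of_real (jdelta t)) w"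
  unfolding z e by (simp only: mult_ac)
 thus ?g2
  unfolding g pp by simp
qed

lemma divsum_zero: "\<tau> > 0 ==> divsum \<tau> \<tau>' 0 = jdelta \<tau>"
proof -
 assume t: "\<tau> > 0"
 have "((\<lambda>d::int. if d \<noteq> 0 \<and> d dvd 0 then exp (- pi * \<tau> * (of_int d)\<^sup>2) * exp (- pi * (of_int (0 div d))\<^sup>2 / \<tau>') else 0) has_sum jdelta \<tau>) UNIV"
  using jtheta_zero_sum[OF t] by (rule has_sum_cong[THEN iffD1, rotated]) auto
 thus ?thesis unfolding divsum_def by (rule infsumI)
qed

lemma mellin_divsum:
 assumes p: "\<alpha> > 0" "\<beta> > 0" and w: "Re w > 1/2"
 shows "mellin_ok (\<lambda>t. of_real (divsum (t * \<alpha>) (t * \<beta>) m)) w" (is ?g1)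
  and "mellin (\<lambda>t. of_real (divsum (t * \<alpha>) (t * \<beta>) m)) w = bes w \<alpha> ((of_int m)\<^sup>2 / \<beta>) * (2 * arith_factor (2 * w) m)"
proof -
 show ?g1
  and "mellin (\<lambda>t. of_real (divsum (t * \<alpha>) (t * \<beta>) m)) w = bes w \<alpha> ((of_int m)\<^sup>2 / \<beta>) * (2 * arith_factor (2 * w) m)"
 proof (atomize (full), cases "m = 0")
  case True
  have e: "of_real (divsum (t * \<alpha>) (t * \<beta>) m) = complex_of_real (jdelta (\<alpha> * t))" if "t > 0" for t
   using divsum_zero[of "t * \<alpha>"] that p True by (simp add: mult.commute)
  have ok: "mellin_ok (\<lambda>t. of_real (divsum (t * \<alpha>) (t * \<beta>) m)) w"
   by (rule mellin_ok_congI[OF mellin_ok_scale[OF p(1) mellin_jdelta(1)[OF w]]]) (rule e)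
  have "mellin (\<lambda>t. of_real (divsum (t * \<alpha>) (t * \<beta>) m)) w = mellin (\<lambda>t. of_real (jdelta (\<alpha> * t))) w"
   by (rule mellin_cong[OF e])
  also have "\<dots> = of_real \<alpha> powr (- w) * (Gamma w * of_real pi powr (- w) * (2 * zeta (2 * w)))"
   using mellin_scale[OF p(1), of "\<lambda>t. of_real (jdelta t)" w] mellin_jdelta(2)[OF w] by simp
  also have "\<dots> = bes w \<alpha> 0 * (2 * zeta (2 * w))"
  proof -
   have "bes w \<alpha> 0 = Gamma w * of_real (pi * \<alpha>) powr (- w)" by (rule bes_zero) (use p w in auto)
   also have "complex_of_real (pi * \<alpha>) powr (- w) = of_real pi powr (- w) * of_real \<alpha> powr (- w)"
    using p by (simp add: powr_times_real)
   finally show ?thesis by (simp only: mult_ac)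
  qed
  finally show "mellin_ok (\<lambda>t. of_real (divsum (t * \<alpha>) (t * \<beta>) m)) w \<and> mellin (\<lambda>t. of_real (divsum (t * \<alpha>) (t * \<beta>) m)) w = bes w \<alpha> ((of_int m)\<^sup>2 / \<beta>) * (2 * arith_factor (2 * w) m)"
   using ok True by (simp add: arith_factor_def)
 next
  case False
  define S where "S = {d::int. d \<noteq> 0 \<and> d dvd m}"
  have fS: "finite S" unfolding S_def by (rule div_sigma_int(1)[OF False])
  define \<gamma> where "\<gamma> = (of_int m)\<^sup>2 / \<beta>"
  have g: "\<gamma> > 0" using p False by (simp add: \<gamma>_def)
  define q where "q = (\<lambda>d::int. (real_of_int d)\<^sup>2)"
  have q: "q d > 0" if "d \<in> S" for d using that by (simp add: S_def q_def)
  have e: "of_real (divsum (t * \<alpha>) (t * \<beta>) m) = (\<Sum>d\<in>S. besf (q d * \<alpha>) (\<gamma> / q d) t)" if t: "t > 0" for t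
  proof -
   define f where "f = (\<lambda>d::int. exp (- pi * (t * \<alpha>) * (of_int d)\<^sup>2) * exp (- pi * (of_int (m div d))\<^sup>2 / (t * \<beta>)))"
   have "divsum (t * \<alpha>) (t * \<beta>) m = (\<Sum>\<^sub>\<infinity>d\<in>S. f d)"
    unfolding divsum_def by (rule infsum_cong_neutral) (auto simp: S_def f_def)
   also have "\<dots> = (\<Sum>d\<in>S. f d)" by (rule infsum_finite[OF fS])
   finally have "divsum (t * \<alpha>) (t * \<beta>) m = (\<Sum>d\<in>S. f d)" .
   moreover have "besf (q d * \<alpha>) (\<gamma> / q d) t = of_real (f d)" if "d \<in> S" for d
   proof -
    have d: "d \<noteq> 0" "m = d * (m div d)" using that by (auto simp: S_def)
    have "real_of_int m = of_int d * of_int (m div d)" using d(2) by (metis of_int_mult)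
    hence "\<gamma> / q d = (of_int (m div d))\<^sup>2 / \<beta>" using d(1) by (simp add: \<gamma>_def q_def power_mult_distrib del: of_int_eq_iff)
    thus ?thesis by (simp add: besf_def f_def q_def mult_ac)
   qed
   ultimately show ?thesis by simp
  qed
  have okd: "mellin_ok (besf (q d * \<alpha>) (\<gamma> / q d)) w" if "d \<in> S" for d by (rule bes_scale(1)[OF q[OF that] p(1) g])
  have ok: "mellin_ok (\<lambda>t. of_real (divsum (t * \<alpha>) (t * \<beta>) m)) w"
   by (rule mellin_ok_congI[OF mellin_sum(1)[where \<phi> = "\<lambda>d. besf (q d * \<alpha>) (\<gamma> / q d)", OF fS okd] e])
  have "mellin (\<lambda>t. of_real (divsum (t * \<alpha>) (t * \<beta>) m)) w = mellin (\<lambda>t. \<Sum>d\<in>S. besf (q d * \<alpha>) (\<gamma> / q d) t) w"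
   by (rule mellin_cong[OF e])
  also have "\<dots> = (\<Sum>d\<in>S. mellin (besf (q d * \<alpha>) (\<gamma> / q d)) w)" by (rule mellin_sum(2)[OF fS okd])
  also have "\<dots> = (\<Sum>d\<in>S. of_real (real_of_int \<bar>d\<bar>) powr (- (2 * w)) * bes w \<alpha> \<gamma>)"
  proof (rule sum.cong[OF refl])
   fix d assume d: "d \<in> S"
   have "complex_of_real (q d) powr (- w) = of_real (real_of_int \<bar>d\<bar>) powr (- (2 * w))"
   proof -
    have d0: "real_of_int \<bar>d\<bar> > 0" using d by (simp add: S_def)
    have qd: "q d = real_of_int \<bar>d\<bar> * real_of_int \<bar>d\<bar>" by (simp add: q_def power2_eq_square)
    have "complex_of_real (real_of_int \<bar>d\<bar> * real_of_int \<bar>d\<bar>) powr (- w) = of_real (real_of_int \<bar>d\<bar>) powr (- w) * of_real (real_of_int \<bar>d\<bar>) powr (- w)"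
     unfolding of_real_mult by (rule powr_times_real) (use d0 in simp_all)
    hence "complex_of_real (q d) powr (- w) = of_real (real_of_int \<bar>d\<bar>) powr (- w) * of_real (real_of_int \<bar>d\<bar>) powr (- w)"
     by (simp only: qd)
    also have "\<dots> = of_real (real_of_int \<bar>d\<bar>) powr (- w + - w)" by (rule powr_add[symmetric])
    also have "- w + - w = - (2 * w)" by simp
    finally show ?thesis .
   qed
   thus "mellin (besf (q d * \<alpha>) (\<gamma> / q d)) w = of_real (real_of_int \<bar>d\<bar>) powr (- (2 * w)) * bes w \<alpha> \<gamma>"
    using bes_scale(2)[OF q[OF d] p(1) g, of w] by (simp only: bes_def)
  qed
  also have "\<dots> = 2 * div_sigma (- (2 * w)) m * bes w \<alpha> \<gamma>"
   unfolding sum_distrib_right[symmetric] S_def div_sigma_int(2)[OF False] ..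
  finally show "mellin_ok (\<lambda>t. of_real (divsum (t * \<alpha>) (t * \<beta>) m)) w \<and> mellin (\<lambda>t. of_real (divsum (t * \<alpha>) (t * \<beta>) m)) w = bes w \<alpha> ((of_int m)\<^sup>2 / \<beta>) * (2 * arith_factor (2 * w) m)"
   using ok False by (simp add: arith_factor_def \<gamma>_def)
 qed
qed

context horocycle
begin

text \<open>The four terms: \<open>k\<close> counts the coordinates of the lattice vector preceding the pivot.\<close>

definition bterm :: "int => int => nat => complex => complex" where
 "bterm m1 m2 k z =
   (if k = 0 then (if m1 = 0 \<and> m2 = 0 then bes z (1 / y1\<^sup>2) 0 else 0)
   else if k = 1 then (if m2 = 0 then of_real y1 * cis (2 * pi * of_int m1 * p1) * bes (z - 1/2) (1 / y2\<^sup>2) ((of_int m1)\<^sup>2 * y1\<^sup>2) else 0)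
   else if k = 2 then (if m1 = 0 then of_real (y1 * y2) * cis (2 * pi * of_int m2 * p5) * bes (z - 1) (y2\<^sup>2) ((of_int m2)\<^sup>2 * y2\<^sup>2) else 0)
   else (if m2 = 0 then of_real y1 * cis (2 * pi * of_int m1 * p1) * bes (z - 3/2) (y1\<^sup>2) ((of_int m1)\<^sup>2 / y2\<^sup>2) else 0))"

lemma powr_half_scale: "t > 0 ==> a > 0 ==> (t * a) powr (- 1/2) = t powr (- (1/2)) * a powr (- (1/2))" for t a :: real
 by (simp add: powr_mult)

lemma square_powr_half: "a > 0 ==> (a\<^sup>2) powr (- (1/2)) = 1 / a" "a > 0 ==> (1 / a\<^sup>2) powr (- (1/2)) = a" for a :: real
proof -
 assume a: "a > 0"
 have "(a\<^sup>2) powr (- (1/2)) = a powr (-1)" using a by (simp add: powr_powr flip: powr_numeral)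
 thus 1: "(a\<^sup>2) powr (- (1/2)) = 1 / a" using a by (simp add: powr_minus_divide)
 have "(1 / a\<^sup>2) powr (- (1/2)) = 1 / (a\<^sup>2) powr (- (1/2))" using a by (subst powr_divide) auto
 thus "(1 / a\<^sup>2) powr (- (1/2)) = a" unfolding 1 by simp
qed

lemma mellin_hat:
 assumes z: "Re z > 2"
 shows "mellin_ok (\<lambda>t. hat t m1 m2 - delta m1 m2) z" (is ?g1)
  and "mellin (\<lambda>t. hat t m1 m2 - delta m1 m2) z =
   bterm m1 m2 0 z * (2 * zeta (2 * z)) + bterm m1 m2 1 z * (2 * arith_factor (2 * z - 1) m1)
   + bterm m1 m2 2 z * (2 * arith_factor (2 * z - 2) m2) + bterm m1 m2 3 z * (2 * arith_factor (2 * z - 3) m1)" (is ?g2)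
proof -
 have p: "y1\<^sup>2 > 0" "y2\<^sup>2 > 0" "1 / y2\<^sup>2 > 0" "1 / y1\<^sup>2 > 0" using y by auto
 define c0 where "c0 = (if m1 = 0 \<and> m2 = 0 then 1 else 0 :: complex)"
 define c1 where "c1 = (if m2 = 0 then of_real y1 * cis (2 * pi * of_int m1 * p1) else 0)"
 define c2 where "c2 = (if m1 = 0 then of_real (y1 * y2) * cis (2 * pi * of_int m2 * p5) else 0)"
 define D0 where "D0 = (\<lambda>t. complex_of_real (divsum (t * (1 / y1\<^sup>2)) (t * 1) 0))"
 define D1 where "D1 = (\<lambda>t. complex_of_real (divsum (t * (1 / y2\<^sup>2)) (t * (1 / y1\<^sup>2)) m1))"
 define D2 where "D2 = (\<lambda>t. complex_of_real (divsum (t * y2\<^sup>2) (t * (1 / y2\<^sup>2)) m2))"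
 define D3 where "D3 = (\<lambda>t. complex_of_real (divsum (t * y1\<^sup>2) (t * y2\<^sup>2) m1))"
 define G where "G = (\<lambda>t. c0 * D0 t + c1 * (of_real (t powr (- (1/2))) * D1 t) + c2 * (of_real (t powr (- 1)) * D2 t)
   + c1 * (of_real (t powr (- (3/2))) * D3 t))"
 have e: "hat t m1 m2 - delta m1 m2 = G t" if t: "t > 0" for t
 proof -
  have a: "\<tau>4 t powr (- 1/2) = t powr (- (1/2)) * y1"
   using powr_half_scale[OF t p(4)] square_powr_half(2)[OF y(1)] by (simp add: \<tau>4_def[OF t])
  have b: "\<tau>3 t powr (- 1/2) = t powr (- (1/2)) * y2"
   using powr_half_scale[OF t p(3)] square_powr_half(2)[OF y(2)] by (simp add: \<tau>3_def[OF t])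
  have d: "\<tau>2 t powr (- 1/2) = t powr (- (1/2)) * (1 / y2)"
   using powr_half_scale[OF t p(2)] square_powr_half(1)[OF y(2)] by (simp add: \<tau>2_def[OF t])
  have t1: "t powr (- (1/2)) * t powr (- (1/2)) = t powr (- 1)" by (simp add: powr_add[symmetric])
  have t3: "t powr (- 1) * t powr (- (1/2)) = t powr (- (3/2))" unfolding powr_add[symmetric] by simp
  have ab: "\<tau>4 t powr (- 1/2) * \<tau>3 t powr (- 1/2) = (y1 * y2) * t powr (- 1)"
   unfolding a b t1[symmetric] by (simp only: mult_ac)
  have abd: "\<tau>4 t powr (- 1/2) * \<tau>3 t powr (- 1/2) * \<tau>2 t powr (- 1/2) = y1 * t powr (- (3/2))"
   unfolding ab d t3[symmetric] using y by simp
  have j: "jtheta (\<tau>4 t) 0 = 1 + divsum (t * (1 / y1\<^sup>2)) (t * 1) 0"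
   using divsum_zero[of "t * (1 / y1\<^sup>2)" "t * 1"] t p by (simp add: jdelta_def \<tau>4_def[OF t])
  show ?thesis unfolding hat_def[OF t] unfolding abd unfolding ab unfolding a j G_def c0_def c1_def c2_def D0_def D1_def D2_def D3_def delta_def
   by (simp add: \<tau>1_def[OF t] \<tau>2_def[OF t] \<tau>3_def[OF t] \<tau>4_def[OF t] algebra_simps)
 qed
 have rz: "Re z > 1/2" "Re (z - of_real (1/2)) > 1/2" "Re (z - of_real 1) > 1/2" "Re (z - of_real (3/2)) > 1/2" using z by auto
 note M0 = mellin_divsum[OF p(4) zero_less_one rz(1), of 0, folded D0_def]
 note M1 = mellin_divsum[OF p(3,4) rz(2), of m1, folded D1_def]
 note M2 = mellin_divsum[OF p(2,3) rz(3), of m2, folded D2_def]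
 note M3 = mellin_divsum[OF p(1,2) rz(4), of m1, folded D3_def]
 note o0 = mellin_cmult(1)[OF M0(1), of c0]
 note o1 = mellin_cmult(1)[OF mellin_shift(1)[THEN iffD2, OF M1(1)], of c1]
 note o2 = mellin_cmult(1)[OF mellin_shift(1)[THEN iffD2, OF M2(1)], of c2]
 note o3 = mellin_cmult(1)[OF mellin_shift(1)[THEN iffD2, OF M3(1)], of c1]
 note o01 = mellin_add[OF o0 o1]
 note o02 = mellin_add[OF o01(1) o2]
 note o03 = mellin_add[OF o02(1) o3]
 show ?g1 by (rule mellin_ok_congI[of G, OF _ e]) (unfold G_def, rule o03(1))
 have "mellin (\<lambda>t. hat t m1 m2 - delta m1 m2) z = mellin G z" by (rule mellin_cong[OF e])
 also have "\<dots> = c0 * (bes z (1 / y1\<^sup>2) 0 * (2 * zeta (2 * z))) + c1 * (bes (z - 1/2) (1 / y2\<^sup>2) ((of_int m1)\<^sup>2 / (1 / y1\<^sup>2)) * (2 * arith_factor (2 * z - 1) m1))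
   + c2 * (bes (z - 1) (y2\<^sup>2) ((of_int m2)\<^sup>2 / (1 / y2\<^sup>2)) * (2 * arith_factor (2 * z - 2) m2)) + c1 * (bes (z - 3/2) (y1\<^sup>2) ((of_int m1)\<^sup>2 / y2\<^sup>2) * (2 * arith_factor (2 * z - 3) m1))"
  unfolding G_def o03(2) o02(2) o01(2) mellin_cmult(2) mellin_shift(2) M0(2) M1(2) M2(2) M3(2) by (simp add: arith_factor_def right_diff_distrib)
 finally show ?g2 by (simp add: bterm_def c0_def c1_def c2_def mult.assoc)
qed

lemma hat_phi_eq: "t > 0 ==> hat_phi m1 m2 t = hat t m1 m2 - delta m1 m2 * of_real (cut t)"
 unfolding hat_phi_def by (rule cube_phiN)

theorem mellin_hat_phi:
 assumes z: "Re z > 2"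
 shows "(mellin (hat_phi m1 m2) z + delta m1 m2 / (z - 2)) * rGamma z - delta m1 m2 * rGamma (z + 1)
  = rGamma z * mellin (\<lambda>t. hat t m1 m2 - delta m1 m2) z"
proof (cases "m1 = 0 \<and> m2 = 0")
 case False
 hence d: "delta m1 m2 = 0" by (simp add: delta_def)
 have "mellin (hat_phi m1 m2) z = mellin (\<lambda>t. hat t m1 m2 - delta m1 m2) z" by (rule mellin_cong) (simp add: hat_phi_eq d)
 thus ?thesis by (simp add: d)
next
 case True
 define \<theta> where "\<theta> = (\<lambda>t. Re (hat t 0 0))"
 have h: "hat t 0 0 = of_real (\<theta> t)" if "t > 0" for t unfolding \<theta>_def hat_def[OF that] by (simp add: complex_eq_iff)
 have d: "delta m1 m2 = 1" using True by (simp add: delta_def)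
 obtain D where D: "rapid_bound D (hat_phi 0 0)" using hat_phi_rapid by blast
 have e: "hat_phi 0 0 t = of_real (\<theta> t - (if t \<le> 1 then 1 * t powr (- 2) else 1))" if "t > 0" for t
  using hat_phi_eq[OF that, of 0 0] h[OF that] unfolding cut_def by (simp add: delta_def)
 have D': "rapid_bound D (\<lambda>t. of_real (\<theta> t - (if t \<le> 1 then 1 * t powr (- 2) else 1)))" by (rule rapid_bound_cong[OF D e])
 have "mellin (\<lambda>t. hat t 0 0 - 1) z = mellin (\<lambda>t. of_real (\<theta> t - 1)) z" by (rule mellin_cong) (simp add: h)
 also have "\<dots> = mellin (\<lambda>t. of_real (\<theta> t - (if t \<le> 1 then 1 * t powr (- 2) else 1))) z + of_real 1 / (z - of_real 2) - 1 / z"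
  by (rule hecke_mellin(2)[OF D']) (use z in auto)
 also have "mellin (\<lambda>t. of_real (\<theta> t - (if t \<le> 1 then 1 * t powr (- 2) else 1))) z = mellin (hat_phi 0 0) z"
  by (rule mellin_cong) (simp add: e)
 finally have M: "mellin (\<lambda>t. hat t 0 0 - 1) z = mellin (hat_phi 0 0) z + 1 / (z - 2) - 1 / z" by simp
 have z0: "z \<noteq> 0" using z by auto
 have "rGamma z * mellin (\<lambda>t. hat t 0 0 - 1) z = (mellin (hat_phi 0 0) z + 1 / (z - 2)) * rGamma z - rGamma z * (1 / z)"
  unfolding M by (simp only: left_diff_distrib right_diff_distrib mult.commute)
 thus ?thesis unfolding rGamma_divide[OF z0] d using True by simp
qed

end

lemma vector_4:
 "(vector [a, b, c, d] :: 'a::zero ^ 4) $ 1 = a" "(vector [a, b, c, d] :: 'a ^ 4) $ 2 = b"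
 "(vector [a, b, c, d] :: 'a ^ 4) $ 3 = c" "(vector [a, b, c, d] :: 'a ^ 4) $ 4 = d" by (simp_all add: vector_def)

lemma matrix_mult_4: "(A ** B) $ i $ j = A$i$1 * B$1$j + A$i$2 * B$2$j + A$i$3 * B$3$j + A$i$4 * B$4$j"
 for A B :: "real^4^4" by (simp add: matrix_matrix_mult_def sum_4)

lemma transpose_nth: "transpose A $ i $ j = A $ j $ i" by (simp add: transpose_def)

lemma J_nth:
 "J$1$1 = 0" "J$1$2 = 0" "J$1$3 = 1" "J$1$4 = 0" "J$2$1 = 0" "J$2$2 = 0" "J$2$3 = 0" "J$2$4 = 1"
 "J$3$1 = -1" "J$3$2 = 0" "J$3$3 = 0" "J$3$4 = 0" "J$4$1 = 0" "J$4$2 = -1" "J$4$3 = 0" "J$4$4 = 0"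
 by (simp_all add: J_def block_def vector_4 mat_def)

lemma eta_nth:
 "eta n$1$1 = 1" "eta n$1$2 = n 1" "eta n$1$3 = n 2" "eta n$1$4 = n 1 * n 5 + n 4"
 "eta n$2$1 = 0" "eta n$2$2 = 1" "eta n$2$3 = n 4" "eta n$2$4 = n 5"
 "eta n$3$1 = 0" "eta n$3$2 = 0" "eta n$3$3 = 1" "eta n$3$4 = 0"
 "eta n$4$1 = 0" "eta n$4$2 = 0" "eta n$4$3 = - n 1" "eta n$4$4 = 1" by (simp_all add: eta_def vector_4)

lemma torus_nth:
 "torus y1 y2$1$1 = y1" "torus y1 y2$1$2 = 0" "torus y1 y2$1$3 = 0" "torus y1 y2$1$4 = 0"
 "torus y1 y2$2$1 = 0" "torus y1 y2$2$2 = y2" "torus y1 y2$2$3 = 0" "torus y1 y2$2$4 = 0"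
 "torus y1 y2$3$1 = 0" "torus y1 y2$3$2 = 0" "torus y1 y2$3$3 = inverse y1" "torus y1 y2$3$4 = 0"
 "torus y1 y2$4$1 = 0" "torus y1 y2$4$2 = 0" "torus y1 y2$4$3 = 0" "torus y1 y2$4$4 = inverse y2" by (simp_all add: torus_def vector_4)

lemma mat_4_nth:
 "(mat 1 :: real^4^4)$1$1 = 1" "(mat 1 :: real^4^4)$1$2 = 0" "(mat 1 :: real^4^4)$1$3 = 0" "(mat 1 :: real^4^4)$1$4 = 0"
 "(mat 1 :: real^4^4)$2$1 = 0" "(mat 1 :: real^4^4)$2$2 = 1" "(mat 1 :: real^4^4)$2$3 = 0" "(mat 1 :: real^4^4)$2$4 = 0"
 "(mat 1 :: real^4^4)$3$1 = 0" "(mat 1 :: real^4^4)$3$2 = 0" "(mat 1 :: real^4^4)$3$3 = 1" "(mat 1 :: real^4^4)$3$4 = 0"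
 "(mat 1 :: real^4^4)$4$1 = 0" "(mat 1 :: real^4^4)$4$2 = 0" "(mat 1 :: real^4^4)$4$3 = 0" "(mat 1 :: real^4^4)$4$4 = 1" by (simp_all add: mat_def)

lemma mat4_eq_iff: "A = B \<longleftrightarrow>
  A$1$1 = B$1$1 \<and> A$1$2 = B$1$2 \<and> A$1$3 = B$1$3 \<and> A$1$4 = B$1$4 \<and>
  A$2$1 = B$2$1 \<and> A$2$2 = B$2$2 \<and> A$2$3 = B$2$3 \<and> A$2$4 = B$2$4 \<and>
  A$3$1 = B$3$1 \<and> A$3$2 = B$3$2 \<and> A$3$3 = B$3$3 \<and> A$3$4 = B$3$4 \<and>
  A$4$1 = B$4$1 \<and> A$4$2 = B$4$2 \<and> A$4$3 = B$4$3 \<and> A$4$4 = B$4$4"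
 for A B :: "real^4^4" by (auto simp: vec_eq_iff forall_4)

section \<open>The symplectic group\<close>

abbreviation "Jt \<equiv> transpose J"

lemma Jt_J: "Jt ** J = mat 1" "J ** Jt = mat 1" by (simp_all add: mat4_eq_iff matrix_mult_4 transpose_nth J_nth mat_4_nth)

definition sinv :: "real^4^4 => real^4^4" where "sinv g = Jt ** transpose g ** J"

lemma Sp4R_iff: "g \<in> Sp4R \<longleftrightarrow> transpose g ** J ** g = J"
proof
 assume "transpose g ** J ** g = J"
 hence "sinv g ** g = mat 1" unfolding sinv_def matrix_mul_assoc[symmetric] by (simp add: Jt_J)
 hence "invertible g" using invertible_left_inverse by blast
 thus "g \<in> Sp4R" using \<open>transpose g ** J ** g = J\<close> by (simp add: Sp4R_def)
qed (simp add: Sp4R_def)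

lemma sinv:
 assumes "g \<in> Sp4R"
 shows "sinv g ** g = mat 1" "g ** sinv g = mat 1"
proof -
 show 1: "sinv g ** g = mat 1" using assms unfolding Sp4R_iff sinv_def matrix_mul_assoc[symmetric] by (simp add: Jt_J)
 thus "g ** sinv g = mat 1" by (simp add: matrix_left_right_inverse)
qed

lemma Sp4R_transpose:
 assumes "g \<in> Sp4R"
 shows "g ** J ** transpose g = J"
proof -
 have "g ** sinv g ** Jt = Jt" using sinv(2)[OF assms] by simp
 hence "g ** Jt ** transpose g = Jt" unfolding sinv_def matrix_mul_assoc[symmetric] by (simp add: Jt_J)
 hence "transpose (g ** Jt ** transpose g) = J" by simp
 thus ?thesis by (simp add: matrix_transpose_mul matrix_mul_assoc)
qed

lemma Sp4R_mult: "g \<in> Sp4R ==> h \<in> Sp4R ==> g ** h \<in> Sp4R"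
proof -
 assume g: "g \<in> Sp4R" and h: "h \<in> Sp4R"
 have "transpose (g ** h) ** J ** (g ** h) = transpose h ** (transpose g ** J ** g) ** h" by (simp only: matrix_transpose_mul matrix_mul_assoc)
 thus ?thesis using g h by (simp add: Sp4R_iff)
qed

lemma Sp4R_sinv: "g \<in> Sp4R ==> sinv g \<in> Sp4R"
proof -
 assume g: "g \<in> Sp4R"
 have "transpose (sinv g) ** J ** sinv g = Jt ** g ** (J ** (J ** Jt)) ** transpose g ** J"
  by (simp only: sinv_def matrix_transpose_mul matrix_mul_assoc transpose_transpose)
 also have "\<dots> = Jt ** (g ** J ** transpose g) ** J" by (simp only: Jt_J matrix_mul_rid matrix_mul_assoc)
 also have "\<dots> = J" unfolding Sp4R_transpose[OF g] by (simp add: Jt_J)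
 finally show ?thesis by (simp add: Sp4R_iff)
qed

lemma eta_Sp4R: "eta n \<in> Sp4R"
 unfolding Sp4R_iff mat4_eq_iff matrix_mult_4 transpose_nth J_nth eta_nth by (simp add: algebra_simps)

lemma Sp4R_form:
 assumes "g \<in> Sp4R"
 shows "g$i$1 * g$j$3 + g$i$2 * g$j$4 - g$i$3 * g$j$1 - g$i$4 * g$j$2 = J $ i $ j"
proof -
 have "(g ** J ** transpose g) $ i $ j = J $ i $ j" using Sp4R_transpose[OF assms] by simp
 thus ?thesis unfolding matrix_mult_4 transpose_nth J_nth by (simp add: algebra_simps)
qed

section \<open>The Iwasawa decomposition\<close>

lemma K_facts:
 assumes "k \<in> K"
 shows "k ** transpose k = mat 1" "k ** J ** transpose k = J"
proof -
 obtain A B where k: "k = block A B (- B) A" and u: "(\<chi> i j. Complex (A $ i $ j) (B $ i $ j)) \<in> U2"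
  using assms unfolding K_def by blast
 define M where "M = (\<chi> i j. Complex (A $ i $ j) (B $ i $ j))"
 have "(M ** (\<chi> i j. cnj (M $ j $ i))) $ i $ j = mat 1 $ i $ j" for i j
  using u by (simp add: U2_def M_def)
 hence e: "M$i$1 * cnj (M$j$1) + M$i$2 * cnj (M$j$2) = mat 1 $ i $ j" for i j by (simp add: matrix_matrix_mult_def sum_2)
 have r: "A$i$1 * A$j$1 + B$i$1 * B$j$1 + A$i$2 * A$j$2 + B$i$2 * B$j$2 = (if i = j then 1 else 0)"
  "B$i$1 * A$j$1 - A$i$1 * B$j$1 + B$i$2 * A$j$2 - A$i$2 * B$j$2 = 0" for i j
  using e[of i j] by (auto simp: M_def mat_def complex_eq_iff split: if_splits)
 have r1: "A$i$1 * A$i$1 + B$i$1 * B$i$1 + A$i$2 * A$i$2 + B$i$2 * B$i$2 = 1" for i using r(1)[of i i] by simp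
 have r2: "A$1$1 * A$2$1 + B$1$1 * B$2$1 + A$1$2 * A$2$2 + B$1$2 * B$2$2 = 0" using r(1)[of 1 2] by simp
 note r' = r1[of 1] r1[of 2] r2 r(2)[of 1 2]
 show "k ** transpose k = mat 1"
  unfolding k mat4_eq_iff matrix_mult_4 transpose_nth mat_4_nth block_def vector_4
  by (intro conjI) (use r' in \<open>simp_all only: vector_uminus_component\<close>, ((simp add: algebra_simps; fail) | linarith | algebra)+)
 show "k ** J ** transpose k = J"
  unfolding k mat4_eq_iff matrix_mult_4 transpose_nth J_nth block_def vector_4
  by (intro conjI) (use r' in \<open>simp_all only: vector_uminus_component\<close>, ((simp add: algebra_simps; fail) | linarith | algebra)+)
qed

lemma K_from_rows:
 fixes u1 u2 u3 u4 v1 v2 v3 v4 :: real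
 assumes "u1\<^sup>2 + u2\<^sup>2 + u3\<^sup>2 + u4\<^sup>2 = 1" "v1\<^sup>2 + v2\<^sup>2 + v3\<^sup>2 + v4\<^sup>2 = 1"
  "u1 * v1 + u2 * v2 + u3 * v3 + u4 * v4 = 0" "u1 * v3 + u2 * v4 - u3 * v1 - u4 * v2 = 0"
 shows "vector [vector [u3, u4, - u1, - u2], vector [v3, v4, - v1, - v2], vector [u1, u2, u3, u4], vector [v1, v2, v3, v4]] \<in> K"
proof -
 define A :: "real^2^2" where "A = vector [vector [u3, u4], vector [v3, v4]]"
 define B :: "real^2^2" where "B = vector [vector [- u1, - u2], vector [- v1, - v2]]"
 have "(\<chi> i j. Complex (A $ i $ j) (B $ i $ j)) \<in> U2"
  unfolding U2_def mem_Collect_eq vec_eq_iff forall_2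
  using assms by (simp add: matrix_matrix_mult_def sum_2 A_def B_def mat_def complex_eq_iff power2_eq_square algebra_simps)
 moreover have "vector [vector [u3, u4, - u1, - u2], vector [v3, v4, - v1, - v2], vector [u1, u2, u3, u4], vector [v1, v2, v3, v4]]
   = block A B (- B) A"
  unfolding block_def by (simp add: A_def B_def)
 ultimately show ?thesis unfolding K_def by blast
qed

definition dot :: "real^4^4 => 4 => 4 => real" where
 "dot g i j = g$i$1 * g$j$1 + g$i$2 * g$j$2 + g$i$3 * g$j$3 + g$i$4 * g$j$4"

lemma dot_eq: "dot g i j = (g ** transpose g) $ i $ j" by (simp add: dot_def matrix_mult_4 transpose_nth)

lemma dot_K: "k \<in> K ==> dot (g ** k) i j = dot g i j"
proof -
 assume k: "k \<in> K"
 have "g ** k ** transpose (g ** k) = g ** (k ** transpose k) ** transpose g" by (simp only: matrix_transpose_mul matrix_mul_assoc)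
 thus ?thesis unfolding dot_eq K_facts(1)[OF k] by simp
qed

lemma dot_iwasawa:
 "y1 > 0 ==> y2 > 0 ==> dot (eta n ** torus y1 y2) 3 3 = 1 / y1\<^sup>2"
 "y1 > 0 ==> y2 > 0 ==> dot (eta n ** torus y1 y2) 3 4 = - n 1 / y1\<^sup>2"
 "y1 > 0 ==> y2 > 0 ==> dot (eta n ** torus y1 y2) 4 4 = (n 1)\<^sup>2 / y1\<^sup>2 + 1 / y2\<^sup>2"
 by (simp_all add: dot_def matrix_mult_4 eta_nth torus_nth field_simps power2_eq_square)

definition gram :: "real^4^4 => real" where "gram g = dot g 3 3 * dot g 4 4 - (dot g 3 4)\<^sup>2"

lemma iwasawa_unique:
 assumes "k \<in> K" "y1 > 0" "y2 > 0" "g = eta n ** torus y1 y2 ** k"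
 shows "y1 = 1 / sqrt (dot g 3 3)" "y2 = sqrt (dot g 3 3) / sqrt (gram g)" "dot g 3 3 > 0" "gram g > 0"
proof -
 have d: "dot g 3 3 = 1 / y1\<^sup>2" "dot g 3 4 = - n 1 / y1\<^sup>2" "dot g 4 4 = (n 1)\<^sup>2 / y1\<^sup>2 + 1 / y2\<^sup>2"
  unfolding assms(4) dot_K[OF assms(1)] by (rule dot_iwasawa[OF assms(2,3)])+
 have G: "gram g = 1 / (y1 * y2)\<^sup>2"
  unfolding gram_def d using assms(2,3) by (simp add: field_simps power2_eq_square)
 show "y1 = 1 / sqrt (dot g 3 3)" unfolding d using assms by (simp add: real_sqrt_divide)
 show "y2 = sqrt (dot g 3 3) / sqrt (gram g)" unfolding d G using assms by (simp add: real_sqrt_divide)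
 show "dot g 3 3 > 0" "gram g > 0" unfolding d G using assms by auto
qed

lemma iwasawa_exists:
 assumes g: "g \<in> Sp4R"
 shows "\<exists>n y1 y2 k. y1 > 0 \<and> y2 > 0 \<and> k \<in> K \<and> g = eta n ** torus y1 y2 ** k"
proof -
 define N where "N = dot g 3 3"
 have sq: "N = (g$3$1)\<^sup>2 + (g$3$2)\<^sup>2 + (g$3$3)\<^sup>2 + (g$3$4)\<^sup>2" by (simp add: N_def dot_def power2_eq_square)
 have N: "N > 0"
 proof (rule ccontr)
  assume "\<not> N > 0"
  hence "(g$3$1)\<^sup>2 + (g$3$2)\<^sup>2 + (g$3$3)\<^sup>2 + (g$3$4)\<^sup>2 \<le> 0" using sq by simp
  hence "g$3$1 = 0" "g$3$2 = 0" "g$3$3 = 0" "g$3$4 = 0"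
   using zero_le_power2[of "g$3$1"] zero_le_power2[of "g$3$2"] zero_le_power2[of "g$3$3"] zero_le_power2[of "g$3$4"]
   by (smt (verit) power2_eq_square zero_less_mult_iff mult_neg_neg)+
  thus False using Sp4R_form[OF g, of 1 3] by (simp add: J_nth)
 qed
 define y1 where "y1 = 1 / sqrt N"
 have y1: "y1 > 0" "y1\<^sup>2 * N = 1" using N by (auto simp: y1_def power_divide)
 define n1 where "n1 = - dot g 3 4 / N"
 define c where "c = (\<lambda>j. g$4$j + n1 * g$3$j)"
 have c0: "c 1 * g$3$1 + c 2 * g$3$2 + c 3 * g$3$3 + c 4 * g$3$4 = 0"
 proof -
  have "c 1 * g$3$1 + c 2 * g$3$2 + c 3 * g$3$3 + c 4 * g$3$4 = dot g 3 4 + n1 * N"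
   unfolding sq by (simp add: c_def dot_def power2_eq_square algebra_simps)
  thus ?thesis using N by (simp add: n1_def)
 qed
 define M where "M = (c 1)\<^sup>2 + (c 2)\<^sup>2 + (c 3)\<^sup>2 + (c 4)\<^sup>2"
 have om: "g$2$1 * c 3 + g$2$2 * c 4 - g$2$3 * c 1 - g$2$4 * c 2 = 1"
  using Sp4R_form[OF g, of 2 4] Sp4R_form[OF g, of 2 3]
  by (simp add: c_def J_nth algebra_simps) (smt (verit) distrib_left mult.assoc mult.commute mult_zero_right)
 have M: "M > 0"
 proof (rule ccontr)
  assume "\<not> M > 0"
  hence "c 1 = 0" "c 2 = 0" "c 3 = 0" "c 4 = 0"
   unfolding M_def using zero_le_power2[of "c 1"] zero_le_power2[of "c 2"] zero_le_power2[of "c 3"] zero_le_power2[of "c 4"]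
   by (smt (verit) power2_eq_square zero_less_mult_iff mult_neg_neg)+
  thus False using om by simp
 qed
 define y2 where "y2 = 1 / sqrt M"
 have y2: "y2 > 0" "y2\<^sup>2 * M = 1" using M by (auto simp: y2_def power_divide)
 define u where "u = (\<lambda>j. y1 * g$3$j)"
 define v where "v = (\<lambda>j. y2 * c j)"
 have uu: "(u 1)\<^sup>2 + (u 2)\<^sup>2 + (u 3)\<^sup>2 + (u 4)\<^sup>2 = 1"
  using y1(2) unfolding sq by (simp add: u_def power_mult_distrib distrib_left)
 have vv: "(v 1)\<^sup>2 + (v 2)\<^sup>2 + (v 3)\<^sup>2 + (v 4)\<^sup>2 = 1"
  using y2(2) unfolding M_def by (simp add: v_def power_mult_distrib distrib_left)
 have uv: "u 1 * v 1 + u 2 * v 2 + u 3 * v 3 + u 4 * v 4 = 0"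
 proof -
  have "u 1 * v 1 + u 2 * v 2 + u 3 * v 3 + u 4 * v 4 = y1 * y2 * (c 1 * g$3$1 + c 2 * g$3$2 + c 3 * g$3$3 + c 4 * g$3$4)"
   by (simp add: u_def v_def algebra_simps)
  thus ?thesis unfolding c0 by simp
 qed
 have "u 1 * v 3 + u 2 * v 4 - u 3 * v 1 - u 4 * v 2
   = y1 * y2 * (g$3$1 * g$4$3 + g$3$2 * g$4$4 - g$3$3 * g$4$1 - g$3$4 * g$4$2)" by (simp add: u_def v_def c_def algebra_simps)
 hence uJv: "u 1 * v 3 + u 2 * v 4 - u 3 * v 1 - u 4 * v 2 = 0"
  unfolding Sp4R_form[OF g] by (simp add: J_nth)
 define k :: "real^4^4" where "k = vector [vector [u 3, u 4, - u 1, - u 2], vector [v 3, v 4, - v 1, - v 2], vector [u 1, u 2, u 3, u 4], vector [v 1, v 2, v 3, v 4]]"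
 have k: "k \<in> K" unfolding k_def by (rule K_from_rows[OF uu vv uv uJv])
 define h where "h = g ** transpose k"
 have "transpose k ** k = mat 1" using K_facts(1)[OF k] by (simp add: matrix_left_right_inverse)
 hence gh: "g = h ** k" unfolding h_def by (simp add: matrix_mul_assoc[symmetric])
 have hJ: "h ** J ** transpose h = J"
 proof -
  have tk: "transpose k ** J ** k = J"
   using \<open>k \<in> K\<close> Sp4R_iff Sp4R_transpose K_facts(2)[OF k]
  proof -
   have "transpose (transpose k) ** J ** transpose k = J" using K_facts(2)[OF k] by simp
   hence "transpose k \<in> Sp4R" by (simp only: Sp4R_iff)
   from Sp4R_transpose[OF this] show ?thesis by simp
  qed
  have "h ** J ** transpose h = g ** (transpose k ** J ** k) ** transpose g"
   by (simp only: h_def matrix_transpose_mul matrix_mul_assoc transpose_transpose)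
  thus ?thesis unfolding tk Sp4R_transpose[OF g] .
 qed
 have f: "h$i$1 * h$j$3 + h$i$2 * h$j$4 - h$i$3 * h$j$1 - h$i$4 * h$j$2 = J $ i $ j" for i j
 proof -
  have "(h ** J ** transpose h) $ i $ j = J $ i $ j" using hJ by simp
  thus ?thesis unfolding matrix_mult_4 transpose_nth J_nth by (simp add: algebra_simps)
 qed
 have r3: "g$3$j = u j / y1" for j using y1 by (simp add: u_def)
 have r4: "g$4$j = v j / y2 - n1 * u j / y1" for j using y1 y2 by (simp add: u_def v_def c_def)
 have hr: "h$i$1 = g$i$1 * u 3 + g$i$2 * u 4 - g$i$3 * u 1 - g$i$4 * u 2"
  "h$i$2 = g$i$1 * v 3 + g$i$2 * v 4 - g$i$3 * v 1 - g$i$4 * v 2"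
  "h$i$3 = g$i$1 * u 1 + g$i$2 * u 2 + g$i$3 * u 3 + g$i$4 * u 4"
  "h$i$4 = g$i$1 * v 1 + g$i$2 * v 2 + g$i$3 * v 3 + g$i$4 * v 4" for i by (simp_all add: h_def matrix_mult_4 transpose_nth k_def vector_4)
 have h3: "h$3$1 = 0" "h$3$2 = 0" "h$3$3 = 1 / y1" "h$3$4 = 0"
 proof -
  have "h$3$1 = (u 1 * u 3 + u 2 * u 4 - u 3 * u 1 - u 4 * u 2) / y1" unfolding hr r3 by (simp add: add_divide_distrib diff_divide_distrib)
  thus "h$3$1 = 0" by simp
  have "h$3$2 = (u 1 * v 3 + u 2 * v 4 - u 3 * v 1 - u 4 * v 2) / y1" unfolding hr r3 by (simp add: add_divide_distrib diff_divide_distrib)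
  thus "h$3$2 = 0" unfolding uJv by simp
  have "h$3$3 = ((u 1)\<^sup>2 + (u 2)\<^sup>2 + (u 3)\<^sup>2 + (u 4)\<^sup>2) / y1" unfolding hr r3 by (simp add: add_divide_distrib power2_eq_square)
  thus "h$3$3 = 1 / y1" unfolding uu .
  have "h$3$4 = (u 1 * v 1 + u 2 * v 2 + u 3 * v 3 + u 4 * v 4) / y1" unfolding hr r3 by (simp add: add_divide_distrib)
  thus "h$3$4 = 0" unfolding uv by simp
 qed
 have h4: "h$4$1 = 0" "h$4$2 = 0" "h$4$3 = - n1 / y1" "h$4$4 = 1 / y2"
 proof -
  have "h$4$1 = - (u 1 * v 3 + u 2 * v 4 - u 3 * v 1 - u 4 * v 2) / y2 - n1 / y1 * (u 1 * u 3 + u 2 * u 4 - u 3 * u 1 - u 4 * u 2)"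
   unfolding hr r4 using y1 y2 by (simp add: field_simps)
  thus "h$4$1 = 0" unfolding uJv by simp
  have "h$4$2 = (v 1 * v 3 + v 2 * v 4 - v 3 * v 1 - v 4 * v 2) / y2 - n1 / y1 * (u 1 * v 3 + u 2 * v 4 - u 3 * v 1 - u 4 * v 2)"
   unfolding hr r4 using y1 y2 by (simp add: field_simps)
  thus "h$4$2 = 0" unfolding uJv by simp
  have "h$4$3 = (u 1 * v 1 + u 2 * v 2 + u 3 * v 3 + u 4 * v 4) / y2 - n1 / y1 * ((u 1)\<^sup>2 + (u 2)\<^sup>2 + (u 3)\<^sup>2 + (u 4)\<^sup>2)"
   unfolding hr r4 using y1 y2 by (simp add: field_simps power2_eq_square)
  thus "h$4$3 = - n1 / y1" unfolding uu uv by simp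
  have "h$4$4 = ((v 1)\<^sup>2 + (v 2)\<^sup>2 + (v 3)\<^sup>2 + (v 4)\<^sup>2) / y2 - n1 / y1 * (u 1 * v 1 + u 2 * v 2 + u 3 * v 3 + u 4 * v 4)"
   unfolding hr r4 using y1 y2 by (simp add: field_simps power2_eq_square)
  thus "h$4$4 = 1 / y2" unfolding vv uv by simp
 qed
 define n where "n = (\<lambda>i::nat. if i = 1 then n1 else if i = 2 then h$1$3 * y1 else if i = 4 then h$2$3 * y1 else h$2$4 * y2)"
 have h1: "h$1$1 = y1" using f[of 1 3] y1 by (simp add: h3 J_nth field_simps)
 have h2: "h$1$2 = n1 * y2" using f[of 1 4] y1 y2 by (simp add: h4 h1 J_nth field_simps)
 have h21: "h$2$1 = 0" using f[of 2 3] y1 by (simp add: h3 J_nth field_simps)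
 have h22: "h$2$2 = y2" using f[of 2 4] y1 y2 by (simp add: h4 h21 J_nth field_simps)
 have h14: "h$1$4 * y2 = y1 * h$2$3 + n1 * y2 * h$2$4" using f[of 1 2] by (simp add: h1 h2 h21 h22 J_nth)
 have "h = eta n ** torus y1 y2"
  unfolding mat4_eq_iff matrix_mult_4 eta_nth torus_nth
  using y1 y2 h14 by (simp add: h1 h2 h21 h22 h3 h4 n_def field_simps)
 thus ?thesis using y1(1) y2(1) k gh by blast
qed

theorem iwasawa_y_eq:
 assumes g: "g \<in> Sp4R"
 shows "iwasawa_y g = (1 / sqrt (dot g 3 3), sqrt (dot g 3 3) / sqrt (gram g))" (is ?g1) "dot g 3 3 > 0" "gram g > 0"
proof -
 obtain n y1 y2 k where k: "y1 > 0" "y2 > 0" "k \<in> K" "g = eta n ** torus y1 y2 ** k"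
  using iwasawa_exists[OF g] by blast
 note u = iwasawa_unique[OF k(3,1,2,4)]
 show "dot g 3 3 > 0" "gram g > 0" by (rule u)+
 show ?g1
  unfolding iwasawa_y_def
 proof (rule the_equality)
  have "eta n \<in> U" by (simp add: U_def)
  thus "0 < fst (1 / sqrt (dot g 3 3), sqrt (dot g 3 3) / sqrt (gram g)) \<and> 0 < snd (1 / sqrt (dot g 3 3), sqrt (dot g 3 3) / sqrt (gram g)) \<and>
   (\<exists>u\<in>U. \<exists>k\<in>K. g = u ** torus (fst (1 / sqrt (dot g 3 3), sqrt (dot g 3 3) / sqrt (gram g))) (snd (1 / sqrt (dot g 3 3), sqrt (dot g 3 3) / sqrt (gram g))) ** k)"
   unfolding fst_conv snd_conv u(1,2)[symmetric] using k by blast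
 next
  fix y assume a: "0 < fst y \<and> 0 < snd y \<and> (\<exists>u\<in>U. \<exists>k\<in>K. g = u ** torus (fst y) (snd y) ** k)"
  then obtain n' k' where "k' \<in> K" "g = eta n' ** torus (fst y) (snd y) ** k'" unfolding U_def by blast
  from iwasawa_unique(1,2)[OF this(1) _ _ this(2)] a
  show "y = (1 / sqrt (dot g 3 3), sqrt (dot g 3 3) / sqrt (gram g))" by (metis prod.collapse)
 qed
qed

lemma I_beta_eq: "g \<in> Sp4R ==> I_beta g \<nu> = of_real (dot g 3 3) powr (- ((\<nu> + 2) / 2))"
proof -
 assume g: "g \<in> Sp4R"
 note i = iwasawa_y_eq[OF g]
 have "I_beta g \<nu> = of_real (1 / sqrt (dot g 3 3)) powr (\<nu> + 2)" by (simp add: I_beta_def i)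
 also have "1 / sqrt (dot g 3 3) = exp (- ln (dot g 3 3) / 2)"
 proof -
  have "exp (ln (dot g 3 3) / 2) = sqrt (dot g 3 3)" using i(2) by (simp flip: ln_sqrt)
  thus ?thesis by (simp add: exp_minus inverse_eq_divide)
 qed
 also have "of_real (exp (- ln (dot g 3 3) / 2)) powr (\<nu> + 2) = exp ((\<nu> + 2) * of_real (- ln (dot g 3 3) / 2))"
  unfolding powr_def by (simp only: Ln_of_real[OF exp_gt_zero] ln_exp) simp
 also have "\<dots> = of_real (dot g 3 3) powr (- ((\<nu> + 2) / 2))"
  unfolding powr_def using i(2) by (simp add: Ln_of_real[OF i(2)])
 finally show ?thesis .
qed

section \<open>Cosets and primitive vectors\<close>

lemma Sp4Z_mult: "g \<in> Sp4Z ==> h \<in> Sp4Z ==> g ** h \<in> Sp4Z"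
 unfolding Sp4Z_def using Sp4R_mult by (auto simp: matrix_mult_4)

lemma J_Ints: "J $ i $ j \<in> \<int>"
proof -
 have "\<forall>i j. J $ i $ j \<in> \<int>" unfolding forall_4 J_nth by simp
 thus ?thesis by blast
qed

lemma Sp4Z_sinv: "g \<in> Sp4Z ==> sinv g \<in> Sp4Z"
 unfolding Sp4Z_def using Sp4R_sinv by (auto simp: sinv_def matrix_mult_4 transpose_nth J_Ints)

type_synonym ivec = "int \<times> int \<times> int \<times> int"

definition row3 :: "real^4^4 => ivec" where
 "row3 g = (\<lfloor>g$3$1\<rfloor>, \<lfloor>g$3$2\<rfloor>, \<lfloor>g$3$4\<rfloor>, \<lfloor>g$3$3\<rfloor>)"

definition smul :: "int => ivec => ivec" where
 "smul k = (\<lambda>(a, b, d, c). (k * a, k * b, k * d, k * c))"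

definition gcd4 :: "ivec => int" where
 "gcd4 = (\<lambda>(a, b, d, c). gcd (gcd a c) (gcd b d))"

lemma row3_iff: "g \<in> Sp4Z ==> row3 g = (a, b, d, c) \<longleftrightarrow>
  g$3$1 = of_int a \<and> g$3$2 = of_int b \<and> g$3$4 = of_int d \<and> g$3$3 = of_int c"
 unfolding row3_def Sp4Z_def by (auto simp: floor_unique elim!: Ints_cases)

lemma gcd4_dvd: "gcd4 (a, b, d, c) dvd a" "gcd4 (a, b, d, c) dvd b" "gcd4 (a, b, d, c) dvd d" "gcd4 (a, b, d, c) dvd c"
 unfolding gcd4_def prod.case
 by (rule dvd_trans[OF gcd_dvd1 gcd_dvd1] dvd_trans[OF gcd_dvd2 gcd_dvd1] dvd_trans[OF gcd_dvd2 gcd_dvd2] dvd_trans[OF gcd_dvd1 gcd_dvd2])+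

lemma gcd4_smul: "gcd4 (smul k v) = \<bar>k\<bar> * gcd4 v" by (cases v) (simp add: gcd4_def smul_def gcd_mult_distrib_int[symmetric])

lemma smul_smul: "smul k (smul l v) = smul (k * l) v" "smul 1 v = v" by (cases v; simp add: smul_def)+

lemma smul_cancel: "k \<noteq> 0 ==> smul k v = smul k w ==> v = w" by (cases v; cases w) (simp add: smul_def)

lemma gcd4_row3:
 assumes "g \<in> Sp4Z"
 shows "gcd4 (row3 g) = 1"
proof -
 obtain a b d c where r: "row3 g = (a, b, d, c)" by (cases "row3 g")
 have e: "g$3$1 = of_int a" "g$3$2 = of_int b" "g$3$4 = of_int d" "g$3$3 = of_int c"
  using r unfolding row3_iff[OF assms] by auto
 define x where "x = (\<lambda>j. \<lfloor>g$1$j\<rfloor>)"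
 have x: "g$1$j = of_int (x j)" for j
 proof -
  have "g$1$j \<in> \<int>" using assms by (simp add: Sp4Z_def)
  thus ?thesis unfolding x_def by (rule Ints_cases) simp
 qed
 have "g \<in> Sp4R" using assms by (simp add: Sp4Z_def)
 from Sp4R_form[OF this, of 1 3] have "of_int (x 1 * c + x 2 * d - x 3 * a - x 4 * b) = (1::real)" by (simp add: e x J_nth)
 hence 1: "x 1 * c + x 2 * d - x 3 * a - x 4 * b = 1" by linarith
 have "gcd4 (row3 g) dvd x 1 * c + x 2 * d - x 3 * a - x 4 * b"
  unfolding r by (rule dvd_diff[OF dvd_diff[OF dvd_add[OF dvd_mult[OF gcd4_dvd(4)] dvd_mult[OF gcd4_dvd(3)]] dvd_mult[OF gcd4_dvd(1)]] dvd_mult[OF gcd4_dvd(2)]])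
 moreover have "gcd4 (row3 g) \<ge> 0" unfolding r gcd4_def by simp
 ultimately show ?thesis unfolding 1 by simp
qed

lemma sl2_column:
 fixes a c :: int
 shows "\<exists>p q r s. p * s - q * r = 1 \<and> a = gcd a c * r \<and> c = gcd a c * s"
proof (cases "gcd a c = 0")
 case True
 hence "1 * 1 - 0 * 0 = (1::int) \<and> a = gcd a c * 0 \<and> c = gcd a c * 1" by simp
 thus ?thesis by blast
next
 case False
 obtain u v where uv: "u * a + v * c = gcd a c" using bezout_int by blast
 define r s where "r = a div gcd a c" and "s = c div gcd a c"
 have rs: "a = gcd a c * r" "c = gcd a c * s" by (simp_all add: r_def s_def)
 have "gcd a c * (u * r + v * s) = u * (gcd a c * r) + v * (gcd a c * s)" by (simp add: algebra_simps)
 also have "\<dots> = gcd a c * 1" using uv rs by simp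
 finally have "v * s - (- u) * r = 1" using False by (simp only: mult_cancel_left) simp
 thus ?thesis using rs by blast
qed

lemma primitive_is_row:
 assumes "gcd4 v = 1"
 shows "\<exists>g\<in>Sp4Z. row3 g = v"
proof -
 obtain a b d c where v: "v = (a, b, d, c)" by (cases v)
 obtain p q r s where 1: "p * s - q * r = 1" "a = gcd a c * r" "c = gcd a c * s" using sl2_column by blast
 obtain p' q' r' s' where 2: "p' * s' - q' * r' = 1" "b = gcd b d * r'" "d = gcd b d * s'" using sl2_column by blast
 define e f where "e = gcd a c" and "f = gcd b d"
 have "gcd e f = 1" using assms by (simp add: v gcd4_def e_def f_def)
 then obtain y x where yx: "y * e + x * f = 1" using bezout_int[of e f] by auto
 define L :: "real^4^4" where "L = vector [vector [of_int y, of_int x, 0, 0], vector [- of_int f, of_int e, 0, 0],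
   vector [0, 0, of_int e, of_int f], vector [0, 0, - of_int x, of_int y]]"
 define S :: "real^4^4" where "S = vector [vector [of_int p, 0, of_int q, 0], vector [0, of_int p', 0, of_int q'],
   vector [of_int r, 0, of_int s, 0], vector [0, of_int r', 0, of_int s']]"
 have R: "real_of_int p * of_int s - of_int q * of_int r = 1" "real_of_int p' * of_int s' - of_int q' * of_int r' = 1"
  "real_of_int y * of_int e + of_int x * of_int f = 1"
  using 1(1) 2(1) yx by (metis of_int_1 of_int_add of_int_diff of_int_mult)+
 have "L \<in> Sp4R"
  unfolding Sp4R_iff mat4_eq_iff matrix_mult_4 transpose_nth J_nth L_def vector_4 by (intro conjI; use R in \<open>simp add: algebra_simps\<close>)
 moreover have "S \<in> Sp4R"
  unfolding Sp4R_iff mat4_eq_iff matrix_mult_4 transpose_nth J_nth S_def vector_4 by (intro conjI; use R in \<open>simp add: algebra_simps\<close>)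
 ultimately have "L \<in> Sp4Z" "S \<in> Sp4Z"
  unfolding Sp4Z_def forall_4 mem_Collect_eq by (simp_all add: L_def S_def vector_4)
 hence LS: "L ** S \<in> Sp4Z" by (rule Sp4Z_mult)
 have "row3 (L ** S) = (a, b, d, c)"
  unfolding row3_iff[OF LS]
 proof (intro conjI)
  have ac: "real_of_int a = of_int e * of_int r" "real_of_int c = of_int e * of_int s"
   "real_of_int b = of_int f * of_int r'" "real_of_int d = of_int f * of_int s'"
   using 1(2,3) 2(2,3) unfolding e_def f_def by (metis of_int_mult)+
  show "(L ** S) $ 3 $ 1 = of_int a" "(L ** S) $ 3 $ 2 = of_int b" "(L ** S) $ 3 $ 4 = of_int d" "(L ** S) $ 3 $ 3 = of_int c"
   unfolding ac by (simp_all add: matrix_mult_4 L_def S_def vector_4)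
 qed
 thus ?thesis using LS v by blast
qed

lemma rel_iff:
 assumes g: "g \<in> Sp4Z" and h: "h \<in> Sp4Z"
 shows "(g, h) \<in> P_beta_Z_rel \<longleftrightarrow> row3 h = row3 g \<or> row3 h = smul (-1) (row3 g)"
proof
 obtain a b d c where r: "row3 g = (a, b, d, c)" by (cases "row3 g")
 hence e: "g$3$1 = of_int a" "g$3$2 = of_int b" "g$3$4 = of_int d" "g$3$3 = of_int c" unfolding row3_iff[OF g] by auto
 assume "(g, h) \<in> P_beta_Z_rel"
 then obtain p where p: "p \<in> P_beta" "p \<in> Sp4Z" "h = p ** g" unfolding P_beta_Z_rel_def by auto
 have z: "p$3$1 = 0" "p$3$2 = 0" "p$3$4 = 0" "p \<in> Sp4R" using p(1) by (auto simp: P_beta_def)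
 have "p$1$1 * p$3$3 = 1" using Sp4R_form[OF z(4), of 1 3] by (simp add: z J_nth)
 moreover obtain i j where ij: "p$1$1 = of_int i" "p$3$3 = of_int j" using p(2) unfolding Sp4Z_def by (metis (mono_tags, lifting) Ints_cases mem_Collect_eq)
 ultimately have "of_int (i * j) = (1::real)" by simp
 hence "i * j = 1" by linarith
 hence "j = 1 \<or> j = -1" using zmult_eq_1_iff by blast
 moreover have "h$3$i = of_int j * g$3$i" for i unfolding p(3) by (simp add: matrix_mult_4 z ij)
 hence "row3 h = smul j (row3 g)" unfolding r smul_def prod.case row3_iff[OF h] by (simp add: e)
 ultimately show "row3 h = row3 g \<or> row3 h = smul (-1) (row3 g)" by (auto simp: smul_smul)
next
 assume "row3 h = row3 g \<or> row3 h = smul (-1) (row3 g)"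
 then obtain j where j: "j = 1 \<or> j = -1" "row3 h = smul j (row3 g)" by (metis smul_smul(2))
 obtain a b d c where r: "row3 g = (a, b, d, c)" by (cases "row3 g")
 hence e: "g$3$1 = of_int a" "g$3$2 = of_int b" "g$3$4 = of_int d" "g$3$3 = of_int c" unfolding row3_iff[OF g] by auto
 have hr: "h$3$1 = of_int j * g$3$1" "h$3$2 = of_int j * g$3$2" "h$3$3 = of_int j * g$3$3" "h$3$4 = of_int j * g$3$4"
  using j(2) unfolding r smul_def prod.case row3_iff[OF h] by (simp_all add: e)
 have gR: "g \<in> Sp4R" using g by (simp add: Sp4Z_def)
 define p where "p = h ** sinv g"
 have pZ: "p \<in> Sp4Z" unfolding p_def by (intro Sp4Z_mult Sp4Z_sinv g h)
 hence pR: "p \<in> Sp4R" by (simp add: Sp4Z_def)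
 have "h = p ** g" unfolding p_def by (simp add: matrix_mul_assoc[symmetric] sinv[OF gR])
 have p3: "p$3$i = of_int j * mat 1 $ 3 $ i" for i
 proof -
  have "p$3$i = of_int j * (g ** sinv g) $ 3 $ i" unfolding p_def by (simp add: matrix_mult_4 hr algebra_simps)
  thus ?thesis by (simp add: sinv[OF gR])
 qed
 have z: "p$3$1 = 0" "p$3$2 = 0" "p$3$4 = 0" "p$3$3 = of_int j" by (simp_all add: p3 mat_4_nth)
 have "p$2$1 = 0" "p$4$1 = 0"
  using Sp4R_form[OF pR, of 2 3] Sp4R_form[OF pR, of 4 3] j(1) by (auto simp: z J_nth)
 hence "p \<in> P_beta" using z pR by (simp add: P_beta_def)
 thus "(g, h) \<in> P_beta_Z_rel" using pZ \<open>h = p ** g\<close> g h unfolding P_beta_Z_rel_def by blast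
qed

definition cls :: "ivec => (real^4^4) set" where
 "cls v = {h \<in> Sp4Z. row3 h = v \<or> row3 h = smul (-1) v}"

lemma cls_neg: "cls (smul (-1) v) = cls v" by (auto simp: cls_def smul_smul)

lemma quotient_cls: "Sp4Z // P_beta_Z_rel = cls ` (row3 ` Sp4Z)"
proof -
 have "P_beta_Z_rel `` {g} = cls (row3 g)" if g: "g \<in> Sp4Z" for g
 proof -
  have "(g, h) \<in> P_beta_Z_rel ==> h \<in> Sp4Z" for h by (auto simp: P_beta_Z_rel_def)
  thus ?thesis using rel_iff[OF g] by (auto simp: cls_def)
 qed
 thus ?thesis by (auto simp: quotient_def image_iff)
qed

abbreviation "cosets \<equiv> Sp4Z // P_beta_Z_rel"

definition coset_rep :: "(real^4^4) set => real^4^4" where "coset_rep C = (SOME \<gamma>. \<gamma> \<in> C)"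

lemma coset_rep:
 assumes "C \<in> cosets"
 shows "coset_rep C \<in> Sp4Z" "C = cls (row3 (coset_rep C))"
proof -
 obtain g where g: "g \<in> Sp4Z" "C = cls (row3 g)" using assms unfolding quotient_cls by blast
 have "g \<in> C" using g by (simp add: cls_def)
 hence "coset_rep C \<in> C" unfolding coset_rep_def by (rule someI)
 hence 1: "coset_rep C \<in> Sp4Z" "row3 (coset_rep C) = row3 g \<or> row3 (coset_rep C) = smul (-1) (row3 g)"
  unfolding g(2) cls_def by auto
 show "coset_rep C \<in> Sp4Z" by (rule 1)
 show "C = cls (row3 (coset_rep C))" using 1(2) g(2) cls_neg[of "row3 g"] by metis
qed

theorem coset_bij:
 "bij_betw (\<lambda>(k, C). smul k (row3 (coset_rep C))) ({k. k \<noteq> 0} \<times> cosets) (- {(0, 0, 0, 0)})"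
 unfolding bij_betw_def
proof
 have g1: "gcd4 (row3 (coset_rep C)) = 1" if "C \<in> cosets" for C by (rule gcd4_row3[OF coset_rep(1)[OF that]])
 show "inj_on (\<lambda>(k, C). smul k (row3 (coset_rep C))) ({k. k \<noteq> 0} \<times> cosets)"
 proof (rule inj_onI)
  fix x y :: "int \<times> (real^4^4) set"
  assume xy: "x \<in> {k. k \<noteq> 0} \<times> cosets" "y \<in> {k. k \<noteq> 0} \<times> cosets"
   "(\<lambda>(k, C). smul k (row3 (coset_rep C))) x = (\<lambda>(k, C). smul k (row3 (coset_rep C))) y"
  obtain k C l D where kCD: "x = (k, C)" "y = (l, D)" by (cases x; cases y)
  have kl: "k \<noteq> 0" "l \<noteq> 0" and CD: "C \<in> cosets" "D \<in> cosets"
   and eq: "smul k (row3 (coset_rep C)) = smul l (row3 (coset_rep D))"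
   using xy unfolding kCD prod.case by simp_all
  have "\<bar>k\<bar> = \<bar>l\<bar>" using arg_cong[OF eq, of gcd4] by (simp add: gcd4_smul g1 CD)
  hence "l = k \<or> l = - k" by linarith
  hence "k = l \<and> C = D"
  proof
   assume l: "l = k"
   hence "row3 (coset_rep C) = row3 (coset_rep D)" using eq smul_cancel[OF kl(1)] by simp
   thus ?thesis using coset_rep(2) CD l by metis
  next
   assume l: "l = - k"
   have "smul k (row3 (coset_rep C)) = smul k (smul (-1) (row3 (coset_rep D)))" using eq by (simp add: smul_smul l)
   hence e: "row3 (coset_rep C) = smul (-1) (row3 (coset_rep D))" using smul_cancel[OF kl(1)] by blast
   hence "C = D" using coset_rep(2) CD cls_neg by metis
   hence "smul k (row3 (coset_rep C)) = smul (- k) (row3 (coset_rep C))" using eq l by simp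
   hence "row3 (coset_rep C) = (0,0,0,0)" using kl by (cases "row3 (coset_rep C)") (simp add: smul_def)
   thus ?thesis using g1[OF CD(1)] by (simp add: gcd4_def)
  qed
  thus "x = y" by (simp add: kCD)
 qed
 show "(\<lambda>(k, C). smul k (row3 (coset_rep C))) ` ({k. k \<noteq> 0} \<times> cosets) = - {(0, 0, 0, 0)}"
 proof
  show "(\<lambda>(k, C). smul k (row3 (coset_rep C))) ` ({k. k \<noteq> 0} \<times> cosets) \<subseteq> - {(0, 0, 0, 0)}"
  proof -
   have *: False if "k \<noteq> 0" "C \<in> cosets" and eq: "smul k (row3 (coset_rep C)) = (0,0,0,0)" for k :: int and C
   proof -
    have "\<bar>k\<bar> * gcd4 (row3 (coset_rep C)) = 0" using arg_cong[OF eq, of gcd4] unfolding gcd4_smul by (simp add: gcd4_def)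
    thus False unfolding g1[OF that(2)] using that(1) by simp
   qed
   show ?thesis
   proof (rule subsetI)
    fix v assume "v \<in> (\<lambda>(k, C). smul k (row3 (coset_rep C))) ` ({k. k \<noteq> 0} \<times> cosets)"
    then obtain x where x: "x \<in> {k. k \<noteq> 0} \<times> cosets" "v = (\<lambda>(k, C). smul k (row3 (coset_rep C))) x" by (rule imageE)
    obtain k C where kC: "x = (k, C)" by (cases x)
    have "k \<noteq> 0" "C \<in> cosets" "v = smul k (row3 (coset_rep C))" using x unfolding kC prod.case by simp_all
    thus "v \<in> - {(0,0,0,0)}" using *[of k C] by (simp only: ComplI singleton_iff) blast
   qed
  qed
  show "- {(0, 0, 0, 0)} \<subseteq> (\<lambda>(k, C). smul k (row3 (coset_rep C))) ` ({k. k \<noteq> 0} \<times> cosets)"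
  proof
   fix v :: ivec assume v: "v \<in> - {(0,0,0,0)}"
   obtain a b d c where ve: "v = (a, b, d, c)" by (cases v)
   define m where "m = gcd4 v"
   have m: "m \<noteq> 0" using v unfolding m_def ve gcd4_def by auto
   have "m \<ge> 0" unfolding m_def ve gcd4_def by simp
   hence mp: "m > 0" using m by simp
   have dv: "m dvd a" "m dvd b" "m dvd d" "m dvd c"
    unfolding m_def ve by (rule gcd4_dvd)+
   define w where "w = (a div m, b div m, d div m, c div m)"
   have vw: "v = smul m w" using dv by (simp add: w_def ve smul_def)
   have "m * gcd4 w = m * 1" using gcd4_smul[of m w] mp unfolding vw[symmetric] m_def[symmetric] by simp
   hence "gcd4 w = 1" using m by (simp only: mult_cancel_left) simp
   then obtain g where g: "g \<in> Sp4Z" "row3 g = w" using primitive_is_row by blast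
   define C where "C = cls w"
   have C: "C \<in> cosets" unfolding quotient_cls C_def using g by blast
   have "coset_rep C \<in> cls w" using someI[of "\<lambda>\<gamma>. \<gamma> \<in> C" g] g unfolding coset_rep_def C_def by (simp add: cls_def)
   then consider "row3 (coset_rep C) = w" | "row3 (coset_rep C) = smul (-1) w" unfolding cls_def by blast
   thus "v \<in> (\<lambda>(k, C). smul k (row3 (coset_rep C))) ` ({k. k \<noteq> 0} \<times> cosets)"
   proof cases
    case 1
    thus ?thesis using m C vw by (intro image_eqI[of _ _ "(m, C)"]) auto
   next
    case 2
    thus ?thesis using m C vw by (intro image_eqI[of _ _ "(- m, C)"]) (auto simp: smul_smul)
   qed
  qed
 qed
qed

section \<open>The Eisenstein series as an Epstein zeta function\<close>

definition rowmat :: "ivec => real^4^4" where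
 "rowmat = (\<lambda>(a, b, d, c). vector [vector [0,0,0,0], vector [0,0,0,0], vector [of_int a, of_int b, of_int c, of_int d], vector [0,0,0,0]])"

definition qf :: "real^4^4 => ivec => real" where "qf h v = dot (rowmat v ** h) 3 3"

lemma qf_smul: "qf h (smul k v) = (of_int k)\<^sup>2 * qf h v"
 by (cases v) (simp add: qf_def dot_def matrix_mult_4 rowmat_def smul_def vector_4 power2_eq_square algebra_simps)

lemma qf_row3: "g \<in> Sp4Z ==> dot (g ** h) 3 3 = qf h (row3 g)"
proof -
 assume g: "g \<in> Sp4Z"
 obtain a b d c where r: "row3 g = (a, b, d, c)" by (cases "row3 g")
 hence e: "g$3$1 = of_int a" "g$3$2 = of_int b" "g$3$4 = of_int d" "g$3$3 = of_int c" unfolding row3_iff[OF g] by auto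
 show ?thesis unfolding r qf_def dot_def matrix_mult_4 rowmat_def prod.case vector_4 e ..
qed

lemma qf_K: "k \<in> K ==> qf (h ** k) v = qf h v"
 unfolding qf_def matrix_mul_assoc by (rule dot_K)

lemma E_beta_series_eq:
 assumes h: "h \<in> Sp4R"
 shows "E_beta_series h \<nu> = (\<Sum>\<^sub>\<infinity>C\<in>cosets. of_real (qf h (row3 (coset_rep C))) powr (- ((\<nu> + 2) / 2)))"
 unfolding E_beta_series_def
proof (rule infsum_cong)
 fix C assume C: "C \<in> cosets"
 have r: "coset_rep C \<in> Sp4Z" by (rule coset_rep[OF C])
 hence "coset_rep C ** h \<in> Sp4R" using h by (intro Sp4R_mult) (auto simp: Sp4Z_def)
 from I_beta_eq[OF this, of \<nu>] show "I_beta ((SOME \<gamma>. \<gamma> \<in> C) ** h) \<nu> = of_real (qf h (row3 (coset_rep C))) powr (- ((\<nu> + 2) / 2))"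
  unfolding qf_row3[OF r] unfolding coset_rep_def .
qed

lemma (in triangular_form) E_beta_series_epstein:
 assumes h: "h \<in> Sp4R" and qf: "qf h = Q" and \<nu>: "Re \<nu> > 2"
 shows "E_beta_series h \<nu> = of_real pi powr ((\<nu> + 2) / 2) * epstein ((\<nu> + 2) / 2) / (2 * zeta (\<nu> + 2))"
proof -
 define z where "z = (\<nu> + 2) / 2"
 have z: "Re z > 2" using \<nu> by (simp add: z_def)
 define f where "f = (\<lambda>v. complex_of_real (Q v) powr (- z))"
 define V0 where "V0 = - {(0, 0, 0, 0) :: ivec}"
 have nf: "norm (f v) = wt v * Q v powr (- Re z)" if "v \<in> V0" for v
  using Q_pos[of v] that by (auto simp: V0_def f_def wt_def norm_powr_real_powr)
 have "(\<lambda>v. wt v * Q v powr (- Re z)) summable_on V0" by (rule summable_on_subset[OF epstein_series(1)[OF z]]) simp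
 hence "(\<lambda>v. norm (f v)) summable_on V0" using nf by (simp cong: summable_on_cong)
 hence fs: "f summable_on V0" by (rule abs_summable_summable)
 have "of_real pi powr z * epstein z = (\<Sum>\<^sub>\<infinity>v. of_real (wt v) * of_real (Q v) powr (- z))" by (rule epstein_series(2)[OF z, symmetric])
 also have "\<dots> = (\<Sum>\<^sub>\<infinity>v\<in>V0. f v)" by (rule infsum_cong_neutral) (auto simp: V0_def f_def wt_def)
 also have "\<dots> = (\<Sum>\<^sub>\<infinity>x\<in>{k. k \<noteq> 0} \<times> cosets. f (case x of (k, C) => smul k (row3 (coset_rep C))))"
  unfolding V0_def by (rule infsum_reindex_bij_betw[OF coset_bij, symmetric])
 also have "\<dots> = (\<Sum>\<^sub>\<infinity>(k, C)\<in>{k. k \<noteq> 0} \<times> cosets. f (smul k (row3 (coset_rep C))))"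
  by (rule infsum_cong) auto
 also have "\<dots> = (\<Sum>\<^sub>\<infinity>k\<in>{k. k \<noteq> 0}. \<Sum>\<^sub>\<infinity>C\<in>cosets. f (smul k (row3 (coset_rep C))))"
 proof (rule infsum_Sigma'_banach[symmetric])
  have "(\<lambda>x. f (case x of (k, C) => smul k (row3 (coset_rep C)))) summable_on {k. k \<noteq> 0} \<times> cosets"
   using summable_on_reindex_bij_betw[OF coset_bij, of f] fs by (simp add: V0_def)
  thus "(\<lambda>(k, C). f (smul k (row3 (coset_rep C)))) summable_on {k. k \<noteq> 0} \<times> cosets"
   by (rule summable_on_cong[THEN iffD1, rotated]) auto
 qed
 also have "\<dots> = (\<Sum>\<^sub>\<infinity>k\<in>{k. k \<noteq> 0}. of_real \<bar>real_of_int k\<bar> powr (- (\<nu> + 2)) * E_beta_series h \<nu>)"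
 proof (rule infsum_cong)
  fix k :: int assume "k \<in> {k. k \<noteq> 0}"
  hence k: "\<bar>real_of_int k\<bar> > 0" by simp
  have "f (smul k v) = of_real \<bar>real_of_int k\<bar> powr (- (\<nu> + 2)) * of_real (qf h v) powr (- ((\<nu> + 2) / 2))" if "v \<noteq> (0,0,0,0)" for v
  proof -
   define \<kappa> where "\<kappa> = \<bar>real_of_int k\<bar>"
   have \<kappa>: "\<kappa> > 0" using k by (simp add: \<kappa>_def)
   have "Q (smul k v) = (\<kappa> * \<kappa>) * Q v" using qf_smul[of h k v] by (simp add: qf power2_eq_square \<kappa>_def)
   hence "f (smul k v) = (of_real \<kappa> powr (- z) * of_real \<kappa> powr (- z)) * of_real (Q v) powr (- z)"
    unfolding f_def using \<kappa> Q_pos[OF that] by (simp add: powr_times_real del: of_real_mult add: of_real_mult[of "\<kappa> * \<kappa>"] of_real_mult[of \<kappa> \<kappa>])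
   hence "f (smul k v) = (of_real \<bar>real_of_int k\<bar> powr (- z) * of_real \<bar>real_of_int k\<bar> powr (- z)) * of_real (Q v) powr (- z)"
    by (simp only: \<kappa>_def)
   also have "complex_of_real \<bar>real_of_int k\<bar> powr (- z) * of_real \<bar>real_of_int k\<bar> powr (- z) = of_real \<bar>real_of_int k\<bar> powr (- (\<nu> + 2))"
    unfolding powr_add[symmetric] by (simp add: z_def)
   finally show ?thesis by (simp add: qf z_def)
  qed
  moreover have "row3 (coset_rep C) \<noteq> (0,0,0,0)" if "C \<in> cosets" for C
   using gcd4_row3[OF coset_rep(1)[OF that]] by (auto simp: gcd4_def)
  ultimately have "(\<Sum>\<^sub>\<infinity>C\<in>cosets. f (smul k (row3 (coset_rep C)))) =
    (\<Sum>\<^sub>\<infinity>C\<in>cosets. of_real \<bar>real_of_int k\<bar> powr (- (\<nu> + 2)) * of_real (qf h (row3 (coset_rep C))) powr (- ((\<nu> + 2) / 2)))"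
   by (intro infsum_cong) auto
  thus "(\<Sum>\<^sub>\<infinity>C\<in>cosets. f (smul k (row3 (coset_rep C)))) = of_real \<bar>real_of_int k\<bar> powr (- (\<nu> + 2)) * E_beta_series h \<nu>"
   unfolding E_beta_series_eq[OF h] infsum_cmult_right' .
 qed
 also have "\<dots> = (\<Sum>\<^sub>\<infinity>k\<in>{k::int. k \<noteq> 0}. of_real \<bar>real_of_int k\<bar> powr (- (\<nu> + 2))) * E_beta_series h \<nu>"
  by (rule infsum_cmult_left')
 also have "(\<Sum>\<^sub>\<infinity>k\<in>{k::int. k \<noteq> 0}. complex_of_real \<bar>real_of_int k\<bar> powr (- (\<nu> + 2))) = 2 * zeta (\<nu> + 2)"
 proof -
  have s: "Re (\<nu> + 2) > 1" "\<nu> + 2 \<noteq> 1" using \<nu> by (auto simp: complex_eq_iff)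
  have "(\<Sum>\<^sub>\<infinity>k\<in>{k::int. k \<noteq> 0}. complex_of_real \<bar>real_of_int k\<bar> powr (- (\<nu> + 2))) =
   (\<Sum>\<^sub>\<infinity>k::int. (if k = 0 then 0 else 1) * of_real \<bar>real_of_int k\<bar> powr (- (\<nu> + 2)))"
   by (rule infsum_cong_neutral) auto
  thus ?thesis unfolding zeta_lattice_sum(2)[OF s(1)] zeta_eq_formula[OF s(2)] .
 qed
 finally have "of_real pi powr z * epstein z = 2 * zeta (\<nu> + 2) * E_beta_series h \<nu>" .
 moreover have "zeta (\<nu> + 2) \<noteq> 0" using \<nu> by (intro zeta_nonzero) simp
 ultimately show ?thesis unfolding z_def by (simp add: field_simps)
qed

theorem (in triangular_form) E_beta_epstein:
 assumes h: "h \<in> Sp4R" and qf: "qf h = Q"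
 shows "E_beta h = remove_sings (\<lambda>\<nu>. of_real pi powr ((\<nu> + 2) / 2) * epstein ((\<nu> + 2) / 2) / (2 * zeta (\<nu> + 2)))"
  and "E_beta h nicely_meromorphic_on UNIV"
proof -
 define F where "F = (\<lambda>\<nu>. of_real pi powr ((\<nu> + 2) / 2) * epstein ((\<nu> + 2) / 2) / (2 * zeta (\<nu> + 2)))"
 have an: "F analytic_on {\<nu>}" if "\<nu> \<noteq> 2" "\<nu> \<noteq> -1" "zeta (\<nu> + 2) \<noteq> 0" for \<nu>
 proof -
  have 1: "(\<lambda>\<nu>. epstein ((\<nu> + 2) / 2)) analytic_on {\<nu>}"
   by (rule analytic_on_compose_gen[OF _ epstein_analytic, unfolded o_def]) (use that(1) in \<open>auto intro!: analytic_intros simp: field_simps\<close>)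
  have "\<nu> + 2 \<noteq> 1"
  proof
   assume "\<nu> + 2 = 1"
   hence "\<nu> = 1 - 2" by (simp only: eq_diff_eq)
   thus False using that(2) by simp
  qed
  have 2: "(\<lambda>\<nu>. zeta (\<nu> + 2)) analytic_on {\<nu>}"
   by (rule analytic_on_compose_gen[OF _ zeta_analytic, unfolded o_def]) (use \<open>\<nu> + 2 \<noteq> 1\<close> in \<open>auto intro!: analytic_intros\<close>)
  show ?thesis unfolding F_def using that(3) by (intro analytic_intros 1 2) auto
 qed
 have mero: "F meromorphic_on UNIV"
 proof -
  have a: "(\<lambda>\<nu>. (\<nu> + 2) / 2 :: complex) analytic_on UNIV" "(\<lambda>\<nu>. \<nu> + 2 :: complex) analytic_on UNIV"
   "(\<lambda>\<nu>. complex_of_real pi powr ((\<nu> + 2) / 2)) analytic_on UNIV" by (intro analytic_intros; simp)+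
  have zm: "zeta meromorphic_on UNIV" using zeta_nicely_meromorphic by (simp add: nicely_meromorphic_on_def)
  have 1: "(\<lambda>\<nu>. epstein ((\<nu> + 2) / 2)) meromorphic_on UNIV" by (rule meromorphic_on_compose[OF epstein_meromorphic a(1)]) simp
  have 2: "(\<lambda>\<nu>. zeta (\<nu> + 2)) meromorphic_on UNIV" by (rule meromorphic_on_compose[OF zm a(2)]) simp
  show ?thesis unfolding F_def by (intro meromorphic_intros 1 2 a(3)[THEN analytic_on_imp_meromorphic_on])
 qed
 show E: "E_beta h = remove_sings F"
  unfolding E_beta_def
 proof (rule mero_cont_eq[OF mero _ open_Re_gt Re_gt_nonempty])
  show "F analytic_on {\<nu>. Re \<nu> > 2}"
  proof (subst analytic_on_analytic_at, rule ballI)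
   fix \<nu> assume "\<nu> \<in> {\<nu>. Re \<nu> > 2}"
   hence \<nu>: "Re \<nu> > 2" by simp
   have "zeta (\<nu> + 2) \<noteq> 0" using \<nu> by (intro zeta_nonzero) simp
   moreover have "\<nu> \<noteq> 2" "\<nu> \<noteq> -1" using \<nu> by auto
   ultimately show "F analytic_on {\<nu>}" by (intro an)
  qed
  show "F s = E_beta_series h s" if "s \<in> {\<nu>. Re \<nu> > 2}" for s
   unfolding F_def by (rule E_beta_series_epstein[OF h qf, symmetric]) (use that in simp)
 qed
 show "E_beta h nicely_meromorphic_on UNIV" unfolding E by (rule remove_sings_nicely_meromorphic[OF mero])
qed

lemma (in horocycle) qf_eq:
 assumes p: "p 1 = p1" "p 2 = p2" "p 4 = p4" "p 5 = p5" and k: "k \<in> K"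
 shows "qf (eta n ** (eta p ** torus y1 y2 ** k)) =
  triangular_form.Q (y1\<^sup>2) (y2\<^sup>2) (1 / y2\<^sup>2) (1 / y1\<^sup>2) (R2 (n 1)) (R3 (n 1) (n 5) (n 4)) (R4 (n 1) (n 5) (n 4) (n 2))"
proof
 fix v :: ivec
 obtain a b d c where v: "v = (a, b, d, c)" by (cases v)
 define M where "M = rowmat v ** (eta n ** (eta p ** torus y1 y2))"
 have m: "M$3$1 = y1 * of_int a" "M$3$2 = y2 * (of_int b + R2 (n 1) a)"
  "M$3$4 = (of_int d + R3 (n 1) (n 5) (n 4) a b) / y2" "M$3$3 = (of_int c + R4 (n 1) (n 5) (n 4) (n 2) a b d) / y1"
  unfolding M_def matrix_mult_4 rowmat_def v prod.case vector_4 eta_nth torus_nth p R2_def R3_def R4_def divide_inverse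
  by (simp_all add: algebra_simps)
 have "qf (eta n ** (eta p ** torus y1 y2 ** k)) v = qf (eta n ** (eta p ** torus y1 y2)) v"
  using qf_K[OF k, of "eta n ** (eta p ** torus y1 y2)" v] by (simp only: matrix_mul_assoc)
 also have "\<dots> = dot M 3 3" by (simp add: qf_def M_def)
 finally show "qf (eta n ** (eta p ** torus y1 y2 ** k)) v =
  triangular_form.Q (y1\<^sup>2) (y2\<^sup>2) (1 / y2\<^sup>2) (1 / y1\<^sup>2) (R2 (n 1)) (R3 (n 1) (n 5) (n 4)) (R4 (n 1) (n 5) (n 4) (n 2)) v"
  unfolding dot_def m v triangular_form.Q_def[OF tf] by (simp add: power2_eq_square)
qed

definition kappa :: "complex => complex" where
 "kappa s = of_real pi powr (- (s / 2)) * Gamma (s / 2)"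

lemma kappa_nonzero: "Re s > 0 ==> kappa s \<noteq> 0"
proof -
 assume s: "Re s > 0"
 have "s / 2 \<notin> \<int>\<^sub>\<le>\<^sub>0" using s by (auto elim!: nonpos_Ints_cases)
 thus ?thesis by (simp add: kappa_def Gamma_eq_zero_iff)
qed

lemma quad_power:
 fixes D A \<xi> :: real
 assumes D: "D > 0" and A: "A > 0" and s: "Re s > 1"
 shows "integrable lborel (\<lambda>x. of_real (D + A * x\<^sup>2) powr (- (s / 2)) * cis (- 2 * pi * \<xi> * x))" (is ?g1)
  and "kappa s * (\<integral>x. of_real (D + A * x\<^sup>2) powr (- (s / 2)) * cis (- 2 * pi * \<xi> * x) \<partial>lborel)
    = of_real (A powr (- (1/2))) * bes ((s - 1) / 2) D (\<xi>\<^sup>2 / A)" (is ?g2)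
proof -
 define q where "q = (\<lambda>x. D + A * x\<^sup>2)"
 have q: "q x > 0" for x using D A by (simp add: q_def add_pos_nonneg)
 define F where "F = (\<lambda>t x. complex_of_real (exp (- pi * (D + A * x\<^sup>2) * t)) * of_real t powr (s / 2 - 1) * cis (- 2 * pi * \<xi> * x))"
 have s2: "Re (s / 2) > 0" "Re ((s - 1) / 2) > 0" using s by auto
 interpret RP: sigma_finite_measure Rpos by (rule sigma_finite_Rpos)
 interpret P: pair_sigma_finite Rpos "lborel :: real measure" ..
 let ?P = "Rpos \<Otimes>\<^sub>M (lborel :: real measure)"
 have m1: "(\<lambda>p. fst p) \<in> borel_measurable ?P"
  by (rule measurable_compose[OF measurable_fst Rpos_measurable_continuous]) (intro continuous_intros)
 have m2: "(\<lambda>p. snd p) \<in> borel_measurable ?P"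
  using measurable_snd[of Rpos "lborel :: real measure"] unfolding measurable_lborel1 by simp
 have expm: "(exp :: real => real) \<in> borel_measurable borel" by (intro borel_measurable_continuous_onI continuous_intros)
 have m3: "(\<lambda>p. exp (- pi * (D + A * (snd p)\<^sup>2) * fst p)) \<in> borel_measurable ?P"
  by (rule measurable_compose[OF borel_measurable_times[OF borel_measurable_times[OF borel_measurable_const
   borel_measurable_add[OF borel_measurable_const borel_measurable_times[OF borel_measurable_const borel_measurable_power[OF m2]]]] m1] expm])
 have m4: "(\<lambda>p. cis (- 2 * pi * \<xi> * snd p)) \<in> borel_measurable ?P"
  by (rule measurable_compose[OF m2]) (intro borel_measurable_continuous_onI continuous_intros)
 have mF: "(\<lambda>(t, x). F t x) \<in> borel_measurable ?P"
  unfolding F_def case_prod_beta'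
  by (rule borel_measurable_times[OF borel_measurable_times[OF of_real_measurable[OF m3] measurable_compose[OF measurable_fst powr_measurable_Rpos]] m4])
 have Fsplit: "F t x = (of_real (exp (- pi * D * t)) * of_real t powr (s / 2 - 1)) * (of_real (exp (- pi * (t * A) * x\<^sup>2)) * cis (- 2 * pi * \<xi> * x))" for t x
 proof -
  have "exp (- pi * (D + A * x\<^sup>2) * t) = exp (- pi * D * t) * exp (- pi * (t * A) * x\<^sup>2)"
   by (simp add: exp_add[symmetric] algebra_simps)
  thus ?thesis by (simp add: F_def mult_ac)
 qed
 have Fx: "integrable lborel (F t)" if "t > 0" for t
  unfolding Fsplit using A that by (intro integrable_mult_right gauss_fourier(1)) simp
 have t_half: "(t * A) powr (- 1/2) = A powr (- (1/2)) * t powr (- (1/2))" if "t > 0" for t :: real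
  using that A by (simp add: powr_mult)
 have Fx_val: "(\<integral>x. F t x \<partial>lborel) = of_real (A powr (- (1/2))) * (besf D (\<xi>\<^sup>2 / A) t * of_real t powr ((s - 1) / 2 - 1))" if t: "t > 0" for t
 proof -
  have "complex_of_real t powr (s / 2 - 1) * of_real (t powr (- (1/2))) = of_real t powr ((s - 1) / 2 - 1)"
  proof -
   have "complex_of_real (t powr (- (1/2))) = of_real t powr (- (1/2))" using powr_of_real[of t "- (1/2)"] t by simp
   moreover have "(s / 2 - 1) + - (1/2) = (s - 1) / 2 - 1" by (simp add: diff_divide_distrib)
   ultimately show ?thesis by (metis powr_add)
  qed
  moreover have "(\<integral>x. F t x \<partial>lborel) = (of_real (exp (- pi * D * t)) * of_real t powr (s / 2 - 1)) * of_real ((t * A) powr (- 1/2) * exp (- pi * \<xi>\<^sup>2 / (t * A)))"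
   unfolding Fsplit integral_mult_right_zero using gauss_fourier(2)[of "t * A" \<xi>] A t by simp
  ultimately show ?thesis unfolding t_half[OF t] by (simp add: besf_def mult_ac)
 qed
 have nF: "norm (F t x) = (exp (- pi * D * t) * t powr (Re s / 2 - 1)) * exp (- pi * (t * A) * x\<^sup>2)" if "t > 0" for t x
  unfolding Fsplit norm_mult norm_real_powr[OF that] by simp
 have FI: "integrable ?P (\<lambda>(t, x). F t x)"
 proof (rule P.Fubini_integrable[OF mF])
  have v: "(\<integral>x. norm (F t x) \<partial>lborel) = A powr (- (1/2)) * norm (of_real (exp (- (pi * D) * t)) * complex_of_real t powr ((s - 1) / 2 - 1))" if t: "t > 0" for t
  proof -
   have g: "(\<integral>x. exp (- pi * (t * A) * x\<^sup>2) \<partial>lborel) = (t * A) powr (- 1/2)"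
   proof -
    have "complex_of_real (\<integral>x. exp (- pi * (t * A) * x\<^sup>2) \<partial>lborel) = of_real ((t * A) powr (- 1/2))"
     using gauss_fourier(2)[of "t * A" 0] A t by simp
    thus ?thesis by (simp only: of_real_eq_iff)
   qed
   have "t powr (Re s / 2 - 1) * t powr (- (1/2)) = t powr (Re ((s - 1) / 2 - 1))" by (simp add: powr_add[symmetric] diff_divide_distrib)
   thus ?thesis unfolding nF[OF t] integral_mult_right_zero g t_half[OF t] norm_mult norm_real_powr[OF t] by (simp add: mult_ac)
  qed
  have p: "pi * D > 0" using D by simp
  have "integrable Rpos (\<lambda>t. A powr (- (1/2)) * norm (of_real (exp (- (pi * D) * t)) * complex_of_real t powr ((s - 1) / 2 - 1)))"
   by (rule integrable_mult_right[OF integrable_norm[OF mellin_exp(1)[OF p s2(2)]]])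
  thus "integrable Rpos (\<lambda>t. \<integral>x. norm (case (t, x) of (t, x) => F t x) \<partial>lborel)"
   unfolding prod.case by (rule integrable_Rpos_cong[THEN iffD1, rotated]) (simp only: v)
  show "AE t in Rpos. integrable lborel (\<lambda>x. case (t, x) of (t, x) => F t x)" by (rule AE_I2) (use Fx in simp)
 qed
 have kq: "(\<integral>t. F t x \<partial>Rpos) = kappa s * (of_real (q x) powr (- (s / 2)) * cis (- 2 * pi * \<xi> * x))" for x
 proof -
  have "(\<integral>t. F t x \<partial>Rpos) = mellin (\<lambda>t. of_real (exp (- (pi * q x) * t))) (s / 2) * cis (- 2 * pi * \<xi> * x)"
   unfolding mellin_def F_def q_def integral_mult_left_zero by simp
  also have "mellin (\<lambda>t. of_real (exp (- (pi * q x) * t))) (s / 2) = Gamma (s / 2) * of_real (pi * q x) powr (- (s / 2))"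
   by (rule mellin_exp(2)) (use q s2 in auto)
  also have "complex_of_real (pi * q x) powr (- (s / 2)) = of_real pi powr (- (s / 2)) * of_real (q x) powr (- (s / 2))"
   using q[of x] by (simp add: powr_times_real)
  finally show ?thesis by (simp add: kappa_def mult_ac)
 qed
 have k0: "kappa s \<noteq> 0" using s by (intro kappa_nonzero) simp
 have "integrable lborel (\<lambda>x. \<integral>t. F t x \<partial>Rpos)" using P.integrable_snd[OF FI] by simp
 thus ?g1
 proof -
  assume *: "integrable lborel (\<lambda>x. \<integral>t. F t x \<partial>Rpos)"
  have e: "of_real (D + A * x\<^sup>2) powr (- (s / 2)) * cis (- 2 * pi * \<xi> * x) = inverse (kappa s) * (\<integral>t. F t x \<partial>Rpos)" for x
   unfolding kq q_def using k0 by simp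
  show ?thesis unfolding e by (rule integrable_mult_right[OF *])
 qed
 have "kappa s * (\<integral>x. of_real (q x) powr (- (s / 2)) * cis (- 2 * pi * \<xi> * x) \<partial>lborel) = (\<integral>x. (\<integral>t. F t x \<partial>Rpos) \<partial>lborel)"
  unfolding kq by simp
 also have "\<dots> = (\<integral>t. (\<integral>x. F t x \<partial>lborel) \<partial>Rpos)" by (rule P.Fubini_integral[OF FI])
 also have "\<dots> = (\<integral>t. of_real (A powr (- (1/2))) * (besf D (\<xi>\<^sup>2 / A) t * of_real t powr ((s - 1) / 2 - 1)) \<partial>Rpos)"
  by (rule Bochner_Integration.integral_cong[OF refl]) (use Fx_val in auto)
 also have "\<dots> = of_real (A powr (- (1/2))) * bes ((s - 1) / 2) D (\<xi>\<^sup>2 / A)"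
  unfolding bes_def mellin_def by (rule integral_mult_right_zero)
 finally show ?g2 unfolding q_def .
qed

lemma quad_power_shift:
 fixes D A \<xi> b :: real
 assumes "D > 0" "A > 0" "Re s > 1"
 shows "integrable lborel (\<lambda>x. of_real (D + A * (x + b)\<^sup>2) powr (- (s / 2)) * cis (- 2 * pi * \<xi> * x))" (is ?g1)
  and "kappa s * (\<integral>x. of_real (D + A * (x + b)\<^sup>2) powr (- (s / 2)) * cis (- 2 * pi * \<xi> * x) \<partial>lborel)
    = of_real (A powr (- (1/2))) * cis (2 * pi * \<xi> * b) * bes ((s - 1) / 2) D (\<xi>\<^sup>2 / A)" (is ?g2)
proof -
 define f where "f = (\<lambda>x. of_real (D + A * x\<^sup>2) powr (- (s / 2)) * cis (- 2 * pi * \<xi> * x))"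
 note Q = quad_power[OF assms, of \<xi>, folded f_def]
 have e: "of_real (D + A * (x + b)\<^sup>2) powr (- (s / 2)) * cis (- 2 * pi * \<xi> * x) = cis (2 * pi * \<xi> * b) * f (b + 1 * x)" for x
 proof -
  have "cis (2 * pi * \<xi> * b) * cis (- 2 * pi * \<xi> * (b + x)) = cis (- 2 * pi * \<xi> * x)" by (simp add: cis_mult algebra_simps)
  thus ?thesis by (simp add: f_def add.commute mult.left_commute)
 qed
 show ?g1
  unfolding e by (intro integrable_mult_right lborel_integrable_real_affine Q(1)) simp
 have "(\<integral>x. f (b + 1 * x) \<partial>lborel) = (\<integral>x. f x \<partial>lborel)"
  using lborel_integral_real_affine[of 1 f b] by simp
 thus ?g2
  unfolding e integral_mult_right_zero using Q(2) by (simp add: mult_ac)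
qed

definition pcoeff :: "complex => real => complex" where
 "pcoeff s A = of_real (A powr (- (1/2))) * kappa (s - 1) / kappa s"

lemma quad_power_zero:
 fixes D A b :: real
 assumes D: "D > 0" and A: "A > 0" and s: "Re s > 1"
 shows "integrable lborel (\<lambda>x. of_real (D + A * (x + b)\<^sup>2) powr (- (s / 2)))" (is ?g1)
  and "(\<integral>x. of_real (D + A * (x + b)\<^sup>2) powr (- (s / 2)) \<partial>lborel) = pcoeff s A * of_real D powr (- ((s - 1) / 2))" (is ?g2)
  and "(\<integral>x. norm (complex_of_real (D + A * (x + b)\<^sup>2) powr (- (s / 2))) \<partial>lborel)
    = Re (pcoeff (of_real (Re s)) A) * norm (complex_of_real D powr (- ((s - 1) / 2)))" (is ?g3)
proof -
 have main: "integrable lborel (\<lambda>x. of_real (D + A * (x + b)\<^sup>2) powr (- (s / 2)))"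
  "(\<integral>x. of_real (D + A * (x + b)\<^sup>2) powr (- (s / 2)) \<partial>lborel) = pcoeff s A * of_real D powr (- ((s - 1) / 2))" if s: "Re s > 1" for s
 proof -
  note Q = quad_power_shift[OF D A s, of b 0]
  show "integrable lborel (\<lambda>x. of_real (D + A * (x + b)\<^sup>2) powr (- (s / 2)))" using Q(1) by simp
  have "bes ((s - 1) / 2) D 0 = Gamma ((s - 1) / 2) * of_real (pi * D) powr (- ((s - 1) / 2))" by (rule bes_zero(2)) (use D s in auto)
  also have "complex_of_real (pi * D) powr (- ((s - 1) / 2)) = of_real pi powr (- ((s - 1) / 2)) * of_real D powr (- ((s - 1) / 2))"
   using D by (simp add: powr_times_real)
  finally have "bes ((s - 1) / 2) D 0 = kappa (s - 1) * of_real D powr (- ((s - 1) / 2))" by (simp add: kappa_def mult_ac)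
  moreover have "kappa s \<noteq> 0" using s by (intro kappa_nonzero) simp
  ultimately show "(\<integral>x. of_real (D + A * (x + b)\<^sup>2) powr (- (s / 2)) \<partial>lborel) = pcoeff s A * of_real D powr (- ((s - 1) / 2))"
   using Q(2) by (simp add: pcoeff_def field_simps)
 qed
 show ?g1
  "(\<integral>x. of_real (D + A * (x + b)\<^sup>2) powr (- (s / 2)) \<partial>lborel) = pcoeff s A * of_real D powr (- ((s - 1) / 2))" by (rule main[OF s])+
 have pos: "D + A * (x + b)\<^sup>2 > 0" for x using D A by (simp add: add_pos_nonneg)
 have n: "complex_of_real q powr (- (of_real \<sigma> / 2)) = of_real (q powr (- \<sigma> / 2))" if "q > 0" for q \<sigma> :: real
  using powr_of_real[of q "- \<sigma> / 2"] that by simp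
 have n': "norm (complex_of_real q powr (- (s / 2))) = q powr (- Re s / 2)" if "q > 0" for q s
  using that by (simp add: norm_powr_real_powr)
 have "Re (complex_of_real (Re s)) > 1" using s by simp
 from main(2)[OF this]
 have "(\<integral>x. complex_of_real ((D + A * (x + b)\<^sup>2) powr (- Re s / 2)) \<partial>lborel) = pcoeff (of_real (Re s)) A * of_real (D powr (- (Re s - 1) / 2))"
  unfolding n[OF pos] using n[OF D, of "Re s - 1"] by simp
 hence "Re (complex_of_real (\<integral>x. (D + A * (x + b)\<^sup>2) powr (- Re s / 2) \<partial>lborel)) = Re (pcoeff (of_real (Re s)) A * of_real (D powr (- (Re s - 1) / 2)))"
  by (simp only: integral_complex_of_real)
 thus ?g3
  unfolding n'[OF pos] n'[OF D] by simp
qed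

lemma poisson_kernel_integral:
 assumes a: "a > 0"
 shows "integrable lborel (\<lambda>x::real. a / (a\<^sup>2 + (x + b)\<^sup>2))" (is ?g1) "(\<integral>x. a / (a\<^sup>2 + (x + b)\<^sup>2) \<partial>lborel) = pi" (is ?g2)
proof -
 have e: "a / (a\<^sup>2 + (x + b)\<^sup>2) = (1 / a) * (1 / (1 + (b / a + (1 / a) * x)\<^sup>2))" for x
 proof -
  define u where "u = b / a + (1 / a) * x"
  have "x + b = a * u" using a by (simp add: u_def distrib_left)
  hence "a\<^sup>2 + (x + b)\<^sup>2 = a * (a * (1 + u\<^sup>2))" by (simp add: power2_eq_square algebra_simps)
  thus ?thesis using a unfolding u_def[symmetric] by simp
 qed
 have a0: "1 / a \<noteq> 0" using a by simp
 show ?g1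
  unfolding e by (rule integrable_mult_right[OF lborel_integrable_real_affine[OF cauchy_density(1) a0]])
 define V where "V = (\<integral>x. 1 / (1 + (b / a + (1 / a) * x)\<^sup>2) \<partial>lborel)"
 have "pi = \<bar>1 / a\<bar> *\<^sub>R V"
  unfolding cauchy_density(2)[symmetric] V_def by (rule lborel_integral_real_affine[OF a0])
 hence "pi = (1 / a) * V" using a by simp
 thus ?g2
  unfolding e integral_mult_right_zero V_def[symmetric] by (rule sym)
qed

section \<open>Iterated integrals over coordinate spaces\<close>

abbreviation PL :: "nat set => (nat => real) measure" where "PL I \<equiv> PiM I (\<lambda>_. lborel)"

lemma PL_measurable: "i \<in> I ==> (\<lambda>n. n i) \<in> borel_measurable (PL I)"
 using measurable_component_singleton[of i I "\<lambda>_. lborel :: real measure"] unfolding measurable_lborel1 .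

lemma PL_update:
 assumes "finite I" "i \<notin> I" and F: "F \<in> borel_measurable (PL (insert i I))" and x: "x \<in> space (PL I)"
 shows "(\<lambda>y. F (x(i := y))) \<in> borel_measurable lborel"
proof -
 have "(\<lambda>y. x(i := y)) \<in> measurable lborel (PL (insert i I))"
  using measurable_component_update[of x I "\<lambda>_. lborel" i] x assms(2) by blast
 from measurable_compose[OF this F] show ?thesis .
qed

lemma PL_step:
 fixes F :: "(nat => real) => complex"
 assumes I: "finite I" "i \<notin> I" and F: "F \<in> borel_measurable (PL (insert i I))"
  and int: "\<forall>x. integrable lborel (\<lambda>y. F (x(i := y)))"
  and val: "\<forall>x. (\<integral>y. F (x(i := y)) \<partial>lborel) = c * G x"
  and nrm: "\<forall>x. (\<integral>y. norm (F (x(i := y))) \<partial>lborel) = c' * norm (G x)"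
  and G: "integrable (PL I) G"
 shows "integrable (PL (insert i I)) F" "(\<integral>n. F n \<partial>PL (insert i I)) = c * (\<integral>n. G n \<partial>PL I)" (is ?g1)
proof -
 interpret P: product_sigma_finite "\<lambda>_::nat. lborel :: real measure" ..
 show FI: "integrable (PL (insert i I)) F"
 proof (rule integrableI_bounded[OF F])
  have mF: "(\<lambda>x. ennreal (norm (F x))) \<in> borel_measurable (PL (insert i I))"
   by (rule measurable_compose[OF measurable_compose[OF F borel_measurable_norm] measurable_ennreal])
  have "(\<integral>\<^sup>+ x. ennreal (norm (F x)) \<partial>PL (insert i I)) = (\<integral>\<^sup>+ x. (\<integral>\<^sup>+ y. ennreal (norm (F (x(i := y)))) \<partial>lborel) \<partial>PL I)"
   by (rule P.product_nn_integral_insert[OF I mF])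
  also have "\<dots> = (\<integral>\<^sup>+ x. ennreal (c' * norm (G x)) \<partial>PL I)"
  proof (rule nn_integral_cong)
   fix x
   have "(\<integral>\<^sup>+ y. ennreal (norm (F (x(i := y)))) \<partial>lborel) = ennreal (\<integral>y. norm (F (x(i := y))) \<partial>lborel)"
    by (rule nn_integral_eq_integral[OF integrable_norm]) (use int in auto)
   thus "(\<integral>\<^sup>+ y. ennreal (norm (F (x(i := y)))) \<partial>lborel) = ennreal (c' * norm (G x))" using nrm by simp
  qed
  also have "\<dots> \<le> (\<integral>\<^sup>+ x. ennreal (norm (c' *\<^sub>R G x)) \<partial>PL I)"
   by (rule nn_integral_mono) (auto intro!: ennreal_leI mult_right_mono)
  also have "\<dots> < \<infinity>"
  proof -
   have "integrable (PL I) (\<lambda>x. c' *\<^sub>R G x)" using G by (rule integrable_scaleR_right)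
   thus ?thesis unfolding integrable_iff_bounded by blast
  qed
  finally show "(\<integral>\<^sup>+ x. ennreal (norm (F x)) \<partial>PL (insert i I)) < \<infinity>" .
 qed
 have "(\<integral>n. F n \<partial>PL (insert i I)) = (\<integral>x. (\<integral>y. F (x(i := y)) \<partial>lborel) \<partial>PL I)"
  by (rule P.product_integral_insert[OF I FI])
 also have "\<dots> = (\<integral>x. c * G x \<partial>PL I)" using val by simp
 also have "\<dots> = c * (\<integral>x. G x \<partial>PL I)" by (rule integral_mult_right_zero)
 finally show ?g1 .
qed

lemma PL_poisson_step:
 fixes H :: "(nat => real) => complex"
 assumes I: "finite I" "i \<notin> I" and \<rho>: "\<rho> \<in> borel_measurable (PL (insert i I))" and mH: "H \<in> borel_measurable (PL (insert i I))"
  and ind: "\<forall>x y. H (x(i := y)) = H x" and kern: "\<forall>x. \<exists>a>0. \<exists>b. \<forall>y. \<rho> (x(i := y)) = a / (a\<^sup>2 + (y + b)\<^sup>2)"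
  and H: "integrable (PL I) H"
 shows "(\<integral>n. H n * of_real (\<rho> n) \<partial>PL (insert i I)) = of_real pi * (\<integral>n. H n \<partial>PL I)"
proof (rule PL_step(2)[OF I _ _ _ _ H, where c' = pi])
 show "(\<lambda>n. H n * of_real (\<rho> n)) \<in> borel_measurable (PL (insert i I))"
  by (rule borel_measurable_times[OF mH of_real_measurable[OF \<rho>]])
 have r: "integrable lborel (\<lambda>y. \<rho> (x(i := y)))" "(\<integral>y. \<rho> (x(i := y)) \<partial>lborel) = pi" "(\<integral>y. \<bar>\<rho> (x(i := y))\<bar> \<partial>lborel) = pi" for x
 proof -
  obtain a b where a: "a > 0" "\<And>y. \<rho> (x(i := y)) = a / (a\<^sup>2 + (y + b)\<^sup>2)" using kern by blast
  show "integrable lborel (\<lambda>y. \<rho> (x(i := y)))" "(\<integral>y. \<rho> (x(i := y)) \<partial>lborel) = pi"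
   unfolding a(2) by (rule poisson_kernel_integral[OF a(1)])+
  have "\<bar>a / (a\<^sup>2 + (y + b)\<^sup>2)\<bar> = a / (a\<^sup>2 + (y + b)\<^sup>2)" for y using a(1) by (simp add: abs_of_nonneg)
  thus "(\<integral>y. \<bar>\<rho> (x(i := y))\<bar> \<partial>lborel) = pi" unfolding a(2) by (simp only: poisson_kernel_integral(2)[OF a(1)])
 qed
 show "\<forall>x. integrable lborel (\<lambda>y. H (x(i := y)) * of_real (\<rho> (x(i := y))))"
  using ind r(1) by (simp only: ind) (intro allI integrable_mult_right integrable_of_real)
 show "\<forall>x. (\<integral>y. H (x(i := y)) * of_real (\<rho> (x(i := y))) \<partial>lborel) = of_real pi * H x"
  using ind r(2) by (simp only: ind integral_mult_right_zero integral_complex_of_real mult.commute) simp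
 show "\<forall>x. (\<integral>y. norm (H (x(i := y)) * of_real (\<rho> (x(i := y)))) \<partial>lborel) = pi * norm (H x)"
  using ind r(3) by (simp only: ind norm_mult norm_of_real integral_mult_right_zero mult.commute) simp
qed

lemma PL_power_step:
 fixes E :: "(nat => real) => complex" and D b :: "(nat => real) => real"
 assumes I: "finite I" "i \<notin> I" and A: "A > 0" and s: "Re s > 1"
  and m: "(\<lambda>n. E n * of_real (D n + A * (n i + b n)\<^sup>2) powr (- (s / 2))) \<in> borel_measurable (PL (insert i I))"
  and D: "\<forall>n. D n > 0" and ind: "\<forall>x y. E (x(i := y)) = E x" "\<forall>x y. D (x(i := y)) = D x" "\<forall>x y. b (x(i := y)) = b x"
  and G: "integrable (PL I) (\<lambda>n. E n * of_real (D n) powr (- ((s - 1) / 2)))"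
 shows "integrable (PL (insert i I)) (\<lambda>n. E n * of_real (D n + A * (n i + b n)\<^sup>2) powr (- (s / 2)))" (is ?g1)
  "(\<integral>n. E n * of_real (D n + A * (n i + b n)\<^sup>2) powr (- (s / 2)) \<partial>PL (insert i I)) = pcoeff s A * (\<integral>n. E n * of_real (D n) powr (- ((s - 1) / 2)) \<partial>PL I)" (is ?g2)
proof -
 have Q: "integrable lborel (\<lambda>y. of_real (D x + A * (y + b x)\<^sup>2) powr (- (s / 2)))"
  "(\<integral>y. of_real (D x + A * (y + b x)\<^sup>2) powr (- (s / 2)) \<partial>lborel) = pcoeff s A * of_real (D x) powr (- ((s - 1) / 2))"
  "(\<integral>y. norm (complex_of_real (D x + A * (y + b x)\<^sup>2) powr (- (s / 2))) \<partial>lborel)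
    = Re (pcoeff (of_real (Re s)) A) * norm (complex_of_real (D x) powr (- ((s - 1) / 2)))" for x
  using quad_power_zero[of "D x" A s "b x"] D A s by auto
 have 1: "\<forall>x. integrable lborel (\<lambda>y. E (x(i := y)) * of_real (D (x(i := y)) + A * ((x(i := y)) i + b (x(i := y)))\<^sup>2) powr (- (s / 2)))"
  unfolding ind[rule_format] fun_upd_same by (intro allI integrable_mult_right Q(1))
 have 2: "\<forall>x. (\<integral>y. E (x(i := y)) * of_real (D (x(i := y)) + A * ((x(i := y)) i + b (x(i := y)))\<^sup>2) powr (- (s / 2)) \<partial>lborel)
   = pcoeff s A * (E x * of_real (D x) powr (- ((s - 1) / 2)))"
  unfolding ind[rule_format] fun_upd_same integral_mult_right_zero Q(2) by (simp add: mult.left_commute)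
 have 3: "\<forall>x. (\<integral>y. norm (E (x(i := y)) * of_real (D (x(i := y)) + A * ((x(i := y)) i + b (x(i := y)))\<^sup>2) powr (- (s / 2))) \<partial>lborel)
   = Re (pcoeff (of_real (Re s)) A) * norm (E x * of_real (D x) powr (- ((s - 1) / 2)))"
  unfolding ind[rule_format] fun_upd_same norm_mult integral_mult_right_zero Q(3) by (simp add: mult.left_commute)
 show ?g1 by (rule PL_step(1)[OF I m 1 2 3 G])
 show ?g2 by (rule PL_step(2)[OF I m 1 2 3 G])
qed

lemma PL_single:
 fixes f :: "real => complex"
 assumes "integrable lborel f"
 shows "integrable (PL {i}) (\<lambda>n. f (n i))" (is ?g1) "(\<integral>n. f (n i) \<partial>PL {i}) = (\<integral>x. f x \<partial>lborel)" (is ?g2)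
proof -
 interpret P: product_sigma_finite "\<lambda>_::nat. lborel :: real measure" ..
 have m: "f \<in> borel_measurable lborel" using assms by (rule borel_measurable_integrable)
 show ?g2 by (rule P.product_integral_singleton[OF m])
 have mf: "(\<lambda>n. f (n i)) \<in> borel_measurable (PL {i})"
  by (rule measurable_compose[of "\<lambda>n. n i" "PL {i}" lborel f borel, OF _ m]) (rule measurable_component_singleton, simp)
 have "(\<integral>\<^sup>+n. ennreal (norm (f (n i))) \<partial>PL {i}) = (\<integral>\<^sup>+x. ennreal (norm (f x)) \<partial>lborel)"
  by (rule P.product_nn_integral_singleton[of "\<lambda>x. ennreal (norm (f x))" i]) (rule measurable_compose[OF measurable_compose[OF m borel_measurable_norm] measurable_ennreal])
 also have "\<dots> < \<infinity>" using assms unfolding integrable_iff_bounded by blast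
 finally show ?g1 by (rule integrableI_bounded[OF mf])
qed

text \<open>Unipotent shears preserve Lebesgue measure.\<close>

lemma PL_shear:
 fixes F :: "(nat => real) => complex" and h :: "(nat => real) => real"
 assumes I: "finite I" "i \<notin> I" and F: "F \<in> borel_measurable (PL (insert i I))"
  and h: "h \<in> borel_measurable (PL (insert i I))" and ind: "\<forall>x y. h (x(i := y)) = h x"
 shows "(\<integral>n. F n \<partial>PL (insert i I)) = (\<integral>n. F (n(i := n i + h n)) \<partial>PL (insert i I))"
proof -
 interpret P: product_sigma_finite "\<lambda>_::nat. lborel :: real measure" ..
 let ?M = "PL (insert i I)"
 define T where "T = (\<lambda>n::nat => real. n(i := n i + h n))"
 have mT: "T \<in> measurable ?M ?M"
 proof -
  have "(\<lambda>n. n i + h n) \<in> borel_measurable ?M" by (intro borel_measurable_add PL_measurable h) simp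
  hence u: "(\<lambda>n. n i + h n) \<in> measurable ?M lborel" unfolding measurable_lborel1 .
  show ?thesis
  proof (rule measurable_PiM_single')
   fix j assume j: "j \<in> insert i I"
   show "(\<lambda>n. T n j) \<in> measurable ?M lborel"
   proof (cases "j = i")
    case True
    show ?thesis unfolding T_def True fun_upd_same by (rule u)
   next
    case False
    have "(\<lambda>n. T n j) = (\<lambda>n. n j)" using False by (simp add: T_def)
    thus ?thesis using measurable_component_singleton[OF j, of "\<lambda>_. lborel :: real measure"] by (simp only:)
   qed
  next
   show "T \<in> space ?M \<rightarrow> (\<Pi>\<^sub>E i\<in>insert i I. space lborel)"
   proof (rule funcsetI)
    fix n assume "n \<in> space ?M"
    hence "n \<in> extensional (insert i I)" by (simp add: space_PiM PiE_def)
    thus "T n \<in> (\<Pi>\<^sub>E i\<in>insert i I. space lborel)" by (simp add: T_def PiE_iff extensional_def)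
   qed
  qed
 qed
 have "distr ?M ?M T = ?M"
 proof (rule measure_eqI)
  show "sets (distr ?M ?M T) = sets ?M" by simp
  fix S assume "S \<in> sets (distr ?M ?M T)"
  hence S: "S \<in> sets ?M" by simp
  have mS: "(indicator S :: _ => ennreal) \<in> borel_measurable ?M" using S by (rule borel_measurable_indicator)
  have mSd: "(indicator S :: _ => ennreal) \<in> borel_measurable (distr ?M ?M T)" by (rule borel_measurable_indicator) fact
  have mST: "(\<lambda>n. indicator S (T n) :: ennreal) \<in> borel_measurable ?M" by (rule measurable_compose[OF mT mS])
  have "emeasure (distr ?M ?M T) S = (\<integral>\<^sup>+n. indicator S n \<partial>distr ?M ?M T)" by (rule nn_integral_indicator[symmetric]) fact
  also have "\<dots> = (\<integral>\<^sup>+n. indicator S (T n) \<partial>?M)" by (rule nn_integral_distr[OF mT mSd])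
  also have "\<dots> = (\<integral>\<^sup>+x. (\<integral>\<^sup>+y. indicator S (T (x(i := y))) \<partial>lborel) \<partial>PL I)" by (rule P.product_nn_integral_insert[OF I mST])
  also have "\<dots> = (\<integral>\<^sup>+x. (\<integral>\<^sup>+y. indicator S (x(i := y)) \<partial>lborel) \<partial>PL I)"
  proof (rule nn_integral_cong)
   fix x assume x: "x \<in> space (PL I)"
   have "(\<lambda>y. indicator S (x(i := y)) :: ennreal) \<in> borel_measurable lborel" by (rule PL_update[OF I mS x])
   hence m: "(\<lambda>y. indicator S (x(i := y)) :: ennreal) \<in> borel_measurable borel" unfolding measurable_lborel2 .
   have "(\<integral>\<^sup>+y. indicator S (x(i := y)) \<partial>lborel) = (\<integral>\<^sup>+y. indicator S (x(i := h x + 1 * y)) \<partial>lborel)"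
    using nn_integral_real_affine[OF m, of 1 "h x"] by simp
   moreover have "T (x(i := y)) = x(i := h x + 1 * y)" for y using ind by (simp add: T_def add.commute)
   ultimately show "(\<integral>\<^sup>+y. indicator S (T (x(i := y))) \<partial>lborel) = (\<integral>\<^sup>+y. indicator S (x(i := y)) \<partial>lborel)" by simp
  qed
  also have "\<dots> = (\<integral>\<^sup>+n. indicator S n \<partial>?M)" by (rule P.product_nn_integral_insert[OF I mS, symmetric])
  also have "\<dots> = emeasure ?M S" by (rule nn_integral_indicator[OF S])
  finally show "emeasure (distr ?M ?M T) S = emeasure ?M S" .
 qed
 hence "(\<integral>n. F n \<partial>?M) = (\<integral>n. F n \<partial>distr ?M ?M T)" by simp
 also have "\<dots> = (\<integral>n. F (T n) \<partial>?M)" by (rule integral_distr[OF mT F])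
 finally show ?thesis by (simp only: T_def)
qed

lemma powr_measurable:
 fixes q :: "'a => real"
 assumes q: "q \<in> borel_measurable M" and pos: "\<And>x. q x > 0"
 shows "(\<lambda>x. complex_of_real (q x) powr c) \<in> borel_measurable M"
proof -
 have "(\<lambda>x. ln (q x)) \<in> borel_measurable M" by (rule borel_measurable_ln[OF q])
 moreover have "(\<lambda>t. exp (c * complex_of_real t)) \<in> borel_measurable borel" by (intro borel_measurable_continuous_onI continuous_intros)
 ultimately have 1: "(\<lambda>x. exp (c * complex_of_real (ln (q x)))) \<in> borel_measurable M" by (rule measurable_compose)
 have "complex_of_real (q x) powr c = exp (c * complex_of_real (ln (q x)))" for x
  using pos[of x] by (simp add: powr_def Ln_of_real)
 thus ?thesis using 1 by (simp only:)
qed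

section \<open>Weyl elements\<close>

lemma s_alpha_nth:
 "s_alpha$1$1 = 0" "s_alpha$1$2 = 1" "s_alpha$1$3 = 0" "s_alpha$1$4 = 0" "s_alpha$2$1 = 1" "s_alpha$2$2 = 0" "s_alpha$2$3 = 0" "s_alpha$2$4 = 0"
 "s_alpha$3$1 = 0" "s_alpha$3$2 = 0" "s_alpha$3$3 = 0" "s_alpha$3$4 = 1" "s_alpha$4$1 = 0" "s_alpha$4$2 = 0" "s_alpha$4$3 = 1" "s_alpha$4$4 = 0"
 by (simp_all add: s_alpha_def vector_4)

lemma s_beta_nth:
 "s_beta$1$1 = 1" "s_beta$1$2 = 0" "s_beta$1$3 = 0" "s_beta$1$4 = 0" "s_beta$2$1 = 0" "s_beta$2$2 = 0" "s_beta$2$3 = 0" "s_beta$2$4 = 1"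
 "s_beta$3$1 = 0" "s_beta$3$2 = 0" "s_beta$3$3 = 1" "s_beta$3$4 = 0" "s_beta$4$1 = 0" "s_beta$4$2 = -1" "s_beta$4$3 = 0" "s_beta$4$4 = 0"
 by (simp_all add: s_beta_def vector_4)

lemma weyl_Sp4R: "s_alpha \<in> Sp4R" "s_beta \<in> Sp4R"
 unfolding Sp4R_iff mat4_eq_iff matrix_mult_4 transpose_nth J_nth s_alpha_nth s_beta_nth by simp_all

lemma weyl_products:
 "s_beta ** s_alpha = vector [vector [0,1,0,0], vector [0,0,1,0], vector [0,0,0,1], vector [-1,0,0,0]]"
 "s_alpha ** s_beta = vector [vector [0,0,0,1], vector [1,0,0,0], vector [0,-1,0,0], vector [0,0,1,0]]"
 "s_beta ** s_alpha ** s_beta = vector [vector [0,0,0,1], vector [0,0,1,0], vector [0,-1,0,0], vector [-1,0,0,0]]"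
 "s_alpha ** s_beta ** s_alpha = vector [vector [0,0,1,0], vector [0,1,0,0], vector [-1,0,0,0], vector [0,0,0,1]]"
 "w_0 = vector [vector [0,0,1,0], vector [0,0,0,1], vector [-1,0,0,0], vector [0,-1,0,0]]"
 unfolding w_0_def mat4_eq_iff matrix_mult_4 s_alpha_nth s_beta_nth vector_4 by simp_all

lemma weyl_orthogonal:
 "s_beta ** transpose s_beta = mat 1" "s_beta ** s_alpha ** transpose (s_beta ** s_alpha) = mat 1"
 "s_beta ** s_alpha ** s_beta ** transpose (s_beta ** s_alpha ** s_beta) = mat 1" "w_0 ** transpose w_0 = mat 1"
 unfolding weyl_products(5) weyl_products(3) unfolding weyl_products(1)
 unfolding mat4_eq_iff matrix_mult_4 transpose_nth mat_4_nth vector_4 s_beta_nth by simp_all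

lemma orthogonal_inverse:
 fixes w :: "real^4^4"
 assumes w: "w ** transpose w = mat 1"
 shows "matrix_inv w = transpose w" "transpose w ** w = mat 1"
proof -
 show t: "transpose w ** w = mat 1" using w by (simp add: matrix_left_right_inverse)
 have "w ** matrix_inv w = mat 1 \<and> matrix_inv w ** w = mat 1"
  unfolding matrix_inv_def by (rule someI[of _ "transpose w"]) (use w t in simp)
 hence "matrix_inv w ** w ** transpose w = transpose w" by simp
 thus "matrix_inv w = transpose w" by (simp add: w flip: matrix_mul_assoc)
qed

lemma conj_iff:
 fixes w :: "real^4^4"
 assumes w: "w ** transpose w = mat 1"
 shows "u = transpose w ** X ** w \<longleftrightarrow> w ** u ** transpose w = X"
proof -
 note t = orthogonal_inverse(2)[OF w]
 have 1: "w ** (transpose w ** X ** w) ** transpose w = X" for X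
 proof -
  have "w ** (transpose w ** X ** w) ** transpose w = (w ** transpose w) ** X ** (w ** transpose w)" by (simp only: matrix_mul_assoc)
  thus ?thesis by (simp add: w)
 qed
 have 2: "transpose w ** (w ** u ** transpose w) ** w = u"
 proof -
  have "transpose w ** (w ** u ** transpose w) ** w = (transpose w ** w) ** u ** (transpose w ** w)" by (simp only: matrix_mul_assoc)
  thus ?thesis by (simp add: t)
 qed
 show ?thesis using 1 2 by metis
qed

lemma U_w_iff:
 assumes w: "w ** transpose w = mat 1"
 shows "eta n \<in> U_w w \<longleftrightarrow> (\<exists>m. w ** eta n ** transpose w = transpose (eta m))"
proof -
 have "eta n \<in> U_w w \<longleftrightarrow> (\<exists>m. eta n = transpose w ** transpose (eta m) ** w)"
  unfolding U_w_def U_def orthogonal_inverse(1)[OF w] by blast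
 thus ?thesis unfolding conj_iff[OF w] .
qed

lemma Ubar_w_elim:
 assumes w: "w ** transpose w = mat 1" and u: "u \<in> Ubar_w w"
 shows "\<exists>n m. u = eta n \<and> w ** eta n ** transpose w = eta m"
proof -
 obtain n m where "u = eta n" "u = transpose w ** eta m ** w"
  using u unfolding Ubar_w_def U_def orthogonal_inverse(1)[OF w] by blast
 thus ?thesis using conj_iff[OF w, of u "eta m"] by metis
qed

lemma free_coordsI:
 assumes "I \<subseteq> U_coords" "\<And>n. eta n \<in> U_w w \<longleftrightarrow> (\<forall>i\<in>U_coords - I. n i = 0)"
 shows "free_coords w = I"
proof
 show "free_coords w \<subseteq> I" unfolding free_coords_def assms(2) by auto
 show "I \<subseteq> free_coords w"
 proof
  fix i assume "i \<in> I"
  moreover have "eta (\<lambda>j. if j \<in> I then 1 else 0) \<in> U_w w" unfolding assms(2) by auto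
  ultimately show "i \<in> free_coords w" unfolding free_coords_def using assms(1) by fastforce
 qed
qed

lemma free_coords_weyl:
 "free_coords s_beta = {5}" "free_coords (s_beta ** s_alpha) = {1, 2}" (is ?g1)
 "free_coords (s_beta ** s_alpha ** s_beta) = {2, 4, 5}" (is ?g2) "free_coords w_0 = {1, 2, 4, 5}"
proof -
 have "eta n \<in> U_w s_beta \<longleftrightarrow> (\<forall>i\<in>U_coords - {5}. n i = 0)" for n
 proof
  assume "eta n \<in> U_w s_beta"
  then obtain m where "s_beta ** eta n ** transpose s_beta = transpose (eta m)" unfolding U_w_iff[OF weyl_orthogonal(1)] by blast
  hence "n 1 = 0 \<and> n 2 = 0 \<and> n 4 = 0" unfolding mat4_eq_iff matrix_mult_4 transpose_nth eta_nth s_beta_nth by auto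
  thus "\<forall>i\<in>U_coords - {5}. n i = 0" by (auto simp: U_coords_def)
 next
  assume "\<forall>i\<in>U_coords - {5}. n i = 0"
  hence z: "n 1 = 0" "n 2 = 0" "n 4 = 0" by (auto simp: U_coords_def)
  have "s_beta ** eta n ** transpose s_beta = transpose (eta (\<lambda>i. if i = 5 then - n 5 else 0))"
   unfolding mat4_eq_iff matrix_mult_4 transpose_nth eta_nth s_beta_nth z by simp
  thus "eta n \<in> U_w s_beta" unfolding U_w_iff[OF weyl_orthogonal(1)] by blast
 qed
 thus "free_coords s_beta = {5}" by (intro free_coordsI) (auto simp: U_coords_def)
 have "eta n \<in> U_w (s_beta ** s_alpha) \<longleftrightarrow> (\<forall>i\<in>U_coords - {1, 2}. n i = 0)" for n
 proof
  assume "eta n \<in> U_w (s_beta ** s_alpha)"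
  then obtain m where "s_beta ** s_alpha ** eta n ** transpose (s_beta ** s_alpha) = transpose (eta m)" unfolding U_w_iff[OF weyl_orthogonal(2)] by blast
  hence "n 4 = 0 \<and> n 5 = 0" unfolding weyl_products(1) unfolding mat4_eq_iff matrix_mult_4 transpose_nth eta_nth vector_4 by auto
  thus "\<forall>i\<in>U_coords - {1, 2}. n i = 0" by (auto simp: U_coords_def)
 next
  assume "\<forall>i\<in>U_coords - {1, 2}. n i = 0"
  hence z: "n 4 = 0" "n 5 = 0" by (auto simp: U_coords_def)
  have "s_beta ** s_alpha ** eta n ** transpose (s_beta ** s_alpha) = transpose (eta (\<lambda>i. if i = 4 then - n 1 else if i = 5 then - n 2 else 0))"
   unfolding weyl_products(1) unfolding mat4_eq_iff matrix_mult_4 transpose_nth eta_nth vector_4 z by simp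
  thus "eta n \<in> U_w (s_beta ** s_alpha)" unfolding U_w_iff[OF weyl_orthogonal(2)] by blast
 qed
 thus ?g1 by (intro free_coordsI) (auto simp: U_coords_def)
 have "eta n \<in> U_w (s_beta ** s_alpha ** s_beta) \<longleftrightarrow> (\<forall>i\<in>U_coords - {2, 4, 5}. n i = 0)" for n
 proof
  assume "eta n \<in> U_w (s_beta ** s_alpha ** s_beta)"
  then obtain m where "s_beta ** s_alpha ** s_beta ** eta n ** transpose (s_beta ** s_alpha ** s_beta) = transpose (eta m)" unfolding U_w_iff[OF weyl_orthogonal(3)] by blast
  hence "n 1 = 0" unfolding weyl_products(3) unfolding mat4_eq_iff matrix_mult_4 transpose_nth eta_nth vector_4 by auto
  thus "\<forall>i\<in>U_coords - {2, 4, 5}. n i = 0" by (auto simp: U_coords_def)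
 next
  assume "\<forall>i\<in>U_coords - {2, 4, 5}. n i = 0"
  hence z: "n 1 = 0" by (auto simp: U_coords_def)
  have "s_beta ** s_alpha ** s_beta ** eta n ** transpose (s_beta ** s_alpha ** s_beta) = transpose (eta (\<lambda>i. if i = 2 then - n 5 else if i = 4 then - n 4 else if i = 5 then - n 2 else 0))"
   unfolding weyl_products(3) unfolding mat4_eq_iff matrix_mult_4 transpose_nth eta_nth vector_4 z by simp
  thus "eta n \<in> U_w (s_beta ** s_alpha ** s_beta)" unfolding U_w_iff[OF weyl_orthogonal(3)] by blast
 qed
 thus ?g2 by (intro free_coordsI) (auto simp: U_coords_def)
 have "eta n \<in> U_w w_0 \<longleftrightarrow> (\<forall>i\<in>U_coords - {1, 2, 4, 5}. n i = 0)" for n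
 proof -
  have "w_0 ** eta n ** transpose w_0 = transpose (eta (\<lambda>i. if i = 1 then - n 1 else if i = 2 then - n 2 else if i = 4 then - (n 1 * n 5 + n 4) else - n 5))"
   unfolding weyl_products(5) unfolding mat4_eq_iff matrix_mult_4 transpose_nth eta_nth vector_4 by simp
  hence "eta n \<in> U_w w_0" unfolding U_w_iff[OF weyl_orthogonal(4)] by blast
  thus ?thesis by (simp add: U_coords_def)
 qed
 thus "free_coords w_0 = {1, 2, 4, 5}" by (intro free_coordsI) (auto simp: U_coords_def)
qed

lemma chi_eta: "cnj (chi m1 m2 (eta n)) = uchar m1 m2 n"
proof -
 have "chi m1 m2 (eta n) = cis (2 * pi * (of_int m1 * n 1 + of_int m2 * n 5))" by (simp add: chi_def eta_nth cis_conv_exp mult_ac)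
 thus ?thesis by (simp add: uchar_def cis_cnj)
qed

lemma chi_zero: "chi 0 0 u = 1" by (simp add: chi_def)

lemma Ubar_trivial:
 "\<forall>u\<in>Ubar_w (s_beta ** s_alpha). chi m1 0 u = 1" (is ?g1)
 "\<forall>u\<in>Ubar_w (s_beta ** s_alpha ** s_beta). chi 0 m2 u = 1" (is ?g2)
 "\<forall>u\<in>Ubar_w w_0. chi m1 0 u = 1" (is ?g3)
proof -
 show ?g1
 proof
  fix u assume "u \<in> Ubar_w (s_beta ** s_alpha)"
  then obtain n m where u: "u = eta n" and e: "s_beta ** s_alpha ** eta n ** transpose (s_beta ** s_alpha) = eta m"
   using Ubar_w_elim[OF weyl_orthogonal(2)] by blast
  have "n 1 = 0" using e unfolding weyl_products(1) unfolding mat4_eq_iff matrix_mult_4 transpose_nth eta_nth vector_4 by auto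
  thus "chi m1 0 u = 1" unfolding u chi_def eta_nth by simp
 qed
 show ?g2
 proof
  fix u assume "u \<in> Ubar_w (s_beta ** s_alpha ** s_beta)"
  then obtain n m where u: "u = eta n" and e: "s_beta ** s_alpha ** s_beta ** eta n ** transpose (s_beta ** s_alpha ** s_beta) = eta m"
   using Ubar_w_elim[OF weyl_orthogonal(3)] by blast
  have "n 5 = 0" using e unfolding weyl_products(3) unfolding mat4_eq_iff matrix_mult_4 transpose_nth eta_nth vector_4 by auto
  thus "chi 0 m2 u = 1" unfolding u chi_def eta_nth by simp
 qed
 show ?g3
 proof
  fix u assume "u \<in> Ubar_w w_0"
  then obtain n m where u: "u = eta n" and e: "w_0 ** eta n ** transpose w_0 = eta m"
   using Ubar_w_elim[OF weyl_orthogonal(4)] by blast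
  have "n 1 = 0" using e unfolding weyl_products(5) unfolding mat4_eq_iff matrix_mult_4 transpose_nth eta_nth vector_4 by auto
  thus "chi m1 0 u = 1" unfolding u chi_def eta_nth by simp
 qed
qed

section \<open>The innermost integration\<close>

lemma I_0_eq:
 assumes h: "h \<in> Sp4R"
 shows "I_0 h (nu_star \<nu>) = of_real (dot h 3 3) powr (- ((\<nu> + 2) / 2)) * of_real (dot h 3 3 / gram h)"
proof -
 note i = iwasawa_y_eq[OF h]
 define y where "y = sqrt (dot h 3 3) / sqrt (gram h)"
 have y: "y > 0" using i by (simp add: y_def)
 have "2 * ((\<nu> + 1) / 2) = \<nu> + 1" by (simp add: field_simps)
 hence ex: "2 * ((\<nu> + 1) / 2) - \<nu> + 1 = 2" by (simp only:) simp
 have "complex_of_real y powr (2 * ((\<nu> + 1) / 2) - \<nu> + 1) = complex_of_real y powr 2" unfolding ex ..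
 also have "\<dots> = of_real (y powr 2)" using powr_of_real[of y 2] y by simp
 also have "y powr 2 = dot h 3 3 / gram h" using y i by (simp add: powr_numeral y_def power_divide)
 finally have 2: "complex_of_real y powr (2 * ((\<nu> + 1) / 2) - \<nu> + 1) = of_real (dot h 3 3 / gram h)" .
 have "of_real (1 / sqrt (dot h 3 3)) powr (\<nu> + 2) = of_real (dot h 3 3) powr (- ((\<nu> + 2) / 2))"
  using I_beta_eq[OF h, of \<nu>] by (simp add: I_beta_def i)
 thus ?thesis using 2 unfolding I_0_def nu_star_def prod.case i(1) fst_conv snd_conv y_def by (simp only:)
qed

definition gram_line :: "real^4^4 => real => real" where
 "gram_line h x = dot h 3 3 * (dot h 2 2 + 2 * x * dot h 2 4 + x\<^sup>2 * dot h 4 4) - (dot h 2 3 + x * dot h 3 4)\<^sup>2"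

lemma beta_kernel:
 assumes h: "h \<in> Sp4R"
 shows "\<exists>a>0. \<exists>b. \<forall>x. dot h 3 3 / gram_line h x = a / (a\<^sup>2 + (x + b)\<^sup>2)"
proof -
 obtain n y1 y2 k where k: "y1 > 0" "y2 > 0" "k \<in> K" "h = eta n ** torus y1 y2 ** k"
  using iwasawa_exists[OF h] by blast
 have d: "dot h i j = dot (eta n ** torus y1 y2) i j" for i j unfolding k(4) by (rule dot_K[OF k(3)])
 have e: "dot h 3 3 = 1 / y1\<^sup>2" "dot h 2 2 = y2\<^sup>2 + (n 4)\<^sup>2 / y1\<^sup>2 + (n 5)\<^sup>2 / y2\<^sup>2" "dot h 2 3 = n 4 / y1\<^sup>2"
  "dot h 2 4 = - n 1 * n 4 / y1\<^sup>2 + n 5 / y2\<^sup>2" "dot h 3 4 = - n 1 / y1\<^sup>2" "dot h 4 4 = (n 1)\<^sup>2 / y1\<^sup>2 + 1 / y2\<^sup>2"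
  unfolding d using k(1,2) by (simp_all add: dot_def matrix_mult_4 eta_nth torus_nth field_simps power2_eq_square)
 have g: "gram_line h x = (1 / y1\<^sup>2) * (((y2\<^sup>2)\<^sup>2 + (x + n 5)\<^sup>2) / y2\<^sup>2)" for x
 proof -
  define a b c where "a = 1 / y1\<^sup>2" and "b = 1 / y2\<^sup>2" and "c = y2\<^sup>2"
  have bc: "b * c = 1" using k(2) by (simp add: b_def c_def)
  have e': "dot h 3 3 = a" "dot h 2 2 = c + (n 4)\<^sup>2 * a + (n 5)\<^sup>2 * b" "dot h 2 3 = n 4 * a"
   "dot h 2 4 = - n 1 * n 4 * a + n 5 * b" "dot h 3 4 = - n 1 * a" "dot h 4 4 = (n 1)\<^sup>2 * a + b"
   unfolding e by (simp_all add: a_def b_def c_def)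
  have "gram_line h x = a * c + a * b * (x + n 5)\<^sup>2"
   unfolding gram_line_def e' by (simp add: power2_eq_square algebra_simps)
  also have "\<dots> = a * c * (b * c) + a * b * (x + n 5)\<^sup>2" by (simp add: bc)
  also have "\<dots> = a * ((c\<^sup>2 + (x + n 5)\<^sup>2) * b)" by (simp add: power2_eq_square algebra_simps)
  finally show ?thesis by (simp add: a_def b_def c_def)
 qed
 have "dot h 3 3 / gram_line h x = y2\<^sup>2 / ((y2\<^sup>2)\<^sup>2 + (x + n 5)\<^sup>2)" for x
 proof -
  have "(y2\<^sup>2)\<^sup>2 + (x + n 5)\<^sup>2 > 0" using k(2) by (simp add: add_pos_nonneg)
  thus ?thesis unfolding g unfolding e(1) using k(1,2) by simp
 qed
 moreover have "y2\<^sup>2 > 0" using k(2) by simp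
 ultimately show ?thesis by blast
qed

lemma gram_lineI:
 assumes e: "e = 1 \<or> e = -1" "e' = 1 \<or> e' = -1"
  and r: "\<forall>j. M$3$j = e * h$3$j" "\<forall>j. M$4$j = e' * (h$2$j + x * h$4$j)"
 shows "dot M 3 3 = dot h 3 3" "gram M = gram_line h x"
proof -
 have e2: "e * e = 1" "e' * e' = 1" using e by auto
 have "dot M 3 3 = (e * e) * dot h 3 3" by (simp add: dot_def r algebra_simps)
 thus 1: "dot M 3 3 = dot h 3 3" by (simp add: e2)
 have "dot M 4 4 = (e' * e') * (dot h 2 2 + 2 * x * dot h 2 4 + x\<^sup>2 * dot h 4 4)" by (simp add: dot_def r power2_eq_square algebra_simps)
 hence 2: "dot M 4 4 = dot h 2 2 + 2 * x * dot h 2 4 + x\<^sup>2 * dot h 4 4" by (simp add: e2)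
 have "dot M 3 4 = (e * e') * (dot h 2 3 + x * dot h 3 4)" by (simp add: dot_def r algebra_simps)
 hence "(dot M 3 4)\<^sup>2 = (e * e) * (e' * e') * (dot h 2 3 + x * dot h 3 4)\<^sup>2" by (simp add: power2_eq_square algebra_simps)
 hence 3: "(dot M 3 4)\<^sup>2 = (dot h 2 3 + x * dot h 3 4)\<^sup>2" by (simp add: e2)
 show "gram M = gram_line h x" unfolding gram_def gram_line_def 1 2 3 ..
qed

lemma row_mult:
 fixes A B g :: "real^4^4"
 shows "\<forall>i. A$3$i = e * B$3$i ==> \<forall>j. (A ** g)$3$j = e * (B ** g)$3$j"
  and "\<forall>i. A$4$i = e' * (B$2$i + x * B$4$i) ==> \<forall>j. (A ** g)$4$j = e' * ((B ** g)$2$j + x * (B ** g)$4$j)"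
 by (simp_all add: matrix_mult_4 algebra_simps)

lemma kernel_from_rows:
 assumes B: "B \<in> Sp4R" and g: "g \<in> Sp4R" and e: "e = 1 \<or> e = -1" "e' = 1 \<or> e' = -1"
  and r: "\<forall>x i. A x$3$i = e * B$3$i" "\<forall>x i. A x$4$i = e' * (B$2$i + x * B$4$i)"
 shows "\<exists>a>0. \<exists>b. \<forall>x. dot (A x ** g) 3 3 / gram (A x ** g) = a / (a\<^sup>2 + (x + b)\<^sup>2)"
proof -
 have Bg: "B ** g \<in> Sp4R" by (rule Sp4R_mult[OF B g])
 have "dot (A x ** g) 3 3 = dot (B ** g) 3 3" "gram (A x ** g) = gram_line (B ** g) x" for x
 proof -
  have "\<forall>i. A x$3$i = e * B$3$i" "\<forall>i. A x$4$i = e' * (B$2$i + x * B$4$i)" using r by blast+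
  from gram_lineI[OF e row_mult(1)[OF this(1), of g] row_mult(2)[OF this(2), of g]]
  show "dot (A x ** g) 3 3 = dot (B ** g) 3 3" "gram (A x ** g) = gram_line (B ** g) x" by blast+
 qed
 thus ?thesis using beta_kernel[OF Bg] by (simp only:)
qed

definition restr :: "nat set => (nat => real) => nat => real" where
 "restr I n = (\<lambda>i. if i \<in> I then n i else 0)"

lemma eta_w_eq: "free_coords w = I ==> eta_w w n = eta (restr I n)" by (simp add: eta_w_def restr_def)

lemma entry_measurable:
 fixes T :: "(nat => real) => nat => real"
 assumes T: "\<And>i. (\<lambda>n. T n i) \<in> borel_measurable M"
 shows "(\<lambda>n. dot (w ** eta (T n) ** g) 3 3 / gram (w ** eta (T n) ** g)) \<in> borel_measurable M"
proof -
 have e: "\<forall>i j. (\<lambda>n. eta (T n) $ i $ j) \<in> borel_measurable M"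
  unfolding forall_4 eta_nth by (intro conjI borel_measurable_add borel_measurable_times borel_measurable_uminus borel_measurable_const T)
 have m: "(\<lambda>n. (w ** eta (T n) ** g) $ i $ j) \<in> borel_measurable M" for i j
  unfolding matrix_mult_4 by (intro borel_measurable_add borel_measurable_times borel_measurable_const e[rule_format])
 have d: "(\<lambda>n. dot (w ** eta (T n) ** g) i j) \<in> borel_measurable M" for i j
  unfolding dot_def by (intro borel_measurable_add borel_measurable_times m)
 show ?thesis unfolding gram_def by (intro borel_measurable_divide borel_measurable_diff borel_measurable_times borel_measurable_power d)
qed

lemma restr_measurable: "(\<lambda>n. restr I n i) \<in> borel_measurable (PL I)"
 unfolding restr_def by (cases "i \<in> I") (simp_all only: if_True if_False PL_measurable borel_measurable_const simp_thms)

section \<open>Jacquet integrals\<close>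

abbreviation ech :: "int => nat => (nat => real) => complex" where
 "ech m i n \<equiv> cis (- 2 * pi * of_int m * n i)"

lemma ech_measurable: "i \<in> I ==> ech m i \<in> borel_measurable (PL I)"
proof -
 assume "i \<in> I"
 have "(\<lambda>x. cis (- 2 * pi * of_int m * x)) \<in> borel_measurable borel" by (intro borel_measurable_continuous_onI continuous_intros)
 from measurable_compose[OF PL_measurable[OF \<open>i \<in> I\<close>] this] show ?thesis .
qed

lemma PL_base:
 fixes D A b :: real
 assumes "D > 0" "A > 0" "Re s > 1"
 shows "integrable (PL {i}) (\<lambda>n. ech m i n * of_real (D + A * (n i + b)\<^sup>2) powr (- (s / 2)))" (is ?g1)
  and "kappa s * (\<integral>n. ech m i n * of_real (D + A * (n i + b)\<^sup>2) powr (- (s / 2)) \<partial>PL {i})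
    = of_real (A powr (- (1/2))) * cis (2 * pi * of_int m * b) * bes ((s - 1) / 2) D ((of_int m)\<^sup>2 / A)" (is ?g2)
proof -
 note Q = quad_power_shift[OF assms, of b "of_int m"]
 have I: "integrable lborel (\<lambda>x. cis (- 2 * pi * of_int m * x) * of_real (D + A * (x + b)\<^sup>2) powr (- (s / 2)))"
  using Q(1) by (simp only: mult.commute)
 show ?g1 by (rule PL_single(1)[OF I])
 show ?g2
  unfolding PL_single(2)[OF I] Q(2)[symmetric] by (simp only: mult.commute)
qed

lemma kappa_pcoeff: "Re s > 0 ==> kappa s * (pcoeff s A * x) = of_real (A powr (- (1/2))) * (kappa (s - 1) * x)"
 using kappa_nonzero[of s] by (simp add: pcoeff_def)

lemma jacquet_unfold:
 assumes "\<forall>u\<in>Ubar_w w. chi m1 m2 u = 1" and I: "free_coords w = I" and w: "w \<in> Sp4R" and g: "g \<in> Sp4R"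
 shows "jacquet_integral w g (nu_star \<nu>) m1 m2 =
   (\<integral>n. (uchar m1 m2 (restr I n) * of_real (dot (w ** eta (restr I n) ** g) 3 3) powr (- ((\<nu> + 2) / 2)))
    * of_real (dot (w ** eta (restr I n) ** g) 3 3 / gram (w ** eta (restr I n) ** g)) \<partial>PL I)"
proof -
 have "w ** eta (restr I n) ** g \<in> Sp4R" for n by (intro Sp4R_mult w g eta_Sp4R)
 note e = I_0_eq[OF this, of _ \<nu>]
 show ?thesis unfolding jacquet_integral_def if_P[OF assms(1)] I eta_w_eq[OF I] chi_eta e by (simp only: mult_ac)
qed

context horocycle
begin

definition NB :: "(nat => real) => real" where "NB n = 1 / y2\<^sup>2 + (1 / y1\<^sup>2) * (n 1 + p1)\<^sup>2"
definition NC :: "(nat => real) => real" where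
 "NC n = (y2\<^sup>2 + (1 / y2\<^sup>2) * (n 5 + p5)\<^sup>2) + (1 / y1\<^sup>2) * (n 4 + (p4 - p1 * n 5))\<^sup>2"
definition ND :: "(nat => real) => real" where
 "ND n = ((y1\<^sup>2 + y2\<^sup>2 * (n 1 + p1)\<^sup>2) + (1 / y2\<^sup>2) * (n 4 + (p1 * p5 + p4 + p5 * n 1))\<^sup>2)
   + (1 / y1\<^sup>2) * (n 2 + (p2 + p4 * n 1 - p1 * n 4))\<^sup>2"

lemma N_pos: "NB n > 0" "NC n > 0" "ND n > 0"
 using y by (auto simp: NB_def NC_def ND_def intro!: add_pos_nonneg)

lemma N_measurable:
 "1 \<in> I ==> NB \<in> borel_measurable (PL I)"
 "4 \<in> I ==> 5 \<in> I ==> NC \<in> borel_measurable (PL I)"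
 "1 \<in> I ==> 2 \<in> I ==> 4 \<in> I ==> ND \<in> borel_measurable (PL I)"
 unfolding NB_def[abs_def] NC_def[abs_def] ND_def[abs_def]
 by (intro borel_measurable_add borel_measurable_times borel_measurable_power borel_measurable_diff borel_measurable_const PL_measurable; assumption)+

context
 fixes p k g
 assumes p: "p 1 = p1" "p 2 = p2" "p 4 = p4" "p 5 = p5" and k: "k \<in> K" and gB: "g = eta p ** torus y1 y2 ** k" and g: "g \<in> Sp4R"
begin

lemma dot_row:
 fixes A :: "real^4^4"
 assumes "A$3$1 = r1" "A$3$2 = r2" "A$3$3 = r3" "A$3$4 = r4"
 shows "dot (A ** g) 3 3 = (y1 * r1)\<^sup>2 + (y2 * (p1 * r1 + r2))\<^sup>2 + (p2 * r1 + p4 * r2 + r3 - p1 * r4)\<^sup>2 / y1\<^sup>2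
   + ((p1 * p5 + p4) * r1 + p5 * r2 + r4)\<^sup>2 / y2\<^sup>2"
proof -
 define M where "M = A ** (eta p ** torus y1 y2)"
 have m: "M$3$1 = y1 * r1" "M$3$2 = y2 * (p1 * r1 + r2)" "M$3$3 = (p2 * r1 + p4 * r2 + r3 - p1 * r4) / y1"
  "M$3$4 = ((p1 * p5 + p4) * r1 + p5 * r2 + r4) / y2"
  unfolding M_def matrix_mult_4 eta_nth torus_nth p assms divide_inverse by (simp_all add: algebra_simps)
 have "dot (A ** g) 3 3 = dot (M ** k) 3 3" unfolding gB M_def by (simp only: matrix_mul_assoc)
 also have "\<dots> = dot M 3 3" by (rule dot_K[OF k])
 finally show ?thesis unfolding dot_def m by (simp add: power2_eq_square)
qed

lemma dot_B: "dot (s_beta ** s_alpha ** eta n ** g) 3 3 = NB n"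
proof -
 have r: "(s_beta ** s_alpha ** eta n)$3$1 = 0" "(s_beta ** s_alpha ** eta n)$3$2 = 0" "(s_beta ** s_alpha ** eta n)$3$3 = - n 1" "(s_beta ** s_alpha ** eta n)$3$4 = 1"
  unfolding weyl_products(1) unfolding matrix_mult_4 eta_nth vector_4 by simp_all
 have "(- n 1 - p1)\<^sup>2 = (n 1 + p1)\<^sup>2" by (simp add: power2_eq_square algebra_simps)
 thus ?thesis unfolding dot_row[OF r] NB_def by simp
qed

lemma dot_C:
 assumes "n 1 = 0"
 shows "dot (s_beta ** s_alpha ** s_beta ** eta n ** g) 3 3 = NC n"
proof -
 have r: "(s_beta ** s_alpha ** s_beta ** eta n)$3$1 = 0" "(s_beta ** s_alpha ** s_beta ** eta n)$3$2 = -1"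
  "(s_beta ** s_alpha ** s_beta ** eta n)$3$3 = - n 4" "(s_beta ** s_alpha ** s_beta ** eta n)$3$4 = - n 5"
  unfolding weyl_products(3) unfolding matrix_mult_4 eta_nth vector_4 by simp_all
 have "(- p4 - n 4 + p1 * n 5)\<^sup>2 = (n 4 + (p4 - p1 * n 5))\<^sup>2" "(- p5 - n 5)\<^sup>2 = (n 5 + p5)\<^sup>2" by (simp_all add: power2_eq_square algebra_simps)
 thus ?thesis unfolding dot_row[OF r] NC_def by simp
qed

lemma dot_D: "dot (w_0 ** eta n ** g) 3 3 = ND (n(4 := n 4 + n 1 * n 5))"
proof -
 have r: "(w_0 ** eta n)$3$1 = -1" "(w_0 ** eta n)$3$2 = - n 1"
  "(w_0 ** eta n)$3$3 = - n 2" "(w_0 ** eta n)$3$4 = - (n 1 * n 5 + n 4)"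
  unfolding weyl_products(5) unfolding matrix_mult_4 eta_nth vector_4 by simp_all
 define t where "t = n 1 * n 5 + n 4"
 have 1: "(y2 * (p1 * - 1 + - n 1))\<^sup>2 = y2\<^sup>2 * (n 1 + p1)\<^sup>2" "(p2 * - 1 + p4 * - n 1 + - n 2 - p1 * - t)\<^sup>2 = (n 2 + (p2 + p4 * n 1 - p1 * t))\<^sup>2"
  "((p1 * p5 + p4) * - 1 + p5 * - n 1 + - t)\<^sup>2 = (t + (p1 * p5 + p4 + p5 * n 1))\<^sup>2" by (simp_all add: power2_eq_square algebra_simps)
 have t: "(n(4 := n 4 + n 1 * n 5)) 1 = n 1" "(n(4 := n 4 + n 1 * n 5)) 2 = n 2" "(n(4 := n 4 + n 1 * n 5)) 4 = t" by (simp_all add: t_def)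
 show ?thesis unfolding dot_row[OF r] ND_def t unfolding t_def[symmetric] 1 by simp
qed

lemmas g_products = Sp4R_mult[OF Sp4R_mult[OF weyl_Sp4R(2) weyl_Sp4R(1)] weyl_Sp4R(2)]

lemma w0_Sp4R: "w_0 \<in> Sp4R" unfolding w_0_def by (intro Sp4R_mult weyl_Sp4R)

lemma restr_insert_measurable: "(\<lambda>n. (restr I (T n)) i) \<in> borel_measurable M" if "\<And>i. i \<in> I ==> (\<lambda>n. T n i) \<in> borel_measurable M"
 unfolding restr_def using that by (cases "i \<in> I") (simp_all only: if_True if_False borel_measurable_const simp_thms)

theorem jacquet_B:
 assumes s: "Re \<nu> > 2"
 shows "kappa (\<nu> + 2) * jacquet_integral (s_beta ** s_alpha) g (nu_star \<nu>) m1 0 = of_real pi * bterm m1 0 1 ((\<nu> + 2) / 2)"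
proof -
 define s where "s = \<nu> + 2"
 have sR: "Re s > 1" "Re s > 0" using s by (auto simp: s_def)
 define I where "I = {1, 2 :: nat}"
 define \<rho> where "\<rho> = (\<lambda>n. dot (s_beta ** s_alpha ** eta (restr I n) ** g) 3 3 / gram (s_beta ** s_alpha ** eta (restr I n) ** g))"
 define H where "H = (\<lambda>n. ech m1 1 n * of_real (NB n) powr (- (s / 2)))"
 have I: "I = insert 2 {1}" by (auto simp: I_def)
 have r: "restr I n 1 = n 1" "restr I n 2 = n 2" "restr I n 4 = 0" "restr I n 5 = 0" for n by (simp_all add: restr_def I_def)
 have pos: "1 / y2\<^sup>2 > 0" "1 / y1\<^sup>2 > 0" using y by auto
 note base = PL_base[OF pos sR(1), of 1 m1 p1, folded NB_def]
 have "jacquet_integral (s_beta ** s_alpha) g (nu_star \<nu>) m1 0 = (\<integral>n. H n * of_real (\<rho> n) \<partial>PL I)"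
 proof -
  have "NB (restr I n) = NB n" "uchar m1 0 (restr I n) = ech m1 1 n" for n by (simp_all only: NB_def uchar_def r) (simp add: mult_ac)
  thus ?thesis
   unfolding jacquet_unfold[OF Ubar_trivial(1) free_coords_weyl(2)[folded I_def] Sp4R_mult[OF weyl_Sp4R(2,1)] g]
   unfolding dot_B H_def \<rho>_def s_def by (simp only: dot_B)
 qed
 also have "\<dots> = of_real pi * (\<integral>n. H n \<partial>PL {1})"
  unfolding I
 proof (rule PL_poisson_step)
  show "\<rho> \<in> borel_measurable (PL (insert 2 {1}))"
   unfolding \<rho>_def I[symmetric] by (rule entry_measurable[OF restr_measurable])
  show "H \<in> borel_measurable (PL (insert 2 {1}))"
   unfolding H_def by (rule borel_measurable_times[OF ech_measurable powr_measurable[OF N_measurable(1) N_pos(1)]]) simp_all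
  show "\<forall>x y. H (x(2 := y)) = H x" by (simp add: H_def NB_def)
  show "integrable (PL {1}) H" unfolding H_def NB_def by (rule base(1)[unfolded NB_def])
  show "\<forall>x. \<exists>a>0. \<exists>b. \<forall>y. \<rho> (x(2 := y)) = a / (a\<^sup>2 + (y + b)\<^sup>2)"
  proof
   fix x
   have r': "restr I (x(2 := y)) 1 = x 1" "restr I (x(2 := y)) 2 = y" "restr I (x(2 := y)) 4 = 0" "restr I (x(2 := y)) 5 = 0"
    "restr {1} x 1 = x 1" "restr {1} x 2 = 0" "restr {1} x 4 = 0" "restr {1} x 5 = 0" for y by (simp_all add: restr_def I_def)
   show "\<exists>a>0. \<exists>b. \<forall>y. \<rho> (x(2 := y)) = a / (a\<^sup>2 + (y + b)\<^sup>2)"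
    unfolding \<rho>_def
   proof (rule kernel_from_rows[where B = "s_alpha ** eta (restr {1} x)" and e = 1 and e' = "-1"])
    show "\<forall>y i. (s_beta ** s_alpha ** eta (restr I (x(2 := y)))) $ 3 $ i = 1 * (s_alpha ** eta (restr {1} x)) $ 3 $ i"
     unfolding weyl_products(1) forall_4 unfolding matrix_mult_4 eta_nth vector_4 s_alpha_nth r' by simp
    show "\<forall>y i. (s_beta ** s_alpha ** eta (restr I (x(2 := y)))) $ 4 $ i = - 1 * ((s_alpha ** eta (restr {1} x)) $ 2 $ i + y * (s_alpha ** eta (restr {1} x)) $ 4 $ i)"
     unfolding weyl_products(1) forall_4 unfolding matrix_mult_4 eta_nth vector_4 s_alpha_nth r' by simp
   qed (auto intro: Sp4R_mult weyl_Sp4R eta_Sp4R g)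
  qed
 qed simp_all
 finally have "kappa s * jacquet_integral (s_beta ** s_alpha) g (nu_star \<nu>) m1 0 = of_real pi * (kappa s * (\<integral>n. H n \<partial>PL {1}))" by simp
 also have "kappa s * (\<integral>n. H n \<partial>PL {1}) = of_real ((1 / y1\<^sup>2) powr (- (1/2))) * cis (2 * pi * of_int m1 * p1) * bes ((s - 1) / 2) (1 / y2\<^sup>2) ((of_int m1)\<^sup>2 / (1 / y1\<^sup>2))"
  unfolding H_def by (rule base(2))
 also have "\<dots> = bterm m1 0 1 (s / 2)"
  unfolding square_powr_half(2)[OF y(1)] by (simp add: bterm_def diff_divide_distrib)
 finally show ?thesis unfolding s_def .
qed

theorem jacquet_A:
 assumes s: "Re \<nu> > 2"
 shows "kappa (\<nu> + 2) * jacquet_integral s_beta g (nu_star \<nu>) 0 0 = of_real pi * bterm 0 0 0 ((\<nu> + 2) / 2)"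
proof -
 define s where "s = \<nu> + 2"
 have sR: "Re (s / 2) > 0" using s by (auto simp: s_def)
 define I where "I = {5 :: nat}"
 define \<rho> where "\<rho> = (\<lambda>n. dot (s_beta ** eta (restr I n) ** g) 3 3 / gram (s_beta ** eta (restr I n) ** g))"
 define c where "c = complex_of_real (1 / y1\<^sup>2) powr (- (s / 2))"
 have I: "I = insert 5 {}" by (auto simp: I_def)
 have r: "restr I n 1 = 0" "restr I n 2 = 0" "restr I n 4 = 0" "restr I n 5 = n 5" for n by (simp_all add: restr_def I_def)
 have d: "dot (s_beta ** eta n ** g) 3 3 = 1 / y1\<^sup>2" for n
 proof -
  have r: "(s_beta ** eta n)$3$1 = 0" "(s_beta ** eta n)$3$2 = 0" "(s_beta ** eta n)$3$3 = 1" "(s_beta ** eta n)$3$4 = 0"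
   unfolding matrix_mult_4 eta_nth s_beta_nth by simp_all
  show ?thesis unfolding dot_row[OF r] by simp
 qed
 have "jacquet_integral s_beta g (nu_star \<nu>) 0 0 = (\<integral>n. c * of_real (\<rho> n) \<partial>PL I)"
 proof -
  have u: "uchar 0 0 n = 1" for n by (simp add: uchar_def)
  have t: "\<forall>u\<in>Ubar_w s_beta. chi 0 0 u = 1" by (simp add: chi_zero)
  show ?thesis
   unfolding jacquet_unfold[OF t free_coords_weyl(1)[folded I_def] weyl_Sp4R(2) g] \<rho>_def by (simp only: d u c_def s_def mult_1)
 qed
 also have "\<dots> = of_real pi * (\<integral>n. c \<partial>PL {})"
  unfolding I
 proof (rule PL_poisson_step)
  show "\<rho> \<in> borel_measurable (PL (insert 5 {}))"
   unfolding \<rho>_def I[symmetric] by (rule entry_measurable[OF restr_measurable])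
  show "(\<lambda>n. c) \<in> borel_measurable (PL (insert 5 {}))" by (rule borel_measurable_const)
  show "integrable (PL {}) (\<lambda>n. c)" unfolding PiM_empty by (rule integrable_count_space) simp
  show "\<forall>x. \<exists>a>0. \<exists>b. \<forall>y. \<rho> (x(5 := y)) = a / (a\<^sup>2 + (y + b)\<^sup>2)"
  proof
   fix x
   have r': "restr I (x(5 := y)) 1 = 0" "restr I (x(5 := y)) 2 = 0" "restr I (x(5 := y)) 4 = 0" "restr I (x(5 := y)) 5 = y" for y
    by (simp_all add: restr_def I_def)
   show "\<exists>a>0. \<exists>b. \<forall>y. \<rho> (x(5 := y)) = a / (a\<^sup>2 + (y + b)\<^sup>2)"
    unfolding \<rho>_def
   proof (rule kernel_from_rows[where B = "eta (\<lambda>_. 0)" and e = 1 and e' = "-1"])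
    show "\<forall>y i. (s_beta ** eta (restr I (x(5 := y)))) $ 3 $ i = 1 * (eta (\<lambda>_. 0)) $ 3 $ i"
     unfolding forall_4 unfolding matrix_mult_4 eta_nth s_beta_nth r' by simp
    show "\<forall>y i. (s_beta ** eta (restr I (x(5 := y)))) $ 4 $ i = - 1 * ((eta (\<lambda>_. 0)) $ 2 $ i + y * (eta (\<lambda>_. 0)) $ 4 $ i)"
     unfolding forall_4 unfolding matrix_mult_4 eta_nth s_beta_nth r' by simp
   qed (auto intro: eta_Sp4R g)
  qed
 qed simp_all
 also have "(\<integral>n. c \<partial>PL {}) = c"
  unfolding PiM_empty by (subst lebesgue_integral_count_space_finite) simp_all
 finally have j: "jacquet_integral s_beta g (nu_star \<nu>) 0 0 = of_real pi * c" .
 have "kappa s * c = bes (s / 2) (1 / y1\<^sup>2) 0"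
 proof -
  have "bes (s / 2) (1 / y1\<^sup>2) 0 = Gamma (s / 2) * of_real (pi * (1 / y1\<^sup>2)) powr (- (s / 2))" by (rule bes_zero(2)) (use y sR in auto)
  also have "complex_of_real (pi * (1 / y1\<^sup>2)) powr (- (s / 2)) = of_real pi powr (- (s / 2)) * of_real (1 / y1\<^sup>2) powr (- (s / 2))"
   unfolding of_real_mult by (rule powr_times_real) (use y in simp_all)
  finally show ?thesis by (simp add: kappa_def c_def mult_ac)
 qed
 thus ?thesis unfolding j by (simp add: bterm_def s_def mult.left_commute)
qed

theorem jacquet_C:
 assumes s: "Re \<nu> > 2"
 shows "kappa (\<nu> + 2) * jacquet_integral (s_beta ** s_alpha ** s_beta) g (nu_star \<nu>) 0 m2 = of_real pi * bterm 0 m2 2 ((\<nu> + 2) / 2)"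
proof -
 define s where "s = \<nu> + 2"
 have sR: "Re s > 1" "Re s > 0" "Re (s - 1) > 1" "Re (s - 1) > 0" using s by (auto simp: s_def)
 define I where "I = {2, 4, 5 :: nat}"
 define \<rho> where "\<rho> = (\<lambda>n. dot (s_beta ** s_alpha ** s_beta ** eta (restr I n) ** g) 3 3 / gram (s_beta ** s_alpha ** s_beta ** eta (restr I n) ** g))"
 define H where "H = (\<lambda>n. ech m2 5 n * of_real (NC n) powr (- (s / 2)))"
 define G where "G = (\<lambda>n :: nat => real. ech m2 5 n * of_real (y2\<^sup>2 + (1 / y2\<^sup>2) * (n 5 + p5)\<^sup>2) powr (- ((s - 1) / 2)))"
 have I: "I = insert 2 {4, 5}" by (auto simp: I_def)
 have r: "restr I n 1 = 0" "restr I n 2 = n 2" "restr I n 4 = n 4" "restr I n 5 = n 5" for n by (simp_all add: restr_def I_def)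
 have pos: "y2\<^sup>2 > 0" "1 / y2\<^sup>2 > 0" "1 / y1\<^sup>2 > 0" using y by auto
 note base = PL_base[OF pos(1,2) sR(3), of 5 m2 p5, folded G_def]
 have mH: "H \<in> borel_measurable (PL J)" if "4 \<in> J" "5 \<in> J" for J
  unfolding H_def by (rule borel_measurable_times[OF ech_measurable[OF that(2)] powr_measurable[OF N_measurable(2)[OF that] N_pos(2)]])
 have step: "integrable (PL (insert 4 {5})) H" "(\<integral>n. H n \<partial>PL (insert 4 {5})) = pcoeff s (1 / y1\<^sup>2) * (\<integral>n. G n \<partial>PL {5})"
 proof -
  have a: "\<forall>n::nat=>real. y2\<^sup>2 + (1 / y2\<^sup>2) * (n 5 + p5)\<^sup>2 > 0" using y by (auto intro: add_pos_nonneg)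
  have b: "finite {5::nat}" "(4::nat) \<notin> {5}" by auto
  have c: "(\<lambda>n. ech m2 5 n * of_real ((y2\<^sup>2 + (1 / y2\<^sup>2) * (n 5 + p5)\<^sup>2) + (1 / y1\<^sup>2) * (n 4 + (p4 - p1 * n 5))\<^sup>2) powr (- (s / 2))) \<in> borel_measurable (PL (insert 4 {5}))"
   by (rule mH[unfolded H_def NC_def]) simp_all
  note st = PL_power_step[where E = "ech m2 5" and D = "\<lambda>n. y2\<^sup>2 + (1 / y2\<^sup>2) * (n 5 + p5)\<^sup>2" and b = "\<lambda>n. p4 - p1 * n 5", OF b pos(3) sR(1) c a _ _ _ base(1)[unfolded G_def]]
  show "integrable (PL (insert 4 {5})) H" unfolding H_def NC_def by (rule st(1)) simp_all
  show "(\<integral>n. H n \<partial>PL (insert 4 {5})) = pcoeff s (1 / y1\<^sup>2) * (\<integral>n. G n \<partial>PL {5})"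
   unfolding H_def NC_def G_def by (rule st(2)) simp_all
 qed
 have "jacquet_integral (s_beta ** s_alpha ** s_beta) g (nu_star \<nu>) 0 m2 = (\<integral>n. H n * of_real (\<rho> n) \<partial>PL I)"
 proof -
  have "NC (restr I n) = NC n" "uchar 0 m2 (restr I n) = ech m2 5 n" for n by (simp_all only: NC_def uchar_def r) (simp add: mult_ac)
  moreover have "dot (s_beta ** s_alpha ** s_beta ** eta (restr I n) ** g) 3 3 = NC (restr I n)" for n by (rule dot_C) (rule r)
  ultimately show ?thesis
   unfolding jacquet_unfold[OF Ubar_trivial(2) free_coords_weyl(3)[folded I_def] g_products g]
   unfolding H_def \<rho>_def s_def by (simp only:)
 qed
 also have "\<dots> = of_real pi * (\<integral>n. H n \<partial>PL {4, 5})"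
  unfolding I
 proof (rule PL_poisson_step)
  show "\<rho> \<in> borel_measurable (PL (insert 2 {4, 5}))"
   unfolding \<rho>_def I[symmetric] by (rule entry_measurable[OF restr_measurable])
  show "H \<in> borel_measurable (PL (insert 2 {4, 5}))" by (rule mH) simp_all
  show "\<forall>x y. H (x(2 := y)) = H x" by (simp add: H_def NC_def)
  show "integrable (PL {4, 5}) H" by (rule step(1))
  show "\<forall>x. \<exists>a>0. \<exists>b. \<forall>y. \<rho> (x(2 := y)) = a / (a\<^sup>2 + (y + b)\<^sup>2)"
  proof
   fix x
   have r': "restr I (x(2 := y)) 1 = 0" "restr I (x(2 := y)) 2 = y" "restr I (x(2 := y)) 4 = x 4" "restr I (x(2 := y)) 5 = x 5"
    "restr {4, 5} x 1 = 0" "restr {4, 5} x 2 = 0" "restr {4, 5} x 4 = x 4" "restr {4, 5} x 5 = x 5" for y by (simp_all add: restr_def I_def)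
   show "\<exists>a>0. \<exists>b. \<forall>y. \<rho> (x(2 := y)) = a / (a\<^sup>2 + (y + b)\<^sup>2)"
    unfolding \<rho>_def
   proof (rule kernel_from_rows[where B = "s_alpha ** s_beta ** eta (restr {4, 5} x)" and e = 1 and e' = "-1"])
    show "\<forall>y i. (s_beta ** s_alpha ** s_beta ** eta (restr I (x(2 := y)))) $ 3 $ i = 1 * (s_alpha ** s_beta ** eta (restr {4, 5} x)) $ 3 $ i"
     unfolding weyl_products(3) weyl_products(2) forall_4 unfolding matrix_mult_4 eta_nth vector_4 r' by simp
    show "\<forall>y i. (s_beta ** s_alpha ** s_beta ** eta (restr I (x(2 := y)))) $ 4 $ i = - 1 * ((s_alpha ** s_beta ** eta (restr {4, 5} x)) $ 2 $ i + y * (s_alpha ** s_beta ** eta (restr {4, 5} x)) $ 4 $ i)"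
     unfolding weyl_products(3) weyl_products(2) forall_4 unfolding matrix_mult_4 eta_nth vector_4 r' by simp
   qed (auto intro: Sp4R_mult weyl_Sp4R eta_Sp4R g)
  qed
 qed simp_all
 finally have "kappa s * jacquet_integral (s_beta ** s_alpha ** s_beta) g (nu_star \<nu>) 0 m2
   = of_real pi * (kappa s * (pcoeff s (1 / y1\<^sup>2) * (\<integral>n. G n \<partial>PL {5})))" unfolding step(2) by simp
 also have "kappa s * (pcoeff s (1 / y1\<^sup>2) * (\<integral>n. G n \<partial>PL {5}))
   = of_real ((1 / y1\<^sup>2) powr (- (1/2))) * (of_real ((1 / y2\<^sup>2) powr (- (1/2))) * cis (2 * pi * of_int m2 * p5) * bes ((s - 1 - 1) / 2) (y2\<^sup>2) ((of_int m2)\<^sup>2 / (1 / y2\<^sup>2)))"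
  unfolding kappa_pcoeff[OF sR(2)] base(2) ..
 also have "\<dots> = bterm 0 m2 2 (s / 2)"
  unfolding square_powr_half(2)[OF y(1)] square_powr_half(2)[OF y(2)] by (simp add: bterm_def diff_divide_distrib)
 finally show ?thesis unfolding s_def .
qed

theorem jacquet_D:
 assumes s: "Re \<nu> > 2"
 shows "kappa (\<nu> + 2) * jacquet_integral w_0 g (nu_star \<nu>) m1 0 = of_real pi * bterm m1 0 3 ((\<nu> + 2) / 2)"
proof -
 define s where "s = \<nu> + 2"
 have sR: "Re s > 1" "Re s > 0" "Re (s - 1) > 1" "Re (s - 1) > 0" "Re (s - 1 - 1) > 1" using s by (auto simp: s_def)
 define I where "I = {1, 2, 4, 5 :: nat}"
 define \<rho> where "\<rho> = (\<lambda>n. dot (w_0 ** eta (restr I n) ** g) 3 3 / gram (w_0 ** eta (restr I n) ** g))"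
 define sh where "sh = (\<lambda>n::nat => real. n(4 := n 4 + - (n 1 * n 5)))"
 define H where "H = (\<lambda>n. ech m1 1 n * of_real (ND n) powr (- (s / 2)))"
 define D2 where "D2 = (\<lambda>n :: nat => real. (y1\<^sup>2 + y2\<^sup>2 * (n 1 + p1)\<^sup>2) + (1 / y2\<^sup>2) * (n 4 + (p1 * p5 + p4 + p5 * n 1))\<^sup>2)"
 define G where "G = (\<lambda>n :: nat => real. ech m1 1 n * of_real (D2 n) powr (- ((s - 1) / 2)))"
 define G' where "G' = (\<lambda>n :: nat => real. ech m1 1 n * of_real (y1\<^sup>2 + y2\<^sup>2 * (n 1 + p1)\<^sup>2) powr (- ((s - 1 - 1) / 2)))"
 have r: "restr I n 1 = n 1" "restr I n 2 = n 2" "restr I n 4 = n 4" "restr I n 5 = n 5" for n by (simp_all add: restr_def I_def)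
 have pos: "y1\<^sup>2 > 0" "y2\<^sup>2 > 0" "1 / y2\<^sup>2 > 0" "1 / y1\<^sup>2 > 0" using y by auto
 note base = PL_base[OF pos(1,2) sR(5), of 1 m1 p1, folded G'_def]
 have mH: "H \<in> borel_measurable (PL J)" if "1 \<in> J" "2 \<in> J" "4 \<in> J" for J
  unfolding H_def by (rule borel_measurable_times[OF ech_measurable[OF that(1)] powr_measurable[OF N_measurable(3)[OF that] N_pos(3)]])
 have D1pos: "\<forall>n::nat=>real. y1\<^sup>2 + y2\<^sup>2 * (n 1 + p1)\<^sup>2 > 0" using y by (auto intro: add_pos_nonneg)
 have D2pos: "\<forall>n. D2 n > 0" unfolding D2_def using y by (auto intro!: add_pos_nonneg)
 have mD2: "D2 \<in> borel_measurable (PL {4, 1})" unfolding D2_def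
  by (intro borel_measurable_add borel_measurable_times borel_measurable_power borel_measurable_diff borel_measurable_const PL_measurable) simp_all
 have step2: "integrable (PL {4, 1}) G" "(\<integral>n. G n \<partial>PL {4, 1}) = pcoeff (s - 1) (1 / y2\<^sup>2) * (\<integral>n. G' n \<partial>PL {1})"
 proof -
  have b: "finite {1::nat}" "(4::nat) \<notin> {1}" by auto
  have "G \<in> borel_measurable (PL {4, 1})"
   unfolding G_def by (rule borel_measurable_times[OF ech_measurable powr_measurable[OF mD2]]) (use D2pos in simp_all)
  note c = this[unfolded G_def D2_def]
  note st = PL_power_step[where E = "ech m1 1" and D = "\<lambda>n. y1\<^sup>2 + y2\<^sup>2 * (n 1 + p1)\<^sup>2" and b = "\<lambda>n. p1 * p5 + p4 + p5 * n 1", OF b pos(3) sR(3) c D1pos _ _ _ base(1)[unfolded G'_def]]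
  show "integrable (PL {4, 1}) G" unfolding G_def D2_def by (rule st(1)) simp_all
  show "(\<integral>n. G n \<partial>PL {4, 1}) = pcoeff (s - 1) (1 / y2\<^sup>2) * (\<integral>n. G' n \<partial>PL {1})"
   unfolding G_def D2_def G'_def by (rule st(2)) simp_all
 qed
 have step: "integrable (PL {2, 4, 1}) H" "(\<integral>n. H n \<partial>PL {2, 4, 1}) = pcoeff s (1 / y1\<^sup>2) * (\<integral>n. G n \<partial>PL {4, 1})"
 proof -
  have b: "finite {4, 1::nat}" "(2::nat) \<notin> {4, 1}" by auto
  have HD: "H = (\<lambda>n. ech m1 1 n * of_real (D2 n + (1 / y1\<^sup>2) * (n 2 + (p2 + p4 * n 1 - p1 * n 4))\<^sup>2) powr (- (s / 2)))"
   unfolding H_def ND_def D2_def ..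
  have c: "(\<lambda>n. ech m1 1 n * of_real (D2 n + (1 / y1\<^sup>2) * (n 2 + (p2 + p4 * n 1 - p1 * n 4))\<^sup>2) powr (- (s / 2))) \<in> borel_measurable (PL {2, 4, 1})"
   by (rule mH[unfolded HD]) simp_all
  note st = PL_power_step[where E = "ech m1 1" and D = D2 and b = "\<lambda>n. p2 + p4 * n 1 - p1 * n 4", OF b pos(4) sR(1) c D2pos _ _ _ step2(1)[unfolded G_def]]
  show "integrable (PL {2, 4, 1}) H" unfolding HD by (rule st(1)) (simp_all add: D2_def)
  show "(\<integral>n. H n \<partial>PL {2, 4, 1}) = pcoeff s (1 / y1\<^sup>2) * (\<integral>n. G n \<partial>PL {4, 1})"
   unfolding HD G_def by (rule st(2)) (simp_all add: D2_def)
 qed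
 define F where "F = (\<lambda>n. (ech m1 1 n * of_real (ND (n(4 := n 4 + n 1 * n 5))) powr (- (s / 2))) * of_real (\<rho> n))"
 have m\<rho>: "\<rho> \<in> borel_measurable (PL I)" unfolding \<rho>_def by (rule entry_measurable[OF restr_measurable])
 have I4: "I = insert 4 {1, 2, 5}" and I5: "I = insert 5 {2, 4, 1}" by (auto simp: I_def)
 have h: "(\<lambda>n. - (n 1 * n 5)) \<in> borel_measurable (PL I)"
  by (intro borel_measurable_uminus borel_measurable_times PL_measurable) (simp_all add: I_def)
 have mND: "(\<lambda>n. ND (n(4 := n 4 + n 1 * n 5))) \<in> borel_measurable (PL I)"
 proof -
  have "(n(4 := n 4 + n 1 * n 5)) 1 = n 1" "(n(4 := n 4 + n 1 * n 5)) 2 = n 2" "(n(4 := n 4 + n 1 * n 5)) 4 = n 4 + n 1 * n 5" for n :: "nat => real" by simp_all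
  thus ?thesis unfolding ND_def
   by (simp only:) (intro borel_measurable_add borel_measurable_times borel_measurable_power borel_measurable_diff borel_measurable_const PL_measurable; simp add: I_def)
 qed
 have mF: "F \<in> borel_measurable (PL I)" unfolding F_def
  by (rule borel_measurable_times[OF borel_measurable_times[OF ech_measurable powr_measurable[OF mND N_pos(3)]] of_real_measurable[OF m\<rho>]]) (simp add: I_def)
 have "jacquet_integral w_0 g (nu_star \<nu>) m1 0 = (\<integral>n. F n \<partial>PL I)"
 proof -
  have "ND ((restr I n)(4 := restr I n 4 + restr I n 1 * restr I n 5)) = ND (n(4 := n 4 + n 1 * n 5))" "uchar m1 0 (restr I n) = ech m1 1 n" for n
  proof -
   show "ND ((restr I n)(4 := restr I n 4 + restr I n 1 * restr I n 5)) = ND (n(4 := n 4 + n 1 * n 5))"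
    unfolding r by (simp add: ND_def r[unfolded One_nat_def])
   show "uchar m1 0 (restr I n) = ech m1 1 n" by (simp only: uchar_def r) (simp add: mult_ac)
  qed
  thus ?thesis
   unfolding jacquet_unfold[OF Ubar_trivial(3) free_coords_weyl(4)[folded I_def] w0_Sp4R g]
   unfolding F_def \<rho>_def s_def by (simp only: dot_D)
 qed
 also have "\<dots> = (\<integral>n. F (sh n) \<partial>PL I)"
  unfolding I4 sh_def
 proof (rule PL_shear)
  show "F \<in> borel_measurable (PL (insert 4 {1, 2, 5}))" using mF unfolding I4 .
  show "(\<lambda>n. - (n 1 * n 5)) \<in> borel_measurable (PL (insert 4 {1, 2, 5}))" using h unfolding I4 .
 qed auto
 also have "\<dots> = (\<integral>n. H n * of_real (\<rho> (sh n)) \<partial>PL I)"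
 proof -
  have "(sh n)(4 := sh n 4 + sh n 1 * sh n 5) = n" "sh n 1 = n 1" for n by (auto simp: sh_def)
  thus ?thesis unfolding F_def H_def by (simp only:)
 qed
 also have "\<dots> = of_real pi * (\<integral>n. H n \<partial>PL {2, 4, 1})"
  unfolding I5
 proof (rule PL_poisson_step)
  show "(\<lambda>n. \<rho> (sh n)) \<in> borel_measurable (PL (insert 5 {2, 4, 1}))"
   unfolding I5[symmetric] \<rho>_def
  proof (rule entry_measurable[OF restr_insert_measurable])
   fix i assume i: "i \<in> I"
   show "(\<lambda>n. sh n i) \<in> borel_measurable (PL I)"
   proof (cases "i = 4")
    case True
    have "(\<lambda>n. n 4 + - (n 1 * n 5)) \<in> borel_measurable (PL I)" by (rule borel_measurable_add[OF PL_measurable h]) (simp add: I_def)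
    thus ?thesis unfolding sh_def True fun_upd_same .
   next
    case False
    have "(\<lambda>n. sh n i) = (\<lambda>n. n i)" using False by (simp add: sh_def)
    thus ?thesis using PL_measurable[OF i] by (simp only:)
   qed
  qed
  show "H \<in> borel_measurable (PL (insert 5 {2, 4, 1}))" by (rule mH) simp_all
  show "\<forall>x y. H (x(5 := y)) = H x" by (simp add: H_def ND_def)
  show "integrable (PL {2, 4, 1}) H" by (rule step(1))
  show "\<forall>x. \<exists>a>0. \<exists>b. \<forall>y. \<rho> (sh (x(5 := y))) = a / (a\<^sup>2 + (y + b)\<^sup>2)"
  proof
   fix x
   have r': "restr I (sh (x(5 := y))) 1 = x 1" "restr I (sh (x(5 := y))) 2 = x 2" "restr I (sh (x(5 := y))) 4 = x 4 - x 1 * y" "restr I (sh (x(5 := y))) 5 = y"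
    "restr {1, 2, 4} x 1 = x 1" "restr {1, 2, 4} x 2 = x 2" "restr {1, 2, 4} x 4 = x 4" "restr {1, 2, 4} x 5 = 0" for y by (simp_all add: restr_def I_def sh_def)
   show "\<exists>a>0. \<exists>b. \<forall>y. \<rho> (sh (x(5 := y))) = a / (a\<^sup>2 + (y + b)\<^sup>2)"
    unfolding \<rho>_def
   proof (rule kernel_from_rows[where B = "s_alpha ** s_beta ** s_alpha ** eta (restr {1, 2, 4} x)" and e = 1 and e' = "-1"])
    show "\<forall>y i. (w_0 ** eta (restr I (sh (x(5 := y))))) $ 3 $ i = 1 * (s_alpha ** s_beta ** s_alpha ** eta (restr {1, 2, 4} x)) $ 3 $ i"
     unfolding weyl_products(5) weyl_products(4) forall_4 unfolding matrix_mult_4 eta_nth vector_4 r' by simp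
    show "\<forall>y i. (w_0 ** eta (restr I (sh (x(5 := y))))) $ 4 $ i = - 1 * ((s_alpha ** s_beta ** s_alpha ** eta (restr {1, 2, 4} x)) $ 2 $ i + y * (s_alpha ** s_beta ** s_alpha ** eta (restr {1, 2, 4} x)) $ 4 $ i)"
     unfolding weyl_products(5) weyl_products(4) forall_4 unfolding matrix_mult_4 eta_nth vector_4 r' by (simp add: algebra_simps)
   qed (auto intro: Sp4R_mult weyl_Sp4R eta_Sp4R g)
  qed
 qed simp_all
 finally have "kappa s * jacquet_integral w_0 g (nu_star \<nu>) m1 0
   = of_real pi * (kappa s * (pcoeff s (1 / y1\<^sup>2) * (pcoeff (s - 1) (1 / y2\<^sup>2) * (\<integral>n. G' n \<partial>PL {1}))))" unfolding step(2) step2(2) by simp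
 also have "kappa s * (pcoeff s (1 / y1\<^sup>2) * (pcoeff (s - 1) (1 / y2\<^sup>2) * (\<integral>n. G' n \<partial>PL {1})))
   = of_real ((1 / y1\<^sup>2) powr (- (1/2))) * (of_real ((1 / y2\<^sup>2) powr (- (1/2))) * (of_real ((y2\<^sup>2) powr (- (1/2))) * cis (2 * pi * of_int m1 * p1) * bes ((s - 1 - 1 - 1) / 2) (y1\<^sup>2) ((of_int m1)\<^sup>2 / y2\<^sup>2)))"
  unfolding kappa_pcoeff[OF sR(2)] kappa_pcoeff[OF sR(4)] base(2) ..
 also have "\<dots> = bterm m1 0 3 (s / 2)"
  unfolding square_powr_half(2)[OF y(1)] square_powr_half(2)[OF y(2)] square_powr_half(1)[OF y(2)]
  using y by (simp add: bterm_def diff_divide_distrib)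
 finally show ?thesis unfolding s_def .
qed

end

end

section \<open>Continuation and comparison\<close>

lemma meromorphic_identity_at:
 fixes A W :: "nat => complex => complex"
 assumes A: "\<And>i. i \<in> S ==> A i meromorphic_on UNIV" "\<And>i. i \<in> S ==> A i analytic_on {\<nu>}"
  and W: "\<And>i. i \<in> S ==> W i nicely_meromorphic_on UNIV" "\<And>i. i \<in> S ==> \<not> is_pole (W i) \<nu>"
  and G: "G meromorphic_on UNIV" "G analytic_on {\<nu>}"
  and eq: "\<And>s. Re s > 2 ==> G s = (\<Sum>i\<in>S. A i s * W i s)"
 shows "G \<nu> = (\<Sum>i\<in>S. A i \<nu> * W i \<nu>)"
proof -
 define R where "R = (\<lambda>s. \<Sum>i\<in>S. A i s * W i s)"
 have Wm: "W i meromorphic_on UNIV" if "i \<in> S" for i using W(1)[OF that] by (simp add: nicely_meromorphic_on_def)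
 have "W i analytic_on {\<nu>}" if "i \<in> S" for i by (rule nicely_meromorphic_on_imp_analytic_at[OF W(1)[OF that] UNIV_I W(2)[OF that]])
 hence Ra: "R analytic_on {\<nu>}" unfolding R_def by (intro analytic_on_sum analytic_on_mult A(2))
 have Rm: "R meromorphic_on UNIV" unfolding R_def by (intro meromorphic_on_sum meromorphic_on_mult A(1) Wm)
 have "eventually (\<lambda>s. G s = R s) (cosparse UNIV)"
  by (rule meromorphic_eq_cosparse[OF G(1) Rm open_Re_gt[of 2] Re_gt_nonempty[of 2]]) (simp add: eq R_def)
 hence ev: "eventually (\<lambda>s. G s = R s) (at \<nu>)" by (auto simp: eventually_cosparse_open_eq)
 have "G \<midarrow>\<nu>\<rightarrow> G \<nu>" "R \<midarrow>\<nu>\<rightarrow> R \<nu>" using G(2) Ra by (simp_all add: analytic_at_imp_isCont isContD)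
 moreover have "R \<midarrow>\<nu>\<rightarrow> G \<nu>" by (rule Lim_transform_eventually[OF \<open>G \<midarrow>\<nu>\<rightarrow> G \<nu>\<close> ev])
 ultimately have "G \<nu> = R \<nu>" using LIM_unique by blast
 thus ?thesis by (simp add: R_def)
qed

lemma zeta_shift_analytic: "w + c \<noteq> 1 ==> (\<lambda>s. zeta (s + c)) analytic_on {w}"
 by (rule analytic_on_compose_gen[OF _ zeta_analytic, unfolded o_def]) (auto intro!: analytic_intros)

lemma zeta_shift_meromorphic: "(\<lambda>s. zeta (s + c)) meromorphic_on UNIV"
proof (rule meromorphic_on_compose[of zeta UNIV])
 show "zeta meromorphic_on UNIV" using zeta_nicely_meromorphic by (simp add: nicely_meromorphic_on_def)
qed (auto intro!: analytic_intros)

lemma zeta_eventually_nonzero: "eventually (\<lambda>s. zeta (s + 2) \<noteq> 0) (at \<nu>)"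
proof -
 from meromorphic_imp_constant_or_avoid[OF zeta_shift_meromorphic[of 2] open_UNIV connected_UNIV, of 0]
 show ?thesis
 proof
  assume "eventually (\<lambda>s. zeta (s + 2) = 0) (cosparse UNIV)"
  hence "eventually (\<lambda>s. zeta (s + 2) = 0) (at 3)" by (auto simp: eventually_cosparse_open_eq)
  moreover have "eventually (\<lambda>s. s \<in> {s. Re s > 2}) (at (3::complex))" by (rule eventually_at_in_open'[OF open_Re_gt]) simp
  ultimately have "eventually (\<lambda>s. False) (at (3::complex))" by eventually_elim (use zeta_nonzero in auto)
  thus ?thesis by simp
 next
  assume "eventually (\<lambda>s. zeta (s + 2) \<noteq> 0) (cosparse UNIV)"
  thus ?thesis by (auto simp: eventually_cosparse_open_eq)
 qed
qed

lemma div_sigma_analytic: "f analytic_on T ==> (\<lambda>s. div_sigma (f s) m) analytic_on T"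
proof -
 assume f: "f analytic_on T"
 have "(\<lambda>s. of_nat d powr f s) analytic_on T" if "d \<in> {d::nat. 0 < d \<and> int d dvd m}" for d
  using that by (intro analytic_intros f) auto
 thus ?thesis unfolding div_sigma_def by (intro analytic_on_sum) auto
qed

section \<open>Continued Whittaker functions\<close>

definition besm :: "complex => real => real => complex" where
 "besm w \<alpha> \<beta> = (if \<beta> = 0 then of_real (pi * \<alpha>) powr (- w) / rGamma w else bes w \<alpha> \<beta>)"

lemma besm_eq: "\<alpha> > 0 ==> Re w > 0 ==> besm w \<alpha> \<beta> = bes w \<alpha> \<beta>"
 by (simp add: besm_def bes_zero rGamma_inverse_Gamma divide_inverse mult.commute)

lemma besm_meromorphic:
 assumes "\<alpha> > 0" "\<beta> \<ge> 0" "f analytic_on UNIV"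
 shows "(\<lambda>s. besm (f s) \<alpha> \<beta>) meromorphic_on UNIV"
proof (cases "\<beta> = 0")
 case True
 have pa: "pi * \<alpha> > 0" using assms(1) by simp
 have 1: "(\<lambda>s. complex_of_real (pi * \<alpha>) powr (- f s)) analytic_on UNIV"
  using pa by (intro analytic_intros assms) (auto simp: complex_nonpos_Reals_iff)
 have 2: "(\<lambda>s. rGamma (f s)) analytic_on UNIV" by (intro analytic_intros assms)
 show ?thesis unfolding besm_def using True
  by (simp only: if_True simp_thms) (intro meromorphic_intros 1[THEN analytic_on_imp_meromorphic_on] 2[THEN analytic_on_imp_meromorphic_on])
next
 case False
 have "(\<lambda>s. bes (f s) \<alpha> \<beta>) analytic_on UNIV" by (rule bes_entire) (use assms False in auto)
 thus ?thesis unfolding besm_def using False by (simp add: analytic_on_imp_meromorphic_on)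
qed

lemma besm_analytic:
 assumes "\<alpha> > 0" "\<beta> \<ge> 0" "f analytic_on T" "\<And>s. s \<in> T ==> Re (f s) > 0"
 shows "(\<lambda>s. besm (f s) \<alpha> \<beta>) analytic_on T"
proof (cases "\<beta> = 0")
 case True
 have "rGamma (f s) \<noteq> 0" if "s \<in> T" for s
  using assms(4)[OF that] by (auto simp: rGamma_eq_zero_iff elim!: nonpos_Ints_cases)
 moreover have "pi * \<alpha> > 0" using assms(1) by simp
 ultimately show ?thesis unfolding besm_def using True
  by (simp only: if_True simp_thms) (intro analytic_intros assms(3); auto simp: complex_nonpos_Reals_iff)
next
 case False
 have "(\<lambda>s. bes (f s) \<alpha> \<beta>) analytic_on T" by (rule bes_entire) (use assms False in auto)
 thus ?thesis unfolding besm_def using False by simp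
qed

definition rkappa :: "complex => complex" where
 "rkappa s = of_real pi powr (s / 2) * rGamma (s / 2)"

lemma kappa_rkappa: "Re s > 0 ==> kappa s * rkappa s = 1"
proof -
 assume s: "Re s > 0"
 have "kappa s * rkappa s = (complex_of_real pi powr (- (s / 2)) * of_real pi powr (s / 2)) * (Gamma (s / 2) * rGamma (s / 2))"
  by (simp add: kappa_def rkappa_def mult_ac)
 also have "complex_of_real pi powr (- (s / 2)) * of_real pi powr (s / 2) = 1" by (simp add: powr_minus)
 also have "Gamma (s / 2) * rGamma (s / 2) = 1"
 proof -
  have "s / 2 \<notin> \<int>\<^sub>\<le>\<^sub>0" using s by (auto elim!: nonpos_Ints_cases)
  thus ?thesis by (simp add: rGamma_inverse_Gamma Gamma_eq_zero_iff)
 qed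
 finally show ?thesis by simp
qed

lemma W_star_facts:
 assumes p: "\<alpha> > 0" "\<beta> \<ge> 0" "a \<le> 3/2"
  and j: "\<And>s. Re s > 2 ==> kappa (s + 2) * jacquet_integral w g (nu_star s) m1 m2 = of_real pi * (c * bes ((s + 2) / 2 - of_real a) \<alpha> \<beta>)"
 shows "W_star w g m1 m2 nicely_meromorphic_on UNIV" (is ?g1)
  and "\<And>s. Re s > 2 ==> W_star w g m1 m2 s = rkappa (s + 2) * (of_real pi * (c * bes ((s + 2) / 2 - of_real a) \<alpha> \<beta>))"
proof -
 define F where "F = (\<lambda>s. rkappa (s + 2) * (of_real pi * (c * besm ((s + 2) / 2 - of_real a) \<alpha> \<beta>)))"
 have k: "(\<lambda>s. rkappa (s + 2)) analytic_on T" for T unfolding rkappa_def by (intro analytic_intros) (auto simp: complex_nonpos_Reals_iff)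
 have l: "(\<lambda>s. (s + 2) / 2 - complex_of_real a) analytic_on T" for T by (intro analytic_intros) auto
 have m: "F meromorphic_on UNIV" unfolding F_def by (intro meromorphic_intros besm_meromorphic[OF p(1,2) l] k[THEN analytic_on_imp_meromorphic_on])
 have re: "Re ((s + 2) / 2 - complex_of_real a) > 0" if "Re s > 2" for s using that p(3) by simp
 have an: "F analytic_on {s. Re s > 2}" unfolding F_def by (intro analytic_on_mult analytic_on_const k besm_analytic[OF p(1,2) l]) (use re in simp)
 have Fj: "F s = jacquet_integral w g (nu_star s) m1 m2" if "Re s > 2" for s
 proof -
  have "F s = rkappa (s + 2) * (kappa (s + 2) * jacquet_integral w g (nu_star s) m1 m2)"
   unfolding F_def j[OF that] besm_eq[OF p(1) re[OF that]] ..
  also have "\<dots> = (kappa (s + 2) * rkappa (s + 2)) * jacquet_integral w g (nu_star s) m1 m2" by (simp only: mult_ac)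
  finally show ?thesis using kappa_rkappa[of "s + 2"] that by simp
 qed
 have W: "W_star w g m1 m2 = remove_sings F"
  unfolding W_star_def by (rule mero_cont_eq[OF m an open_Re_gt Re_gt_nonempty]) (use Fj in simp)
 show ?g1 unfolding W by (rule remove_sings_nicely_meromorphic[OF m])
 fix s :: complex assume s: "Re s > 2"
 have "F analytic_on {s}" by (rule analytic_on_subset[OF an]) (use s in simp)
 hence "W_star w g m1 m2 s = F s" unfolding W by (rule remove_sings_at_analytic)
 thus "W_star w g m1 m2 s = rkappa (s + 2) * (of_real pi * (c * bes ((s + 2) / 2 - of_real a) \<alpha> \<beta>))"
  unfolding F_def besm_eq[OF p(1) re[OF s]] .
qed

section \<open>Fourier coefficients of the continued Eisenstein series\<close>

definition Cc :: "complex => complex" where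
 "Cc s = of_real pi powr ((s + 2) / 2) / (2 * zeta (s + 2))"

definition good :: "complex => bool" where
 "good s \<longleftrightarrow> s \<noteq> 2 \<and> s \<noteq> -1 \<and> zeta (s + 2) \<noteq> 0"

lemma good_eventually: "eventually good (at \<nu>)"
 unfolding good_def by (intro eventually_conj zeta_eventually_nonzero eventually_neq_at_within)

lemma shift_neq: "s \<noteq> -1 ==> s + 2 \<noteq> (1::complex)"
proof
 assume "s \<noteq> -1" "s + 2 = 1"
 hence "s = 1 - 2" by (simp only: eq_diff_eq)
 thus False using \<open>s \<noteq> -1\<close> by simp
qed

lemma Cc_analytic: "good w ==> Cc analytic_on {w}"
 unfolding good_def Cc_def by (intro analytic_intros zeta_shift_analytic shift_neq) (auto simp: complex_nonpos_Reals_iff)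

lemma Cc_meromorphic: "Cc meromorphic_on UNIV"
proof -
 have "(\<lambda>s. complex_of_real pi powr ((s + 2) / 2)) analytic_on UNIV" by (intro analytic_intros) (auto simp: complex_nonpos_Reals_iff)
 thus ?thesis unfolding Cc_def by (intro meromorphic_intros zeta_shift_meromorphic analytic_on_imp_meromorphic_on)
qed

context horocycle
begin

definition Zc :: "int => int => complex => complex" where
 "Zc m1 m2 z = (mellin (hat_phi m1 m2) z + delta m1 m2 / (z - 2)) * rGamma z - delta m1 m2 * rGamma (z + 1)"

lemma Zc_halfplane: "Re z > 2 ==> Zc m1 m2 z = rGamma z *
   (bterm m1 m2 0 z * (2 * zeta (2 * z)) + bterm m1 m2 1 z * (2 * arith_factor (2 * z - 1) m1)
   + bterm m1 m2 2 z * (2 * arith_factor (2 * z - 2) m2) + bterm m1 m2 3 z * (2 * arith_factor (2 * z - 3) m1))"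
 unfolding Zc_def mellin_hat_phi mellin_hat(2) ..

lemma half_neq: "w \<noteq> 2 ==> (w + 2) / 2 - 2 \<noteq> (0::complex)"
proof
 assume "w \<noteq> 2" "(w + 2) / 2 - 2 = 0"
 hence "(w + 2) / 2 * 2 = 2 * 2" by simp
 hence "w = 4 - 2" by (simp add: eq_diff_eq)
 thus False using \<open>w \<noteq> 2\<close> by simp
qed

lemma Zc_analytic: "w \<noteq> 2 ==> (\<lambda>s. Zc m1 m2 ((s + 2) / 2)) analytic_on {w}"
proof -
 assume w: "w \<noteq> 2"
 obtain D where D: "rapid_bound D (hat_phi m1 m2)" using hat_phi_rapid by blast
 show ?thesis unfolding Zc_def using half_neq[OF w] by (intro analytic_intros mellin_analytic[OF D]) auto
qed

lemma Zc_meromorphic: "(\<lambda>s. Zc m1 m2 ((s + 2) / 2)) meromorphic_on UNIV"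
proof -
 obtain D where D: "rapid_bound D (hat_phi m1 m2)" using hat_phi_rapid by blast
 have a: "(\<lambda>s. mellin (hat_phi m1 m2) ((s + 2) / 2)) analytic_on UNIV" "(\<lambda>s. rGamma ((s + 2) / 2 :: complex)) analytic_on UNIV"
  "(\<lambda>s. rGamma ((s + 2) / 2 + 1 :: complex)) analytic_on UNIV" "(\<lambda>s. (s + 2) / 2 - 2 :: complex) analytic_on UNIV"
  by (intro analytic_intros mellin_analytic[OF D]; simp)+
 show ?thesis unfolding Zc_def by (intro meromorphic_intros a[THEN analytic_on_imp_meromorphic_on])
qed

lemma epsteinN_analytic: "w \<noteq> 2 ==> (\<lambda>s. epsteinN n ((s + 2) / 2)) analytic_on {w}"
proof -
 assume w: "w \<noteq> 2"
 obtain D where D: "\<And>n. rapid_bound D (phiN n)" using phiN_rapid by blast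
 show ?thesis unfolding epsteinN_eq using half_neq[OF w] by (intro analytic_intros mellin_analytic[OF D]) auto
qed

lemma cube_epstein_integrable: "set_integrable cube_measure cube (\<lambda>n. epsteinN n z * uchar m1 m2 n)"
proof -
 have b: "\<forall>n\<in>cube. norm (uchar m1 m2 n) \<le> 1" by (simp add: uchar_def)
 have eq: "epsteinN n z * uchar m1 m2 n = rGamma z * (mellin (phiN n) z * uchar m1 m2 n)
   + (1 / (z - 2) * rGamma z - rGamma (z + 1)) * uchar m1 m2 n" for n
  unfolding epsteinN_eq by (simp add: algebra_simps)
 show ?thesis unfolding eq
  by (rule set_integral_add(1)[OF set_integrable_mult_right[OF mellin_fubini_integrable] set_integrable_mult_right[OF cube_integrable[OF uchar_measurable b]]])
qed

context
 fixes p k g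
 assumes p: "p 1 = p1" "p 2 = p2" "p 4 = p4" "p 5 = p5" and k: "k \<in> K" and gB: "g = eta p ** torus y1 y2 ** k" and g: "g \<in> Sp4R"
begin

lemma hSp: "eta n ** g \<in> Sp4R" by (intro Sp4R_mult eta_Sp4R g)

lemma E_remove_sings: "E_beta (eta n ** g) = remove_sings (\<lambda>s. Cc s * epsteinN n ((s + 2) / 2))" (is ?g1)
 and E_nice: "E_beta (eta n ** g) nicely_meromorphic_on UNIV" (is ?g2)
proof -
 have q: "qf (eta n ** g) = triangular_form.Q (y1\<^sup>2) (y2\<^sup>2) (1 / y2\<^sup>2) (1 / y1\<^sup>2) (R2 (n 1)) (R3 (n 1) (n 5) (n 4)) (R4 (n 1) (n 5) (n 4) (n 2))"
  unfolding gB by (rule qf_eq[OF p k])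
 show ?g2 by (rule triangular_form.E_beta_epstein(2)[OF tf hSp q])
 have "(\<lambda>s. Cc s * epsteinN n ((s + 2) / 2)) = (\<lambda>s. of_real pi powr ((s + 2) / 2) * epsteinN n ((s + 2) / 2) / (2 * zeta (s + 2)))"
  by (rule ext) (simp add: Cc_def)
 thus ?g1
  using triangular_form.E_beta_epstein(1)[OF tf hSp q] unfolding epsteinN_def by simp
qed

lemma E_at_good:
 assumes "good w"
 shows "E_beta (eta n ** g) w = Cc w * epsteinN n ((w + 2) / 2)" (is ?g1) "E_beta (eta n ** g) analytic_on {w}"
proof -
 have a: "(\<lambda>s. Cc s * epsteinN n ((s + 2) / 2)) analytic_on {w}"
  by (intro analytic_on_mult Cc_analytic epsteinN_analytic) (use assms in \<open>auto simp: good_def\<close>)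
 show ?g1 unfolding E_remove_sings by (rule remove_sings_at_analytic[OF a])
 show "E_beta (eta n ** g) analytic_on {w}" unfolding E_remove_sings by (rule remove_sings_analytic_on[OF a])
qed

lemma coeff_formula:
 assumes "good w"
 shows "E_beta_coeff m1 m2 g w = Cc w * Zc m1 m2 ((w + 2) / 2)"
 unfolding E_beta_coeff_def chi_eta E_at_good(1)[OF assms] mult.assoc set_integral_mult_right cube_epstein Zc_def ..

lemma not_two:
 assumes no_pole: "\<And>h. h \<in> Sp4R ==> \<not> is_pole (E_beta h) \<nu>"
 shows "\<nu> \<noteq> 2"
proof
 assume n2: "\<nu> = 2"
 define n where "n = (\<lambda>_::nat. 0::real)"
 obtain D where D: "\<And>n. rapid_bound D (phiN n)" using phiN_rapid by blast
 have E: "E_beta (eta n ** g) analytic_on {2}" by (rule nicely_meromorphic_on_imp_analytic_at[OF E_nice UNIV_I]) (use no_pole[OF hSp] n2 in simp)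
 define P where "P = (\<lambda>s. Cc s * (((s - 2) * mellin (phiN n) ((s + 2) / 2) + 2) * rGamma ((s + 2) / 2) - (s - 2) * rGamma ((s + 2) / 2 + 1)))"
 have z4: "zeta (2 + 2) \<noteq> 0" by (rule zeta_nonzero) simp
 have Ca: "Cc analytic_on {2}" unfolding Cc_def using z4 by (intro analytic_intros zeta_shift_analytic) (auto simp: complex_nonpos_Reals_iff)
 have Pa: "P analytic_on {2}" unfolding P_def by (intro analytic_intros Ca mellin_analytic[OF D]) auto
 have ev: "eventually (\<lambda>s. (s - 2) * E_beta (eta n ** g) s = P s) (at 2)"
  using good_eventually[of 2]
 proof eventually_elim
  fix s assume s: "good s"
  hence s2: "s - 2 \<noteq> 0" by (simp add: good_def)
  have "1 / ((s + 2) / 2 - 2) = 2 / (s - 2)" using s2 by (simp add: field_simps)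
  moreover have "(s - 2) * (2 / (s - 2)) = 2" using s2 by (simp only: times_divide_eq_right nonzero_mult_div_cancel_left not_False_eq_True)
  ultimately have "(s - 2) * (1 / ((s + 2) / 2 - 2)) = 2" by (simp only:)
  hence "(s - 2) * (mellin (phiN n) ((s + 2) / 2) + 1 / ((s + 2) / 2 - 2)) = (s - 2) * mellin (phiN n) ((s + 2) / 2) + 2"
   by (simp only: distrib_left)
  moreover have "(s - 2) * E_beta (eta n ** g) s = Cc s * ((s - 2) * (mellin (phiN n) ((s + 2) / 2) + 1 / ((s + 2) / 2 - 2)) * rGamma ((s + 2) / 2) - (s - 2) * rGamma ((s + 2) / 2 + 1))"
   unfolding E_at_good(1)[OF s] epsteinN_eq by (simp only: right_diff_distrib mult_ac)
  ultimately show "(s - 2) * E_beta (eta n ** g) s = P s" unfolding P_def by (simp only:)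
 qed
 have "(\<lambda>s. (s - 2) * E_beta (eta n ** g) s) analytic_on {2}" by (intro analytic_intros E)
 hence "(\<lambda>s. (s - 2) * E_beta (eta n ** g) s) \<midarrow>2\<rightarrow> (2 - 2) * E_beta (eta n ** g) 2"
  using analytic_at_imp_isCont isContD by blast
 hence "P \<midarrow>2\<rightarrow> (2 - 2) * E_beta (eta n ** g) 2" by (rule Lim_transform_eventually[OF _ ev])
 moreover have "P \<midarrow>2\<rightarrow> P 2" using Pa analytic_at_imp_isCont isContD by blast
 ultimately have "P 2 = 0" using LIM_unique by fastforce
 moreover have "rGamma (2::complex) \<noteq> 0" by (auto simp: rGamma_eq_zero_iff elim!: nonpos_Ints_cases)
 moreover have "Cc 2 \<noteq> 0" using z4 by (simp add: Cc_def)
 ultimately show False by (simp add: P_def)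
qed

lemma Zc_zero: "m1 \<noteq> 0 ==> m2 \<noteq> 0 ==> Zc m1 m2 z = 0"
proof -
 assume m: "m1 \<noteq> 0" "m2 \<noteq> 0"
 have "mellin (hat_phi m1 m2) z = mellin (\<lambda>_. 0) z" by (rule mellin_cong) (use m in \<open>simp add: hat_phi_eq hat_def delta_def\<close>)
 thus ?thesis using m by (simp add: Zc_def delta_def mellin_def)
qed

lemma epsteinN_bound:
 "\<exists>M\<ge>0. \<forall>n z. \<bar>Re z\<bar> \<le> R \<longrightarrow> norm (epsteinN n z) \<le> (M + norm (1 / (z - 2))) * norm (rGamma z) + norm (rGamma (z + 1))"
proof -
 obtain D where D: "\<And>n. rapid_bound D (phiN n)" using phiN_rapid by blast
 define M where "M = (\<integral>t. 2 * D (nat \<lceil>R\<rceil> + 1) * (1 / (1 + t\<^sup>2)) \<partial>Rpos)"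
 have b: "norm (mellin (phiN n) z) \<le> M" if z: "\<bar>Re z\<bar> \<le> R" for n z
 proof -
  have "norm (mellin (phiN n) z) \<le> (\<integral>t. norm (phiN n t * of_real t powr (z - 1)) \<partial>Rpos)" unfolding mellin_def by (rule integral_norm_bound)
  also have "\<dots> \<le> M" unfolding M_def
  proof (rule integral_mono[OF integrable_norm[OF mellin_integrable[OF D]] integrable_Rpos_cauchy])
   fix t assume "t \<in> space Rpos"
   hence t: "t > 0" by simp
   have "norm (phiN n t) * t powr (Re z - 1) \<le> 2 * D (nat \<lceil>R\<rceil> + 1) * (1 / (1 + t\<^sup>2))"
    by (rule rapid_dominated[OF rapid_boundD(2,3)[OF D t] t z norm_ge_zero])
   thus "norm (phiN n t * of_real t powr (z - 1)) \<le> 2 * D (nat \<lceil>R\<rceil> + 1) * (1 / (1 + t\<^sup>2))"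
    by (simp add: norm_mult norm_real_powr[OF t])
  qed
  finally show ?thesis .
 qed
 have "norm (epsteinN n z) \<le> (max M 0 + norm (1 / (z - 2))) * norm (rGamma z) + norm (rGamma (z + 1))" if z: "\<bar>Re z\<bar> \<le> R" for n z
 proof -
  have "norm (epsteinN n z) \<le> norm (mellin (phiN n) z + 1 / (z - 2)) * norm (rGamma z) + norm (rGamma (z + 1))"
   unfolding epsteinN_eq norm_mult[symmetric] by (rule norm_triangle_ineq4)
  also have "\<dots> \<le> (max M 0 + norm (1 / (z - 2))) * norm (rGamma z) + norm (rGamma (z + 1))"
   using b[OF z, of n] norm_triangle_ineq[of "mellin (phiN n) z" "1 / (z - 2)"]
   by (intro add_mono mult_right_mono order.refl norm_ge_zero) linarith
  finally show ?thesis .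
 qed
 thus ?thesis by (intro exI[of _ "max M 0"]) auto
qed

theorem coeff_zero:
 assumes no_pole: "\<And>h. h \<in> Sp4R ==> \<not> is_pole (E_beta h) \<nu>" and m: "m1 \<noteq> 0" "m2 \<noteq> 0"
 shows "E_beta_coeff m1 m2 g \<nu> = 0"
proof -
 define f where "f = (\<lambda>n. E_beta (eta n ** g))"
 have f\<nu>: "f n analytic_on {\<nu>}" for n
  unfolding f_def by (rule nicely_meromorphic_on_imp_analytic_at[OF E_nice UNIV_I no_pole[OF hSp]])
 obtain d where d: "d > 0" "\<And>w. w \<noteq> \<nu> ==> dist w \<nu> < d ==> good w"
  using good_eventually[of \<nu>] unfolding eventually_at by blast
 define r where "r = d / 2"
 have r: "r > 0" using d by (simp add: r_def)
 have gd: "good w" if "w \<noteq> \<nu>" "w \<in> cball \<nu> r" for w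
  using d(2)[of w] that d(1) by (auto simp: r_def dist_commute)
 have fa: "f n analytic_on {w}" if "w \<in> cball \<nu> r" for n w
  using f\<nu> E_at_good(2)[OF gd] that by (cases "w = \<nu>") (auto simp: f_def)
 have fan: "f n analytic_on cball \<nu> r" for n using fa by (subst analytic_on_analytic_at) blast
 obtain M where M: "M \<ge> 0" "\<And>n z. \<bar>Re z\<bar> \<le> (norm \<nu> + r + 2) / 2 ==>
   norm (epsteinN n z) \<le> (M + norm (1 / (z - 2))) * norm (rGamma z) + norm (rGamma (z + 1))"
  using epsteinN_bound[of "(norm \<nu> + r + 2) / 2"] by blast
 define b where "b = (\<lambda>w. norm (Cc w) * ((M + norm (1 / ((w + 2) / 2 - 2))) * norm (rGamma ((w + 2) / 2)) + norm (rGamma ((w + 2) / 2 + 1))))"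
 have gs: "good w" if "w \<in> sphere \<nu> r" for w using that r by (intro gd) auto
 have bc: "continuous_on (sphere \<nu> r) b"
 proof -
  have "Cc analytic_on sphere \<nu> r" using Cc_analytic gs by (subst analytic_on_analytic_at) blast
  moreover have "(\<lambda>w. 1 / ((w + 2) / 2 - 2)) analytic_on sphere \<nu> r"
   by (intro analytic_intros) (use half_neq gs in \<open>auto simp: good_def\<close>)
  moreover have "(\<lambda>w. rGamma ((w + 2) / 2)) analytic_on sphere \<nu> r" "(\<lambda>w. rGamma ((w + 2) / 2 + 1)) analytic_on sphere \<nu> r"
   by (intro analytic_intros; simp)+
  ultimately show ?thesis unfolding b_def
   by (intro continuous_on_mult continuous_on_add continuous_on_norm continuous_on_const analytic_imp_holomorphic[THEN holomorphic_on_imp_continuous_on])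
 qed
 obtain B where B: "\<And>w. w \<in> sphere \<nu> r ==> b w \<le> B"
  using compact_imp_bounded[OF compact_continuous_image[OF bc compact_sphere]]
  unfolding bounded_real by (metis abs_le_D1 image_eqI)
 have fs: "norm (f n w) \<le> B" if w: "w \<in> sphere \<nu> r" for n w
 proof -
  have "norm w \<le> norm \<nu> + r" using w norm_triangle_sub[of w \<nu>] by (simp add: dist_norm norm_minus_commute)
  hence "\<bar>Re w\<bar> \<le> norm \<nu> + r" using abs_Re_le_cmod[of w] by linarith
  hence "\<bar>Re ((w + 2) / 2)\<bar> \<le> (norm \<nu> + r + 2) / 2" by simp
  from M(2)[OF this, of n] have "norm (f n w) \<le> b w"
   unfolding f_def E_at_good(1)[OF gs[OF w]] b_def norm_mult by (rule mult_left_mono) simp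
  thus ?thesis using B[OF w] by linarith
 qed
 have fb: "norm (f n w) \<le> B" if w: "w \<in> cball \<nu> r" for n w
 proof (rule maximum_modulus_frontier[of "f n" "cball \<nu> r" B w])
  show "f n holomorphic_on interior (cball \<nu> r)"
   using analytic_imp_holomorphic[OF fan] by (rule holomorphic_on_subset) (rule interior_subset)
  show "continuous_on (closure (cball \<nu> r)) (f n)"
   using holomorphic_on_imp_continuous_on[OF analytic_imp_holomorphic[OF fan]] by simp
  show "norm (f n z) \<le> B" if "z \<in> frontier (cball \<nu> r)" for z using that r by (intro fs) simp
 qed (use w in auto)
 define \<nu>s where "\<nu>s = (\<lambda>j::nat. \<nu> + of_real (r * inverse (real (Suc j))))"
 have s1: "\<nu>s j \<in> cball \<nu> r" "\<nu>s j \<noteq> \<nu>" for j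
  using r by (auto simp: \<nu>s_def dist_norm norm_mult norm_inverse field_simps norm_divide abs_mult simp del: of_nat_Suc)
 have s2: "\<nu>s \<longlonglongrightarrow> \<nu>"
 proof -
  have "(\<lambda>j. r * inverse (real (Suc j))) \<longlonglongrightarrow> r * 0" by (intro tendsto_intros LIMSEQ_inverse_real_of_nat)
  hence "(\<lambda>j. \<nu> + complex_of_real (r * inverse (real (Suc j)))) \<longlonglongrightarrow> \<nu> + of_real (r * 0)" by (rule tendsto_add[OF tendsto_const tendsto_of_real])
  thus ?thesis unfolding \<nu>s_def by (simp only: mult_zero_right of_real_0 add_0_right)
 qed
 define h where "h = (\<lambda>w n. indicator cube n *\<^sub>R (f n w * uchar m1 m2 n))"
 have hc: "E_beta_coeff m1 m2 g w = (\<integral>n. h w n \<partial>cube_measure)" for w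
  unfolding E_beta_coeff_def chi_eta set_lebesgue_integral_def h_def f_def ..
 have hi: "integrable cube_measure (h (\<nu>s j))" for j
 proof -
  have "h (\<nu>s j) = (\<lambda>n. Cc (\<nu>s j) * (indicator cube n *\<^sub>R (epsteinN n ((\<nu>s j + 2) / 2) * uchar m1 m2 n)))"
   by (rule ext) (simp add: h_def f_def E_at_good(1)[OF gd[OF s1(2,1)]] scaleR_conv_of_real mult_ac)
  moreover have "integrable cube_measure (\<lambda>n. Cc (\<nu>s j) * (indicator cube n *\<^sub>R (epsteinN n ((\<nu>s j + 2) / 2) * uchar m1 m2 n)))"
   by (rule integrable_mult_right[OF cube_epstein_integrable[unfolded set_integrable_def]])
  ultimately show ?thesis by (simp only:)
 qed
 have lim: "(\<lambda>j. h (\<nu>s j) n) \<longlonglongrightarrow> h \<nu> n" for n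
 proof -
  have "isCont (f n) \<nu>" using f\<nu> by (rule analytic_at_imp_isCont)
  from isCont_tendsto_compose[OF this s2] show ?thesis unfolding h_def by (intro tendsto_intros)
 qed
 interpret PF: product_sigma_finite "\<lambda>_::nat. lborel :: real measure" ..
 have Ufin: "finite U_coords" by (simp add: U_coords_def)
 have box: "cube \<in> sets cube_measure" using Ufin by (intro sets_PiM_I_finite) auto
 have fin: "emeasure cube_measure cube < \<infinity>" using Ufin by (subst PF.emeasure_PiM) auto
 have wi: "integrable cube_measure (\<lambda>n. indicator cube n *\<^sub>R B)"
  by (rule integrable_scaleR_left) (rule integrable_real_indicator[OF box fin])
 have hm: "h (\<nu>s j) \<in> borel_measurable cube_measure" for j by (rule borel_measurable_integrable[OF hi])
 have hm': "h \<nu> \<in> borel_measurable cube_measure" by (rule borel_measurable_LIMSEQ_metric[OF hm lim])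
 have bd: "norm (h (\<nu>s j) n) \<le> indicator cube n *\<^sub>R B" for j n
  using fb[OF s1(1)[of j], of n] by (auto simp: h_def norm_mult uchar_def indicator_def)
 have "(\<lambda>j. \<integral>n. h (\<nu>s j) n \<partial>cube_measure) \<longlonglongrightarrow> (\<integral>n. h \<nu> n \<partial>cube_measure)"
  by (rule integral_dominated_convergence[OF hm' hm wi AE_I2[OF lim] AE_I2[OF bd]])
 moreover have "(\<integral>n. h (\<nu>s j) n \<partial>cube_measure) = 0" for j
  unfolding hc[symmetric] coeff_formula[OF gd[OF s1(2,1)]] Zc_zero[OF m] by simp
 ultimately have "(\<lambda>j::nat. 0) \<longlonglongrightarrow> (\<integral>n. h \<nu> n \<partial>cube_measure)" by (simp only:)
 thus ?thesis unfolding hc using LIMSEQ_const_iff by metis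
qed

lemma W_A:
 "W_star s_beta g 0 0 nicely_meromorphic_on UNIV" (is ?g1)
 "Re s > 2 ==> W_star s_beta g 0 0 s = rkappa (s + 2) * (of_real pi * bterm 0 0 0 ((s + 2) / 2))"
proof -
 have b: "bterm 0 0 0 z = 1 * bes (z - of_real 0) (1 / y1\<^sup>2) 0" for z by (simp add: bterm_def)
 have q: "1 / y1\<^sup>2 > 0" "(0::real) \<ge> 0" "(0::real) \<le> 3/2" using y by auto
 note F = W_star_facts[OF q jacquet_A[OF p k gB g, unfolded b]]
 show ?g1 by (rule F(1))
 show "Re s > 2 ==> W_star s_beta g 0 0 s = rkappa (s + 2) * (of_real pi * bterm 0 0 0 ((s + 2) / 2))" unfolding b by (rule F(2))
qed

lemma W_B:
 "W_star (s_beta ** s_alpha) g m1 0 nicely_meromorphic_on UNIV" (is ?g1)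
 "Re s > 2 ==> W_star (s_beta ** s_alpha) g m1 0 s = rkappa (s + 2) * (of_real pi * bterm m1 0 1 ((s + 2) / 2))"
proof -
 have b: "bterm m1 0 1 z = (of_real y1 * cis (2 * pi * of_int m1 * p1)) * bes (z - of_real (1/2)) (1 / y2\<^sup>2) ((of_int m1)\<^sup>2 * y1\<^sup>2)" for z by (simp add: bterm_def)
 have q: "1 / y2\<^sup>2 > 0" "(of_int m1)\<^sup>2 * y1\<^sup>2 \<ge> 0" "(1/2::real) \<le> 3/2" using y by auto
 note F = W_star_facts[OF q jacquet_B[OF p k gB g, where ?m1.0 = m1, unfolded b]]
 show ?g1 by (rule F(1))
 show "Re s > 2 ==> W_star (s_beta ** s_alpha) g m1 0 s = rkappa (s + 2) * (of_real pi * bterm m1 0 1 ((s + 2) / 2))" unfolding b by (rule F(2))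
qed

lemma W_C:
 "W_star (s_beta ** s_alpha ** s_beta) g 0 m2 nicely_meromorphic_on UNIV" (is ?g1)
 "Re s > 2 ==> W_star (s_beta ** s_alpha ** s_beta) g 0 m2 s = rkappa (s + 2) * (of_real pi * bterm 0 m2 2 ((s + 2) / 2))"
proof -
 have b: "bterm 0 m2 2 z = (of_real (y1 * y2) * cis (2 * pi * of_int m2 * p5)) * bes (z - of_real 1) (y2\<^sup>2) ((of_int m2)\<^sup>2 * y2\<^sup>2)" for z by (simp add: bterm_def)
 have q: "y2\<^sup>2 > 0" "(of_int m2)\<^sup>2 * y2\<^sup>2 \<ge> 0" "(1::real) \<le> 3/2" using y by auto
 note F = W_star_facts[OF q jacquet_C[OF p k gB g, where ?m2.0 = m2, unfolded b]]
 show ?g1 by (rule F(1))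
 show "Re s > 2 ==> W_star (s_beta ** s_alpha ** s_beta) g 0 m2 s = rkappa (s + 2) * (of_real pi * bterm 0 m2 2 ((s + 2) / 2))" unfolding b by (rule F(2))
qed

lemma W_D:
 "W_star w_0 g m1 0 nicely_meromorphic_on UNIV" (is ?g1)
 "Re s > 2 ==> W_star w_0 g m1 0 s = rkappa (s + 2) * (of_real pi * bterm m1 0 3 ((s + 2) / 2))"
proof -
 have b: "bterm m1 0 3 z = (of_real y1 * cis (2 * pi * of_int m1 * p1)) * bes (z - of_real (3/2)) (y1\<^sup>2) ((of_int m1)\<^sup>2 / y2\<^sup>2)" for z by (simp add: bterm_def)
 have q: "y1\<^sup>2 > 0" "(of_int m1)\<^sup>2 / y2\<^sup>2 \<ge> 0" "(3/2::real) \<le> 3/2" using y by auto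
 note F = W_star_facts[OF q jacquet_D[OF p k gB g, where ?m1.0 = m1, unfolded b]]
 show ?g1 by (rule F(1))
 show "Re s > 2 ==> W_star w_0 g m1 0 s = rkappa (s + 2) * (of_real pi * bterm m1 0 3 ((s + 2) / 2))" unfolding b by (rule F(2))
qed

definition Gc :: "int => int => complex => complex" where
 "Gc m1 m2 s = of_real pi * (Cc s * Zc m1 m2 ((s + 2) / 2))"

lemma Gc_meromorphic: "Gc m1 m2 meromorphic_on UNIV"
 unfolding Gc_def[abs_def] by (intro meromorphic_on_mult meromorphic_on_const Cc_meromorphic Zc_meromorphic)

lemma Gc_analytic: "good w ==> Gc m1 m2 analytic_on {w}"
 unfolding Gc_def[abs_def] by (intro analytic_on_mult analytic_on_const Cc_analytic Zc_analytic) (auto simp: good_def)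

lemma Gc_coeff: "good w ==> of_real pi * E_beta_coeff m1 m2 g w = Gc m1 m2 w"
 unfolding Gc_def coeff_formula ..

lemma Gc_halfplane:
 assumes s: "Re s > 2"
 shows "Gc m1 m2 s = rkappa (s + 2) * (of_real pi * bterm m1 m2 0 ((s + 2) / 2))
  + arith_factor (s + 1) m1 / zeta (s + 2) * (rkappa (s + 2) * (of_real pi * bterm m1 m2 1 ((s + 2) / 2)))
  + arith_factor s m2 / zeta (s + 2) * (rkappa (s + 2) * (of_real pi * bterm m1 m2 2 ((s + 2) / 2)))
  + arith_factor (s - 1) m1 / zeta (s + 2) * (rkappa (s + 2) * (of_real pi * bterm m1 m2 3 ((s + 2) / 2)))"
proof -
 have nz: "zeta (s + 2) \<noteq> 0" using s by (intro zeta_nonzero) simp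
 have z: "Re ((s + 2) / 2) > 2" using s by simp
 have e: "2 * ((s + 2) / 2) = s + 2" by (simp add: field_simps)
 have e': "s + 2 - 1 = s + 1" "s + 2 - 2 = s" "s + 2 - 3 = s - 1" by simp_all
 have alg: "q * ((P / (2 * Z)) * (R * (b0 * (2 * Z) + b1 * (2 * a1) + b2 * (2 * a2) + b3 * (2 * a3))))
   = (P * R) * (q * b0) + a1 / Z * ((P * R) * (q * b1)) + a2 / Z * ((P * R) * (q * b2)) + a3 / Z * ((P * R) * (q * b3))"
  if "Z \<noteq> 0" for q P Z R b0 b1 b2 b3 a1 a2 a3 :: complex
  using that by (simp add: field_simps)
 show ?thesis unfolding Gc_def Zc_halfplane[OF z] e e' Cc_def rkappa_def by (rule alg[OF nz])
qed

end

end

lemma zeta_ratio_regular: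
 assumes "\<nu> + c \<noteq> 1" "good \<nu>"
 shows "(\<lambda>s. zeta (s + c) / zeta (s + 2)) analytic_on {\<nu>}" (is ?g1) "(\<lambda>s. zeta (s + c) / zeta (s + 2)) meromorphic_on UNIV" (is ?g2)
proof -
 show ?g1 by (intro analytic_on_divide zeta_shift_analytic assms(1) shift_neq) (use assms(2) in \<open>auto simp: good_def\<close>)
 show ?g2 by (intro meromorphic_intros zeta_shift_meromorphic)
qed

lemma sigma_ratio_regular:
 assumes "good \<nu>"
 shows "(\<lambda>s. div_sigma (- (s + c)) m / zeta (s + 2)) analytic_on {\<nu>}" (is ?g1) "(\<lambda>s. div_sigma (- (s + c)) m / zeta (s + 2)) meromorphic_on UNIV" (is ?g2)
proof -
 have d: "(\<lambda>s. div_sigma (- (s + c)) m) analytic_on T" for T by (rule div_sigma_analytic) (intro analytic_intros)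
 show ?g1 by (intro analytic_on_divide d zeta_shift_analytic shift_neq) (use assms in \<open>auto simp: good_def\<close>)
 show ?g2 by (intro meromorphic_intros zeta_shift_meromorphic d[THEN analytic_on_imp_meromorphic_on])
qed

theorem corollary7p10:
 fixes g :: "real^4^4" and \<nu> :: complex and m1 m2 :: int
 assumes g: "g \<in> Sp4R"
  and no_pole_E: "\<And>h. h \<in> Sp4R \<Longrightarrow> \<not> is_pole (E_beta h) \<nu>"
 shows
  "(m1 = 0 \<and> m2 = 0 \<and> \<nu> \<notin> {-1, 0, 1, 2} \<and>
   zeta \<nu> \<noteq> 0 \<and> zeta (\<nu> + 1) \<noteq> 0 \<and> zeta (\<nu> + 2) \<noteq> 0 \<and>
   (\<forall>w \<in> {s_beta, s_beta ** s_alpha, s_beta ** s_alpha ** s_beta, w_0}.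
     \<not> is_pole (W_star w g m1 m2) \<nu>) \<longrightarrow>
    of_real pi * E_beta_coeff m1 m2 g \<nu> =
     W_star s_beta g m1 m2 \<nu>
     + zeta (\<nu> + 1) / zeta (\<nu> + 2) * W_star (s_beta ** s_alpha) g m1 m2 \<nu>
     + zeta \<nu> / zeta (\<nu> + 1) * (zeta (\<nu> + 1) / zeta (\<nu> + 2))
       * W_star (s_beta ** s_alpha ** s_beta) g m1 m2 \<nu>
     + zeta (\<nu> - 1) / zeta \<nu> * (zeta \<nu> / zeta (\<nu> + 1)) * (zeta (\<nu> + 1) / zeta (\<nu> + 2))
       * W_star w_0 g m1 m2 \<nu>)
  \<and> (m1 \<noteq> 0 \<and> m2 = 0 \<and> \<nu> \<notin> {-1, 0, 1} \<and>
   zeta \<nu> \<noteq> 0 \<and> zeta (\<nu> + 1) \<noteq> 0 \<and> zeta (\<nu> + 2) \<noteq> 0 \<and>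
   (\<forall>w \<in> {s_beta ** s_alpha, w_0}. \<not> is_pole (W_star w g m1 m2) \<nu>) \<longrightarrow>
    of_real pi * E_beta_coeff m1 m2 g \<nu> =
     div_sigma (- \<nu> - 1) m1 / zeta (\<nu> + 2) * W_star (s_beta ** s_alpha) g m1 m2 \<nu>
     + div_sigma (- \<nu> + 1) m1 / zeta \<nu> * (zeta \<nu> / zeta (\<nu> + 1)) * (zeta (\<nu> + 1) / zeta (\<nu> + 2))
       * W_star w_0 g m1 m2 \<nu>)
  \<and> (m1 = 0 \<and> m2 \<noteq> 0 \<and> \<nu> \<notin> {-1, 0} \<and>
   zeta (\<nu> + 1) \<noteq> 0 \<and> zeta (\<nu> + 2) \<noteq> 0 \<and>
   \<not> is_pole (W_star (s_beta ** s_alpha ** s_beta) g m1 m2) \<nu> \<longrightarrow>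
    of_real pi * E_beta_coeff m1 m2 g \<nu> =
     div_sigma (- \<nu>) m2 / zeta (\<nu> + 1) * (zeta (\<nu> + 1) / zeta (\<nu> + 2))
       * W_star (s_beta ** s_alpha ** s_beta) g m1 m2 \<nu>)
  \<and> (m1 \<noteq> 0 \<and> m2 \<noteq> 0 \<longrightarrow> E_beta_coeff m1 m2 g \<nu> = 0)"
proof -
 obtain p y1 y2 k where y: "y1 > 0" "y2 > 0" and k: "k \<in> K" and gp: "g = eta p ** torus y1 y2 ** k"
  using iwasawa_exists[OF g] by blast
 interpret H: horocycle y1 y2 "p 1" "p 2" "p 4" "p 5" by standard (use y in auto)
 note dec = refl[of "p 1"] refl[of "p 2"] refl[of "p 4"] refl[of "p 5"] k gp g
 have n2: "\<nu> \<noteq> 2" by (rule H.not_two[OF dec no_pole_E])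
 show ?thesis
 proof (intro conjI impI, goal_cases)
  case 1
  hence m: "m1 = 0" "m2 = 0" and z: "zeta \<nu> \<noteq> 0" "zeta (\<nu> + 1) \<noteq> 0" "zeta (\<nu> + 2) \<noteq> 0" and ne: "\<nu> \<noteq> -1" "\<nu> \<noteq> 0" "\<nu> \<noteq> 1" "\<nu> \<noteq> 2"
   and np: "\<not> is_pole (W_star s_beta g 0 0) \<nu>" "\<not> is_pole (W_star (s_beta ** s_alpha) g 0 0) \<nu>"
    "\<not> is_pole (W_star (s_beta ** s_alpha ** s_beta) g 0 0) \<nu>" "\<not> is_pole (W_star w_0 g 0 0) \<nu>" by auto
  have gd: "good \<nu>" using ne z by (simp add: good_def)
  define A where "A = (\<lambda>i::nat. if i = 0 then (\<lambda>s::complex. 1) else if i = 1 then (\<lambda>s. zeta (s + 1) / zeta (s + 2))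
   else if i = 2 then (\<lambda>s. zeta (s + 0) / zeta (s + 2)) else (\<lambda>s. zeta (s + - 1) / zeta (s + 2)))"
  define W where "W = (\<lambda>i::nat. W_star (if i = 0 then s_beta else if i = 1 then s_beta ** s_alpha else if i = 2 then s_beta ** s_alpha ** s_beta else w_0) g 0 0)"
  have c: "\<nu> + 1 \<noteq> 1" "\<nu> + 0 \<noteq> 1" "\<nu> + - 1 \<noteq> 1"
  proof -
   show "\<nu> + 1 \<noteq> 1" "\<nu> + 0 \<noteq> 1" using ne by auto
   show "\<nu> + - 1 \<noteq> 1"
   proof
    assume "\<nu> + - 1 = 1"
    hence "\<nu> = 1 + 1" by (simp only: diff_conv_add_uminus[symmetric] diff_eq_eq)
    thus False using ne(4) by simp
   qed
  qed
  have "H.Gc 0 0 \<nu> = (\<Sum>i\<in>{0,1,2,3}. A i \<nu> * W i \<nu>)"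
  proof (rule meromorphic_identity_at)
   show "A i meromorphic_on UNIV" "A i analytic_on {\<nu>}" for i
    unfolding A_def using zeta_ratio_regular[OF c(1) gd] zeta_ratio_regular[OF c(2) gd] zeta_ratio_regular[OF c(3) gd] by (auto simp del: add_0_right)
   show "W i nicely_meromorphic_on UNIV" for i
    unfolding W_def using H.W_A(1)[OF dec] H.W_B(1)[OF dec, of 0] H.W_C(1)[OF dec, of 0] H.W_D(1)[OF dec, of 0] by auto
   show "\<not> is_pole (W i) \<nu>" for i unfolding W_def using np by auto
   show "H.Gc 0 0 meromorphic_on UNIV" "H.Gc 0 0 analytic_on {\<nu>}" by (rule H.Gc_meromorphic[OF dec] H.Gc_analytic[OF dec gd])+
   fix s :: complex assume s: "Re s > 2"
   show "H.Gc 0 0 s = (\<Sum>i\<in>{0,1,2,3}. A i s * W i s)"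
    using H.Gc_halfplane[OF dec s, of 0 0] H.W_A(2)[OF dec s] H.W_B(2)[OF dec s, of 0] H.W_C(2)[OF dec s, of 0] H.W_D(2)[OF dec s, of 0]
    by (simp add: A_def W_def arith_factor_def)
  qed
  hence "of_real pi * E_beta_coeff 0 0 g \<nu> = W_star s_beta g 0 0 \<nu> + zeta (\<nu> + 1) / zeta (\<nu> + 2) * W_star (s_beta ** s_alpha) g 0 0 \<nu>
    + zeta \<nu> / zeta (\<nu> + 2) * W_star (s_beta ** s_alpha ** s_beta) g 0 0 \<nu> + zeta (\<nu> - 1) / zeta (\<nu> + 2) * W_star w_0 g 0 0 \<nu>"
   unfolding H.Gc_coeff[OF dec gd] by (simp add: A_def W_def)
  thus ?case using z by (simp add: m)
 next
  case 2
  hence m: "m1 \<noteq> 0" "m2 = 0" and z: "zeta \<nu> \<noteq> 0" "zeta (\<nu> + 1) \<noteq> 0" "zeta (\<nu> + 2) \<noteq> 0" and ne: "\<nu> \<noteq> -1"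
   and np: "\<not> is_pole (W_star (s_beta ** s_alpha) g m1 0) \<nu>" "\<not> is_pole (W_star w_0 g m1 0) \<nu>" by auto
  have gd: "good \<nu>" using ne n2 z by (simp add: good_def)
  define A where "A = (\<lambda>i::nat. if i = 1 then (\<lambda>s. div_sigma (- (s + 1)) m1 / zeta (s + 2)) else (\<lambda>s. div_sigma (- (s + - 1)) m1 / zeta (s + 2)))"
  define W where "W = (\<lambda>i::nat. W_star (if i = 1 then s_beta ** s_alpha else w_0) g m1 0)"
  have "H.Gc m1 0 \<nu> = (\<Sum>i\<in>{1,3}. A i \<nu> * W i \<nu>)"
  proof (rule meromorphic_identity_at)
   show "A i meromorphic_on UNIV" "A i analytic_on {\<nu>}" for i
    unfolding A_def using sigma_ratio_regular[OF gd, of 1 m1] sigma_ratio_regular[OF gd, of "- 1" m1] by auto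
   show "W i nicely_meromorphic_on UNIV" for i
    unfolding W_def using H.W_B(1)[OF dec, of m1] H.W_D(1)[OF dec, of m1] by auto
   show "\<not> is_pole (W i) \<nu>" for i unfolding W_def using np by auto
   show "H.Gc m1 0 meromorphic_on UNIV" "H.Gc m1 0 analytic_on {\<nu>}" by (rule H.Gc_meromorphic[OF dec] H.Gc_analytic[OF dec gd])+
   fix s :: complex assume s: "Re s > 2"
   have b: "H.bterm m1 0 0 ((s + 2) / 2) = 0" "H.bterm m1 0 2 ((s + 2) / 2) = 0" unfolding H.bterm_def using m by simp_all
   show "H.Gc m1 0 s = (\<Sum>i\<in>{1,3}. A i s * W i s)"
    using H.Gc_halfplane[OF dec s, of m1 0] H.W_B(2)[OF dec s, of m1] H.W_D(2)[OF dec s, of m1] m unfolding b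
    by (simp add: A_def W_def arith_factor_def)
  qed
  hence "of_real pi * E_beta_coeff m1 0 g \<nu> = div_sigma (- \<nu> - 1) m1 / zeta (\<nu> + 2) * W_star (s_beta ** s_alpha) g m1 0 \<nu>
    + div_sigma (- \<nu> + 1) m1 / zeta (\<nu> + 2) * W_star w_0 g m1 0 \<nu>"
   unfolding H.Gc_coeff[OF dec gd] by (simp add: A_def W_def)
  thus ?case using z by (simp add: m)
 next
  case 3
  hence m: "m1 = 0" "m2 \<noteq> 0" and z: "zeta (\<nu> + 1) \<noteq> 0" "zeta (\<nu> + 2) \<noteq> 0" and ne: "\<nu> \<noteq> -1"
   and np: "\<not> is_pole (W_star (s_beta ** s_alpha ** s_beta) g 0 m2) \<nu>" by auto
  have gd: "good \<nu>" using ne n2 z by (simp add: good_def)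
  have "H.Gc 0 m2 \<nu> = (\<Sum>i\<in>{2::nat}. div_sigma (- (\<nu> + 0)) m2 / zeta (\<nu> + 2) * W_star (s_beta ** s_alpha ** s_beta) g 0 m2 \<nu>)"
  proof (rule meromorphic_identity_at[where A = "\<lambda>_ s. div_sigma (- (s + 0)) m2 / zeta (s + 2)" and W = "\<lambda>_. W_star (s_beta ** s_alpha ** s_beta) g 0 m2"])
   show "(\<lambda>s. div_sigma (- (s + 0)) m2 / zeta (s + 2)) meromorphic_on UNIV" "(\<lambda>s. div_sigma (- (s + 0)) m2 / zeta (s + 2)) analytic_on {\<nu>}"
    by (rule sigma_ratio_regular[OF gd])+
   show "W_star (s_beta ** s_alpha ** s_beta) g 0 m2 nicely_meromorphic_on UNIV" by (rule H.W_C(1)[OF dec])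
   show "H.Gc 0 m2 meromorphic_on UNIV" "H.Gc 0 m2 analytic_on {\<nu>}" by (rule H.Gc_meromorphic[OF dec] H.Gc_analytic[OF dec gd])+
   fix s :: complex assume s: "Re s > 2"
   have b: "H.bterm 0 m2 0 ((s + 2) / 2) = 0" "H.bterm 0 m2 1 ((s + 2) / 2) = 0" "H.bterm 0 m2 3 ((s + 2) / 2) = 0" unfolding H.bterm_def using m by simp_all
   show "H.Gc 0 m2 s = (\<Sum>i\<in>{2::nat}. div_sigma (- (s + 0)) m2 / zeta (s + 2) * W_star (s_beta ** s_alpha ** s_beta) g 0 m2 s)"
    using H.Gc_halfplane[OF dec s, of 0 m2] H.W_C(2)[OF dec s, of m2] m unfolding b by (simp add: arith_factor_def)
  qed (rule np)
  hence "of_real pi * E_beta_coeff 0 m2 g \<nu> = div_sigma (- \<nu>) m2 / zeta (\<nu> + 2) * W_star (s_beta ** s_alpha ** s_beta) g 0 m2 \<nu>"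
   unfolding H.Gc_coeff[OF dec gd] by simp
  thus ?case using z by (simp add: m)
 next
  case 4
  thus ?case using H.coeff_zero[OF dec no_pole_E] by blast
 qed
qed

end
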